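(* Let $N\geq 1$, let $\Omega\subset\mathbb{R}^N$ be a bounded Lipschitz domain containing the origin, and let $\mu>-1$. Then: (i) (lower bound for the first eigenvalue) $$\lambda_1^{\ln,\mu}(\Omega)\;\geq\; 2\Big(\psi\Big(\frac N4\Big)+\log 2\Big)-2(1+\mu)\log R_0,$$ where $R_0=\sup_{x\in \Omega}|x|$; (ii) for every $k\in\mathbb{N}$ and every $l>0$, $$\lambda_k^{\ln,\mu}(\Omega_l)=\lambda_k^{\ln,\mu}(\Omega)-2(1+\mu)\log l,$$ where $\Omega_l=l\,\Omega=\{lx:x\in\Omega\}$.
   Context: $C_c^\infty(\Omega)$ is the set of smooth real functions on $\mathbb{R}^N$ with compact support contained in $\Omega$; $\|u\|_2=(\int_\Omega u^2dx)^{1/2}$; $a_\pm=\max\{0,\pm a\}$; $B_r(x)$ is the open ball of radius $r$ centred at $x$; $\log=\ln$ is the natural logarithm; $|\Omega|$ is Lebesgue measure; $\Gamma$ is the Gamma function, $\psi=\Gamma'/\Gamma$ is the Digamma function, $\gamma=-\Gamma'(1)$; $\mathbb{N}=\{1,2,\dots\}$. Constants: $$c_N=\frac{\Gamma(\frac N2)}{\pi^{\frac N2}},\quad \rho_N=2\ln 2+\psi\Big(\frac N2\Big)-\gamma,\quad C_N=c_N\Big(\int_{\mathbb{R}^N\setminus B_1(0)} |y|^{-2N}\,dy\Big)^{\frac12},$$ $$d_{N,\Omega}= 2\psi\Big(\frac N4 \Big)-2\psi\Big(\frac N2 \Big) +1-\gamma-C_N |\Omega|^{\frac12}.$$ The logarithmic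 Laplacian (the operator with Fourier symbol $2\ln|\xi|$) is, for Hölder continuous compactly supported $u$, $$(-\Delta)^{\ln} u(x)=c_N\,\mathrm{p.v.}\int_{B_1(x)}\frac{u(x)-u(y)}{|x-y|^{N}}\,dy - c_N\int_{\mathbb{R}^N\setminus B_1(0)}\frac{u(x+y)}{|y|^N}\,dy+\rho_N\,u(x),$$ and the logarithmic Hardy operator is $\mathcal{L}_\mu u=(-\Delta)^{\ln}u+2\mu\big(\log\frac1{|x|}\big)u$. Inner products: $$\langle u,v\rangle_{\ln}=c_N\iint_{\{x,y\in\mathbb{R}^N:\,|x-y|<1\}}\frac{(u(x)-u(y))(v(x)-v(y))}{|x-y|^{N}}\,dx\,dy+\int_{\Omega} u(x)v(x)\,dx,$$ $$\langle u,v\rangle_{\ln,\mu} = \langle u,v\rangle_{\ln} +2\mu \int_{\Omega} \Big(\log\frac1{|x|} \Big)_+u(x) v(x)\,dx+ (d_{N,\Omega})_+ \int_{\Omega} u(x) v(x)\,dx,$$ with $\|u\|_{\ln,\mu}=\sqrt{\langle u,u\rangle_{\ln,\mu}}$. $\mathbb{H}_0^{\ln,\mu}(\Omega)$ is the closure (completion) of $C_c^\infty(\Omega)$ with respect to $\|\cdot\|_{\ln,\mu}$. The Dirichlet energy of $\mathcal{L}_\mu$ in $\Omega$ is the bilinear form $$\mathcal{E}_{\ln,\mu}(u,\varphi)=\int_{\Omega}u(x)(-\Delta)^{\ln}\varphi(x)\,dx+2\mu \int_{\Omega} \Big(\log\frac1{|x|}\Big) u(x)\varphi(x)\,dx,$$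 understood for all $u,\varphi\in\mathbb{H}_0^{\ln,\mu}(\Omega)$ by density of $C_c^\infty(\Omega)$ and continuity. The Dirichlet eigenvalues $\lambda_1^{\ln,\mu}(\Omega)<\lambda_2^{\ln,\mu}(\Omega)\le\cdots$ of $\mathcal{L}_\mu$ in $\Omega$ are defined inductively by successive minimization: for $k\ge1$, $$\lambda_k^{\ln,\mu}(\Omega)=\min\Big\{\mathcal{E}_{\ln,\mu}(u,u): u\in\mathbb{H}_0^{\ln,\mu}(\Omega),\ \|u\|_2=1,\ \int_\Omega u\,\phi_j^{\ln,\mu}\,dx=0\text{ for }1\le j\le k-1\Big\},$$ and $\phi_k^{\ln,\mu}$ is a minimizer. These are eigenvalues with eigenfunctions $\phi_k^{\ln,\mu}$ in the weak sense $\mathcal{E}_{\ln,\mu}(\phi_k^{\ln,\mu},\varphi)=\lambda_k^{\ln,\mu}(\Omega)\int_\Omega\phi_k^{\ln,\mu}\varphi\,dx$ for all $\varphi\in\mathbb{H}_0^{\ln,\mu}(\Omega)$. The same definitions apply with $\Omega_l$ in place of $\Omega$. *)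

theory Defs
  imports "HOL-Analysis.Analysis"
begin

section \<open>Domains and test functions\<close>

text \<open>Near each boundary point, the domain is the strict epigraph, in some unit direction \<open>\<nu>\<close>,
  of a Lipschitz function on the hyperplane orthogonal to \<open>\<nu>\<close>.\<close>

definition bounded_lipschitz_domain :: "'a::euclidean_space set \<Rightarrow> bool" where
  "bounded_lipschitz_domain \<Omega> \<longleftrightarrow> open \<Omega> \<and> connected \<Omega> \<and> \<Omega> \<noteq> {} \<and> bounded \<Omega> \<and>
     (\<forall>p\<in>frontier \<Omega>. \<exists>\<nu> r L g. norm \<nu> = 1 \<and> r > 0 \<and> L-lipschitz_on {y. y \<bullet> \<nu> = 0} g \<and>
        \<Omega> \<inter> ball p r = {x \<in> ball p r. g (x - (x \<bullet> \<nu>) *\<^sub>R \<nu>) < x \<bullet> \<nu>})"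

primrec times_differentiable :: "nat \<Rightarrow> ('a::euclidean_space \<Rightarrow> real) \<Rightarrow> bool" where
  "times_differentiable 0 f \<longleftrightarrow> continuous_on UNIV f"
| "times_differentiable (Suc n) f \<longleftrightarrow> (\<forall>x. f differentiable (at x)) \<and>
     (\<forall>b\<in>Basis. times_differentiable n (\<lambda>x. frechet_derivative f (at x) b))"

definition smooth :: "('a::euclidean_space \<Rightarrow> real) \<Rightarrow> bool" where
  "smooth f \<longleftrightarrow> (\<forall>n. times_differentiable n f)"

definition test_functions :: "'a::euclidean_space set \<Rightarrow> ('a \<Rightarrow> real) set" where
  "test_functions \<Omega> = {f. smooth f \<and> compact (closure {x. f x \<noteq> 0}) \<and> closure {x. f x \<noteq> 0} \<subseteq> \<Omega>}"

section \<open>Constants\<close>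

text \<open>The dimension \<open>N\<close> of the paper is \<open>DIM('a)\<close>.\<close>

definition c_const :: "nat \<Rightarrow> real" where
  "c_const N = Gamma (real N / 2) / pi powr (real N / 2)"

definition rho_const :: "nat \<Rightarrow> real" where
  "rho_const N = 2 * ln 2 + Digamma (real N / 2) - euler_mascheroni"

definition C_const :: "'a::euclidean_space itself \<Rightarrow> real" where
  "C_const (_ :: 'a itself) =
     c_const DIM('a) * sqrt (LINT y:UNIV - ball (0::'a) 1|lborel. 1 / norm y ^ (2 * DIM('a)))"

definition d_const :: "'a::euclidean_space set \<Rightarrow> real" where
  "d_const \<Omega> = 2 * Digamma (real DIM('a) / 4) - 2 * Digamma (real DIM('a) / 2) + 1
     - euler_mascheroni - C_const TYPE('a) * sqrt (measure lborel \<Omega>)"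

section \<open>The logarithmic Laplacian\<close>

definition pv_part :: "('a::euclidean_space \<Rightarrow> real) \<Rightarrow> 'a \<Rightarrow> real" where
  "pv_part u x = Lim (at_right 0)
     (\<lambda>\<epsilon>. LINT y:ball x 1 - ball x \<epsilon>|lborel. (u x - u y) / norm (x - y) ^ DIM('a))"

definition log_laplacian :: "('a::euclidean_space \<Rightarrow> real) \<Rightarrow> 'a \<Rightarrow> real" where
  "log_laplacian u x = c_const DIM('a) * pv_part u x
     - c_const DIM('a) * (LINT y:UNIV - ball 0 1|lborel. u (x + y) / norm y ^ DIM('a))
     + rho_const DIM('a) * u x"

section \<open>The energy space\<close>

definition inner_ln :: "'a::euclidean_space set \<Rightarrow> ('a \<Rightarrow> real) \<Rightarrow> ('a \<Rightarrow> real) \<Rightarrow> real" where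
  "inner_ln \<Omega> u v =
     c_const DIM('a) *
       (LINT z:{(x, y). norm (x - y) < 1}|lborel \<Otimes>\<^sub>M lborel.
          (case z of (x, y) \<Rightarrow> (u x - u y) * (v x - v y) / norm (x - y) ^ DIM('a)))
     + (LINT x:\<Omega>|lborel. u x * v x)"

definition inner_ln_mu ::
    "'a::euclidean_space set \<Rightarrow> real \<Rightarrow> ('a \<Rightarrow> real) \<Rightarrow> ('a \<Rightarrow> real) \<Rightarrow> real" where
  "inner_ln_mu \<Omega> \<mu> u v = inner_ln \<Omega> u v
     + 2 * \<mu> * (LINT x:\<Omega>|lborel. max 0 (ln (1 / norm x)) * u x * v x)
     + max 0 (d_const \<Omega>) * (LINT x:\<Omega>|lborel. u x * v x)"

definition norm_ln_mu :: "'a::euclidean_space set \<Rightarrow> real \<Rightarrow> ('a \<Rightarrow> real) \<Rightarrow> real" where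
  "norm_ln_mu \<Omega> \<mu> u = sqrt (inner_ln_mu \<Omega> \<mu> u u)"

text \<open>Square-integrable functions on \<open>\<Omega>\<close>, extended by zero; elements that agree almost
  everywhere are not identified.\<close>

definition L2_space :: "'a::euclidean_space set \<Rightarrow> ('a \<Rightarrow> real) set" where
  "L2_space \<Omega> = {u. u \<in> borel_measurable borel \<and> (\<forall>x. x \<notin> \<Omega> \<longrightarrow> u x = 0) \<and>
     set_integrable lborel \<Omega> (\<lambda>x. (u x)\<^sup>2)}"

definition L2_norm :: "'a::euclidean_space set \<Rightarrow> ('a \<Rightarrow> real) \<Rightarrow> real" where
  "L2_norm \<Omega> u = sqrt (LINT x:\<Omega>|lborel. (u x)\<^sup>2)"

text \<open>The completion of the test functions is realised inside \<open>L\<^sup>2(\<Omega>)\<close>: an element is the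
  \<open>L\<^sup>2\<close>-limit of a sequence of test functions that is Cauchy for the energy norm.\<close>

definition approximates ::
    "'a::euclidean_space set \<Rightarrow> real \<Rightarrow> (nat \<Rightarrow> 'a \<Rightarrow> real) \<Rightarrow> ('a \<Rightarrow> real) \<Rightarrow> bool" where
  "approximates \<Omega> \<mu> s u \<longleftrightarrow> (\<forall>n. s n \<in> test_functions \<Omega>) \<and>
     (\<forall>\<epsilon>>0. \<exists>M. \<forall>m\<ge>M. \<forall>n\<ge>M. norm_ln_mu \<Omega> \<mu> (\<lambda>x. s m x - s n x) < \<epsilon>) \<and>
     (\<lambda>n. L2_norm \<Omega> (\<lambda>x. s n x - u x)) \<longlonglongrightarrow> 0"

definition energy_space :: "'a::euclidean_space set \<Rightarrow> real \<Rightarrow> ('a \<Rightarrow> real) set" where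
  "energy_space \<Omega> \<mu> = {u \<in> L2_space \<Omega>. \<exists>s. approximates \<Omega> \<mu> s u}"

section \<open>Dirichlet energy and eigenvalues\<close>

definition test_energy ::
    "'a::euclidean_space set \<Rightarrow> real \<Rightarrow> ('a \<Rightarrow> real) \<Rightarrow> ('a \<Rightarrow> real) \<Rightarrow> real" where
  "test_energy \<Omega> \<mu> u \<phi> = (LINT x:\<Omega>|lborel. u x * log_laplacian \<phi> x)
     + 2 * \<mu> * (LINT x:\<Omega>|lborel. ln (1 / norm x) * u x * \<phi> x)"

text \<open>Extension from test functions to the energy space by density and continuity.\<close>

definition energy ::
    "'a::euclidean_space set \<Rightarrow> real \<Rightarrow> ('a \<Rightarrow> real) \<Rightarrow> ('a \<Rightarrow> real) \<Rightarrow> real" where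
  "energy \<Omega> \<mu> u \<phi> = (THE e. \<forall>s t. approximates \<Omega> \<mu> s u \<longrightarrow> approximates \<Omega> \<mu> t \<phi> \<longrightarrow>
     (\<lambda>n. test_energy \<Omega> \<mu> (s n) (t n)) \<longlonglongrightarrow> e)"

definition admissible ::
    "'a::euclidean_space set \<Rightarrow> real \<Rightarrow> (nat \<Rightarrow> 'a \<Rightarrow> real) \<Rightarrow> nat \<Rightarrow> ('a \<Rightarrow> real) set" where
  "admissible \<Omega> \<mu> \<phi> k = {u \<in> energy_space \<Omega> \<mu>. L2_norm \<Omega> u = 1 \<and>
     (\<forall>j\<in>{1..<k}. (LINT x:\<Omega>|lborel. u x * \<phi> j x) = 0)}"

text \<open>Indices start at 1; the value \<open>\<phi> 0\<close> is irrelevant.\<close>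

definition successive_minimizers ::
    "'a::euclidean_space set \<Rightarrow> real \<Rightarrow> (nat \<Rightarrow> 'a \<Rightarrow> real) \<Rightarrow> bool" where
  "successive_minimizers \<Omega> \<mu> \<phi> \<longleftrightarrow> (\<forall>k\<ge>1. \<phi> k \<in> admissible \<Omega> \<mu> \<phi> k \<and>
     (\<forall>u\<in>admissible \<Omega> \<mu> \<phi> k. energy \<Omega> \<mu> (\<phi> k) (\<phi> k) \<le> energy \<Omega> \<mu> u u))"

definition eigenfunction ::
    "'a::euclidean_space set \<Rightarrow> real \<Rightarrow> nat \<Rightarrow> 'a \<Rightarrow> real" where
  "eigenfunction \<Omega> \<mu> = (SOME \<phi>. successive_minimizers \<Omega> \<mu> \<phi>)"

definition eigenvalue :: "'a::euclidean_space set \<Rightarrow> real \<Rightarrow> nat \<Rightarrow> real" where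
  "eigenvalue \<Omega> \<mu> k =
     (LEAST e. \<exists>u\<in>admissible \<Omega> \<mu> (eigenfunction \<Omega> \<mu>) k. e = energy \<Omega> \<mu> u u)"

end

theory Submission
  imports Defs "HOL-Complex_Analysis.Great_Picard" "HOL-Library.Diagonal_Subsequence"
begin

text \<open>The constants come from a Hardy inequality with logarithmic weight. For small \<open>e > 0\<close> the kernel
  \<open>\<bar>x - y\<bar>\<^sup>e\<^sup>-\<^sup>N\<close> is bounded by Schur's test with weight \<open>\<bar>x\<bar>\<^sup>-\<^sup>N\<^sup>/\<^sup>2\<close>, whose Riesz potential is explicit
  in terms of Gamma functions; splitting the kernel at distance 1, cancelling the pole \<open>2/e\<close>
  and letting \<open>e\<close> tend to 0 produces the Digamma values. The resulting inequality says
  that the logarithmic Laplacian dominates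
  \<open>2 (Digamma (N/4) + ln 2) - 2 ln \<bar>x\<bar>\<close>, which gives the lower bound, and for \<open>\<mu> > -1\<close> it also gives
  coercivity of the energy, so the energy space is the closure of the test functions in the graph norm.

  Since eigenvalues are values at chosen minimizers, minimizers must exist. Functions of bounded
  energy are precompact in \<open>L\<^sup>2\<close>: mollification with truncations of the kernel \<open>\<bar>z\<bar>\<^sup>-\<^sup>N\<close>, whose mass diverges,
  is compact by Arzela--Ascoli and is close to the identity. The value at the \<open>k\<close>-th minimizer does
  not depend on the choice, by the Courant--Fischer argument. Finally, \<open>L\<^sup>2\<close>-normalized dilation by \<open>l\<close> shifts
  the logarithmic Laplacian by \<open>-2 ln l\<close> and the potential by \<open>-2 \<mu> ln l\<close>, and maps
  minimizers to minimizers.\<close>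

section \<open>Square-integrable functions\<close>

text \<open>The condition \<mu> > -1 is what the Hardy inequality can pay for: it bounds the form of
  -2 log|x| by the whole near part of the energy plus L2 terms. For negative \<mu> a fraction -\<mu>
  < 1 of the near part is spent, and the rest still controls the norm. When the Hardy constant is
  added to \<open>rho_const\<close>, Digamma (N/2) and Euler's constant cancel, which leaves 2
  (Digamma (N/4) + ln 2). Neither the energy nor the inner product of the space controls the near
  form by itself, but only up to a multiple of the L2 norm; the L2 convergence built into
  \<open>approximates\<close> absorbs that multiple. Elements are functions rather than classes and
  vanish at every point outside the domain. Limits are therefore chosen pointwise, and the L2 form
  is only semidefinite. Dilation moves the cutoff at distance 1, so the graph norm is not invariant
  under it. The exact shift of the energy, combined with coercivity on the dilated domain, takes the
  place of invariance.\<close>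

definition square_integrable :: "'b measure \<Rightarrow> ('b \<Rightarrow> real) \<Rightarrow> bool" where
  "square_integrable M f \<longleftrightarrow> f \<in> borel_measurable M \<and> integrable M (\<lambda>x. (f x)\<^sup>2)"

lemma square_integrable_square: "square_integrable M f \<Longrightarrow> integrable M (\<lambda>x. (f x)\<^sup>2)"
  by (simp add: square_integrable_def)

lemma square_integrable_mult:
  assumes "square_integrable M f" "square_integrable M g"
  shows "integrable M (\<lambda>x. f x * g x)"
proof (rule Bochner_Integration.integrable_bound)
  show "integrable M (\<lambda>x. (f x)\<^sup>2 + (g x)\<^sup>2)"
    using assms by (auto simp: square_integrable_def)
  show "(\<lambda>x. f x * g x) \<in> borel_measurable M"
    using assms by (auto simp: square_integrable_def)
  have "\<bar>a * b\<bar> \<le> a\<^sup>2 + b\<^sup>2" for a b :: real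
    using sum_squares_bound[of "\<bar>a\<bar>" "\<bar>b\<bar>"] mult_nonneg_nonneg[OF abs_ge_zero[of a] abs_ge_zero[of b]]
    unfolding abs_mult power2_abs by linarith
  then show "AE x in M. norm (f x * g x) \<le> norm ((f x)\<^sup>2 + (g x)\<^sup>2)"
    by (simp add: real_norm_def)
qed

lemma square_integrable_lincomb:
  assumes "square_integrable M f" "square_integrable M g"
  shows "square_integrable M (\<lambda>x. a * f x + b * g x)"
  unfolding square_integrable_def
proof
  show "(\<lambda>x. a * f x + b * g x) \<in> borel_measurable M"
    using assms by (auto simp: square_integrable_def)
  have "(\<lambda>x. (a * f x + b * g x)\<^sup>2) =
      (\<lambda>x. a\<^sup>2 * (f x)\<^sup>2 + 2 * a * b * (f x * g x) + b\<^sup>2 * (g x)\<^sup>2)"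
    by (auto simp: power2_eq_square algebra_simps)
  then show "integrable M (\<lambda>x. (a * f x + b * g x)\<^sup>2)"
    using square_integrable_mult[OF assms] assms by (auto simp: square_integrable_def)
qed

lemma square_integrable_diff:
  assumes "square_integrable M f" "square_integrable M g"
  shows "square_integrable M (\<lambda>x. f x - g x)"
  using square_integrable_lincomb[OF assms, of 1 "-1"] by simp

lemma square_integrable_Fatou:
  fixes f :: "nat \<Rightarrow> 'b \<Rightarrow> real"
  assumes f: "\<And>n. square_integrable M (f n)" and g: "g \<in> borel_measurable M"
    and lim: "AE x in M. (\<lambda>n. f n x) \<longlonglongrightarrow> g x"
    and bound: "\<forall>\<^sub>F n in sequentially. (LINT x|M. (f n x)\<^sup>2) \<le> C"
  shows "square_integrable M g \<and> (LINT x|M. (g x)\<^sup>2) \<le> C"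
proof -
  have meas[measurable]: "f n \<in> borel_measurable M" "g \<in> borel_measurable M" for n
    using f g by (auto simp: square_integrable_def)
  obtain n0 where n0: "(LINT x|M. (f n0 x)\<^sup>2) \<le> C"
    using bound by (auto simp: eventually_sequentially)
  then have C: "0 \<le> C" by (rule order_trans[rotated]) simp
  have "(\<integral>\<^sup>+x. ennreal ((g x)\<^sup>2) \<partial>M) = (\<integral>\<^sup>+x. liminf (\<lambda>n. ennreal ((f n x)\<^sup>2)) \<partial>M)"
  proof (rule nn_integral_cong_AE)
    show "AE x in M. ennreal ((g x)\<^sup>2) = liminf (\<lambda>n. ennreal ((f n x)\<^sup>2))"
      using lim
    proof eventually_elim
      case (elim x)
      then have "(\<lambda>n. ennreal ((f n x)\<^sup>2)) \<longlonglongrightarrow> ennreal ((g x)\<^sup>2)"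
        by (intro tendsto_ennrealI tendsto_power)
      then show ?case using lim_imp_Liminf[OF sequentially_bot] by metis
    qed
  qed
  also have "\<dots> \<le> liminf (\<lambda>n. \<integral>\<^sup>+x. ennreal ((f n x)\<^sup>2) \<partial>M)"
    by (rule nn_integral_liminf) auto
  also have "\<dots> \<le> ennreal C"
  proof (rule Liminf_le)
    show "\<forall>\<^sub>F n in sequentially. (\<integral>\<^sup>+x. ennreal ((f n x)\<^sup>2) \<partial>M) \<le> ennreal C"
      using bound
    proof eventually_elim
      case (elim n)
      have "(\<integral>\<^sup>+x. ennreal ((f n x)\<^sup>2) \<partial>M) = ennreal (LINT x|M. (f n x)\<^sup>2)"
        using f[of n] by (intro nn_integral_eq_integral) (auto simp: square_integrable_def)
      then show ?case using elim by (simp add: ennreal_leI)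
    qed
  qed simp
  finally have le: "(\<integral>\<^sup>+x. ennreal ((g x)\<^sup>2) \<partial>M) \<le> ennreal C" .
  then have int: "integrable M (\<lambda>x. (g x)\<^sup>2)"
    by (intro integrableI_nonneg) (auto simp: le_less_trans)
  have "ennreal (LINT x|M. (g x)\<^sup>2) \<le> ennreal C"
    using le int by (subst nn_integral_eq_integral[symmetric]) auto
  then show ?thesis using int C g by (simp add: square_integrable_def)
qed

text \<open>The limit is prescribed along a subsequence instead of being produced. One sequence of
  functions can thus be followed at the same time in Lebesgue measure and, through its differences,
  in a measure on pairs.\<close>

lemma square_integrable_Cauchy_limit:
  fixes f :: "nat \<Rightarrow> 'b \<Rightarrow> real"
  assumes f: "\<And>n. square_integrable M (f n)" and g: "g \<in> borel_measurable M"
    and r: "strict_mono r" and lim: "AE x in M. (\<lambda>n. f (r n) x) \<longlonglongrightarrow> g x"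
    and cauchy: "\<And>e. e > 0 \<Longrightarrow> \<exists>K. \<forall>m\<ge>K. \<forall>n\<ge>K. (LINT x|M. (f m x - f n x)\<^sup>2) < e"
  shows "square_integrable M g" "(\<lambda>n. LINT x|M. (f n x - g x)\<^sup>2) \<longlonglongrightarrow> 0"
proof -
  have *: "\<exists>K. \<forall>n\<ge>K. square_integrable M (\<lambda>x. f n x - g x) \<and> (LINT x|M. (f n x - g x)\<^sup>2) \<le> e"
    if e: "e > 0" for e
  proof -
    obtain K where K: "\<And>m n. m \<ge> K \<Longrightarrow> n \<ge> K \<Longrightarrow> (LINT x|M. (f m x - f n x)\<^sup>2) < e"
      using cauchy[OF e] by blast
    \<comment> \<open>Fatou's lemma with \<open>n\<close> fixed and \<open>k\<close> tending to
      infinity carries the Cauchy bound from \<open>f n - f (r k)\<close> over to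
      \<open>f n - g\<close>.\<close>
    have "square_integrable M (\<lambda>x. f n x - g x) \<and> (LINT x|M. (f n x - g x)\<^sup>2) \<le> e" if n: "n \<ge> K" for n
    proof (rule square_integrable_Fatou[where f="\<lambda>k x. f n x - f (r k) x"])
      show "(\<lambda>x. f n x - g x) \<in> borel_measurable M" using f[of n] g by (auto simp: square_integrable_def)
      show "AE x in M. (\<lambda>k. f n x - f (r k) x) \<longlonglongrightarrow> f n x - g x"
        using lim by eventually_elim (intro tendsto_intros)
      show "\<forall>\<^sub>F k in sequentially. (LINT x|M. (f n x - f (r k) x)\<^sup>2) \<le> e"
        unfolding eventually_sequentially
        using K n seq_suble[OF r] by (meson less_imp_le order_trans)
    qed (intro square_integrable_diff f)
    then show ?thesis by blast
  qed
  obtain n where "square_integrable M (\<lambda>x. f n x - g x)" using *[of 1] by auto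
  from square_integrable_diff[OF f[of n] this] show "square_integrable M g" by simp
  show "(\<lambda>n. LINT x|M. (f n x - g x)\<^sup>2) \<longlonglongrightarrow> 0"
  proof (rule LIMSEQ_I)
    fix e :: real assume "e > 0"
    then obtain K where K: "\<And>n. n \<ge> K \<Longrightarrow> (LINT x|M. (f n x - g x)\<^sup>2) \<le> e / 2"
      using *[of "e/2"] by auto
    have "norm ((LINT x|M. (f n x - g x)\<^sup>2) - 0) < e" if "n \<ge> K" for n
      using K[OF that] \<open>e > 0\<close> by simp
    then show "\<exists>K. \<forall>n\<ge>K. norm ((LINT x|M. (f n x - g x)\<^sup>2) - 0) < e" by blast
  qed
qed

text \<open>The elementary bound \<open>\<bar>d\<bar> \<le> 2\<^sup>n d\<^sup>2 + 2\<^sup>-\<^sup>n\<close> turns a rapidly decreasing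
  sequence of \<open>L\<^sup>2\<close> distances into an almost everywhere absolutely summable telescope.\<close>

lemma square_integrable_AE_subseq:
  fixes f :: "nat \<Rightarrow> 'b \<Rightarrow> real"
  assumes f: "\<And>n. square_integrable M (f n)"
    and cauchy: "\<And>e. e > 0 \<Longrightarrow> \<exists>K. \<forall>m\<ge>K. \<forall>n\<ge>K. (LINT x|M. (f m x - f n x)\<^sup>2) < e"
  obtains r where "strict_mono r" "AE x in M. convergent (\<lambda>n. f (r n) x)"
proof -
  have meas[measurable]: "f n \<in> borel_measurable M" for n
    using f by (auto simp: square_integrable_def)
  have "\<exists>K. \<forall>m\<ge>K. \<forall>n\<ge>K. (LINT x|M. (f m x - f n x)\<^sup>2) < (1/4)^k" for k
    using cauchy[of "(1/4)^k"] by simp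
  then obtain K :: "nat \<Rightarrow> nat" where K: "\<And>k m n. m \<ge> K k \<Longrightarrow> n \<ge> K k \<Longrightarrow> (LINT x|M. (f m x - f n x)\<^sup>2) < (1/4)^k"
    by metis
  \<comment> \<open>The maximum gives strict growth and \<open>r n \<ge> K n\<close>. Squared
    distances of order (1/4)^n leave room for the weight 2^n, with a summable (1/2)^n
    remaining.\<close>
  define r where "r = rec_nat (K 0) (\<lambda>n p. max (Suc p) (K (Suc n)))"
  have r_Suc: "r (Suc n) = max (Suc (r n)) (K (Suc n))" for n by (simp add: r_def)
  have mono: "strict_mono r" by (auto simp: strict_mono_Suc_iff r_Suc)
  have rK: "r n \<ge> K n" for n by (cases n) (auto simp: r_Suc, simp add: r_def)
  define d where "d n x = f (r (Suc n)) x - f (r n) x" for n x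
  have d_meas[measurable]: "d n \<in> borel_measurable M" for n unfolding d_def by measurable
  have d_sqi: "square_integrable M (d n)" for n
    unfolding d_def by (intro square_integrable_diff f)
  have d_le: "(LINT x|M. (d n x)\<^sup>2) \<le> (1/4)^n" for n
  proof -
    have "r n < r (Suc n)" using mono by (simp add: strict_mono_less)
    then show ?thesis unfolding d_def using K[where k=n and m = "r (Suc n)" and n = "r n"] rK[of n] by simp
  qed
  have "(\<integral>\<^sup>+x. (\<Sum>n. ennreal (2^n * (d n x)\<^sup>2)) \<partial>M) = (\<Sum>n. \<integral>\<^sup>+x. ennreal (2^n * (d n x)\<^sup>2) \<partial>M)"
    by (rule nn_integral_suminf) measurable
  also have "\<dots> \<le> (\<Sum>n. ennreal ((1/2)^n))"
  proof (rule suminf_le)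
    fix n
    have "(\<integral>\<^sup>+x. ennreal (2^n * (d n x)\<^sup>2) \<partial>M) = ennreal (LINT x|M. 2^n * (d n x)\<^sup>2)"
      using d_sqi[of n] by (intro nn_integral_eq_integral) (auto simp: square_integrable_def)
    also have "(LINT x|M. 2^n * (d n x)\<^sup>2) \<le> 2^n * (1/4)^n" using d_le[of n] by simp
    also have "(2::real)^n * (1/4)^n = (1/2)^n" by (simp add: power_mult_distrib[symmetric])
    finally show "(\<integral>\<^sup>+x. ennreal (2^n * (d n x)\<^sup>2) \<partial>M) \<le> ennreal ((1/2)^n)"
      by (simp add: ennreal_leI)
  qed auto
  also have "\<dots> = ennreal (\<Sum>n. (1/2)^n)" by (rule suminf_ennreal2) (auto simp: summable_geometric)
  also have "\<dots> < \<infinity>" by simp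
  finally have fin: "(\<integral>\<^sup>+x. (\<Sum>n. ennreal (2^n * (d n x)\<^sup>2)) \<partial>M) \<noteq> \<infinity>" by simp
  have "AE x in M. (\<Sum>n. ennreal (2^n * (d n x)\<^sup>2)) \<noteq> \<infinity>"
    by (rule nn_integral_PInf_AE[OF _ fin]) measurable
  then have "AE x in M. convergent (\<lambda>n. f (r n) x)"
  proof eventually_elim
    case (elim x)
    then have s1: "summable (\<lambda>n. 2^n * (d n x)\<^sup>2)" by (intro summable_suminf_not_top) auto
    have s2: "summable (\<lambda>n. 2^n * (d n x)\<^sup>2 + (1/2)^n)"
      by (intro summable_add s1 summable_geometric) simp
    have "\<bar>a\<bar> \<le> 2^n * a\<^sup>2 + (1/2)^n" for a :: real and n :: nat
    proof (cases "\<bar>a\<bar> \<le> (1/2)^n")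
      case True then show ?thesis by (smt (verit) zero_le_power2 mult_nonneg_nonneg zero_le_power)
    next
      case False
      then have "1 \<le> 2^n * \<bar>a\<bar>" by (simp add: power_one_over field_simps)
      then have "1 * \<bar>a\<bar> \<le> 2^n * \<bar>a\<bar> * \<bar>a\<bar>" by (intro mult_right_mono) auto
      also have "\<dots> = 2^n * a\<^sup>2" by (simp add: power2_eq_square)
      finally show ?thesis by (smt (verit) zero_le_power zero_le_divide_1_iff)
    qed
    then have "summable (\<lambda>n. d n x)" by (intro summable_comparison_test'[OF s2]) auto
    then have "convergent (\<lambda>n. \<Sum>i<n. d i x)" by (simp add: summable_iff_convergent)
    then have "convergent (\<lambda>n. (\<Sum>i<n. d i x) + f (r 0) x)"
      by (intro convergent_add convergent_const)
    also have "(\<lambda>n. (\<Sum>i<n. d i x) + f (r 0) x) = (\<lambda>n. f (r n) x)"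
      unfolding d_def using sum_lessThan_telescope[of "\<lambda>i. f (r i) x"] by auto
    finally show ?case .
  qed
  with mono that show ?thesis by blast
qed

text \<open>The limit is exported in the explicit form \<open>lim\<close>, so that zeros of all
  members survive at every point and not merely almost everywhere; members of the energy space have
  to vanish everywhere outside the domain.\<close>

lemma square_integrable_complete:
  fixes f :: "nat \<Rightarrow> 'b \<Rightarrow> real"
  assumes f: "\<And>n. square_integrable M (f n)"
    and cauchy: "\<And>e. e > 0 \<Longrightarrow> \<exists>K. \<forall>m\<ge>K. \<forall>n\<ge>K. (LINT x|M. (f m x - f n x)\<^sup>2) < e"
  obtains g r where "square_integrable M g" "(\<lambda>n. LINT x|M. (f n x - g x)\<^sup>2) \<longlonglongrightarrow> 0"
    "strict_mono r" "g = (\<lambda>x. lim (\<lambda>n. f (r n) x))" "AE x in M. (\<lambda>n. f (r n) x) \<longlonglongrightarrow> g x"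
proof -
  obtain r where r: "strict_mono r" "AE x in M. convergent (\<lambda>n. f (r n) x)"
    using square_integrable_AE_subseq[OF assms] by blast
  have meas[measurable]: "f n \<in> borel_measurable M" for n
    using f by (auto simp: square_integrable_def)
  define g where "g = (\<lambda>x. lim (\<lambda>n. f (r n) x))"
  have g: "g \<in> borel_measurable M" unfolding g_def by (rule borel_measurable_lim_metric) simp
  have lim: "AE x in M. (\<lambda>n. f (r n) x) \<longlonglongrightarrow> g x"
    using r(2) unfolding g_def by eventually_elim (simp add: convergent_LIMSEQ_iff)
  show ?thesis
    using that[OF square_integrable_Cauchy_limit[OF f g r(1) lim cauchy] r(1) g_def lim] by blast
qed

section \<open>Successive minimization of a quadratic form\<close>

definition function_subspace :: "('a \<Rightarrow> real) set \<Rightarrow> bool" where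
  "function_subspace H \<longleftrightarrow> H \<noteq> {} \<and> (\<forall>u\<in>H. \<forall>v\<in>H. \<forall>a b. (\<lambda>x. a * u x + b * v x) \<in> H)"

definition symmetric_bilinear_on ::
    "('a \<Rightarrow> real) set \<Rightarrow> (('a \<Rightarrow> real) \<Rightarrow> ('a \<Rightarrow> real) \<Rightarrow> real) \<Rightarrow> bool" where
  "symmetric_bilinear_on H F \<longleftrightarrow> (\<forall>u\<in>H. \<forall>v\<in>H. F u v = F v u) \<and>
     (\<forall>u\<in>H. \<forall>v\<in>H. \<forall>w\<in>H. \<forall>a b. F (\<lambda>x. a * u x + b * v x) w = a * F u w + b * F v w)"

lemma function_subspace_lincomb:
  "function_subspace H \<Longrightarrow> u \<in> H \<Longrightarrow> v \<in> H \<Longrightarrow> (\<lambda>x. a * u x + b * v x) \<in> H"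
  by (simp add: function_subspace_def)

lemma function_subspace_diff:
  "function_subspace H \<Longrightarrow> u \<in> H \<Longrightarrow> v \<in> H \<Longrightarrow> (\<lambda>x. u x - v x) \<in> H"
  using function_subspace_lincomb[of H u v 1 "-1"] by simp

lemma function_subspace_add:
  "function_subspace H \<Longrightarrow> u \<in> H \<Longrightarrow> v \<in> H \<Longrightarrow> (\<lambda>x. u x + v x) \<in> H"
  using function_subspace_lincomb[of H u v 1 1] by simp

lemma function_subspace_scale:
  "function_subspace H \<Longrightarrow> u \<in> H \<Longrightarrow> (\<lambda>x. a * u x) \<in> H"
  using function_subspace_lincomb[of H u u a 0] by simp

lemma function_subspace_sum:
  assumes "function_subspace H" "finite I" "\<And>i. i \<in> I \<Longrightarrow> f i \<in> H"
  shows "(\<lambda>x. \<Sum>i\<in>I. a i * f i x) \<in> H"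
  using assms(2,3)
proof (induction I rule: finite_induct)
  case empty
  obtain u where "u \<in> H" using assms(1) by (auto simp: function_subspace_def)
  then show ?case using function_subspace_scale[OF assms(1), of u 0] by simp
next
  case (insert i I)
  then show ?case
    using function_subspace_lincomb[OF assms(1), of "f i" "\<lambda>x. \<Sum>i\<in>I. a i * f i x" "a i" 1] by simp
qed

locale bilinear_on =
  fixes H :: "('a \<Rightarrow> real) set" and F :: "('a \<Rightarrow> real) \<Rightarrow> ('a \<Rightarrow> real) \<Rightarrow> real"
  assumes subspace: "function_subspace H" and bilin: "symmetric_bilinear_on H F"
begin

lemma sym: "u \<in> H \<Longrightarrow> v \<in> H \<Longrightarrow> F u v = F v u"
  using bilin by (auto simp: symmetric_bilinear_on_def)

lemma left: "u \<in> H \<Longrightarrow> v \<in> H \<Longrightarrow> w \<in> H \<Longrightarrow> F (\<lambda>x. a * u x + b * v x) w = a * F u w + b * F v w"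
  using bilin by (auto simp: symmetric_bilinear_on_def)

lemma left_scale: "u \<in> H \<Longrightarrow> w \<in> H \<Longrightarrow> F (\<lambda>x. a * u x) w = a * F u w"
  using left[of u u w a 0] by simp

lemma left_diff: "u \<in> H \<Longrightarrow> v \<in> H \<Longrightarrow> w \<in> H \<Longrightarrow> F (\<lambda>x. u x - v x) w = F u w - F v w"
  using left[of u v w 1 "-1"] by simp

lemma right_diff: "u \<in> H \<Longrightarrow> v \<in> H \<Longrightarrow> w \<in> H \<Longrightarrow> F w (\<lambda>x. u x - v x) = F w u - F w v"
  using left_diff[of u v w] sym[of w] function_subspace_diff[OF subspace, of u v] by simp

lemma quadratic: 
  assumes "u \<in> H" "v \<in> H"
  shows "F (\<lambda>x. a * u x + b * v x) (\<lambda>x. a * u x + b * v x) = a\<^sup>2 * F u u + 2 * a * b * F u v + b\<^sup>2 * F v v"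
proof -
  note c = function_subspace_lincomb[OF subspace assms, of a b]
  have "F (\<lambda>x. a * u x + b * v x) (\<lambda>x. a * u x + b * v x)
      = a * F u (\<lambda>x. a * u x + b * v x) + b * F v (\<lambda>x. a * u x + b * v x)"
    using left assms c by blast
  also have "F u (\<lambda>x. a * u x + b * v x) = a * F u u + b * F u v"
    using left[of u v u a b] assms sym[OF assms(1) c] sym[OF assms] by simp
  also have "F v (\<lambda>x. a * u x + b * v x) = a * F u v + b * F v v"
    using left[of u v v a b] assms sym[OF assms(2) c] by simp
  finally show ?thesis by (simp add: power2_eq_square algebra_simps)
qed

lemma quadratic_diff:
  assumes "u \<in> H" "v \<in> H"
  shows "F (\<lambda>x. u x - v x) (\<lambda>x. u x - v x) = F u u - 2 * F u v + F v v"
  using quadratic[OF assms, of 1 "-1"] by simp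

lemma quadratic_add:
  assumes "u \<in> H" "v \<in> H"
  shows "F (\<lambda>x. u x + v x) (\<lambda>x. u x + v x) = F u u + 2 * F u v + F v v"
  using quadratic[OF assms, of 1 1] by simp

lemma quadratic_scale:
  assumes "u \<in> H"
  shows "F (\<lambda>x. a * u x) (\<lambda>x. a * u x) = a\<^sup>2 * F u u"
  using quadratic[OF assms assms, of a 0] by simp

lemma left_sum:
  assumes "finite I" "\<And>i. i \<in> I \<Longrightarrow> f i \<in> H" "w \<in> H"
  shows "F (\<lambda>x. \<Sum>i\<in>I. a i * f i x) w = (\<Sum>i\<in>I. a i * F (f i) w)"
  using assms(1,2)
proof (induction I rule: finite_induct)
  case empty
  then show ?case using left_scale[OF assms(3) assms(3), of 0] by simp
next
  case (insert i I)
  have "(\<lambda>x. \<Sum>i\<in>I. a i * f i x) \<in> H"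
    by (rule function_subspace_sum[OF subspace]) (use insert in auto)
  then show ?case
    using left[of "f i" "\<lambda>x. \<Sum>i\<in>I. a i * f i x" w "a i" 1] insert assms(3) by simp
qed

lemma quadratic_sum_orthogonal:
  assumes "finite I" "\<And>i. i \<in> I \<Longrightarrow> f i \<in> H" "\<And>i j. i \<in> I \<Longrightarrow> j \<in> I \<Longrightarrow> i \<noteq> j \<Longrightarrow> F (f i) (f j) = 0"
  shows "F (\<lambda>x. \<Sum>i\<in>I. a i * f i x) (\<lambda>x. \<Sum>i\<in>I. a i * f i x) = (\<Sum>i\<in>I. (a i)\<^sup>2 * F (f i) (f i))"
proof -
  let ?s = "\<lambda>x. \<Sum>i\<in>I. a i * f i x"
  have s: "?s \<in> H" by (rule function_subspace_sum[OF subspace]) (use assms in auto)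
  have "F (f i) ?s = a i * F (f i) (f i)" if i: "i \<in> I" for i
  proof -
    have "F (f i) ?s = (\<Sum>j\<in>I. a j * F (f j) (f i))"
      using sym[OF assms(2)[OF i] s] left_sum[of I f "f i" a] assms i by simp
    also have "\<dots> = (\<Sum>j\<in>I. if j = i then a j * F (f j) (f i) else 0)"
      by (rule sum.cong) (use assms i in auto)
    finally show ?thesis using i assms(1) by simp
  qed
  then show ?thesis
    using left_sum[of I f ?s a] assms s by (simp add: power2_eq_square mult.assoc)
qed

end

text \<open>Polarization at b p + q/b and b p - q/b turns the diagonal bound into |F(p,q)| \<le> |C|
  (a G(p,p) + G(q,q)/a) with a = b^2. The free weight \<open>a\<close> does the work of the
  Cauchy-Schwarz inequality without square roots.\<close>

lemma bounded_form_convergence: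
  assumes F: "bilinear_on H F" and G: "bilinear_on H G"
    and nonneg: "\<And>u. u \<in> H \<Longrightarrow> 0 \<le> G u u"
    and bound: "\<And>u. u \<in> H \<Longrightarrow> \<bar>F u u\<bar> \<le> C * G u u"
    and H: "\<And>n. s n \<in> H" "\<And>n. t n \<in> H" "u \<in> H" "v \<in> H"
    and s: "(\<lambda>n. G (\<lambda>x. s n x - u x) (\<lambda>x. s n x - u x)) \<longlonglongrightarrow> 0"
    and t: "(\<lambda>n. G (\<lambda>x. t n x - v x) (\<lambda>x. t n x - v x)) \<longlonglongrightarrow> 0"
  shows "(\<lambda>n. F (s n) (t n)) \<longlonglongrightarrow> F u v"
proof -
  interpret F: bilinear_on H F by fact
  interpret G: bilinear_on H G by fact
  note sub = F.subspace
  have fb: "\<bar>F p q\<bar> \<le> \<bar>C\<bar> * (a * G p p + G q q / a)"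
    if pq: "p \<in> H" "q \<in> H" and a: "a > 0" for p q a
  proof -
    define b where "b = sqrt a"
    have b: "b > 0" "b * b = a" using a by (auto simp: b_def)
    let ?p = "\<lambda>x. b * p x + (1/b) * q x" and ?m = "\<lambda>x. b * p x + (- (1/b)) * q x"
    have mem: "?p \<in> H" "?m \<in> H" by (rule function_subspace_lincomb[OF sub pq])+
    have "4 * F p q = F ?p ?p - F ?m ?m"
      using b by (simp only: F.quadratic[OF pq]) (simp add: field_simps power2_eq_square)
    then have "4 * \<bar>F p q\<bar> \<le> \<bar>F ?p ?p\<bar> + \<bar>F ?m ?m\<bar>" by linarith
    also have "\<dots> \<le> \<bar>C\<bar> * G ?p ?p + \<bar>C\<bar> * G ?m ?m"
      using bound[OF mem(1)] bound[OF mem(2)] nonneg[OF mem(1)] nonneg[OF mem(2)]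
      by (intro add_mono) (meson abs_ge_self mult_right_mono order_trans)+
    also have "\<dots> = \<bar>C\<bar> * (G ?p ?p + G ?m ?m)" by (simp only: distrib_left)
    also have "G ?p ?p + G ?m ?m = 2 * ((b*b) * G p p + G q q / (b*b))"
      using b(1) by (simp only: G.quadratic[OF pq]) (simp add: field_simps power2_eq_square)
    finally have "4 * \<bar>F p q\<bar> \<le> \<bar>C\<bar> * (2 * (a * G p p + G q q / a))" using b by simp
    moreover have "0 \<le> \<bar>C\<bar> * (a * G p p + G q q / a)"
      using nonneg[OF pq(1)] nonneg[OF pq(2)] a by simp
    ultimately show ?thesis by linarith
  qed
  have to0: "(\<lambda>n. F p (w n)) \<longlonglongrightarrow> 0"
    if p: "p \<in> H" and w: "\<And>n. w n \<in> H" and lim: "(\<lambda>n. G (w n) (w n)) \<longlonglongrightarrow> 0" for p w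
  proof (rule LIMSEQ_I)
    fix e :: real assume e: "e > 0"
    \<comment> \<open>The weight makes the contribution of the fixed function \<open>p\<close> at
      most e/2; the summand 1 keeps the denominator positive when G p p or C vanishes.\<close>
    define a where "a = e / (2 * (\<bar>C\<bar> * G p p + 1))"
    have pos: "\<bar>C\<bar> * G p p + 1 > 0" using nonneg[OF p] by (smt (verit) abs_ge_zero mult_nonneg_nonneg)
    then have a: "a > 0" using e by (simp add: a_def)
    have "\<bar>C\<bar> * (a * G p p) = e / 2 * (\<bar>C\<bar> * G p p / (\<bar>C\<bar> * G p p + 1))"
      by (simp add: a_def)
    also have "\<dots> \<le> e / 2 * 1" using pos e by (intro mult_left_mono) auto
    finally have 1: "\<bar>C\<bar> * (a * G p p) \<le> e / 2" by simp
    have "(\<lambda>n. \<bar>C\<bar> * (G (w n) (w n) / a)) \<longlonglongrightarrow> \<bar>C\<bar> * (0 / a)" using a by (intro tendsto_intros lim) auto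
    then have "\<forall>\<^sub>F n in sequentially. \<bar>C\<bar> * (G (w n) (w n) / a) < e / 2"
      by (rule order_tendstoD(2)) (use e in simp)
    then obtain K where K: "\<And>n. n \<ge> K \<Longrightarrow> \<bar>C\<bar> * (G (w n) (w n) / a) < e / 2"
      by (auto simp: eventually_sequentially)
    have "norm (F p (w n) - 0) < e" if "n \<ge> K" for n
    proof -
      have "\<bar>F p (w n)\<bar> \<le> \<bar>C\<bar> * (a * G p p) + \<bar>C\<bar> * (G (w n) (w n) / a)"
        using fb[OF p w a, of n] by (simp only: distrib_left)
      then show ?thesis using 1 K[OF that] unfolding real_norm_def diff_0_right by linarith
    qed
    then show "\<exists>K. \<forall>n\<ge>K. norm (F p (w n) - 0) < e" by blast
  qed
  let ?s = "\<lambda>n x. s n x - u x" and ?t = "\<lambda>n x. t n x - v x"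
  have mem: "?s n \<in> H" "?t n \<in> H" for n
    using function_subspace_diff[OF sub H(1) H(3)] function_subspace_diff[OF sub H(2) H(4)] by auto
  have "(\<lambda>n. F (?s n) (?t n)) \<longlonglongrightarrow> 0"
  proof (rule tendsto_0_le)
    have "(\<lambda>n. 1 * G (?s n) (?s n) + G (?t n) (?t n) / 1) \<longlonglongrightarrow> 1 * 0 + 0 / 1"
      by (intro tendsto_intros s t) auto
    then show "(\<lambda>n. 1 * G (?s n) (?s n) + G (?t n) (?t n) / 1) \<longlonglongrightarrow> 0" by simp
    show "\<forall>\<^sub>F n in sequentially. norm (F (?s n) (?t n))
        \<le> norm (1 * G (?s n) (?s n) + G (?t n) (?t n) / 1) * \<bar>C\<bar>"
    proof (rule always_eventually, rule allI)
      fix n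
      show "norm (F (?s n) (?t n)) \<le> norm (1 * G (?s n) (?s n) + G (?t n) (?t n) / 1) * \<bar>C\<bar>"
        using fb[OF mem(1)[of n] mem(2)[of n] zero_less_one] nonneg[OF mem(1)[of n]] nonneg[OF mem(2)[of n]]
        by (simp add: mult.commute)
    qed
  qed
  moreover have "(\<lambda>n. F u (?t n)) \<longlonglongrightarrow> 0" by (rule to0[OF H(3) mem(2) t])
  moreover have "(\<lambda>n. F v (?s n)) \<longlonglongrightarrow> 0" by (rule to0[OF H(4) mem(1) s])
  ultimately have "(\<lambda>n. F (?s n) (?t n) + F u (?t n) + F v (?s n) + F u v) \<longlonglongrightarrow> 0 + 0 + 0 + F u v"
    by (intro tendsto_intros)
  \<comment> \<open>Expansion of F around (u, v): the three terms containing an increment tend to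
    0.\<close>
  moreover have "F (?s n) (?t n) + F u (?t n) + F v (?s n) + F u v = F (s n) (t n)" for n
    using F.left_diff[OF H(1)[of n] H(3) mem(2)[of n]] F.sym[OF H(4) mem(1)[of n]]
      F.right_diff[OF H(2)[of n] H(4) H(1)[of n]] F.left_diff[OF H(1)[of n] H(3) H(4)] by simp
  ultimately show ?thesis by simp
qed

text \<open>Gaussian elimination by induction on the equations. If equation \<open>q\<close> is not
  vacuous, a pivot \<open>p\<close> with c p q \<noteq> 0 is eliminated from the others, and its
  coefficient is then recovered as the value that equation \<open>q\<close> forces.\<close>

lemma underdetermined_system:
  fixes c :: "'i \<Rightarrow> 'j \<Rightarrow> real"
  assumes "finite J" "finite I" "card J < card I"
  shows "\<exists>a. (\<exists>i\<in>I. a i \<noteq> 0) \<and> (\<forall>j\<in>J. (\<Sum>i\<in>I. a i * c i j) = 0)"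
  using assms
proof (induction J arbitrary: I c rule: finite_induct)
  case empty
  then have "I \<noteq> {}" by auto
  then show ?case by (intro exI[of _ "\<lambda>_. 1"]) auto
next
  case (insert q J)
  show ?case
  proof (cases "\<forall>i\<in>I. c i q = 0")
    case True
    have "card J < card I" using insert by simp
    from insert.IH[OF \<open>finite I\<close> this, of c] obtain a where
      "\<exists>i\<in>I. a i \<noteq> 0" "\<forall>j\<in>J. (\<Sum>i\<in>I. a i * c i j) = 0" by blast
    with True show ?thesis by (intro exI[of _ a]) auto
  next
    case False
    then obtain p where p: "p \<in> I" "c p q \<noteq> 0" by auto
    have "card J < card (I - {p})" using insert p by simp
    from insert.IH[OF _ this, of "\<lambda>i j. c i j - c i q / c p q * c p j"] insert.prems(1)
    have "\<exists>a. (\<exists>i\<in>I-{p}. a i \<noteq> 0) \<and>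
        (\<forall>j\<in>J. (\<Sum>i\<in>I-{p}. a i * (c i j - c i q / c p q * c p j)) = 0)" by blast
    then obtain a where a: "\<exists>i\<in>I-{p}. a i \<noteq> 0"
      "\<And>j. j \<in> J \<Longrightarrow> (\<Sum>i\<in>I-{p}. a i * (c i j - c i q / c p q * c p j)) = 0" by blast
    define a' where "a' = a(p := - (\<Sum>i\<in>I-{p}. a i * c i q / c p q))"
    have split: "(\<Sum>i\<in>I. a' i * c i j) = (\<Sum>i\<in>I-{p}. a i * (c i j - c i q / c p q * c p j))" for j
    proof -
      have "(\<Sum>i\<in>I. a' i * c i j) = a' p * c p j + (\<Sum>i\<in>I-{p}. a' i * c i j)"
        using p insert.prems(1) by (simp add: sum.remove)
      also have "(\<Sum>i\<in>I-{p}. a' i * c i j) = (\<Sum>i\<in>I-{p}. a i * c i j)"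
        by (rule sum.cong) (auto simp: a'_def)
      also have "a' p * c p j = (\<Sum>i\<in>I-{p}. - (a i * c i q / c p q * c p j))"
        by (simp add: a'_def sum_distrib_right sum_negf)
      finally have "(\<Sum>i\<in>I. a' i * c i j)
          = (\<Sum>i\<in>I-{p}. - (a i * c i q / c p q * c p j)) + (\<Sum>i\<in>I-{p}. a i * c i j)" .
      then show ?thesis by (simp only: sum.distrib[symmetric]) (simp add: right_diff_distrib mult.assoc)
    qed
    have "(\<Sum>i\<in>I. a' i * c i q) = 0" unfolding split using p by simp
    moreover have "\<exists>i\<in>I. a' i \<noteq> 0" using a(1) by (auto simp: a'_def)
    ultimately show ?thesis using a(2) split by (intro exI[of _ a']) auto
  qed
qed

section \<open>Minimizers under orthogonality constraints\<close>

definition constrained_unit_sphere ::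
    "('a \<Rightarrow> real) set \<Rightarrow> (('a \<Rightarrow> real) \<Rightarrow> ('a \<Rightarrow> real) \<Rightarrow> real) \<Rightarrow> (nat \<Rightarrow> 'a \<Rightarrow> real) \<Rightarrow> nat \<Rightarrow> ('a \<Rightarrow> real) set" where
  "constrained_unit_sphere H P \<phi> k = {u \<in> H. P u u = 1 \<and> (\<forall>j\<in>{1..<k}. P u (\<phi> j) = 0)}"

text \<open>First-order optimality: at t = -b / (|c| + 1) the linear term outweighs the quadratic
  one, so the polynomial would be negative if b were nonzero.\<close>

lemma discriminant_zero:
  fixes b c :: real
  assumes "\<And>t. 0 \<le> 2 * t * b + t\<^sup>2 * c"
  shows "b = 0"
proof (rule ccontr)
  assume b: "b \<noteq> 0"
  define d where "d = \<bar>c\<bar> + 1"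
  have d: "d > 0" "c < d" by (auto simp: d_def)
  have "2 * (- b / d) * b + (- b / d)\<^sup>2 * c = b\<^sup>2 * (c - 2 * d) / d\<^sup>2"
    using d by (simp add: field_simps power2_eq_square)
  also have "\<dots> < 0" using b d by (intro divide_neg_pos mult_pos_neg) auto
  finally show False using assms[of "- b / d"] by simp
qed

text \<open>\<open>P\<close> is semidefinite only, because functions that agree almost everywhere
  stay distinct. The Cauchy condition on \<open>Q\<close> in \<open>complete\<close> is one-sided;
  \<open>Q_lower\<close> together with the condition on \<open>P\<close> supplies the other side.
  The last assumption makes every constrained problem feasible.\<close>

locale variational_problem =
  P: bilinear_on H P + Q: bilinear_on H Q
  for H :: "('a \<Rightarrow> real) set" and P Q :: "('a \<Rightarrow> real) \<Rightarrow> ('a \<Rightarrow> real) \<Rightarrow> real" +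
  fixes K :: real
  assumes P_nonneg: "\<And>u. u \<in> H \<Longrightarrow> 0 \<le> P u u"
    and Q_lower: "\<And>u. u \<in> H \<Longrightarrow> - K * P u u \<le> Q u u"
    and complete: "\<And>s. (\<And>n. s n \<in> H) \<Longrightarrow>
      (\<And>e. e > 0 \<Longrightarrow> \<exists>M. \<forall>m\<ge>M. \<forall>n\<ge>M. P (\<lambda>x. s m x - s n x) (\<lambda>x. s m x - s n x) < e) \<Longrightarrow>
      (\<And>e. e > 0 \<Longrightarrow> \<exists>M. \<forall>m\<ge>M. \<forall>n\<ge>M. Q (\<lambda>x. s m x - s n x) (\<lambda>x. s m x - s n x) < e) \<Longrightarrow>
      \<exists>u\<in>H. (\<lambda>n. P (\<lambda>x. s n x - u x) (\<lambda>x. s n x - u x)) \<longlonglongrightarrow> 0 \<and>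
        (\<lambda>n. Q (\<lambda>x. s n x - u x) (\<lambda>x. s n x - u x)) \<longlonglongrightarrow> 0"
    and compact: "\<And>(s :: nat \<Rightarrow> 'a \<Rightarrow> real) C. (\<And>n. s n \<in> H) \<Longrightarrow> (\<And>n. P (s n) (s n) = 1) \<Longrightarrow> (\<And>n. Q (s n) (s n) \<le> C) \<Longrightarrow>
      \<exists>r :: nat \<Rightarrow> nat. strict_mono r \<and> (\<forall>e>0. \<exists>M. \<forall>m\<ge>M. \<forall>n\<ge>M.
        P (\<lambda>x. s (r m) x - s (r n) x) (\<lambda>x. s (r m) x - s (r n) x) < e)"
    and infinite_dimensional: "\<And>\<phi> k. (\<And>j. j \<in> {1..<k} \<Longrightarrow> \<phi> j \<in> H) \<Longrightarrow> constrained_unit_sphere H P \<phi> k \<noteq> {}"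
begin

definition is_minimizer :: "(nat \<Rightarrow> 'a \<Rightarrow> real) \<Rightarrow> nat \<Rightarrow> ('a \<Rightarrow> real) \<Rightarrow> bool" where
  "is_minimizer \<phi> k u \<longleftrightarrow> u \<in> constrained_unit_sphere H P \<phi> k \<and>
     (\<forall>v\<in>constrained_unit_sphere H P \<phi> k. Q u u \<le> Q v v)"

lemma homogeneous_lower_bound:
  assumes m: "\<And>v. v \<in> constrained_unit_sphere H P \<phi> k \<Longrightarrow> m \<le> Q v v"
    and \<phi>: "\<And>j. j \<in> {1..<k} \<Longrightarrow> \<phi> j \<in> H"
    and w: "w \<in> H" "\<And>j. j \<in> {1..<k} \<Longrightarrow> P w (\<phi> j) = 0"
  shows "m * P w w \<le> Q w w"
proof (cases "P w w = 0")
  \<comment> \<open>Normalization is impossible for a function that vanishes almost everywhere;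
    there \<open>Q_lower\<close> already gives Q w w \<ge> 0.\<close>
  case True
  then show ?thesis using Q_lower[OF w(1)] by simp
next
  case False
  then have pos: "P w w > 0" using P_nonneg[OF w(1)] by simp
  define a where "a = 1 / sqrt (P w w)"
  have a: "a\<^sup>2 * P w w = 1" using pos by (simp add: a_def power_divide)
  have "(\<lambda>x. a * w x) \<in> constrained_unit_sphere H P \<phi> k"
    unfolding constrained_unit_sphere_def
    using function_subspace_scale[OF P.subspace w(1)] a w \<phi>
    by (auto simp: P.quadratic_scale P.left_scale)
  then have "m \<le> a\<^sup>2 * Q w w" using m Q.quadratic_scale[OF w(1)] by metis
  then have "m * P w w \<le> a\<^sup>2 * Q w w * P w w" using pos by (intro mult_right_mono) auto
  also have "\<dots> = a\<^sup>2 * P w w * Q w w" by simp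
  finally show ?thesis using a by simp
qed

lemma P_limit:
  assumes "\<And>n. s n \<in> H" "\<And>n. t n \<in> H" "u \<in> H" "v \<in> H"
    "(\<lambda>n. P (\<lambda>x. s n x - u x) (\<lambda>x. s n x - u x)) \<longlonglongrightarrow> 0"
    "(\<lambda>n. P (\<lambda>x. t n x - v x) (\<lambda>x. t n x - v x)) \<longlonglongrightarrow> 0"
  shows "(\<lambda>n. P (s n) (t n)) \<longlonglongrightarrow> P u v"
  by (rule bounded_form_convergence[OF P.bilinear_on_axioms P.bilinear_on_axioms P_nonneg _ assms, where C=1])
    (use P_nonneg in auto)

lemma Q_limit:
  assumes H: "\<And>n. s n \<in> H" "u \<in> H"
    and s: "(\<lambda>n. P (\<lambda>x. s n x - u x) (\<lambda>x. s n x - u x)) \<longlonglongrightarrow> 0"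
      "(\<lambda>n. Q (\<lambda>x. s n x - u x) (\<lambda>x. s n x - u x)) \<longlonglongrightarrow> 0"
  shows "(\<lambda>n. Q (s n) (s n)) \<longlonglongrightarrow> Q u u"
proof -
  \<comment> \<open>With the factor 2 the form \<open>G\<close> stays above |K| P and dominates Q
    and -Q alike, so the convergence lemma applies to Q.\<close>
  define G where "G u v = Q u v + 2 * \<bar>K\<bar> * P u v" for u v
  have sub: "function_subspace H" by (rule P.subspace)
  have G: "bilinear_on H G"
  proof
    show "symmetric_bilinear_on H G"
      unfolding symmetric_bilinear_on_def G_def
      using P.sym Q.sym P.left Q.left by (auto simp: algebra_simps)
  qed (rule sub)
  have low: "- \<bar>K\<bar> * P v v \<le> Q v v" if "v \<in> H" for v
  proof -
    have "- \<bar>K\<bar> * P v v \<le> - K * P v v"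
      using P_nonneg[OF that] by (intro mult_right_mono) auto
    then show ?thesis using Q_lower[OF that] by linarith
  qed
  have pos: "0 \<le> \<bar>K\<bar> * P v v" if "v \<in> H" for v using P_nonneg[OF that] by simp
  have lim: "(\<lambda>n. G (\<lambda>x. s n x - u x) (\<lambda>x. s n x - u x)) \<longlonglongrightarrow> 0"
    using tendsto_add[OF s(2) tendsto_mult_left[OF s(1), of "2 * \<bar>K\<bar>"]] by (simp add: G_def)
  have nonneg: "0 \<le> G v v" if "v \<in> H" for v
    using low[OF that] pos[OF that] by (simp add: G_def)
  have bound: "\<bar>Q v v\<bar> \<le> 1 * G v v" if "v \<in> H" for v
    using low[OF that] pos[OF that] by (simp add: G_def abs_le_iff)
  show ?thesis
    by (rule bounded_form_convergence[OF Q.bilinear_on_axioms G nonneg bound H(1) H(1) H(2) H(2) lim lim])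
qed

text \<open>By the parallelogram law a minimizing sequence that is Cauchy for \<open>P\<close> is automatically
  Cauchy for \<open>Q\<close>, so no weak convergence is needed.\<close>

lemma minimizer_exists:
  assumes \<phi>: "\<And>j. j \<in> {1..<k} \<Longrightarrow> \<phi> j \<in> H"
  shows "\<exists>u. is_minimizer \<phi> k u"
proof -
  let ?A = "constrained_unit_sphere H P \<phi> k"
  have A: "u \<in> H" "P u u = 1" "\<And>j. j \<in> {1..<k} \<Longrightarrow> P u (\<phi> j) = 0" if "u \<in> ?A" for u
    using that by (auto simp: constrained_unit_sphere_def)
  define m where "m = (INF u\<in>?A. Q u u)"
  have ne: "?A \<noteq> {}" by (rule infinite_dimensional[OF \<phi>])
  have bdd: "bdd_below ((\<lambda>u. Q u u) ` ?A)"
    using Q_lower A(1,2) by (intro bdd_belowI2[of _ "-K"]) fastforce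
  have m: "m \<le> Q v v" if "v \<in> ?A" for v
    unfolding m_def by (rule cINF_lower[OF bdd that])
  have "\<exists>u\<in>?A. Q u u < m + 1 / real (Suc n)" for n
    using cINF_less_iff[OF ne bdd, of "m + 1 / real (Suc n)"] by (simp add: m_def)
  then obtain s where s: "\<And>n. s n \<in> ?A" "\<And>n. Q (s n) (s n) < m + 1 / real (Suc n)" by metis
  have sH: "s n \<in> H" and sP: "P (s n) (s n) = 1" and s\<phi>: "j \<in> {1..<k} \<Longrightarrow> P (s n) (\<phi> j) = 0" for n j
    using A[OF s(1)[of n]] by auto
  have "Q (s n) (s n) \<le> m + 1" for n
  proof -
    have "1 / real (Suc n) \<le> 1" by simp
    then show ?thesis using s(2)[of n] by linarith
  qed
  from compact[of s, OF sH sP this] obtain r :: "nat \<Rightarrow> nat" where r: "strict_mono r"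
    and P_cauchy: "\<forall>e>0. \<exists>M. \<forall>i\<ge>M. \<forall>j\<ge>M.
        P (\<lambda>x. s (r i) x - s (r j) x) (\<lambda>x. s (r i) x - s (r j) x) < e"
    by (elim exE conjE)
  define t where "t = (\<lambda>n. s (r n))"
  have tH: "t n \<in> H" and tP: "P (t n) (t n) = 1" and t\<phi>: "j \<in> {1..<k} \<Longrightarrow> P (t n) (\<phi> j) = 0"
    and tA: "t n \<in> ?A" for n j
    using sH sP s\<phi> s(1) by (auto simp: t_def)
  let ?d = "\<lambda>i j x. t i x - t j x"
  have tQ: "Q (t n) (t n) < m + 1 / real (Suc n)" for n
  proof -
    have "1 / real (Suc (r n)) \<le> 1 / real (Suc n)"
      using seq_suble[OF r, of n] by (simp add: frac_le)
    then show ?thesis using s(2)[of "r n"] unfolding t_def by linarith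
  qed
  have Q_diff: "Q (?d i j) (?d i j) \<le> 2 / real (Suc i) + 2 / real (Suc j) + \<bar>m\<bar> * P (?d i j) (?d i j)" for i j
  proof -
    let ?s = "\<lambda>x. t i x + t j x"
    have sH: "?s \<in> H" by (rule function_subspace_add[OF P.subspace tH tH])
    have c: "P ?s (\<phi> l) = 0" if "l \<in> {1..<k}" for l
      using P.left[OF tH[of i] tH[of j] \<phi>[OF that], of 1 1] t\<phi>[OF that] by simp
    \<comment> \<open>The sum of two members of the minimizing sequence still satisfies the
      orthogonality constraints, so the infimum bounds Q from below there; the parallelogram law
      converts this into an upper bound at the difference.\<close>
    have "m * P ?s ?s \<le> Q ?s ?s"
      by (rule homogeneous_lower_bound[OF m \<phi> sH c])
    moreover have "m * P ?s ?s = 4 * m - m * P (?d i j) (?d i j)"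
    proof -
      have "P ?s ?s = 4 - P (?d i j) (?d i j)"
        using P.quadratic_add[OF tH[of i] tH[of j]] P.quadratic_diff[OF tH[of i] tH[of j]] tP by simp
      then show ?thesis by (simp only: right_diff_distrib mult.commute)
    qed
    moreover have "Q (?d i j) (?d i j) = 2 * Q (t i) (t i) + 2 * Q (t j) (t j) - Q ?s ?s"
      using Q.quadratic_add[OF tH[of i] tH[of j]] Q.quadratic_diff[OF tH[of i] tH[of j]] by simp
    moreover have "m * P (?d i j) (?d i j) \<le> \<bar>m\<bar> * P (?d i j) (?d i j)"
      using P_nonneg[OF function_subspace_diff[OF P.subspace tH[of i] tH[of j]]] by (intro mult_right_mono) auto
    ultimately have "Q (?d i j) (?d i j) \<le> 2 * (1 / real (Suc i)) + 2 * (1 / real (Suc j)) + \<bar>m\<bar> * P (?d i j) (?d i j)"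
      using tQ[of i] tQ[of j] by linarith
    then show ?thesis by simp
  qed
  have P_cauchy': "\<exists>M. \<forall>i\<ge>M. \<forall>j\<ge>M. P (?d i j) (?d i j) < e" if "e > 0" for e
    using P_cauchy that by (simp add: t_def)
  have Q_cauchy: "\<exists>M. \<forall>i\<ge>M. \<forall>j\<ge>M. Q (?d i j) (?d i j) < e" if e: "e > 0" for e
  proof -
    obtain M1 where M1: "\<And>i j. i \<ge> M1 \<Longrightarrow> j \<ge> M1 \<Longrightarrow> P (?d i j) (?d i j) < e / (2 * (\<bar>m\<bar> + 1))"
    proof -
      have "e / (2 * (\<bar>m\<bar> + 1)) > 0" using e by simp
      from P_cauchy'[OF this] that show ?thesis by blast
    qed
    obtain M2 where M2: "8 / e < real M2" using reals_Archimedean2 by blast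
    have small: "2 / real (Suc i) < e / 4" if "i \<ge> M2" for i
    proof -
      have "8 / e < real (Suc i)" using M2 that by linarith
      then show ?thesis using e by (simp add: field_simps)
    qed
    have "Q (?d i j) (?d i j) < e" if ij: "i \<ge> max M1 M2" "j \<ge> max M1 M2" for i j
    proof -
      have "\<bar>m\<bar> * P (?d i j) (?d i j) \<le> \<bar>m\<bar> * (e / (2 * (\<bar>m\<bar> + 1)))"
        using M1[of i j] ij by (intro mult_left_mono) auto
      also have "\<dots> = e / 2 * (\<bar>m\<bar> / (\<bar>m\<bar> + 1))" by simp
      also have "\<dots> \<le> e / 2 * 1" using e by (intro mult_left_mono) auto
      finally show ?thesis using Q_diff[of i j] small[of i] small[of j] ij by simp
    qed
    then show ?thesis by blast
  qed
  have "\<exists>u\<in>H. (\<lambda>n. P (\<lambda>x. t n x - u x) (\<lambda>x. t n x - u x)) \<longlonglongrightarrow> 0 \<and>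
      (\<lambda>n. Q (\<lambda>x. t n x - u x) (\<lambda>x. t n x - u x)) \<longlonglongrightarrow> 0"
    by (rule complete) (fact tH, erule P_cauchy', erule Q_cauchy)
  then obtain u where u: "u \<in> H" "(\<lambda>n. P (\<lambda>x. t n x - u x) (\<lambda>x. t n x - u x)) \<longlonglongrightarrow> 0"
    "(\<lambda>n. Q (\<lambda>x. t n x - u x) (\<lambda>x. t n x - u x)) \<longlonglongrightarrow> 0"
    by (elim bexE conjE)
  have "(\<lambda>n. P (t n) (t n)) \<longlonglongrightarrow> P u u" by (rule P_limit[OF tH tH u(1) u(1) u(2) u(2)])
  then have "P u u = 1" by (simp add: tP LIMSEQ_const_iff)
  moreover have "P u (\<phi> j) = 0" if j: "j \<in> {1..<k}" for j
  proof -
    have "P (\<lambda>x. \<phi> j x - \<phi> j x) (\<lambda>x. \<phi> j x - \<phi> j x) = 0"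
      using P.quadratic_diff[OF \<phi>[OF j] \<phi>[OF j]] by simp
    then have "(\<lambda>n. P (t n) (\<phi> j)) \<longlonglongrightarrow> P u (\<phi> j)"
      by (intro P_limit[OF tH \<phi>[OF j] u(1) \<phi>[OF j] u(2)]) simp
    then show ?thesis by (simp add: t\<phi>[OF j] LIMSEQ_const_iff)
  qed
  ultimately have uA: "u \<in> ?A" using u(1) by (simp add: constrained_unit_sphere_def)
  have "(\<lambda>n. Q (t n) (t n)) \<longlonglongrightarrow> Q u u" by (rule Q_limit[OF tH u])
  moreover have "(\<lambda>n. m + 1 / real (Suc n)) \<longlonglongrightarrow> m"
    using tendsto_add[OF tendsto_const LIMSEQ_inverse_real_of_nat, of m] by (simp add: inverse_eq_divide)
  ultimately have "Q u u \<le> m"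
    by (rule LIMSEQ_le) (intro exI[of _ 0] allI impI less_imp_le[OF tQ])
  then show ?thesis using uA m unfolding is_minimizer_def by (meson order_trans)
qed

definition minimizer_sequence :: "(nat \<Rightarrow> 'a \<Rightarrow> real) \<Rightarrow> bool" where
  "minimizer_sequence \<phi> \<longleftrightarrow> (\<forall>k\<ge>1. is_minimizer \<phi> k (\<phi> k))"

lemma constrained_unit_sphere_cong:
  assumes "\<And>j. j \<in> {1..<k} \<Longrightarrow> \<phi> j = \<psi> j"
  shows "constrained_unit_sphere H P \<phi> k = constrained_unit_sphere H P \<psi> k"
  using assms by (auto simp: constrained_unit_sphere_def)

text \<open>The k-th minimization depends on all earlier choices. The recursion therefore carries a
  whole sequence and overwrites one entry per step; entries are never changed later, and the
  diagonal collects them.\<close>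

lemma minimizer_sequence_exists: "\<exists>\<phi>. minimizer_sequence \<phi>"
proof -
  define step where "step n \<phi> = \<phi>(Suc n := SOME u. is_minimizer \<phi> (Suc n) u)" for n and \<phi> :: "nat \<Rightarrow> 'a \<Rightarrow> real"
  define \<Phi> where "\<Phi> = rec_nat (\<lambda>_ _. 0) step"
  have \<Phi>_Suc: "\<Phi> (Suc n) = (\<Phi> n)(Suc n := SOME u. is_minimizer (\<Phi> n) (Suc n) u)" for n
    by (simp add: \<Phi>_def step_def)
  have stable: "\<Phi> (n + d) j = \<Phi> n j" if "j \<le> n" for n d j
    using that by (induction d) (auto simp: \<Phi>_Suc)
  have diag: "\<Phi> n j = \<Phi> j j" if "j \<le> n" for n j
    using stable[of j j "n - j"] that by simp
  define \<phi> where "\<phi> k = \<Phi> k k" for k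
  have "is_minimizer \<phi> k (\<phi> k) \<and> \<phi> k \<in> H" if "k \<ge> 1" for k
    using that
  proof (induction k rule: less_induct)
    case (less k)
    then obtain n where k: "k = Suc n" by (cases k) auto
    have eq: "constrained_unit_sphere H P \<phi> k = constrained_unit_sphere H P (\<Phi> n) k"
      by (rule constrained_unit_sphere_cong) (simp add: \<phi>_def k diag[symmetric])
    have "\<Phi> n j \<in> H" if "j \<in> {1..<k}" for j
      using less.IH[of j] that diag[of j n] by (auto simp: \<phi>_def k)
    then have "\<exists>u. is_minimizer (\<Phi> n) k u" by (rule minimizer_exists)
    then have "is_minimizer (\<Phi> n) k (SOME u. is_minimizer (\<Phi> n) k u)" by (rule someI_ex)
    then have "is_minimizer (\<Phi> n) k (\<phi> k)" by (simp add: \<phi>_def k \<Phi>_Suc)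
    then show ?case unfolding is_minimizer_def eq by (auto simp: constrained_unit_sphere_def)
  qed
  then show ?thesis unfolding minimizer_sequence_def by blast
qed

context
  fixes \<phi> assumes seq: "minimizer_sequence \<phi>"
begin

lemma sequence_mem:
  assumes "k \<ge> 1"
  shows "\<phi> k \<in> H" "P (\<phi> k) (\<phi> k) = 1" "\<And>j. j \<in> {1..<k} \<Longrightarrow> P (\<phi> k) (\<phi> j) = 0"
  using seq assms by (auto simp: minimizer_sequence_def is_minimizer_def constrained_unit_sphere_def)

lemma sequence_lower_bound:
  assumes "k \<ge> 1" "w \<in> H" "\<And>j. j \<in> {1..<k} \<Longrightarrow> P w (\<phi> j) = 0"
  shows "Q (\<phi> k) (\<phi> k) * P w w \<le> Q w w"
proof (rule homogeneous_lower_bound[OF _ _ assms(2,3)])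
  show "Q (\<phi> k) (\<phi> k) \<le> Q v v" if "v \<in> constrained_unit_sphere H P \<phi> k" for v
    using seq assms(1) that by (auto simp: minimizer_sequence_def is_minimizer_def)
qed (use sequence_mem in auto)

lemma sequence_mono:
  assumes "1 \<le> j" "j \<le> k"
  shows "Q (\<phi> j) (\<phi> j) \<le> Q (\<phi> k) (\<phi> k)"
  using sequence_lower_bound[of j "\<phi> k"] sequence_mem[of k] assms by auto

text \<open>For j < k the perturbation \<phi> j + t \<phi> k is still feasible for the j-th problem.
  Minimality for every t removes the term linear in t, which is the mixed value of Q.\<close>

lemma sequence_orthogonal:
  assumes "1 \<le> j" "1 \<le> k" "j \<noteq> k"
  shows "P (\<phi> j) (\<phi> k) = 0" "Q (\<phi> j) (\<phi> k) = 0"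
proof -
  have *: "P (\<phi> j) (\<phi> k) = 0 \<and> Q (\<phi> j) (\<phi> k) = 0" if jk: "1 \<le> j" "j < k" for j k
  proof
    note mj = sequence_mem[of j] and mk = sequence_mem[of k]
    show P0: "P (\<phi> j) (\<phi> k) = 0" using mj mk jk P.sym[of "\<phi> j" "\<phi> k"] by auto
    show "Q (\<phi> j) (\<phi> k) = 0"
    proof (rule discriminant_zero)
      fix t
      let ?w = "\<lambda>x. 1 * \<phi> j x + t * \<phi> k x"
      have "?w \<in> H" using mj mk jk by (intro function_subspace_lincomb[OF P.subspace]) auto
      moreover have "P ?w (\<phi> i) = 0" if "i \<in> {1..<j}" for i
        using P.left[of "\<phi> j" "\<phi> k" "\<phi> i" 1 t] mj mk sequence_mem(1)[of i] that jk by auto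
      ultimately have "Q (\<phi> j) (\<phi> j) * P ?w ?w \<le> Q ?w ?w"
        using jk by (intro sequence_lower_bound) auto
      moreover have "P ?w ?w = 1 + t\<^sup>2"
        using P.quadratic[of "\<phi> j" "\<phi> k" 1 t] mj mk P0 jk by simp
      moreover have "Q ?w ?w = Q (\<phi> j) (\<phi> j) + 2 * t * Q (\<phi> j) (\<phi> k) + t\<^sup>2 * Q (\<phi> k) (\<phi> k)"
        using Q.quadratic[of "\<phi> j" "\<phi> k" 1 t] mj mk jk by simp
      ultimately show "0 \<le> 2 * t * Q (\<phi> j) (\<phi> k) + t\<^sup>2 * (Q (\<phi> k) (\<phi> k) - Q (\<phi> j) (\<phi> j))"
        by (simp add: algebra_simps)
    qed
  qed
  show "P (\<phi> j) (\<phi> k) = 0" "Q (\<phi> j) (\<phi> k) = 0"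
    using *[of j k] *[of k j] assms P.sym[of "\<phi> j" "\<phi> k"] Q.sym[of "\<phi> j" "\<phi> k"] sequence_mem(1)
    by (metis linorder_neqE_nat)+
qed

end

text \<open>Courant--Fischer: the span of \<open>\<psi> 1, \<dots>, \<psi> k\<close> contains a vector orthogonal to
  \<open>\<phi> 1, \<dots>, \<phi> (k - 1)\<close>.\<close>

lemma minimizer_sequence_le:
  assumes \<phi>: "minimizer_sequence \<phi>" and \<psi>: "minimizer_sequence \<psi>" and k: "k \<ge> 1"
  shows "Q (\<phi> k) (\<phi> k) \<le> Q (\<psi> k) (\<psi> k)"
proof -
  have "card {1..<k} < card {1..k}" using k by simp
  then obtain a where a: "\<exists>i\<in>{1..k}. a i \<noteq> 0" "\<And>j. j \<in> {1..<k} \<Longrightarrow> (\<Sum>i\<in>{1..k}. a i * P (\<psi> i) (\<phi> j)) = 0"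
    using underdetermined_system[OF finite_atLeastLessThan finite_atLeastAtMost, of 1 k 1 k "\<lambda>i j. P (\<psi> i) (\<phi> j)"]
    by blast
  let ?u = "\<lambda>x. \<Sum>i\<in>{1..k}. a i * \<psi> i x"
  have mem: "\<psi> i \<in> H" if "i \<in> {1..k}" for i using sequence_mem(1)[OF \<psi>] that by auto
  have u: "?u \<in> H" by (rule function_subspace_sum[OF P.subspace]) (use mem in auto)
  have "P ?u (\<phi> j) = 0" if "j \<in> {1..<k}" for j
    using P.left_sum[of "{1..k}" \<psi> "\<phi> j" a] mem sequence_mem(1)[OF \<phi>, of j] a(2)[OF that] that by auto
  then have "Q (\<phi> k) (\<phi> k) * P ?u ?u \<le> Q ?u ?u"
    by (intro sequence_lower_bound[OF \<phi> k u]) auto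
  moreover have Pu: "P ?u ?u = (\<Sum>i\<in>{1..k}. (a i)\<^sup>2)"
  proof -
    have "P ?u ?u = (\<Sum>i\<in>{1..k}. (a i)\<^sup>2 * P (\<psi> i) (\<psi> i))"
      by (rule P.quadratic_sum_orthogonal) (use mem sequence_orthogonal(1)[OF \<psi>] in auto)
    then show ?thesis using sequence_mem(2)[OF \<psi>] by simp
  qed
  \<comment> \<open>Both forms are diagonal on the span of \<psi> 1, ..., \<psi> k, and the diagonal
    values of Q increase with the index.\<close>
  moreover have "Q ?u ?u \<le> Q (\<psi> k) (\<psi> k) * P ?u ?u"
  proof -
    have "Q ?u ?u = (\<Sum>i\<in>{1..k}. (a i)\<^sup>2 * Q (\<psi> i) (\<psi> i))"
      by (rule Q.quadratic_sum_orthogonal) (use mem sequence_orthogonal(2)[OF \<psi>] in auto)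
    also have "\<dots> \<le> (\<Sum>i\<in>{1..k}. (a i)\<^sup>2 * Q (\<psi> k) (\<psi> k))"
      by (intro sum_mono mult_left_mono sequence_mono[OF \<psi>]) auto
    finally show ?thesis unfolding Pu by (simp add: sum_distrib_left mult.commute)
  qed
  moreover have "P ?u ?u > 0"
    unfolding Pu using a(1) by (auto intro!: sum_pos2)
  ultimately show ?thesis
    using mult_le_cancel_right_pos order_trans by blast
qed

lemma minimizer_sequence_value:
  assumes "minimizer_sequence \<phi>" "minimizer_sequence \<psi>" "k \<ge> 1"
  shows "Q (\<phi> k) (\<phi> k) = Q (\<psi> k) (\<psi> k)"
  using minimizer_sequence_le assms by (intro antisym) auto

end

section \<open>Riesz kernels\<close>

lemma nn_integral_lborel_affine:
  fixes f :: "'a::euclidean_space \<Rightarrow> ennreal"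
  assumes [measurable]: "f \<in> borel_measurable borel" and c: "c \<noteq> 0"
  shows "(\<integral>\<^sup>+x. f x \<partial>lborel) = ennreal (\<bar>c\<bar> ^ DIM('a)) * (\<integral>\<^sup>+x. f (t + c *\<^sub>R x) \<partial>lborel)"
  by (subst lborel_affine[OF c, of t])
    (simp add: nn_integral_density nn_integral_distr nn_integral_cmult)

lemma lborel_integrable_affine_iff:
  fixes f :: "'a::euclidean_space \<Rightarrow> real"
  assumes c: "c \<noteq> 0"
  shows "integrable lborel (\<lambda>x. f (t + c *\<^sub>R x)) \<longleftrightarrow> integrable lborel f"
proof -
  have *: "integrable lborel (\<lambda>x. f (t + c *\<^sub>R x))" if f: "integrable lborel f" and c: "c \<noteq> 0"
    for f :: "'a \<Rightarrow> real" and t c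
  proof -
    have [measurable]: "f \<in> borel_measurable borel" using borel_measurable_integrable[OF f] by simp
    have "integrable (density (distr lborel borel (\<lambda>x. t + c *\<^sub>R x)) (\<lambda>_. \<bar>c\<bar> ^ DIM('a))) f"
      using f lborel_affine[OF c, of t] by simp
    then have "integrable lborel (\<lambda>x. \<bar>c\<bar> ^ DIM('a) * f (t + c *\<^sub>R x))"
      by (simp add: integrable_density integrable_distr_eq)
    then have "integrable lborel (\<lambda>x. inverse (\<bar>c\<bar> ^ DIM('a)) * (\<bar>c\<bar> ^ DIM('a) * f (t + c *\<^sub>R x)))"
      by (rule integrable_mult_right)
    then show ?thesis using c by (simp add: mult.assoc[symmetric])
  qed
  show ?thesis
  proof
    assume "integrable lborel (\<lambda>x. f (t + c *\<^sub>R x))"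
    from *[OF this, of "1 / c" "- (1 / c) *\<^sub>R t"] c show "integrable lborel f"
      by (simp add: scaleR_diff_right)
  qed (rule *[OF _ c])
qed

lemma lborel_integral_affine:
  fixes f :: "'a::euclidean_space \<Rightarrow> real"
  assumes c: "c \<noteq> 0"
  shows "(LINT x|lborel. f x) = \<bar>c\<bar> ^ DIM('a) * (LINT x|lborel. f (t + c *\<^sub>R x))"
proof (cases "integrable lborel f")
  case True
  then have [measurable]: "f \<in> borel_measurable borel" using borel_measurable_integrable by auto
  show ?thesis
    by (subst lborel_affine[OF c, of t]) (simp add: integral_density integral_distr)
next
  case False
  then show ?thesis using lborel_integrable_affine_iff[OF c, of f t] by (simp add: not_integrable_integral_eq)
qed

text \<open>Polar coordinates without a measure on the sphere: the image measure under the norm is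
  determined by the volumes of balls, since the half-lines generate the Borel sets and are stable
  under intersection.\<close>

lemma distr_lborel_norm:
  "distr lborel borel (norm :: 'a::euclidean_space \<Rightarrow> real) =
     density lborel (\<lambda>r. ennreal (real DIM('a) * unit_ball_vol DIM('a) * r ^ (DIM('a) - 1)) * indicator {0..} r)"
    (is "?D = ?E")
proof (rule measure_eqI_generator_eq[where E="range (\<lambda>a::real. {..a})" and \<Omega>=UNIV and A="\<lambda>i. {..real i}"])
  let ?V = "unit_ball_vol (real DIM('a))"
  show "Int_stable (range (\<lambda>a::real. {..a}))"
    by (auto simp: Int_stable_def)
  show eq: "emeasure ?D X = emeasure ?E X" if "X \<in> range (\<lambda>a::real. {..a})" for X
  proof -
    obtain a :: real where X: "X = {..a}" using \<open>X \<in> range (\<lambda>a::real. {..a})\<close> by (rule imageE)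
    have "emeasure ?D X = emeasure lborel (cball (0::'a) a)"
      by (subst emeasure_distr) (auto simp: X vimage_def cball_def)
    also have "\<dots> = (if a \<ge> 0 then ennreal (?V * a ^ DIM('a)) else 0)"
      by (simp add: emeasure_cball)
    also have "\<dots> = (\<integral>\<^sup>+r. ennreal (real DIM('a) * ?V * r ^ (DIM('a) - 1)) * indicator {0..a} r \<partial>lborel)"
    proof (cases "a \<ge> 0")
      case True
      have "(\<integral>\<^sup>+r. ennreal (real DIM('a) * ?V * r ^ (DIM('a) - 1)) * indicator {0..a} r \<partial>lborel)
          = ennreal (?V * a ^ DIM('a) - ?V * 0 ^ DIM('a))"
        using True by (intro nn_integral_FTC_Icc) (auto intro!: derivative_eq_intros)
      then show ?thesis using True by simp
    qed auto
    also have "\<dots> = emeasure ?E X"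
      by (subst emeasure_density) (auto simp: X intro!: nn_integral_cong split: split_indicator)
    finally show ?thesis .
  qed
  show "emeasure ?D {..real i} \<noteq> \<infinity>" for i
  proof -
    have "emeasure ?D {..real i} = emeasure lborel (cball (0::'a) (real i))"
      by (subst emeasure_distr) (auto simp: vimage_def cball_def)
    then show ?thesis by (simp add: emeasure_cball)
  qed
  show "(\<Union>i. {..real i}) = UNIV"
    using real_arch_simple by auto
qed (auto simp: borel_eq_atMost)

lemma nn_integral_radial:
  assumes [measurable]: "f \<in> borel_measurable borel"
  shows "(\<integral>\<^sup>+x. f (norm x) \<partial>(lborel :: 'a::euclidean_space measure)) =
    (\<integral>\<^sup>+r. ennreal (real DIM('a) * unit_ball_vol DIM('a) * r ^ (DIM('a) - 1)) * indicator {0..} r * f r \<partial>lborel)"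
proof -
  have "(\<integral>\<^sup>+x. f (norm x) \<partial>(lborel :: 'a measure)) = (\<integral>\<^sup>+r. f r \<partial>distr lborel borel (norm :: 'a \<Rightarrow> real))"
    by (simp add: nn_integral_distr)
  then show ?thesis unfolding distr_lborel_norm by (simp add: nn_integral_density)
qed

text \<open>\<open>c_const\<close> is 2 divided by the surface area of the unit sphere. This 2 is
  the coefficient in the pole 2/e and in the shift -2 ln l.\<close>

lemma c_const_unit_ball_vol: "c_const DIM('a::euclidean_space) * (real DIM('a) * unit_ball_vol DIM('a)) = 2"
proof -
  have "Gamma (real DIM('a) / 2 + 1) = real DIM('a) / 2 * Gamma (real DIM('a) / 2)"
    by (rule Gamma_plus1) (use nonpos_Ints_nonpos[of "real DIM('a) / 2"] in force)
  moreover have "Gamma (real DIM('a) / 2 + 1) > 0" by (rule Gamma_real_pos) simp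
  then have "Gamma (real DIM('a) / 2 + 1) \<noteq> 0" by (metis less_irrefl)
  ultimately have "Gamma (real DIM('a) / 2) / Gamma (real DIM('a) / 2 + 1) * real DIM('a) = 2"
    by (simp only:) (simp add: field_simps)
  then show ?thesis by (simp add: c_const_def unit_ball_vol_def mult.commute mult.left_commute)
qed

lemma c_const_pos: "c_const DIM('a::euclidean_space) > 0"
  by (simp add: c_const_def Gamma_real_pos)

text \<open>The exponent \<open>e\<close> restores integrability of |x|^-N at the origin; the mass
  then grows like 1/e and is the origin of the pole that has to cancel in the limit.\<close>

lemma nn_integral_unit_ball_powr:
  assumes e: "e > 0"
  shows "(\<integral>\<^sup>+x. ennreal (indicator {..<1} (norm x) * norm x powr (e - real DIM('a))) \<partial>(lborel :: 'a::euclidean_space measure))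
    = ennreal (real DIM('a) * unit_ball_vol DIM('a) / e)"
proof -
  let ?c = "real DIM('a) * unit_ball_vol DIM('a)"
  have "(\<integral>\<^sup>+x. ennreal (indicator {..<1} (norm x) * norm x powr (e - real DIM('a))) \<partial>(lborel :: 'a measure)) =
    (\<integral>\<^sup>+r. ennreal (?c * r ^ (DIM('a) - 1)) * indicator {0..} r * ennreal (indicator {..<1} r * r powr (e - real DIM('a))) \<partial>lborel)"
    by (rule nn_integral_radial) measurable
  also have "\<dots> = (\<integral>\<^sup>+r. ennreal (?c * r powr (e - 1)) * indicator {0..1} r \<partial>lborel)"
  proof (rule nn_integral_cong_AE)
    have p: "r ^ (DIM('a) - 1) * r powr (e - real DIM('a)) = r powr (e - 1)" if "r > 0" for r :: real
    proof -
      have "r ^ (DIM('a) - 1) = r powr (real DIM('a) - 1)" using that by (simp add: powr_realpow[symmetric] of_nat_diff Suc_leI)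
      then show ?thesis using that by (simp add: powr_add[symmetric])
    qed
    then have *: "?c * r ^ (DIM('a) - 1) * r powr (e - real DIM('a)) = ?c * r powr (e - 1)" if "r > 0" for r :: real
      using that by (simp add: mult.assoc)
    show "AE r in lborel. ennreal (?c * r ^ (DIM('a) - 1)) * indicator {0..} r * ennreal (indicator {..<1} r * r powr (e - real DIM('a)))
        = ennreal (?c * r powr (e - 1)) * indicator {0..1} r"
      using AE_lborel_singleton[of 0] AE_lborel_singleton[of 1]
      by eventually_elim (auto simp: p[simplified] ennreal_mult'[symmetric] mult.assoc split: split_indicator)
  qed
  also have "\<dots> = (\<integral>\<^sup>+r. ennreal (indicator {0..1} r * (?c * r powr (e - 1))) \<partial>lborel)"
    by (intro nn_integral_cong) (auto split: split_indicator)
  also have "\<dots> = ennreal (?c / e * 1 powr e - ?c / e * 0 powr e)"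
  proof (rule nn_integral_has_integral_lebesgue)
    show "((\<lambda>r. ?c * r powr (e - 1)) has_integral (?c / e * 1 powr e - ?c / e * 0 powr e)) {0..1}"
    \<comment> \<open>For e < 1 the integrand is unbounded at 0, so differentiability of the
      primitive is used only in the interior and continuity at the end points.\<close>
    proof (rule fundamental_theorem_of_calculus_interior)
      show "continuous_on {0..1} (\<lambda>r. ?c / e * r powr e)"
        using e by (intro continuous_intros continuous_on_powr') auto
      show "((\<lambda>r. ?c / e * r powr e) has_vector_derivative ?c * r powr (e - 1)) (at r)" if "r \<in> {0<..<1}" for r
      proof -
        have "((\<lambda>r. ?c / e * r powr e) has_real_derivative ?c / e * (e * r powr (e - 1))) (at r)"
          using that by (intro DERIV_cmult has_real_derivative_powr) auto
        then show ?thesis using e by (simp add: has_real_derivative_iff_has_vector_derivative mult.assoc)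
      qed
    qed simp
  qed auto
  finally show ?thesis using e by simp
qed

text \<open>The measure |x|^-N dx is scale invariant, so only the ratio of the radii enters. Both
  the logarithmic shift under dilation and the divergent mass behind compactness come from
  here.\<close>

lemma nn_integral_annulus:
  assumes ab: "0 < a" "a \<le> b"
  shows "(\<integral>\<^sup>+x. ennreal (indicator {a..<b} (norm x) / norm x ^ DIM('a)) \<partial>(lborel :: 'a::euclidean_space measure))
    = ennreal (real DIM('a) * unit_ball_vol DIM('a) * ln (b / a))"
proof -
  let ?c = "real DIM('a) * unit_ball_vol DIM('a)"
  have "(\<integral>\<^sup>+x. ennreal (indicator {a..<b} (norm x) / norm x ^ DIM('a)) \<partial>(lborel :: 'a measure)) =
    (\<integral>\<^sup>+r. ennreal (?c * r ^ (DIM('a) - 1)) * indicator {0..} r * ennreal (indicator {a..<b} r / r ^ DIM('a)) \<partial>lborel)"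
    by (rule nn_integral_radial) measurable
  also have "\<dots> = (\<integral>\<^sup>+r. ennreal (?c / r) * indicator {a..b} r \<partial>lborel)"
  proof (rule nn_integral_cong_AE)
    have *: "?c * r ^ (DIM('a) - 1) * (1 / r ^ DIM('a)) = ?c / r" if "r > 0" for r :: real
      using that by (simp add: power_diff Suc_leI)
    show "AE r in lborel. ennreal (?c * r ^ (DIM('a) - 1)) * indicator {0..} r * ennreal (indicator {a..<b} r / r ^ DIM('a))
        = ennreal (?c / r) * indicator {a..b} r"
      using AE_lborel_singleton[of b]
    proof eventually_elim
      case (elim r)
      show ?case
      proof (cases "r \<in> {a..<b}")
        case True
        then have "r > 0" using ab by auto
        have "ennreal (?c * r ^ (DIM('a) - 1)) * ennreal (1 / r ^ DIM('a)) = ennreal (?c / r)"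
          using *[OF \<open>r > 0\<close>] \<open>r > 0\<close> by (subst ennreal_mult[symmetric]) (auto simp del: times_divide_eq_right)
        then show ?thesis using True \<open>r > 0\<close> by simp
      qed (use elim in \<open>auto split: split_indicator\<close>)
    qed
  qed
  also have "\<dots> = ennreal (?c * ln b - ?c * ln a)"
    using ab by (intro nn_integral_FTC_Icc) (auto intro!: derivative_eq_intros)
  also have "?c * ln b - ?c * ln a = ?c * ln (b / a)"
    using ab by (simp add: ln_div right_diff_distrib)
  finally show ?thesis .
qed

section \<open>Gamma, Gaussian and beta integrals\<close>

lemma ennreal_mult_eq_iff_divide:
  assumes "ennreal a * I = ennreal b" "a > 0"
  shows "I = ennreal (b / a)"
proof -
  have "ennreal (1 / a) * (ennreal a * I) = I"
    using assms(2) by (simp add: mult.assoc[symmetric] ennreal_mult''[symmetric])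
  then have "I = ennreal (1 / a) * ennreal b" using assms(1) by simp
  then show ?thesis using assms(2) by (simp add: ennreal_mult'[symmetric])
qed

text \<open>The density of the Gamma distribution with shape \<open>p\<close> and rate
  \<open>c\<close>, left unnormalized: its integral writes c^-p as a superposition of exponentials
  in c.\<close>

definition gamma_density :: "real \<Rightarrow> real \<Rightarrow> real \<Rightarrow> real" where
  "gamma_density p c t = indicator {0<..} t * (t powr (p - 1) * exp (- (c * t)))"

lemma gamma_density_nonneg: "0 \<le> gamma_density p c t"
  by (simp add: gamma_density_def)

lemma borel_measurable_gamma_density[measurable (raw)]:
  assumes [measurable]: "c \<in> borel_measurable M" "t \<in> borel_measurable M"
  shows "(\<lambda>x. gamma_density p (c x) (t x)) \<in> borel_measurable M"
  unfolding gamma_density_def by measurable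

lemma nn_integral_gamma_density:
  assumes p: "p > 0" and c: "c > 0"
  shows "(\<integral>\<^sup>+t. ennreal (gamma_density p c t) \<partial>lborel) = ennreal (Gamma p / c powr p)"
proof -
  let ?f = "\<lambda>t. ennreal (indicator {0..} t * t powr (p - 1) / exp t)"
  have "ennreal (Gamma p) = (\<integral>\<^sup>+t. ?f t \<partial>lborel)"
    using Gamma_conv_nn_integral_real[OF p] by simp
  also have "\<dots> = ennreal \<bar>c\<bar> * (\<integral>\<^sup>+t. ?f (0 + c * t) \<partial>lborel)"
    by (rule nn_integral_real_affine) (use c in auto)
  also have "\<dots> = (\<integral>\<^sup>+t. ennreal \<bar>c\<bar> * ?f (0 + c * t) \<partial>lborel)"
    by (rule nn_integral_cmult[symmetric]) measurable
  also have "\<dots> = (\<integral>\<^sup>+t. ennreal (c powr p) * ennreal (gamma_density p c t) \<partial>lborel)"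
  proof (rule nn_integral_cong_AE)
    show "AE t in lborel. ennreal \<bar>c\<bar> * ?f (0 + c * t) = ennreal (c powr p) * ennreal (gamma_density p c t)"
      using AE_lborel_singleton[of 0]
    proof eventually_elim
      case (elim t)
      show ?case
      proof (cases "t > 0")
        case True
        have "c * ((c * t) powr (p - 1) / exp (c * t)) = c powr p * (t powr (p - 1) * exp (- (c * t)))"
          using True c by (simp add: powr_mult powr_diff exp_minus field_simps)
        then show ?thesis using True c
          by (simp add: gamma_density_def ennreal_mult'[symmetric])
      next
        case False
        then show ?thesis using elim c
          by (auto simp: gamma_density_def zero_le_mult_iff)
      qed
    qed
  qed
  also have "\<dots> = ennreal (c powr p) * (\<integral>\<^sup>+t. ennreal (gamma_density p c t) \<partial>lborel)"
    by (rule nn_integral_cmult) measurable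
  finally show ?thesis using ennreal_mult_eq_iff_divide c by simp
qed

text \<open>Layer-cake argument: the Gaussian is the integral of exp(-t) over t \<ge> s|y|^2. After
  the exchange of integrals only volumes of balls remain, and the Gamma value in the ball volume
  cancels against the Gamma integral in t. All dimensions are treated at once.\<close>

lemma nn_integral_gaussian:
  assumes s: "s > 0"
  shows "(\<integral>\<^sup>+y. ennreal (exp (- (s * (norm y)\<^sup>2))) \<partial>(lborel :: 'a::euclidean_space measure))
    = ennreal ((pi / s) powr (real DIM('a) / 2))"
proof -
  let ?h = "real DIM('a) / 2"
  let ?i = "\<lambda>(y::'a) t. ennreal (exp (- t)) * indicator {s * (norm y)\<^sup>2 ..} t"
  have "(\<integral>\<^sup>+y. ennreal (exp (- (s * (norm y)\<^sup>2))) \<partial>(lborel :: 'a measure))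
      = (\<integral>\<^sup>+y. (\<integral>\<^sup>+t. ?i y t \<partial>lborel) \<partial>lborel)"
  proof (rule nn_integral_cong)
    fix y :: 'a
    have "(\<integral>\<^sup>+t. ?i y t \<partial>lborel) = ennreal (0 - (- exp (- (s * (norm y)\<^sup>2))))"
    proof (rule nn_integral_FTC_atLeast)
      show "((\<lambda>t::real. - exp (- t)) \<longlongrightarrow> 0) at_top"
        using tendsto_minus[OF filterlim_compose[OF exp_at_bot filterlim_uminus_at_bot_at_top]] by simp
    qed (auto intro!: derivative_eq_intros)
    then show "ennreal (exp (- (s * (norm y)\<^sup>2))) = (\<integral>\<^sup>+t. ?i y t \<partial>lborel)" by simp
  qed
  also have "\<dots> = (\<integral>\<^sup>+t. (\<integral>\<^sup>+y. ?i y t \<partial>(lborel :: 'a measure)) \<partial>lborel)"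
  proof (rule lborel_pair.Fubini'[symmetric])
    have "(\<lambda>(y::'a, t). ?i y t) = (\<lambda>z. ennreal (if s * (norm (fst z))\<^sup>2 \<le> snd z then exp (- snd z) else 0))"
      by (auto simp: fun_eq_iff)
    also have "\<dots> \<in> borel_measurable (lborel \<Otimes>\<^sub>M lborel)" by measurable
    finally show "(\<lambda>(y::'a, t). ?i y t) \<in> borel_measurable (lborel \<Otimes>\<^sub>M lborel)" .
  qed
  also have "\<dots> = (\<integral>\<^sup>+t. ennreal (unit_ball_vol DIM('a) / s powr ?h) * ennreal (gamma_density (?h + 1) 1 t) \<partial>lborel)"
  proof (rule nn_integral_cong_AE)
    show "AE t in lborel. (\<integral>\<^sup>+y. ?i y t \<partial>(lborel :: 'a measure))
        = ennreal (unit_ball_vol DIM('a) / s powr ?h) * ennreal (gamma_density (?h + 1) 1 t)"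
      using AE_lborel_singleton[of 0]
    proof eventually_elim
      case (elim t)
      have "(\<integral>\<^sup>+y. ?i y t \<partial>(lborel :: 'a measure)) = (\<integral>\<^sup>+y. ennreal (exp (- t)) * indicator {y. s * (norm y)\<^sup>2 \<le> t} y \<partial>(lborel :: 'a measure))"
        by (intro nn_integral_cong) (auto split: split_indicator)
      also have "\<dots> = ennreal (exp (- t)) * emeasure lborel {y::'a. s * (norm y)\<^sup>2 \<le> t}"
        by (rule nn_integral_cmult_indicator) measurable
      also have "\<dots> = ennreal (unit_ball_vol DIM('a) / s powr ?h) * ennreal (gamma_density (?h + 1) 1 t)"
      proof (cases "t > 0")
        case True
        have "{y::'a. s * (norm y)\<^sup>2 \<le> t} = cball 0 (sqrt (t / s))"
          using s True by (auto simp: real_le_rsqrt field_simps intro!: real_le_lsqrt)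
            (smt (verit) divide_nonneg_pos mult.commute nonzero_mult_div_cancel_left norm_ge_zero pos_le_divide_eq real_sqrt_le_iff real_sqrt_abs2 real_sqrt_pow2 power_mono)
        then have "emeasure lborel {y::'a. s * (norm y)\<^sup>2 \<le> t} = ennreal (unit_ball_vol DIM('a) * sqrt (t / s) ^ DIM('a))"
          using True s by (simp add: emeasure_cball)
        moreover have "sqrt (t / s) ^ DIM('a) = t powr ?h / s powr ?h"
          using True s by (simp add: powr_half_sqrt[symmetric] powr_realpow[symmetric] powr_powr powr_divide)
        ultimately show ?thesis using True
          by (simp add: gamma_density_def ennreal_mult'[symmetric] mult_ac)
      next
        case False
        then have "{y::'a. s * (norm y)\<^sup>2 \<le> t} = {}"
          using elim s by (auto simp: not_le) (smt (verit) mult_nonneg_nonneg zero_le_power2)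
        then show ?thesis using False by (simp add: gamma_density_def)
      qed
      finally show ?case .
    qed
  qed
  also have "\<dots> = ennreal (unit_ball_vol DIM('a) / s powr ?h) * ennreal (Gamma (?h + 1) / 1 powr (?h + 1))"
  proof -
    have "?h + 1 > 0" by (rule add_nonneg_pos) auto
    then show ?thesis by (subst nn_integral_cmult) (auto simp only: nn_integral_gamma_density zero_less_one, measurable)
  qed
  also have "\<dots> = ennreal ((pi / s) powr ?h)"
  proof -
    have "Gamma (?h + 1) > 0" by (rule Gamma_real_pos) simp
    then have "Gamma (?h + 1) \<noteq> 0" by (metis less_irrefl)
    then have "unit_ball_vol DIM('a) / s powr ?h * (Gamma (?h + 1) / 1 powr (?h + 1)) = (pi / s) powr ?h"
      using s by (simp add: unit_ball_vol_def powr_divide)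
    then show ?thesis by (subst ennreal_mult'[symmetric]) auto
  qed
  finally show ?thesis .
qed

lemma nn_integral_gaussian_product:
  fixes x :: "'a::euclidean_space"
  assumes s: "s > 0" and t: "t > 0"
  shows "(\<integral>\<^sup>+y. ennreal (exp (- (s * (norm y)\<^sup>2 + t * (norm (x - y))\<^sup>2))) \<partial>lborel)
    = ennreal ((pi / (s + t)) powr (real DIM('a) / 2) * exp (- (s * t / (s + t) * (norm x)\<^sup>2)))"
proof -
  let ?f = "\<lambda>y. ennreal (exp (- (s * (norm y)\<^sup>2 + t * (norm (x - y))\<^sup>2)))"
  \<comment> \<open>The point \<theta> x minimizes the exponent in y; translating it to the origin
    removes the cross term.\<close>
  define \<theta> where "\<theta> = t / (s + t)"
  have st: "s + t > 0" using s t by simp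
  have \<theta>1: "s * \<theta> = t * (1 - \<theta>)" using st by (simp add: \<theta>_def field_simps)
  have \<theta>2: "s * \<theta> * \<theta> + t * (1 - \<theta>) * (1 - \<theta>) = s * t / (s + t)"
  proof -
    have "s * \<theta> * \<theta> + t * (1 - \<theta>) * (1 - \<theta>) = s * \<theta>"
      unfolding \<theta>1[symmetric] by (simp add: algebra_simps)
    then show ?thesis by (simp add: \<theta>_def)
  qed
  have exponent: "s * (norm (\<theta> *\<^sub>R x + y))\<^sup>2 + t * (norm (x - (\<theta> *\<^sub>R x + y)))\<^sup>2
      = (s + t) * (norm y)\<^sup>2 + s * t / (s + t) * (norm x)\<^sup>2" for y
  proof -
    have "x - (\<theta> *\<^sub>R x + y) = (1 - \<theta>) *\<^sub>R x - y" by (simp add: algebra_simps)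
    then have "s * (norm (\<theta> *\<^sub>R x + y))\<^sup>2 + t * (norm (x - (\<theta> *\<^sub>R x + y)))\<^sup>2
      = (s + t) * (y \<bullet> y) + 2 * (s * \<theta> - t * (1 - \<theta>)) * (x \<bullet> y)
        + (s * \<theta> * \<theta> + t * (1 - \<theta>) * (1 - \<theta>)) * (x \<bullet> x)"
      by (simp add: power2_norm_eq_inner inner_add_left inner_add_right inner_diff_left inner_diff_right inner_commute)
        (simp add: algebra_simps)
    then show ?thesis unfolding \<theta>1 \<theta>2[symmetric] by (simp add: power2_norm_eq_inner)
  qed
  have "(\<integral>\<^sup>+y. ?f y \<partial>lborel) = ennreal (\<bar>1\<bar> ^ DIM('a)) * (\<integral>\<^sup>+y. ?f (\<theta> *\<^sub>R x + 1 *\<^sub>R y) \<partial>lborel)"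
    by (rule nn_integral_lborel_affine) auto
  also have "\<dots> = (\<integral>\<^sup>+y. ennreal (exp (- (s * t / (s + t) * (norm x)\<^sup>2))) * ennreal (exp (- ((s + t) * (norm y)\<^sup>2))) \<partial>(lborel :: 'a measure))"
    unfolding abs_one power_one scaleR_one ennreal_1 mult_1 exponent
    by (intro nn_integral_cong) (simp add: ennreal_mult'[symmetric] exp_add[symmetric] algebra_simps)
  also have "\<dots> = ennreal (exp (- (s * t / (s + t) * (norm x)\<^sup>2))) * ennreal ((pi / (s + t)) powr (real DIM('a) / 2))"
    by (subst nn_integral_cmult) (auto simp: nn_integral_gaussian[OF st])
  also have "\<dots> = ennreal ((pi / (s + t)) powr (real DIM('a) / 2) * exp (- (s * t / (s + t) * (norm x)\<^sup>2)))"
    by (simp add: ennreal_mult'[symmetric] mult.commute)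
  finally show ?thesis .
qed

text \<open>The power of 1 + v is a Gamma integral in s. In the other order of integration the
  v-integral is a Gamma integral with rate s, and a Gamma integral of shape b is left.\<close>

lemma nn_integral_beta_prime:
  assumes a: "a > 0" and b: "b > 0"
  shows "(\<integral>\<^sup>+v. ennreal (indicator {0<..} v * (v powr (a - 1) * (1 + v) powr (- (a + b)))) \<partial>lborel)
    = ennreal (Gamma a * Gamma b / Gamma (a + b))"
proof -
  let ?g = "\<lambda>v. indicator {0<..} v * (v powr (a - 1) * (1 + v) powr (- (a + b))) :: real"
  let ?F = "\<lambda>v s. ennreal (indicator {0<..} v * v powr (a - 1) * gamma_density (a + b) (1 + v) s)"
  have G: "Gamma (a + b) > 0" using a b by (simp add: Gamma_real_pos)
  have "ennreal (Gamma (a + b)) * (\<integral>\<^sup>+v. ennreal (?g v) \<partial>lborel) = (\<integral>\<^sup>+v. ennreal (Gamma (a + b)) * ennreal (?g v) \<partial>lborel)"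
    by (rule nn_integral_cmult[symmetric]) measurable
  also have "\<dots> = (\<integral>\<^sup>+v. (\<integral>\<^sup>+s. ?F v s \<partial>lborel) \<partial>lborel)"
  proof (rule nn_integral_cong)
    fix v :: real
    show "ennreal (Gamma (a + b)) * ennreal (?g v) = (\<integral>\<^sup>+s. ?F v s \<partial>lborel)"
    proof (cases "v > 0")
      case True
      have "(\<integral>\<^sup>+s. ?F v s \<partial>lborel) = (\<integral>\<^sup>+s. ennreal (v powr (a - 1)) * ennreal (gamma_density (a + b) (1 + v) s) \<partial>lborel)"
        using True by (simp add: ennreal_mult' gamma_density_nonneg)
      also have "\<dots> = ennreal (v powr (a - 1)) * ennreal (Gamma (a + b) / (1 + v) powr (a + b))"
        using True a b by (subst nn_integral_cmult) (auto simp: nn_integral_gamma_density)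
      moreover have "(1 + v) powr (- a - b) = inverse ((1 + v) powr (a + b))"
        using powr_minus[of "1 + v" "a + b"] by simp
      ultimately show ?thesis using True G
        by (simp add: ennreal_mult'[symmetric] divide_inverse mult_ac)
    qed simp
  qed
  also have "\<dots> = (\<integral>\<^sup>+s. (\<integral>\<^sup>+v. ?F v s \<partial>lborel) \<partial>lborel)"
    by (rule lborel_pair.Fubini'[symmetric]) measurable
  also have "\<dots> = (\<integral>\<^sup>+s. ennreal (Gamma a) * ennreal (gamma_density b 1 s) \<partial>lborel)"
  proof (rule nn_integral_cong)
    fix s :: real
    show "(\<integral>\<^sup>+v. ?F v s \<partial>lborel) = ennreal (Gamma a) * ennreal (gamma_density b 1 s)"
    proof (cases "s > 0")
      case True
      have "(\<integral>\<^sup>+v. ?F v s \<partial>lborel) = (\<integral>\<^sup>+v. ennreal (s powr (a + b - 1) * exp (- s)) * ennreal (gamma_density a s v) \<partial>lborel)"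
      proof (rule nn_integral_cong)
        fix v :: real
        have "exp (- ((1 + v) * s)) = exp (- s) * exp (- (s * v))"
          by (simp add: exp_add[symmetric] algebra_simps)
        then show "?F v s = ennreal (s powr (a + b - 1) * exp (- s)) * ennreal (gamma_density a s v)"
          using True by (simp only: gamma_density_def) (simp add: ennreal_mult'[symmetric] mult_ac)
      qed
      also have "\<dots> = ennreal (s powr (a + b - 1) * exp (- s)) * ennreal (Gamma a / s powr a)"
        using True a by (subst nn_integral_cmult) (auto simp: nn_integral_gamma_density)
      also have "\<dots> = ennreal (Gamma a) * ennreal (gamma_density b 1 s)"
        using True a by (simp add: gamma_density_def ennreal_mult'[symmetric] Gamma_real_pos powr_add powr_diff)
      finally show ?thesis .
    qed (simp add: gamma_density_def)
  qed
  also have "\<dots> = ennreal (Gamma a) * ennreal (Gamma b / 1 powr b)"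
    using b by (subst nn_integral_cmult) (auto simp: nn_integral_gamma_density)
  also have "\<dots> = ennreal (Gamma a * Gamma b)"
    using a by (simp add: ennreal_mult'[symmetric] Gamma_real_pos)
  finally show ?thesis by (rule ennreal_mult_eq_iff_divide) (rule G)
qed

text \<open>Both powers of the norm are superpositions of Gaussians with parameters \<open>s\<close> and \<open>s v\<close>;
  after the Gaussian integral in \<open>y\<close>, a Gamma integral in \<open>s\<close> and a beta integral in \<open>v\<close> remain.\<close>

lemma nn_integral_Riesz_composition:
  fixes x :: "'a::euclidean_space" and p q :: real
  defines "h \<equiv> real DIM('a) / 2"
  assumes p: "0 < p" "p < h" and q: "0 < q" "q < h" and pq: "h < p + q" and x: "x \<noteq> 0"
  shows "(\<integral>\<^sup>+y. ennreal (norm y powr (- 2 * p) * norm (x - y) powr (- 2 * q)) \<partial>lborel)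
    = ennreal (pi powr h * Gamma (h - p) * Gamma (h - q) * Gamma (p + q - h)
        / (Gamma p * Gamma q * Gamma (2 * h - p - q)) * norm x powr (2 * h - 2 * p - 2 * q))"
proof -
  define m where "m = p + q - h"
  have m: "m > 0" using pq by (simp add: m_def)
  let ?w = "\<lambda>y. norm y powr (- 2 * p) * norm (x - y) powr (- 2 * q)"
  \<comment> \<open>The powers are s^(p-1) and (s v)^(q-1), and the substitution of s v for the
    second parameter contributes one more factor s.\<close>
  let ?F = "\<lambda>y s v. ennreal (indicator {0<..} s * indicator {0<..} v * (s powr (p + q - 1) * v powr (q - 1))
      * exp (- (s * (norm y)\<^sup>2 + s * v * (norm (x - y))\<^sup>2)))"
  have G: "Gamma p > 0" "Gamma q > 0" "Gamma m > 0" using p q m by (auto simp: Gamma_real_pos)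
  have norm_powr: "(norm z)\<^sup>2 powr r = norm z powr (2 * r)" if "z \<noteq> 0" for z :: 'a and r
    using that by (simp add: powr_powr[symmetric] powr_numeral)
  have inner: "(\<integral>\<^sup>+s. (\<integral>\<^sup>+v. ?F y s v \<partial>lborel) \<partial>lborel) = ennreal (Gamma p * Gamma q) * ennreal (?w y)"
    if y: "y \<noteq> 0" "y \<noteq> x" for y
  proof -
    have ny: "norm y > 0" "norm (x - y) > 0" using y by auto
    have "(\<integral>\<^sup>+v. ?F y s v \<partial>lborel) = ennreal (Gamma q * norm (x - y) powr (- 2 * q)) * ennreal (gamma_density p ((norm y)\<^sup>2) s)" for s
    proof (cases "s > 0")
      case True
      have "(\<integral>\<^sup>+v. ?F y s v \<partial>lborel) =
          (\<integral>\<^sup>+v. ennreal (s powr (p + q - 1) * exp (- (s * (norm y)\<^sup>2))) * ennreal (gamma_density q (s * (norm (x - y))\<^sup>2) v) \<partial>lborel)"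
      proof (rule nn_integral_cong)
        fix v
        have "exp (- (s * (norm y)\<^sup>2 + s * v * (norm (x - y))\<^sup>2))
            = exp (- (s * (norm y)\<^sup>2)) * exp (- (s * (norm (x - y))\<^sup>2 * v))"
          by (simp add: exp_add[symmetric] algebra_simps)
        then show "?F y s v = ennreal (s powr (p + q - 1) * exp (- (s * (norm y)\<^sup>2)))
            * ennreal (gamma_density q (s * (norm (x - y))\<^sup>2) v)"
          using True by (simp only: gamma_density_def) (simp add: ennreal_mult'[symmetric] mult_ac)
      qed
      also have "\<dots> = ennreal (s powr (p + q - 1) * exp (- (s * (norm y)\<^sup>2))) * ennreal (Gamma q / (s * (norm (x - y))\<^sup>2) powr q)"
        using True q ny by (subst nn_integral_cmult) (auto simp: nn_integral_gamma_density)
      also have "(s * (norm (x - y))\<^sup>2) powr q = s powr q * norm (x - y) powr (2 * q)"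
        using True y by (simp add: powr_mult norm_powr)
      finally show ?thesis using True G(2)
        by (simp add: gamma_density_def ennreal_mult'[symmetric] powr_add powr_diff powr_minus field_simps)
    qed (simp add: gamma_density_def)
    then have "(\<integral>\<^sup>+s. (\<integral>\<^sup>+v. ?F y s v \<partial>lborel) \<partial>lborel)
        = ennreal (Gamma q * norm (x - y) powr (- 2 * q)) * ennreal (Gamma p / (norm y)\<^sup>2 powr p)"
      using p ny by (simp add: nn_integral_cmult nn_integral_gamma_density)
    also have "(norm y)\<^sup>2 powr p = norm y powr (2 * p)" using y by (simp add: norm_powr)
    finally show ?thesis using G
      by (simp add: ennreal_mult'[symmetric] powr_minus divide_inverse mult_ac)
  qed
  have "ennreal (Gamma p * Gamma q) * (\<integral>\<^sup>+y. ennreal (?w y) \<partial>lborel)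
      = (\<integral>\<^sup>+y. ennreal (Gamma p * Gamma q) * ennreal (?w y) \<partial>lborel)"
    by (rule nn_integral_cmult[symmetric]) measurable
  also have "\<dots> = (\<integral>\<^sup>+y. (\<integral>\<^sup>+s. (\<integral>\<^sup>+v. ?F y s v \<partial>lborel) \<partial>lborel) \<partial>lborel)"
  proof (rule nn_integral_cong_AE)
    show "AE y in lborel. ennreal (Gamma p * Gamma q) * ennreal (?w y) = (\<integral>\<^sup>+s. (\<integral>\<^sup>+v. ?F y s v \<partial>lborel) \<partial>lborel)"
      using AE_lborel_singleton[of 0] AE_lborel_singleton[of x]
      by eventually_elim (rule inner[symmetric])
  qed
  also have "\<dots> = (\<integral>\<^sup>+s. (\<integral>\<^sup>+y. (\<integral>\<^sup>+v. ?F y s v \<partial>lborel) \<partial>lborel) \<partial>lborel)"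
    by (rule lborel_pair.Fubini'[symmetric]) measurable
  also have "\<dots> = (\<integral>\<^sup>+s. (\<integral>\<^sup>+v. (\<integral>\<^sup>+y. ?F y s v \<partial>lborel) \<partial>lborel) \<partial>lborel)"
    by (intro nn_integral_cong lborel_pair.Fubini'[symmetric]) measurable
  also have "\<dots> = (\<integral>\<^sup>+v. (\<integral>\<^sup>+s. (\<integral>\<^sup>+y. ?F y s v \<partial>lborel) \<partial>lborel) \<partial>lborel)"
    by (rule lborel_pair.Fubini'[symmetric]) measurable
  also have "\<dots> = (\<integral>\<^sup>+v. ennreal (pi powr h * Gamma m * norm x powr (- 2 * m))
      * ennreal (indicator {0<..} v * (v powr ((h - p) - 1) * (1 + v) powr (- ((h - p) + (h - q))))) \<partial>lborel)"
  proof (rule nn_integral_cong)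
    fix v :: real
    show "(\<integral>\<^sup>+s. (\<integral>\<^sup>+y. ?F y s v \<partial>lborel) \<partial>lborel) = ennreal (pi powr h * Gamma m * norm x powr (- 2 * m))
      * ennreal (indicator {0<..} v * (v powr ((h - p) - 1) * (1 + v) powr (- ((h - p) + (h - q)))))"
    proof (cases "v > 0")
      case True
      \<comment> \<open>Completing the square leaves the exponent -c s, so the s-integral is a Gamma
        integral of shape m and rate c.\<close>
      define c where "c = v / (1 + v) * (norm x)\<^sup>2"
      have c: "c > 0" using True x by (simp add: c_def)
      have "(\<integral>\<^sup>+y. ?F y s v \<partial>lborel) = ennreal (v powr (q - 1) * (pi / (1 + v)) powr h) * ennreal (gamma_density m c s)" for s
      proof (cases "s > 0")
        case s: True
        have "(\<integral>\<^sup>+y. ?F y s v \<partial>lborel) = (\<integral>\<^sup>+y. ennreal (s powr (p + q - 1) * v powr (q - 1))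
            * ennreal (exp (- (s * (norm y)\<^sup>2 + (s * v) * (norm (x - y))\<^sup>2))) \<partial>lborel)"
          using s True by (simp add: ennreal_mult'[symmetric])
        also have "\<dots> = ennreal (s powr (p + q - 1) * v powr (q - 1))
            * ennreal ((pi / (s + s * v)) powr h * exp (- (s * (s * v) / (s + s * v) * (norm x)\<^sup>2)))"
          unfolding h_def using s True
          by (subst nn_integral_cmult, measurable, subst nn_integral_gaussian_product) auto
        also have "s * (s * v) / (s + s * v) * (norm x)\<^sup>2 = c * s"
        proof -
          have "s + s * v = s * (1 + v)" by (simp add: algebra_simps)
          then show ?thesis using s by (simp add: c_def)
        qed
        also have "(pi / (s + s * v)) powr h = (pi / (1 + v)) powr h / s powr h"
        proof -
          have "pi / (s + s * v) = (pi / (1 + v)) / s" using s True by (simp add: field_simps)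
          then show ?thesis using s True by (simp add: powr_divide powr_mult)
        qed
        finally show ?thesis using s
          by (simp add: gamma_density_def m_def ennreal_mult'[symmetric] powr_add powr_diff mult_ac)
      qed (simp add: gamma_density_def)
      then have "(\<integral>\<^sup>+s. (\<integral>\<^sup>+y. ?F y s v \<partial>lborel) \<partial>lborel)
          = ennreal (v powr (q - 1) * (pi / (1 + v)) powr h) * ennreal (Gamma m / c powr m)"
        using m c by (simp add: nn_integral_cmult nn_integral_gamma_density)
      also have "\<dots> = ennreal (v powr (q - 1) * (pi / (1 + v)) powr h * (Gamma m / c powr m))"
        by (rule ennreal_mult'[symmetric]) simp
      also have "v powr (q - 1) * (pi / (1 + v)) powr h * (Gamma m / c powr m) = pi powr h * Gamma m * norm x powr (- 2 * m)
          * (v powr ((h - p) - 1) * (1 + v) powr (- ((h - p) + (h - q))))"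
      proof -
        have "c powr m = v powr m / (1 + v) powr m * norm x powr (2 * m)"
          using True x by (simp add: c_def powr_mult powr_divide norm_powr)
        moreover have "v powr ((h - p) - 1) = v powr (q - 1) / v powr m"
          by (simp add: powr_diff[symmetric] m_def algebra_simps)
        moreover have "(1 + v) powr (- ((h - p) + (h - q))) = (1 + v) powr m / (1 + v) powr h"
          by (simp add: powr_diff[symmetric] m_def algebra_simps)
        moreover have "norm x powr (- 2 * m) = 1 / norm x powr (2 * m)"
          by (simp add: powr_minus_divide[symmetric])
        moreover have "(pi / (1 + v)) powr h = pi powr h / (1 + v) powr h"
          using True by (simp add: powr_divide)
        ultimately show ?thesis by (simp only:) (simp add: mult_ac)
      qed
      finally show ?thesis using True G(3) by (simp add: ennreal_mult')
    qed simp
  qed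
  also have "\<dots> = ennreal (pi powr h * Gamma m * norm x powr (- 2 * m)) * ennreal (Gamma (h - p) * Gamma (h - q) / Gamma ((h - p) + (h - q)))"
    using p q by (subst nn_integral_cmult, measurable, subst nn_integral_beta_prime) auto
  also have "\<dots> = ennreal (pi powr h * Gamma m * norm x powr (- 2 * m) * (Gamma (h - p) * Gamma (h - q) / Gamma ((h - p) + (h - q))))"
    using G(3) by (simp add: ennreal_mult'[symmetric])
  finally have "(\<integral>\<^sup>+y. ennreal (?w y) \<partial>lborel) = ennreal (pi powr h * Gamma m * norm x powr (- 2 * m)
      * (Gamma (h - p) * Gamma (h - q) / Gamma ((h - p) + (h - q))) / (Gamma p * Gamma q))"
    using G by (intro ennreal_mult_eq_iff_divide) auto
  also have "pi powr h * Gamma m * norm x powr (- 2 * m) * (Gamma (h - p) * Gamma (h - q) / Gamma ((h - p) + (h - q))) / (Gamma p * Gamma q)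
    = pi powr h * Gamma (h - p) * Gamma (h - q) * Gamma (p + q - h)
        / (Gamma p * Gamma q * Gamma (2 * h - p - q)) * norm x powr (2 * h - 2 * p - 2 * q)"
  proof -
    have e: "(h - p) + (h - q) = 2 * h - p - q" "- 2 * m = 2 * h - 2 * p - 2 * q" by (auto simp: m_def)
    show ?thesis unfolding e m_def[symmetric] by (simp add: mult_ac)
  qed
  finally show ?thesis .
qed

section \<open>The logarithmic Hardy inequality\<close>

text \<open>With the singular kernel placed in the measure, finite near energy means that
  \<open>difference u\<close> is square integrable, and Fatou's lemma and completeness apply
  verbatim. On the diagonal the density is 0, because division by zero gives 0.\<close>

definition near_measure :: "('a::euclidean_space \<times> 'a) measure" where
  "near_measure = density (lborel \<Otimes>\<^sub>M lborel)
     (\<lambda>z. ennreal (indicator {..<1} (norm (fst z - snd z)) / norm (fst z - snd z) ^ DIM('a)))"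

definition difference :: "('a \<Rightarrow> real) \<Rightarrow> 'a \<times> 'a \<Rightarrow> real" where
  "difference u z = u (fst z) - u (snd z)"

definition near_form :: "('a::euclidean_space \<Rightarrow> real) \<Rightarrow> ('a \<Rightarrow> real) \<Rightarrow> real" where
  "near_form u v = (LINT z|near_measure. difference u z * difference v z)"

definition far_form :: "('a::euclidean_space \<Rightarrow> real) \<Rightarrow> ('a \<Rightarrow> real) \<Rightarrow> real" where
  "far_form u v = (LINT z|(lborel \<Otimes>\<^sub>M lborel).
     indicator {1..} (norm (fst z - snd z)) / norm (fst z - snd z) ^ DIM('a) * (u (fst z) * v (snd z)))"

text \<open>The constant in \<open>\<integral> \<bar>y\<bar>\<^sup>-\<^sup>N\<^sup>/\<^sup>2 \<bar>x - y\<bar>\<^sup>e\<^sup>-\<^sup>N dy = const \<cdot> \<bar>x\<bar>\<^sup>e\<^sup>-\<^sup>N\<^sup>/\<^sup>2\<close>.\<close>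

definition Riesz_const :: "nat \<Rightarrow> real \<Rightarrow> real" where
  "Riesz_const N e = pi powr (N / 2) * Gamma (e / 2) * Gamma (N / 4 - e / 2)
     / (Gamma (N / 2 - e / 2) * Gamma (N / 4 + e / 2))"

text \<open>c_N times the Riesz constant equals (2/e) G(e/2) for a quotient G of Gamma functions
  with G(0) = 1. The expression is thus minus a difference quotient of G at 0; the logarithmic
  derivative of G gives the Digamma values, with Digamma 1 as minus Euler's constant.\<close>

lemma Riesz_const_asymptotics:
  assumes N: "N > 0" and e: "e \<longlonglongrightarrow> 0" "\<And>n. e n > 0"
  shows "(\<lambda>n. 2 / e n - c_const N * Riesz_const N (e n)) \<longlonglongrightarrow>
    2 * Digamma (N / 4) - Digamma (N / 2) + euler_mascheroni"
proof -
  define h where "h = real N / 2"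
  have h: "h > 0" using N by (simp add: h_def)
  define G where "G t = Gamma (1 + t) * Gamma h * Gamma (h / 2 - t) / (Gamma (h - t) * Gamma (h / 2 + t))" for t
  have nonpos: "z \<notin> \<int>\<^sub>\<le>\<^sub>0" if "z > 0" for z :: real using that nonpos_Ints_nonpos[of z] by force
  have pos: "Gamma h > 0" "Gamma (h / 2) > 0" using h by (auto simp: Gamma_real_pos)
  then have nz: "Gamma h \<noteq> 0" "Gamma (h / 2) \<noteq> 0" by (metis less_irrefl)+
  have G0: "G 0 = 1" using pos by (simp add: G_def)
  have "(G has_field_derivative (Digamma 1 - 2 * Digamma (h / 2) + Digamma h)) (at 0)"
    unfolding G_def using h nz nonpos[of h] nonpos[of "h/2"] nonpos[of 1]
    by (auto intro!: derivative_eq_intros simp: field_simps power2_eq_square)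
  then have "((\<lambda>t. (G (0 + t) - G 0) / t) \<longlongrightarrow> Digamma 1 - 2 * Digamma (h / 2) + Digamma h) (at 0)"
    by (rule DERIV_D)
  moreover have "filterlim (\<lambda>n. e n / 2) (at 0) sequentially"
  proof -
    have "(\<lambda>n. e n / 2) \<longlonglongrightarrow> 0 / 2" by (intro tendsto_intros e) auto
    then show ?thesis using e(2) by (auto simp: filterlim_at intro!: always_eventually) (metis less_irrefl)
  qed
  ultimately have "(\<lambda>n. (G (0 + e n / 2) - G 0) / (e n / 2)) \<longlonglongrightarrow> Digamma 1 - 2 * Digamma (h / 2) + Digamma h"
    by (rule filterlim_compose)
  then have "(\<lambda>n. - ((G (0 + e n / 2) - G 0) / (e n / 2))) \<longlonglongrightarrow> - (Digamma 1 - 2 * Digamma (h / 2) + Digamma h)"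
    by (rule tendsto_minus)
  moreover have "- ((G (0 + e n / 2) - G 0) / (e n / 2)) = 2 / e n - c_const N * Riesz_const N (e n)" for n
  proof -
    have g: "Gamma (1 + e n / 2) = e n / 2 * Gamma (e n / 2)"
      using Gamma_plus1[of "e n / 2"] e(2)[of n] nonpos[of "e n / 2"] by (simp add: add.commute)
    have "G (e n / 2) = e n / 2 * (c_const N * Riesz_const N (e n))"
      by (simp only: G_def c_const_def Riesz_const_def h_def g) (simp add: mult_ac)
    then show ?thesis using e(2)[of n] by (simp add: G0 field_simps)
  qed
  ultimately show ?thesis by (simp add: h_def algebra_simps)
qed

text \<open>The Riesz composition with p = N/4 and q = N/2 - e/2. The condition e < N/2 is
  convergence of the integral at infinity, and e > 0 is convergence at y = x.\<close>

lemma nn_integral_kernel_ground_state: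
  fixes x :: "'a::euclidean_space"
  assumes e: "0 < e" "e < real DIM('a) / 2" and x: "x \<noteq> 0"
  shows "(\<integral>\<^sup>+y. ennreal (norm y powr (- (DIM('a) / 2)) * norm (x - y) powr (e - real DIM('a))) \<partial>lborel)
    = ennreal (Riesz_const DIM('a) e * norm x powr (e - real DIM('a) / 2))"
proof -
  let ?N = "real DIM('a)"
  have G: "Gamma (?N / 4) > 0" by (simp add: Gamma_real_pos)
  have "(\<integral>\<^sup>+y. ennreal (norm y powr (- (?N / 2)) * norm (x - y) powr (e - ?N)) \<partial>lborel)
      = (\<integral>\<^sup>+y. ennreal (norm y powr (- 2 * (?N / 4)) * norm (x - y) powr (- 2 * (?N / 2 - e / 2))) \<partial>lborel)"
    by simp
  also have "\<dots> = ennreal (pi powr (?N / 2) * Gamma (?N / 2 - ?N / 4) * Gamma (?N / 2 - (?N / 2 - e / 2))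
      * Gamma (?N / 4 + (?N / 2 - e / 2) - ?N / 2)
      / (Gamma (?N / 4) * Gamma (?N / 2 - e / 2) * Gamma (2 * (?N / 2) - ?N / 4 - (?N / 2 - e / 2)))
      * norm x powr (2 * (?N / 2) - 2 * (?N / 4) - 2 * (?N / 2 - e / 2)))"
    by (rule nn_integral_Riesz_composition) (use e x in \<open>auto simp: field_simps\<close>)
  also have "?N / 2 - ?N / 4 = ?N / 4" by simp
  also have "?N / 2 - (?N / 2 - e / 2) = e / 2" by simp
  also have "?N / 4 + (?N / 2 - e / 2) - ?N / 2 = ?N / 4 - e / 2" by simp
  also have "2 * (?N / 2) - ?N / 4 - (?N / 2 - e / 2) = ?N / 4 + e / 2" by simp
  also have "2 * (?N / 2) - 2 * (?N / 4) - 2 * (?N / 2 - e / 2) = e - ?N / 2" by simp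
  finally show ?thesis using G by (simp add: Riesz_const_def mult.assoc)
qed

lemma Riesz_const_pos:
  assumes "0 < e" "e < real N / 2"
  shows "Riesz_const N e > 0"
proof -
  have "Gamma (e / 2) > 0" "Gamma (real N / 4 - e / 2) > 0" "Gamma (real N / 2 - e / 2) > 0" "Gamma (real N / 4 + e / 2) > 0"
    using assms by (auto intro!: Gamma_real_pos)
  then show ?thesis by (simp add: Riesz_const_def)
qed

text \<open>Schur's test with the weight \<open>\<bar>x\<bar>\<^sup>-\<^sup>N\<^sup>/\<^sup>2\<close>, the ground state of the sharp
  logarithmic Hardy inequality.\<close>

lemma kernel_Schur_test:
  fixes u :: "'a::euclidean_space \<Rightarrow> real"
  assumes e: "0 < e" "e < real DIM('a) / 2" and [measurable]: "u \<in> borel_measurable borel"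
  shows "(\<integral>\<^sup>+z. ennreal (norm (fst z - snd z) powr (e - real DIM('a)) * \<bar>u (fst z) * u (snd z)\<bar>) \<partial>(lborel \<Otimes>\<^sub>M lborel))
    \<le> (\<integral>\<^sup>+x. ennreal (Riesz_const DIM('a) e * norm x powr e * (u x)\<^sup>2) \<partial>lborel)"
proof -
  let ?N = "real DIM('a)" and ?h = "real DIM('a) / 2"
  let ?k = "\<lambda>x y. norm (x - y :: 'a) powr (e - ?N)"
  let ?P = "\<lambda>x y. ennreal (1/2 * (u x)\<^sup>2 * norm x powr ?h * (norm y powr (- ?h) * ?k x y))"
  have half: "(\<integral>\<^sup>+x. (\<integral>\<^sup>+y. ?P x y \<partial>lborel) \<partial>lborel)
      = (\<integral>\<^sup>+x. ennreal (1/2 * (Riesz_const DIM('a) e * norm x powr e * (u x)\<^sup>2)) \<partial>lborel)"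
  proof (rule nn_integral_cong_AE)
    show "AE x in lborel. (\<integral>\<^sup>+y. ?P x y \<partial>lborel) = ennreal (1/2 * (Riesz_const DIM('a) e * norm x powr e * (u x)\<^sup>2))"
      using AE_lborel_singleton[of 0]
    proof eventually_elim
      case (elim x)
      have "(\<integral>\<^sup>+y. ?P x y \<partial>lborel) = (\<integral>\<^sup>+y. ennreal (1/2 * (u x)\<^sup>2 * norm x powr ?h) * ennreal (norm y powr (- ?h) * ?k x y) \<partial>lborel)"
        by (intro nn_integral_cong ennreal_mult') simp
      also have "\<dots> = ennreal (1/2 * (u x)\<^sup>2 * norm x powr ?h) * ennreal (Riesz_const DIM('a) e * norm x powr (e - ?h))"
        using e elim by (subst nn_integral_cmult, measurable, subst nn_integral_kernel_ground_state) auto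
      also have "\<dots> = ennreal (1/2 * (Riesz_const DIM('a) e * (norm x powr ?h * norm x powr (e - ?h)) * (u x)\<^sup>2))"
        by (subst ennreal_mult'[symmetric]) (auto simp: mult_ac)
      also have "norm x powr ?h * norm x powr (e - ?h) = norm x powr e"
        by (simp add: powr_add[symmetric])
      finally show ?case .
    qed
  qed
  have "(\<integral>\<^sup>+z. ennreal (norm (fst z - snd z) powr (e - ?N) * \<bar>u (fst z) * u (snd z)\<bar>) \<partial>(lborel \<Otimes>\<^sub>M lborel))
      = (\<integral>\<^sup>+x. (\<integral>\<^sup>+y. ennreal (?k x y * \<bar>u x * u y\<bar>) \<partial>lborel) \<partial>lborel)"
    by (subst lborel.nn_integral_fst[symmetric]) auto
  also have "\<dots> \<le> (\<integral>\<^sup>+x. (\<integral>\<^sup>+y. ?P x y + ?P y x \<partial>lborel) \<partial>lborel)"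
  proof (rule nn_integral_mono_AE)
    show "AE x in lborel. (\<integral>\<^sup>+y. ennreal (?k x y * \<bar>u x * u y\<bar>) \<partial>lborel) \<le> (\<integral>\<^sup>+y. ?P x y + ?P y x \<partial>lborel)"
      using AE_lborel_singleton[of 0]
    proof eventually_elim
      case x: (elim x)
      show ?case
      proof (rule nn_integral_mono_AE)
        show "AE y in lborel. ennreal (?k x y * \<bar>u x * u y\<bar>) \<le> ?P x y + ?P y x"
          using AE_lborel_singleton[of 0]
        proof eventually_elim
          case y: (elim y)
          define a where "a = norm x powr (?h / 2)"
          define b where "b = norm y powr (?h / 2)"
          have ab: "a > 0" "b > 0" using x y by (auto simp: a_def b_def)
          have pw: "norm x powr ?h = a\<^sup>2" "norm y powr ?h = b\<^sup>2" 
            by (simp_all add: a_def b_def power2_eq_square powr_add[symmetric])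
          have pm: "norm x powr (- ?h) = 1 / a\<^sup>2" "norm y powr (- ?h) = 1 / b\<^sup>2"
            unfolding pw[symmetric] by (simp_all add: powr_minus_divide[symmetric])
          have half_le: "0 \<le> A + B - 2 * c \<Longrightarrow> c \<le> 1/2 * A + 1/2 * B" for A B c :: real by linarith
          \<comment> \<open>Young's inequality weighted with the ratio of the ground states at the
            two points; \<open>a\<close> and \<open>b\<close> are square roots of the inverse ground
            states, so that a complete square appears.\<close>
          have "0 \<le> (\<bar>u x\<bar> * a / b - \<bar>u y\<bar> * b / a)\<^sup>2" by simp
          also have "\<dots> = (u x)\<^sup>2 * a\<^sup>2 * (1 / b\<^sup>2) + (u y)\<^sup>2 * b\<^sup>2 * (1 / a\<^sup>2) - 2 * \<bar>u x * u y\<bar>"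
            using ab by (simp add: power2_diff power_divide power_mult_distrib abs_mult)
          finally have "\<bar>u x * u y\<bar> \<le> 1/2 * ((u x)\<^sup>2 * a\<^sup>2 * (1 / b\<^sup>2)) + 1/2 * ((u y)\<^sup>2 * b\<^sup>2 * (1 / a\<^sup>2))" by (rule half_le)
          then have "?k x y * \<bar>u x * u y\<bar> \<le> ?k x y * (1/2 * ((u x)\<^sup>2 * a\<^sup>2 * (1 / b\<^sup>2)) + 1/2 * ((u y)\<^sup>2 * b\<^sup>2 * (1 / a\<^sup>2)))"
            by (intro mult_left_mono) auto
          also have "\<dots> = 1/2 * (u x)\<^sup>2 * norm x powr ?h * (norm y powr (- ?h) * ?k x y)
              + 1/2 * (u y)\<^sup>2 * norm y powr ?h * (norm x powr (- ?h) * ?k y x)"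
            unfolding pw pm norm_minus_commute[of y x] by (simp add: algebra_simps)
          finally show ?case
            by (simp add: ennreal_plus[symmetric] ennreal_leI del: ennreal_plus)
        qed
      qed
    qed
  qed
  also have "\<dots> = (\<integral>\<^sup>+x. (\<integral>\<^sup>+y. ?P x y \<partial>lborel) \<partial>lborel) + (\<integral>\<^sup>+x. (\<integral>\<^sup>+y. ?P y x \<partial>lborel) \<partial>lborel)"
    by (subst nn_integral_add[symmetric]) (auto intro!: nn_integral_cong nn_integral_add)
  also have "(\<integral>\<^sup>+x. (\<integral>\<^sup>+y. ?P y x \<partial>lborel) \<partial>lborel) = (\<integral>\<^sup>+x. (\<integral>\<^sup>+y. ?P x y \<partial>lborel) \<partial>lborel)"
    by (rule lborel_pair.Fubini') measurable
  also have "(\<integral>\<^sup>+x. (\<integral>\<^sup>+y. ?P x y \<partial>lborel) \<partial>lborel) + (\<integral>\<^sup>+x. (\<integral>\<^sup>+y. ?P x y \<partial>lborel) \<partial>lborel)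
      = (\<integral>\<^sup>+x. ennreal (Riesz_const DIM('a) e * norm x powr e * (u x)\<^sup>2) \<partial>lborel)"
    unfolding half using Riesz_const_pos[OF e]
    by (subst nn_integral_add[symmetric]) (auto simp: ennreal_plus[symmetric] mult.assoc simp del: ennreal_plus)
  finally show ?thesis .
qed

section \<open>Integration over pairs of points\<close>

lemma nn_integral_lborel_pair_product:
  fixes f :: "'a::euclidean_space \<Rightarrow> ennreal" and g :: "'a \<Rightarrow> ennreal"
  assumes [measurable]: "f \<in> borel_measurable borel" "g \<in> borel_measurable borel"
  shows "(\<integral>\<^sup>+z. f (fst z) * g (fst z - snd z) \<partial>(lborel \<Otimes>\<^sub>M lborel)) = (\<integral>\<^sup>+x. f x \<partial>lborel) * (\<integral>\<^sup>+x. g x \<partial>lborel)"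
proof -
  have "(\<integral>\<^sup>+y. g (x - y) \<partial>lborel) = (\<integral>\<^sup>+x. g x \<partial>lborel)" for x
    using nn_integral_lborel_affine[of g "-1" x] by simp
  then show ?thesis
    by (subst lborel.nn_integral_fst[symmetric]) (auto simp: nn_integral_cmult nn_integral_multc)
qed

lemma lborel_pair_swap:
  fixes f :: "'a::euclidean_space \<times> 'a \<Rightarrow> real"
  shows "integrable (lborel \<Otimes>\<^sub>M lborel) (\<lambda>z. f (snd z, fst z)) \<longleftrightarrow> integrable (lborel \<Otimes>\<^sub>M lborel) f"
    and "(LINT z|(lborel \<Otimes>\<^sub>M lborel). f (snd z, fst z)) = (LINT z|(lborel \<Otimes>\<^sub>M lborel). f z)"
proof -
  have *: "(\<lambda>z. f (snd z, fst z)) = (\<lambda>(x, y). f (y, x))" by (auto simp: fun_eq_iff)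
  show i: "integrable (lborel \<Otimes>\<^sub>M lborel) (\<lambda>z. f (snd z, fst z)) \<longleftrightarrow> integrable (lborel \<Otimes>\<^sub>M lborel) f"
    unfolding * by (rule lborel_pair.integrable_product_swap_iff)
  show "(LINT z|(lborel \<Otimes>\<^sub>M lborel). f (snd z, fst z)) = (LINT z|(lborel \<Otimes>\<^sub>M lborel). f z)"
  proof (cases "integrable (lborel \<Otimes>\<^sub>M lborel) f")
    case True
    then show ?thesis unfolding * by (intro lborel_pair.integral_product_swap) auto
  next
    case False
    then show ?thesis using i by (simp add: not_integrable_integral_eq)
  qed
qed

lemma integrable_lborel_pair_product:
  fixes f g :: "'a::euclidean_space \<Rightarrow> real"
  assumes "integrable lborel f" "integrable lborel g"
  shows "integrable (lborel \<Otimes>\<^sub>M lborel) (\<lambda>z. f (fst z) * g (snd z))"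
proof -
  have [measurable]: "f \<in> borel_measurable borel" "g \<in> borel_measurable borel"
    using assms borel_measurable_integrable by auto
  have "(\<integral>\<^sup>+z. ennreal (norm (f (fst z) * g (snd z))) \<partial>(lborel \<Otimes>\<^sub>M lborel))
      = (\<integral>\<^sup>+x. ennreal (norm (f x)) \<partial>lborel) * (\<integral>\<^sup>+x. ennreal (norm (g x)) \<partial>lborel)"
    by (subst lborel.nn_integral_fst[symmetric])
      (auto simp: abs_mult ennreal_mult' nn_integral_cmult nn_integral_multc)
  also have "\<dots> < \<infinity>" using assms by (simp add: integrable_iff_bounded ennreal_mult_less_top)
  finally show ?thesis by (intro integrableI_bounded) auto
qed

lemma square_integrable_bounded_support:
  fixes u :: "'a::euclidean_space \<Rightarrow> real"
  assumes u: "square_integrable lborel u" and supp: "\<And>x. norm x > R \<Longrightarrow> u x = 0"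
  shows "integrable lborel u"
proof (rule Bochner_Integration.integrable_bound)
  show "integrable lborel (\<lambda>x. indicator (cball 0 R) x + (u x)\<^sup>2 :: real)"
    using u by (intro Bochner_Integration.integrable_add integrable_real_indicator)
      (use emeasure_bounded_finite[of "cball (0::'a) R"] in \<open>auto simp: square_integrable_def\<close>)
  show "u \<in> borel_measurable lborel" using u by (simp add: square_integrable_def)
  have "norm (u x) \<le> norm (indicator (cball 0 R) x + (u x)\<^sup>2 :: real)" for x
  proof (cases "norm x > R")
    case False
    have "2 * \<bar>u x\<bar> \<le> 1 + (u x)\<^sup>2" using sum_squares_bound[of 1 "\<bar>u x\<bar>"] by simp
    then show ?thesis using False by (simp add: indicator_def)
  qed (simp add: supp)
  then show "AE x in lborel. norm (u x) \<le> norm (indicator (cball 0 R) x + (u x)\<^sup>2 :: real)" by simp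
qed

lemma near_measure_integrable_iff:
  fixes f :: "'a::euclidean_space \<times> 'a \<Rightarrow> real"
  assumes [measurable]: "f \<in> borel_measurable (lborel \<Otimes>\<^sub>M lborel)"
  shows "integrable near_measure f \<longleftrightarrow> integrable (lborel \<Otimes>\<^sub>M lborel)
      (\<lambda>z. indicator {..<1} (norm (fst z - snd z)) / norm (fst z - snd z) ^ DIM('a) * f z)"
  and "(LINT z|near_measure. f z) = (LINT z|(lborel \<Otimes>\<^sub>M lborel).
      indicator {..<1} (norm (fst z - snd z)) / norm (fst z - snd z) ^ DIM('a) * f z)"
  unfolding near_measure_def
  by (subst integrable_density integral_density, auto)+

lemma sets_near_measure[simp, measurable_cong]: "sets near_measure = sets (lborel \<Otimes>\<^sub>M lborel)"
  by (simp add: near_measure_def)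

lemma borel_measurable_difference[measurable]:
  assumes [measurable]: "u \<in> borel_measurable borel"
  shows "difference u \<in> borel_measurable (lborel \<Otimes>\<^sub>M lborel)"
  unfolding difference_def[abs_def] by measurable

text \<open>Schur's bound controls the full double integral of the regularized kernel. Below
  distance 1 the product u(x) u(y) is rewritten through (u(x) - u(y))^2, whose diagonal terms have
  the explicit mass of order 1/e, while the part beyond distance 1 is kept as it is.\<close>

lemma truncated_energy_bound:
  fixes u :: "'a::euclidean_space \<Rightarrow> real"
  assumes e: "0 < e" "e < real DIM('a) / 2" and R: "1 \<le> R"
    and u: "square_integrable lborel u" "square_integrable near_measure (difference u)"
    and supp: "\<And>x. norm x > R \<Longrightarrow> u x = 0"
  shows "(LINT x|lborel. (2 / e - c_const DIM('a) * Riesz_const DIM('a) e * norm x powr e) * (u x)\<^sup>2)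
    \<le> c_const DIM('a) / 2 * near_form u u - c_const DIM('a) * (LINT z|(lborel \<Otimes>\<^sub>M lborel).
     indicator {1..} (norm (fst z - snd z)) * norm (fst z - snd z) powr (e - real DIM('a)) * (u (fst z) * u (snd z)))"
    (is "_ \<le> _ - _ * ?far")
    and "integrable lborel (\<lambda>x. norm x powr e * (u x)\<^sup>2)"
proof -
  let ?N = "real DIM('a)" and ?M = "lborel \<Otimes>\<^sub>M lborel :: ('a \<times> 'a) measure"
  let ?C = "real DIM('a) * unit_ball_vol DIM('a)"
  let ?n = "\<lambda>z. norm (fst z - snd z :: 'a)"
  define K where "K z = ?n z powr (e - ?N)" for z
  define \<kappa> where "\<kappa> z = (indicator {..<1} (?n z) :: real)" for z
  have [measurable]: "u \<in> borel_measurable borel" using u by (simp add: square_integrable_def)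
  have [measurable]: "K \<in> borel_measurable ?M" "\<kappa> \<in> borel_measurable ?M"
    unfolding K_def[abs_def] \<kappa>_def[abs_def] by measurable
  have K0: "0 \<le> K z" for z by (simp add: K_def)
  have \<kappa>: "0 \<le> \<kappa> z" "\<kappa> z \<le> 1" for z by (auto simp: \<kappa>_def indicator_def)
  have u2: "integrable lborel (\<lambda>x. (u x)\<^sup>2)" using u(1) by (rule square_integrable_square)
  show w_int: "integrable lborel (\<lambda>x. norm x powr e * (u x)\<^sup>2)"
  proof (rule Bochner_Integration.integrable_bound)
    show "integrable lborel (\<lambda>x. R powr e * (u x)\<^sup>2)" using u2 by simp
    have "norm x powr e * (u x)\<^sup>2 \<le> R powr e * (u x)\<^sup>2" for x
      using supp[of x] e by (cases "norm x > R") (auto intro!: mult_right_mono powr_mono2)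
    then show "AE x in lborel. norm (norm x powr e * (u x)\<^sup>2) \<le> norm (R powr e * (u x)\<^sup>2)" by simp
  qed measurable
  have Rc: "Riesz_const DIM('a) e > 0" by (rule Riesz_const_pos[OF e])
  have Schur: "(\<integral>\<^sup>+z. ennreal (K z * \<bar>u (fst z) * u (snd z)\<bar>) \<partial>?M)
      \<le> ennreal (Riesz_const DIM('a) e * (LINT x|lborel. norm x powr e * (u x)\<^sup>2))"
  proof -
    have "(\<integral>\<^sup>+x. ennreal (Riesz_const DIM('a) e * norm x powr e * (u x)\<^sup>2) \<partial>lborel)
       = ennreal (LINT x|lborel. Riesz_const DIM('a) e * (norm x powr e * (u x)\<^sup>2))"
      using w_int Rc by (subst nn_integral_eq_integral[symmetric]) (auto simp: mult.assoc)
    then show ?thesis using kernel_Schur_test[OF e, of u] by (simp add: K_def)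
  qed
  have Kuu: "integrable ?M (\<lambda>z. K z * (u (fst z) * u (snd z)))"
  proof (rule integrableI_bounded)
    show "(\<integral>\<^sup>+z. ennreal (norm (K z * (u (fst z) * u (snd z)))) \<partial>?M) < \<infinity>"
      using Schur K0 by (auto simp: abs_mult le_less_trans)
  qed measurable
  have a_le: "(LINT z|?M. K z * (u (fst z) * u (snd z))) \<le> Riesz_const DIM('a) e * (LINT x|lborel. norm x powr e * (u x)\<^sup>2)"
  proof -
    have "ennreal (LINT z|?M. K z * \<bar>u (fst z) * u (snd z)\<bar>) = (\<integral>\<^sup>+z. ennreal (K z * \<bar>u (fst z) * u (snd z)\<bar>) \<partial>?M)"
      using Kuu[THEN integrable_abs] K0 by (intro nn_integral_eq_integral[symmetric]) (auto simp: abs_mult)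
    also note Schur
    finally have "(LINT z|?M. K z * \<bar>u (fst z) * u (snd z)\<bar>) \<le> Riesz_const DIM('a) e * (LINT x|lborel. norm x powr e * (u x)\<^sup>2)"
      using Rc by (subst (asm) ennreal_le_iff) auto
    moreover have "(LINT z|?M. K z * (u (fst z) * u (snd z))) \<le> (LINT z|?M. K z * \<bar>u (fst z) * u (snd z)\<bar>)"
    proof (intro integral_mono mult_left_mono abs_ge_self K0 Kuu)
      show "integrable ?M (\<lambda>z. K z * \<bar>u (fst z) * u (snd z)\<bar>)"
        using Kuu[THEN integrable_abs] K0 by (simp add: abs_mult)
    qed
    ultimately show ?thesis by simp
  qed
  have near_int: "integrable ?M (\<lambda>z. \<kappa> z * K z * (u (fst z) * u (snd z)))"
    by (rule Bochner_Integration.integrable_bound[OF Kuu])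
      (use \<kappa> K0 in \<open>auto simp: abs_mult \<kappa>_def indicator_def\<close>)
  have far_int: "integrable ?M (\<lambda>z. (1 - \<kappa> z) * K z * (u (fst z) * u (snd z)))"
    by (rule Bochner_Integration.integrable_bound[OF Kuu])
      (use \<kappa> K0 in \<open>auto simp: abs_mult \<kappa>_def indicator_def\<close>)
  have split: "(LINT z|?M. K z * (u (fst z) * u (snd z)))
      = (LINT z|?M. \<kappa> z * K z * (u (fst z) * u (snd z))) + (LINT z|?M. (1 - \<kappa> z) * K z * (u (fst z) * u (snd z)))"
    by (subst Bochner_Integration.integral_add[OF near_int far_int, symmetric]) (simp add: algebra_simps)
  have "(\<integral>\<^sup>+z. ennreal (\<kappa> z * K z * (u (fst z))\<^sup>2) \<partial>?M)
      = (\<integral>\<^sup>+z. ennreal ((u (fst z))\<^sup>2) * ennreal (indicator {..<1} (?n z) * ?n z powr (e - ?N)) \<partial>?M)"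
    by (simp add: \<kappa>_def K_def ennreal_mult'[symmetric] mult_ac)
  also have "\<dots> = (\<integral>\<^sup>+x. ennreal ((u x)\<^sup>2) \<partial>lborel) * (\<integral>\<^sup>+x. ennreal (indicator {..<1} (norm x) * norm x powr (e - ?N)) \<partial>(lborel :: 'a measure))"
    by (rule nn_integral_lborel_pair_product) measurable
  also have "\<dots> = ennreal (LINT x|lborel. (u x)\<^sup>2) * ennreal (?C / e)"
    using u2 by (simp add: nn_integral_eq_integral nn_integral_unit_ball_powr[OF e(1)])
  also have "\<dots> = ennreal ((LINT x|lborel. (u x)\<^sup>2) * (?C / e))"
    by (rule ennreal_mult'[symmetric]) simp
  finally have nn1: "(\<integral>\<^sup>+z. ennreal (\<kappa> z * K z * (u (fst z))\<^sup>2) \<partial>?M) = ennreal ((LINT x|lborel. (u x)\<^sup>2) * (?C / e))" .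
  have i1: "integrable ?M (\<lambda>z. \<kappa> z * K z * (u (fst z))\<^sup>2)"
    by (rule integrableI_nonneg) (use nn1 \<kappa> K0 in auto)
  have I1: "(LINT z|?M. \<kappa> z * K z * (u (fst z))\<^sup>2) = (LINT x|lborel. (u x)\<^sup>2) * (?C / e)"
  proof -
    have "(LINT z|?M. \<kappa> z * K z * (u (fst z))\<^sup>2) = enn2real (ennreal ((LINT x|lborel. (u x)\<^sup>2) * (?C / e)))"
      unfolding nn1[symmetric] by (rule integral_eq_nn_integral) (use \<kappa> K0 in auto)
    then show ?thesis using e by simp
  qed
  have swap: "\<kappa> (snd z, fst z) = \<kappa> z" "K (snd z, fst z) = K z" for z
    by (auto simp: \<kappa>_def K_def norm_minus_commute)
  have i2: "integrable ?M (\<lambda>z. \<kappa> z * K z * (u (snd z))\<^sup>2)"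
    and I2: "(LINT z|?M. \<kappa> z * K z * (u (snd z))\<^sup>2) = (LINT x|lborel. (u x)\<^sup>2) * (?C / e)"
    using lborel_pair_swap[of "\<lambda>z. \<kappa> z * K z * (u (fst z))\<^sup>2"] i1 I1 by (simp_all add: swap)
  have sq: "\<kappa> z * K z * (difference u z)\<^sup>2 = \<kappa> z * K z * (u (fst z))\<^sup>2 + \<kappa> z * K z * (u (snd z))\<^sup>2
      - 2 * (\<kappa> z * K z * (u (fst z) * u (snd z)))" for z
    by (simp add: difference_def power2_eq_square algebra_simps)
  have isq: "integrable ?M (\<lambda>z. \<kappa> z * K z * (difference u z)\<^sup>2)"
    unfolding sq by (intro Bochner_Integration.integrable_diff Bochner_Integration.integrable_add i1 i2 integrable_mult_right near_int)
  have Isq: "(LINT z|?M. \<kappa> z * K z * (difference u z)\<^sup>2)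
      = 2 * ((LINT x|lborel. (u x)\<^sup>2) * (?C / e)) - 2 * (LINT z|?M. \<kappa> z * K z * (u (fst z) * u (snd z)))"
    unfolding sq using i1 i2 near_int I1 I2 by simp
  \<comment> \<open>Below distance 1 the factor |x - y|^e is at most 1, so regularization only
    lowers the energy.\<close>
  have "(LINT z|?M. \<kappa> z * K z * (difference u z)\<^sup>2) \<le> near_form u u"
  proof -
    have d2: "integrable near_measure (\<lambda>z. difference u z * difference u z)"
      using u(2) by (simp add: square_integrable_def power2_eq_square)
    have "(LINT z|?M. \<kappa> z * K z * (difference u z)\<^sup>2)
        \<le> (LINT z|?M. indicator {..<1} (?n z) / ?n z ^ DIM('a) * (difference u z * difference u z))"
    proof (rule integral_mono[OF isq])
      show "integrable ?M (\<lambda>z. indicator {..<1} (?n z) / ?n z ^ DIM('a) * (difference u z * difference u z))"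
        using d2 by (subst (asm) near_measure_integrable_iff) auto
      fix z :: "'a \<times> 'a"
      show "\<kappa> z * K z * (difference u z)\<^sup>2 \<le> indicator {..<1} (?n z) / ?n z ^ DIM('a) * (difference u z * difference u z)"
      proof (cases "?n z < 1 \<and> fst z \<noteq> snd z")
        case True
        then have n: "0 < ?n z" "?n z < 1" by auto
        have "K z = ?n z powr e * (1 / ?n z ^ DIM('a))"
          using n by (simp add: K_def powr_diff powr_realpow)
        also have "\<dots> \<le> 1 * (1 / ?n z ^ DIM('a))"
          using n e by (intro mult_right_mono) (auto simp: powr_le_one_le intro: powr_le1)
        finally have "K z \<le> 1 / ?n z ^ DIM('a)" by simp
        then have "K z * (difference u z * difference u z) \<le> 1 / ?n z ^ DIM('a) * (difference u z * difference u z)"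
          by (rule mult_right_mono) simp
        then show ?thesis using n by (simp add: \<kappa>_def power2_eq_square)
      next
        case False
        then show ?thesis by (auto simp: \<kappa>_def difference_def)
      qed
    qed
    also have "\<dots> = near_form u u" unfolding near_form_def by (rule near_measure_integrable_iff(2)[symmetric]) measurable
    finally show ?thesis .
  qed
  moreover have "?far = (LINT z|?M. (1 - \<kappa> z) * K z * (u (fst z) * u (snd z)))"
    by (intro Bochner_Integration.integral_cong) (auto simp: \<kappa>_def K_def indicator_def)
  ultimately have "(LINT x|lborel. (u x)\<^sup>2) * (?C / e) - Riesz_const DIM('a) e * (LINT x|lborel. norm x powr e * (u x)\<^sup>2)
      \<le> near_form u u / 2 - ?far"
    using Isq split a_le by linarith
  then have main: "c_const DIM('a) * ((LINT x|lborel. (u x)\<^sup>2) * (?C / e) - Riesz_const DIM('a) e * (LINT x|lborel. norm x powr e * (u x)\<^sup>2))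
      \<le> c_const DIM('a) * (near_form u u / 2 - ?far)"
    using c_const_pos[where 'a='a] by (intro mult_left_mono) auto
  have C2: "c_const DIM('a) * ((LINT x|lborel. (u x)\<^sup>2) * (?C / e)) = 2 / e * (LINT x|lborel. (u x)\<^sup>2)"
  proof -
    have "c_const DIM('a) * ((LINT x|lborel. (u x)\<^sup>2) * (?C / e)) = c_const DIM('a) * ?C / e * (LINT x|lborel. (u x)\<^sup>2)"
      by simp
    then show ?thesis unfolding c_const_unit_ball_vol .
  qed
  have "(LINT x|lborel. (2 / e - c_const DIM('a) * Riesz_const DIM('a) e * norm x powr e) * (u x)\<^sup>2)
      = 2 / e * (LINT x|lborel. (u x)\<^sup>2) - c_const DIM('a) * (Riesz_const DIM('a) e * (LINT x|lborel. norm x powr e * (u x)\<^sup>2))"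
    using u2 w_int by (simp add: left_diff_distrib mult.assoc)
  also have "\<dots> \<le> c_const DIM('a) * (near_form u u / 2) - c_const DIM('a) * ?far"
    using main unfolding right_diff_distrib C2 .
  finally show "(LINT x|lborel. (2 / e - c_const DIM('a) * Riesz_const DIM('a) e * norm x powr e) * (u x)\<^sup>2)
    \<le> c_const DIM('a) / 2 * near_form u u - c_const DIM('a) * ?far"
    by simp
qed


text \<open>Only the far part has an integrable majorant. The weighted L2 terms converge merely
  pointwise and are bounded below uniformly on the support; Fatou's lemma then yields the inequality
  together with the integrability of ln|x| u^2, which is not known beforehand.\<close>

theorem logarithmic_Hardy:
  fixes u :: "'a::euclidean_space \<Rightarrow> real"
  assumes R: "1 \<le> R"
    and u: "square_integrable lborel u" "square_integrable near_measure (difference u)"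
    and supp: "\<And>x. norm x > R \<Longrightarrow> u x = 0"
  defines "A \<equiv> 2 * Digamma (DIM('a) / 4) - Digamma (DIM('a) / 2) + euler_mascheroni"
  shows "integrable lborel (\<lambda>x. ln (norm x) * (u x)\<^sup>2)"
    and "A * (LINT x|lborel. (u x)\<^sup>2) - 2 * (LINT x|lborel. ln (norm x) * (u x)\<^sup>2)
      \<le> c_const DIM('a) / 2 * near_form u u - c_const DIM('a) * far_form u u"
proof -
  let ?N = "real DIM('a)" and ?M = "lborel \<Otimes>\<^sub>M lborel :: ('a \<times> 'a) measure"
  let ?h = "real DIM('a) / 2" and ?c = "c_const DIM('a)"
  let ?n = "\<lambda>z. norm (fst z - snd z :: 'a)"
  \<comment> \<open>The shift by 2 keeps even \<open>e 0\<close> strictly below N/2.\<close>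
  define e where "e n = ?h / real (n + 2)" for n
  have e: "e n > 0" "e n < ?h" for n
  proof -
    show "e n > 0" unfolding e_def by (intro divide_pos_pos) auto
    have "?h / real (n + 2) < ?h / 1" by (rule divide_strict_left_mono) auto
    then show "e n < ?h" by (simp add: e_def)
  qed
  have e0: "e \<longlonglongrightarrow> 0"
    unfolding e_def using LIMSEQ_ignore_initial_segment[OF lim_const_over_n[of ?h], of 2] by simp
  have [measurable]: "u \<in> borel_measurable borel" using u by (simp add: square_integrable_def)
  have u1: "integrable lborel u" by (rule square_integrable_bounded_support[OF u(1) supp])
  have u2: "integrable lborel (\<lambda>x. (u x)\<^sup>2)" using u(1) by (rule square_integrable_square)
  define d where "d n = 2 / e n - ?c * Riesz_const DIM('a) (e n)" for n
  have d: "d \<longlonglongrightarrow> A"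
    unfolding d_def A_def by (rule Riesz_const_asymptotics[OF _ e0 e(1)]) simp
  then obtain D where D: "\<And>n. \<bar>d n\<bar> \<le> D"
    using convergent_imp_Bseq[of d] by (auto simp: convergent_def Bseq_def)
  define f where "f n x = 2 / e n - ?c * Riesz_const DIM('a) (e n) * norm x powr e n" for n and x :: 'a
  \<comment> \<open>This form separates the difference quotient of t \<mapsto> |x|^t at 0, whose
    limit is ln|x|, from the convergent constant \<open>d n\<close>.\<close>
  have f_eq: "f n x = 2 / e n * (1 - norm x powr e n) + norm x powr e n * d n" for n x
    by (simp add: f_def d_def algebra_simps)
  \<comment> \<open>Convexity of exp gives 1 - R^e \<ge> -e ln R R^e. Dividing by e cancels the
    pole, and R^e \<le> R^(N/2) makes the bound uniform in n.\<close>
  define C where "C = 2 * ln R * R powr ?h + R powr ?h * D"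
  have f_lower: "- C \<le> f n x" if x: "norm x \<le> R" for n x
  proof -
    have xR: "norm x powr e n \<le> R powr e n" using x e(1)[of n] by (intro powr_mono2) auto
    have Rh: "R powr e n \<le> R powr ?h" using R e(2)[of n] by (intro powr_mono) auto
    have "1 - e n * ln R \<le> exp (- (e n * ln R))" using exp_ge_add_one_self[of "- (e n * ln R)"] by simp
    then have "(1 - e n * ln R) * exp (e n * ln R) \<le> exp (- (e n * ln R)) * exp (e n * ln R)"
      by (intro mult_right_mono) auto
    then have "R powr e n - e n * ln R * R powr e n \<le> 1"
      using R by (simp add: powr_def exp_add[symmetric] algebra_simps)
    then have "2 / e n * (R powr e n - e n * ln R * R powr e n) \<le> 2 / e n * 1"
      using e(1)[of n] by (intro mult_left_mono) auto
    moreover have "2 / e n * (R powr e n - e n * ln R * R powr e n) = 2 / e n * R powr e n - 2 * ln R * R powr e n"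
      using e(1)[of n] by (simp add: field_simps)
    moreover have "2 / e n * (1 - R powr e n) \<le> 2 / e n * (1 - norm x powr e n)"
      using xR e(1)[of n] by (intro mult_left_mono) auto
    moreover have "2 * ln R * R powr e n \<le> 2 * ln R * R powr ?h"
      using Rh R by (intro mult_left_mono) auto
    moreover have "- (R powr ?h * D) \<le> norm x powr e n * d n"
    proof -
      have "\<bar>norm x powr e n * d n\<bar> \<le> R powr ?h * D"
        unfolding abs_mult using xR Rh D[of n] by (intro mult_mono) auto
      then show ?thesis by linarith
    qed
    ultimately show ?thesis unfolding f_eq C_def by (simp add: right_diff_distrib)
  qed
  define far where "far n = (LINT z|?M. indicator {1..} (?n z) * ?n z powr (e n - ?N) * (u (fst z) * u (snd z)))" for n
  note trunc = truncated_energy_bound[OF e R u supp, folded far_def f_def]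
  have far_lim: "far \<longlonglongrightarrow> far_form u u"
    unfolding far_def far_form_def
  proof (rule integral_dominated_convergence)
    let ?w = "\<lambda>z. (2 * R) powr ?h * (\<bar>u (fst z)\<bar> * \<bar>u (snd z)\<bar>)"
    show "integrable ?M ?w"
      using integrable_lborel_pair_product[of "\<lambda>x. \<bar>u x\<bar>" "\<lambda>x. \<bar>u x\<bar>"] u1 by simp
    show "AE z in ?M. (\<lambda>n. indicator {1..} (?n z) * ?n z powr (e n - ?N) * (u (fst z) * u (snd z)))
        \<longlonglongrightarrow> indicator {1..} (?n z) / ?n z ^ DIM('a) * (u (fst z) * u (snd z))"
    proof (rule AE_I2)
      fix z :: "'a \<times> 'a"
      show "(\<lambda>n. indicator {1..} (?n z) * ?n z powr (e n - ?N) * (u (fst z) * u (snd z)))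
        \<longlonglongrightarrow> indicator {1..} (?n z) / ?n z ^ DIM('a) * (u (fst z) * u (snd z))"
      proof (cases "?n z \<ge> 1")
        case True
        have "(\<lambda>n. ?n z powr (e n - ?N)) \<longlonglongrightarrow> ?n z powr (0 - ?N)"
          using True by (intro tendsto_intros e0) auto
        also have "?n z powr (0 - ?N) = 1 / ?n z ^ DIM('a)"
        proof -
          have "0 < ?n z" using True by linarith
          then show ?thesis by (simp add: powr_minus_divide powr_realpow)
        qed
        finally have "(\<lambda>n. ?n z powr (e n - ?N) * (u (fst z) * u (snd z)))
            \<longlonglongrightarrow> 1 / ?n z ^ DIM('a) * (u (fst z) * u (snd z))" by (intro tendsto_intros)
        then show ?thesis using True by simp
      qed simp
    qed
    fix n
    show "AE z in ?M. norm (indicator {1..} (?n z) * ?n z powr (e n - ?N) * (u (fst z) * u (snd z))) \<le> ?w z"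
    proof (rule AE_I2)
      fix z :: "'a \<times> 'a"
      show "norm (indicator {1..} (?n z) * ?n z powr (e n - ?N) * (u (fst z) * u (snd z))) \<le> ?w z"
      proof (cases "?n z \<ge> 1 \<and> norm (fst z) \<le> R \<and> norm (snd z) \<le> R")
        case True
        have "?n z powr (e n - ?N) \<le> ?n z powr ?h"
          using True e(2)[of n] by (intro powr_mono) auto
        also have "\<dots> \<le> (2 * R) powr ?h"
          using True norm_triangle_ineq4[of "fst z" "snd z"] by (intro powr_mono2) auto
        finally have "?n z powr (e n - ?N) * (\<bar>u (fst z)\<bar> * \<bar>u (snd z)\<bar>) \<le> ?w z"
          by (rule mult_right_mono) simp
        then show ?thesis using True by (simp add: abs_mult)
      next
        case False
        then show ?thesis using supp[of "fst z"] supp[of "snd z"] by (auto simp: not_le)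
      qed
    qed
  qed measurable
  let ?U = "LINT x|lborel. (u x)\<^sup>2"
  define B where "B = ?c / 2 * near_form u u - ?c * far_form u u + C * ?U"
  have B_lim: "(\<lambda>n. ?c / 2 * near_form u u - ?c * far n + C * ?U) \<longlonglongrightarrow> B"
    unfolding B_def by (intro tendsto_intros far_lim)
  have g_int: "integrable lborel (\<lambda>x. (f n x + C) * (u x)\<^sup>2)"
    and g_le: "(LINT x|lborel. (f n x + C) * (u x)\<^sup>2) \<le> ?c / 2 * near_form u u - ?c * far n + C * ?U" for n
  proof -
    have i: "integrable lborel (\<lambda>x. f n x * (u x)\<^sup>2)"
      unfolding f_def left_diff_distrib mult.assoc
      by (intro Bochner_Integration.integrable_diff integrable_mult_right u2 trunc(2)) 
    then show "integrable lborel (\<lambda>x. (f n x + C) * (u x)\<^sup>2)" using u2 by (simp add: distrib_right)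
    show "(LINT x|lborel. (f n x + C) * (u x)\<^sup>2) \<le> ?c / 2 * near_form u u - ?c * far n + C * ?U"
      using trunc(1)[of n] i u2 by (simp add: distrib_right)
  qed
  have g_nonneg: "0 \<le> (f n x + C) * (u x)\<^sup>2" for n x
    using f_lower[of x n] supp[of x] by (cases "norm x \<le> R") auto
  define g where "g x = (A - 2 * ln (norm x) + C) * (u x)\<^sup>2" for x
  have [measurable]: "g \<in> borel_measurable borel" unfolding g_def[abs_def] by measurable
  have f_lim: "(\<lambda>n. f n x) \<longlonglongrightarrow> A - 2 * ln (norm x)" if x: "x \<noteq> 0" for x
  proof -
    have "((\<lambda>t. norm x powr t) has_field_derivative ln (norm x)) (at 0)"
      using x by (auto intro!: derivative_eq_intros)
    then have "((\<lambda>t. (norm x powr (0 + t) - norm x powr 0) / t) \<longlongrightarrow> ln (norm x)) (at 0)"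
      by (rule DERIV_D)
    moreover have "filterlim e (at 0) sequentially"
      using e0 e(1) by (auto simp: filterlim_at intro!: always_eventually) (metis less_irrefl)
    ultimately have "(\<lambda>n. (norm x powr (0 + e n) - norm x powr 0) / e n) \<longlonglongrightarrow> ln (norm x)"
      by (rule filterlim_compose)
    then have "(\<lambda>n. - 2 * ((norm x powr (0 + e n) - norm x powr 0) / e n) + norm x powr e n * d n) \<longlonglongrightarrow>
        - 2 * ln (norm x) + norm x powr 0 * A"
      using x by (intro tendsto_intros e0 d) auto
    moreover have "- 2 * ((norm x powr (0 + e n) - norm x powr 0) / e n) + norm x powr e n * d n = f n x" for n
      using x e(1)[of n] by (simp add: f_eq field_simps)
    ultimately show ?thesis using x by simp
  qed
  have g_lim: "(\<lambda>n. (f n x + C) * (u x)\<^sup>2) \<longlonglongrightarrow> g x" if "x \<noteq> 0" for x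
    unfolding g_def by (intro tendsto_intros f_lim that)
  have gx: "0 \<le> g x" if "x \<noteq> 0" for x
    using LIMSEQ_le_const[OF g_lim[OF that], of 0] g_nonneg by auto
  have "(\<integral>\<^sup>+x. ennreal (g x) \<partial>lborel) = (\<integral>\<^sup>+x. liminf (\<lambda>n. ennreal ((f n x + C) * (u x)\<^sup>2)) \<partial>lborel)"
  proof (rule nn_integral_cong_AE)
    show "AE x in lborel. ennreal (g x) = liminf (\<lambda>n. ennreal ((f n x + C) * (u x)\<^sup>2))"
      using AE_lborel_singleton[of 0]
    proof eventually_elim
      case (elim x)
      then have "(\<lambda>n. ennreal ((f n x + C) * (u x)\<^sup>2)) \<longlonglongrightarrow> ennreal (g x)"
        by (intro tendsto_ennrealI g_lim)
      then show ?case using lim_imp_Liminf[OF sequentially_bot] by metis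
    qed
  qed
  also have "\<dots> \<le> liminf (\<lambda>n. \<integral>\<^sup>+x. ennreal ((f n x + C) * (u x)\<^sup>2) \<partial>lborel)"
    by (rule nn_integral_liminf) (simp add: f_def)
  also have "\<dots> \<le> liminf (\<lambda>n. ennreal (?c / 2 * near_form u u - ?c * far n + C * ?U))"
  proof (intro Liminf_mono always_eventually allI)
    fix n
    have "(\<integral>\<^sup>+x. ennreal ((f n x + C) * (u x)\<^sup>2) \<partial>lborel) = ennreal (LINT x|lborel. (f n x + C) * (u x)\<^sup>2)"
      by (intro nn_integral_eq_integral g_int) (simp add: g_nonneg)
    then show "(\<integral>\<^sup>+x. ennreal ((f n x + C) * (u x)\<^sup>2) \<partial>lborel) \<le> ennreal (?c / 2 * near_form u u - ?c * far n + C * ?U)"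
      using g_le[of n] by (simp add: ennreal_leI)
  qed
  also have "\<dots> = ennreal B"
    using lim_imp_Liminf[OF sequentially_bot tendsto_ennrealI[OF B_lim]] .
  finally have g_B: "(\<integral>\<^sup>+x. ennreal (g x) \<partial>lborel) \<le> ennreal B" .
  have g_AE: "AE x in lborel. 0 \<le> g x" using AE_lborel_singleton[of 0] by eventually_elim (rule gx)
  have gi: "integrable lborel g"
  proof (rule integrableI_nonneg)
    show "AE x in lborel. 0 \<le> g x" by (rule g_AE)
    show "(\<integral>\<^sup>+x. ennreal (g x) \<partial>lborel) < \<infinity>" using g_B by (auto simp: le_less_trans)
  qed simp
  have ln_eq: "(\<lambda>x. ln (norm x) * (u x)\<^sup>2) = (\<lambda>x. 1/2 * ((A + C) * (u x)\<^sup>2 - g x))"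
    by (auto simp: g_def algebra_simps)
  show ln_int: "integrable lborel (\<lambda>x. ln (norm x) * (u x)\<^sup>2)"
    unfolding ln_eq by (intro integrable_mult_right Bochner_Integration.integrable_diff u2 gi)
  \<comment> \<open>Nonnegativity of the limit is required for leaving \<open>ennreal\<close>, where
    a negative B would be truncated to 0.\<close>
  have B0: "0 \<le> B"
  proof (rule LIMSEQ_le_const[OF B_lim], intro exI allI impI)
    fix n
    have "0 \<le> (LINT x|lborel. (f n x + C) * (u x)\<^sup>2)" by (rule integral_nonneg_AE) (simp add: g_nonneg)
    then show "0 \<le> ?c / 2 * near_form u u - ?c * far n + C * ?U" using g_le[of n] by simp
  qed
  have "ennreal (LINT x|lborel. g x) = (\<integral>\<^sup>+x. ennreal (g x) \<partial>lborel)"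
    by (rule nn_integral_eq_integral[symmetric, OF gi g_AE])
  then have "(LINT x|lborel. g x) \<le> B" using g_B B0 by (metis ennreal_le_iff)
  moreover have "(LINT x|lborel. g x) = (A + C) * ?U - 2 * (LINT x|lborel. ln (norm x) * (u x)\<^sup>2)"
    unfolding ln_eq using gi u2 by (simp add: diff_divide_distrib)
  ultimately show "A * (LINT x|lborel. (u x)\<^sup>2) - 2 * (LINT x|lborel. ln (norm x) * (u x)\<^sup>2)
      \<le> ?c / 2 * near_form u u - ?c * far_form u u"
    by (simp add: B_def algebra_simps)
qed

section \<open>Test functions\<close>

lemma times_differentiable_lincomb:
  assumes "times_differentiable n f" "times_differentiable n g"
  shows "times_differentiable n (\<lambda>x. a * f x + b * g x)"
  using assms
proof (induction n arbitrary: f g)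
  case 0
  then show ?case by (auto intro!: continuous_intros)
next
  case (Suc n)
  have D: "((\<lambda>x. a * f x + b * g x) has_derivative
      (\<lambda>v. a * frechet_derivative f (at x) v + b * frechet_derivative g (at x) v)) (at x)" for x
    using Suc.prems by (auto intro!: derivative_eq_intros simp: frechet_derivative_works[symmetric])
  then have "frechet_derivative (\<lambda>x. a * f x + b * g x) (at x) =
      (\<lambda>v. a * frechet_derivative f (at x) v + b * frechet_derivative g (at x) v)" for x
    by (metis frechet_derivative_at)
  then show ?case using Suc differentiableI[OF D] by auto
qed

text \<open>The scalar \<open>c\<close> varies in the induction because every derivative brings out
  another factor \<open>a\<close>.\<close>

lemma times_differentiable_dilation:
  assumes "times_differentiable n f"
  shows "times_differentiable n (\<lambda>x. c * f (a *\<^sub>R x))"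
  using assms
proof (induction n arbitrary: f c)
  case 0
  then show ?case
    by (auto intro!: continuous_intros continuous_on_compose2[of UNIV f UNIV "\<lambda>x. a *\<^sub>R x"])
next
  case (Suc n)
  have D: "((\<lambda>x. c * f (a *\<^sub>R x)) has_derivative (\<lambda>v. c * frechet_derivative f (at (a *\<^sub>R x)) (a *\<^sub>R v))) (at x)" for x
  proof -
    have "(f has_derivative frechet_derivative f (at (a *\<^sub>R x))) (at (a *\<^sub>R x))"
      using Suc.prems by (simp add: frechet_derivative_works[symmetric])
    moreover have "((\<lambda>x. a *\<^sub>R x) has_derivative (\<lambda>v. a *\<^sub>R v)) (at x)"
      by (auto intro!: derivative_eq_intros)
    ultimately have "((\<lambda>x. f (a *\<^sub>R x)) has_derivative (\<lambda>v. frechet_derivative f (at (a *\<^sub>R x)) (a *\<^sub>R v))) (at x)"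
      using diff_chain_at[of "\<lambda>x. a *\<^sub>R x" "\<lambda>v. a *\<^sub>R v" x f] by (simp add: o_def)
    then show ?thesis by (rule has_derivative_mult_right)
  qed
  have lin: "linear (frechet_derivative f (at x))" for x
    using Suc.prems by (auto intro: linear_frechet_derivative)
  have "frechet_derivative (\<lambda>x. c * f (a *\<^sub>R x)) (at x) v = (c * a) * frechet_derivative f (at (a *\<^sub>R x)) v" for x v
    by (simp add: frechet_derivative_at[OF D, of x, symmetric] linear_scale[OF lin] mult.assoc)
  then have "times_differentiable n (\<lambda>x. frechet_derivative (\<lambda>x. c * f (a *\<^sub>R x)) (at x) b)" if "b \<in> Basis" for b
    using Suc.IH[of "\<lambda>x. frechet_derivative f (at x) b" "c * a"] Suc.prems that by simp
  then show ?case using differentiableI[OF D] by simp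
qed

lemma smooth_lincomb: "smooth f \<Longrightarrow> smooth g \<Longrightarrow> smooth (\<lambda>x. a * f x + b * g x)"
  by (simp add: smooth_def times_differentiable_lincomb)

lemma smooth_dilation: "smooth f \<Longrightarrow> smooth (\<lambda>x. c * f (a *\<^sub>R x))"
  by (simp add: smooth_def times_differentiable_dilation)

lemma smooth_imp:
  assumes "smooth f"
  shows smooth_imp_continuous: "continuous_on UNIV f"
    and smooth_imp_has_derivative: "(f has_derivative frechet_derivative f (at x)) (at x)"
    and smooth_imp_continuous_partial: "b \<in> Basis \<Longrightarrow> continuous_on UNIV (\<lambda>x. frechet_derivative f (at x) b)"
proof -
  have *: "times_differentiable 0 f" "times_differentiable (Suc 0) f" using assms by (auto simp only: smooth_def)
  show "continuous_on UNIV f" using *(1) by simp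
  show "(f has_derivative frechet_derivative f (at x)) (at x)" using *(2) by (simp add: frechet_derivative_works[symmetric])
  show "b \<in> Basis \<Longrightarrow> continuous_on UNIV (\<lambda>x. frechet_derivative f (at x) b)" using *(2) by simp
qed

lemma test_functionsD:
  assumes "f \<in> test_functions \<Omega>"
  shows "smooth f" "continuous_on UNIV f" "f \<in> borel_measurable borel" "\<And>x. x \<notin> \<Omega> \<Longrightarrow> f x = 0"
proof -
  show "smooth f" using assms by (simp add: test_functions_def)
  then show "continuous_on UNIV f" by (rule smooth_imp_continuous)
  then show "f \<in> borel_measurable borel" by (rule borel_measurable_continuous_onI)
  show "f x = 0" if "x \<notin> \<Omega>" for x
    using assms that closure_subset[of "{x. f x \<noteq> 0}"] by (auto simp: test_functions_def)
qed

lemma compact_subset_closure: "compact K \<Longrightarrow> A \<subseteq> K \<Longrightarrow> compact (closure A) \<and> closure A \<subseteq> K"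
  for A :: "'a::euclidean_space set"
  by (meson bounded_subset closure_minimal compact_closure compact_imp_bounded compact_imp_closed)

lemma test_functionsI:
  assumes "smooth f" "compact K" "K \<subseteq> \<Omega>" "\<And>x. x \<notin> K \<Longrightarrow> f x = 0"
  shows "f \<in> test_functions \<Omega>"
proof -
  have "{x. f x \<noteq> 0} \<subseteq> K" using assms(4) by auto
  then show ?thesis using assms compact_subset_closure[of K "{x. f x \<noteq> 0}"] by (auto simp: test_functions_def)
qed

lemma test_functions_support:
  assumes "f \<in> test_functions \<Omega>"
  shows "\<exists>K. compact K \<and> K \<subseteq> \<Omega> \<and> (\<forall>x. x \<notin> K \<longrightarrow> f x = 0)"
proof (intro exI conjI allI impI)
  show "f x = 0" if "x \<notin> closure {x. f x \<noteq> 0}" for x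
    using that closure_subset[of "{x. f x \<noteq> 0}"] by auto
qed (use assms in \<open>auto simp: test_functions_def\<close>)

lemma test_functions_lincomb:
  assumes "f \<in> test_functions \<Omega>" "g \<in> test_functions \<Omega>"
  shows "(\<lambda>x. a * f x + b * g x) \<in> test_functions \<Omega>"
proof -
  obtain K where K: "compact K" "K \<subseteq> \<Omega>" "\<And>x. x \<notin> K \<Longrightarrow> f x = 0" using test_functions_support[OF assms(1)] by blast
  obtain L where L: "compact L" "L \<subseteq> \<Omega>" "\<And>x. x \<notin> L \<Longrightarrow> g x = 0" using test_functions_support[OF assms(2)] by blast
  show ?thesis
    using K L
    by (intro test_functionsI[of _ "K \<union> L"] smooth_lincomb test_functionsD(1)[OF assms(1)] test_functionsD(1)[OF assms(2)]) auto
qed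

lemma test_functions_dilation:
  assumes f: "f \<in> test_functions \<Omega>" and l: "l > 0"
  shows "(\<lambda>x. c * f ((1 / l) *\<^sub>R x)) \<in> test_functions ((\<lambda>x. l *\<^sub>R x) ` \<Omega>)"
proof -
  obtain K where K: "compact K" "K \<subseteq> \<Omega>" "\<And>x. x \<notin> K \<Longrightarrow> f x = 0" using test_functions_support[OF f] by blast
  show ?thesis
  proof (rule test_functionsI)
    show "smooth (\<lambda>x. c * f ((1 / l) *\<^sub>R x))" by (intro smooth_dilation test_functionsD(1)[OF f])
    show "compact ((\<lambda>x. l *\<^sub>R x) ` K)" by (rule compact_scaling[OF K(1)])
    show "(\<lambda>x. l *\<^sub>R x) ` K \<subseteq> (\<lambda>x. l *\<^sub>R x) ` \<Omega>" using K(2) by auto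
    fix x assume "x \<notin> (\<lambda>x. l *\<^sub>R x) ` K"
    then have "(1 / l) *\<^sub>R x \<notin> K" using l by (auto simp: image_iff)
    then show "c * f ((1 / l) *\<^sub>R x) = 0" using K(3) by simp
  qed
qed

lemma test_functions_bounded:
  assumes f: "f \<in> test_functions \<Omega>"
  shows "\<exists>M R. 0 < R \<and> (\<forall>x. \<bar>f x\<bar> \<le> M) \<and> (\<forall>x. norm x > R \<longrightarrow> f x = 0)"
proof -
  obtain K where K: "compact K" "K \<subseteq> \<Omega>" "\<And>x. x \<notin> K \<Longrightarrow> f x = 0" using test_functions_support[OF f] by blast
  obtain R where R: "R > 0" "\<And>x. x \<in> K \<Longrightarrow> norm x \<le> R"
    using compact_imp_bounded[OF K(1)] by (auto simp: bounded_pos)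
  have "compact (f ` K)"
    by (rule compact_continuous_image[OF continuous_on_subset[OF test_functionsD(2)[OF f]] K(1)]) simp
  then have "bounded (f ` K)" by (rule compact_imp_bounded)
  then obtain M where M: "\<And>x. x \<in> K \<Longrightarrow> \<bar>f x\<bar> \<le> M"
    unfolding bounded_iff real_norm_def by blast
  have "\<bar>f x\<bar> \<le> max M 0" for x using M[of x] K(3)[of x] by (cases "x \<in> K") auto
  moreover have "f x = 0" if "norm x > R" for x using R(2)[of x] K(3)[of x] that by force
  ultimately show ?thesis using R(1) by blast
qed

text \<open>The gradient is bounded on a ball exceeding the support by 1, which settles pairs inside
  it. If one point lies outside, either both values vanish or the points are at distance at least 1,
  where the supremum of |f| serves as Lipschitz constant.\<close>

lemma test_functions_Lipschitz:
  assumes f: "f \<in> test_functions \<Omega>"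
  shows "\<exists>L\<ge>0. \<forall>x y. \<bar>f x - f y\<bar> \<le> L * norm (x - y)"
proof -
  obtain M R where R: "0 < R" and M: "\<And>x. \<bar>f x\<bar> \<le> M" and supp: "\<And>x. norm x > R \<Longrightarrow> f x = 0"
    using test_functions_bounded[OF f] by blast
  note sm = test_functionsD(1)[OF f]
  define D where "D x = (\<Sum>b\<in>Basis. \<bar>frechet_derivative f (at x) b\<bar>)" for x
  have "continuous_on (cball 0 (R + 1)) D"
    unfolding D_def by (intro continuous_intros continuous_on_subset[OF smooth_imp_continuous_partial[OF sm]]) auto
  then have "compact (D ` cball 0 (R + 1))" by (intro compact_continuous_image) auto
  then have "bounded (D ` cball 0 (R + 1))" by (rule compact_imp_bounded)
  then obtain B where B0: "\<And>x. x \<in> cball 0 (R + 1) \<Longrightarrow> \<bar>D x\<bar> \<le> B"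
    unfolding bounded_iff real_norm_def by blast
  have B: "D x \<le> B" if "x \<in> cball 0 (R + 1)" for x using B0[OF that] by linarith
  have inside: "\<bar>f x - f y\<bar> \<le> B * norm (x - y)" if xy: "norm x \<le> R + 1" "norm y \<le> R + 1" for x y
  proof -
    have "norm (f x - f y) \<le> B * norm (x - y)"
    proof (rule differentiable_bound[of "cball 0 (R + 1)" f "\<lambda>x. frechet_derivative f (at x)"])
      fix z :: 'a assume z: "z \<in> cball 0 (R + 1)"
      show "(f has_derivative frechet_derivative f (at z)) (at z within cball 0 (R + 1))"
        using smooth_imp_has_derivative[OF sm] by (rule has_derivative_at_withinI)
      have lin: "linear (frechet_derivative f (at z))"
        by (rule has_derivative_linear[OF smooth_imp_has_derivative[OF sm]])
      have "norm (frechet_derivative f (at z) v) \<le> B * norm v" for v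
      proof -
        have "frechet_derivative f (at z) v = frechet_derivative f (at z) (\<Sum>b\<in>Basis. (v \<bullet> b) *\<^sub>R b)"
          by (simp add: euclidean_representation)
        also have "\<dots> = (\<Sum>b\<in>Basis. (v \<bullet> b) * frechet_derivative f (at z) b)"
          by (simp add: linear_sum[OF lin] linear_scale[OF lin])
        finally have "\<bar>frechet_derivative f (at z) v\<bar> \<le> (\<Sum>b\<in>Basis. \<bar>(v \<bullet> b) * frechet_derivative f (at z) b\<bar>)"
          by (metis sum_abs)
        also have "\<dots> \<le> (\<Sum>b\<in>Basis. norm v * \<bar>frechet_derivative f (at z) b\<bar>)"
          by (intro sum_mono) (auto simp: abs_mult intro!: mult_right_mono Basis_le_norm)
        also have "\<dots> = norm v * D z" by (simp add: D_def sum_distrib_left)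
        also have "\<dots> \<le> norm v * B" using B[OF z] by (intro mult_left_mono) auto
        finally show ?thesis by (simp add: mult.commute)
      qed
      then show "onorm (frechet_derivative f (at z)) \<le> B" by (rule onorm_le)
    qed (use xy in auto)
    then show ?thesis by simp
  qed
  have outside: "\<bar>f x - f y\<bar> \<le> M * norm (x - y)" if "norm y > R + 1" for x y
  proof (cases "norm x > R")
    case True
    then show ?thesis using supp that R M[of x] by (simp add: order_trans[OF abs_ge_zero])
  next
    case False
    have "1 \<le> norm (x - y)" using norm_triangle_ineq2[of y x] False that by (simp add: norm_minus_commute)
    moreover have "0 \<le> M" using M[of x] by linarith
    ultimately have "M * 1 \<le> M * norm (x - y)" by (intro mult_left_mono)
    moreover have "f y = 0" using supp[of y] that by simp
    ultimately show ?thesis using M[of x] by simp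
  qed
  have "\<bar>f x - f y\<bar> \<le> max (max B M) 0 * norm (x - y)" for x y
  proof -
    have "\<bar>f x - f y\<bar> \<le> B * norm (x - y) \<or> \<bar>f x - f y\<bar> \<le> M * norm (x - y)"
      using inside[of x y] outside[of y x] outside[of x y]
      by (cases "norm y > R + 1"; cases "norm x > R + 1") (auto simp: norm_minus_commute abs_minus_commute)
    moreover have "B * norm (x - y) \<le> max (max B M) 0 * norm (x - y)" "M * norm (x - y) \<le> max (max B M) 0 * norm (x - y)"
      by (auto intro!: mult_right_mono)
    ultimately show ?thesis by linarith
  qed
  then show ?thesis by (intro exI[of _ "max (max B M) 0"]) simp
qed

section \<open>Smooth bump functions\<close>

definition flat_exp :: "nat \<Rightarrow> real \<Rightarrow> real" where
  "flat_exp m t = (if t > 0 then exp (- 1 / t) / t ^ m else 0)"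

lemma flat_exp_tendsto_0: "(flat_exp m \<longlongrightarrow> 0) (at 0)"
proof (rule filterlim_split_at)
  show "(flat_exp m \<longlongrightarrow> 0) (at_left 0)"
    by (rule Lim_transform_eventually[OF tendsto_const])
      (auto simp: flat_exp_def eventually_at_left_field intro!: exI[of _ "-1"])
  have "((\<lambda>t. inverse t ^ m / exp (inverse t)) \<longlongrightarrow> (0::real)) (at_right 0)"
    by (rule filterlim_compose[OF tendsto_power_div_exp_0 filterlim_inverse_at_top_right])
  then show "(flat_exp m \<longlongrightarrow> 0) (at_right 0)"
    by (rule Lim_transform_eventually)
      (auto simp: flat_exp_def eventually_at_right_field exp_minus field_simps intro!: exI[of _ 1])
qed

text \<open>Dividing exp(-1/t) by powers of t gives a family that is closed under differentiation up
  to linear combinations, at the flat point t = 0 as well.\<close>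

lemma DERIV_flat_exp: "(flat_exp m has_real_derivative (- real m * flat_exp (Suc m) t + flat_exp (m + 2) t)) (at t)"
proof -
  consider "t < 0" | "t = 0" | "t > 0" by linarith
  then show ?thesis
  proof cases
    case 1
    have "((\<lambda>_. 0) has_real_derivative 0) (at t)" by simp
    then have "(flat_exp m has_real_derivative 0) (at t)"
      by (rule DERIV_cong_ev[THEN iffD1, rotated -1])
        (use 1 in \<open>auto simp: flat_exp_def eventually_nhds intro!: exI[of _ "{..<0}"]\<close>)
    then show ?thesis using 1 by (simp add: flat_exp_def)
  next
    case 2
    \<comment> \<open>The difference quotient of \<open>flat_exp m\<close> at 0 is
      \<open>flat_exp (Suc m)\<close>, which tends to 0.\<close>
    have "((\<lambda>h. (flat_exp m (0 + h) - flat_exp m 0) / h) \<longlongrightarrow> 0) (at 0)"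
      using flat_exp_tendsto_0[of "Suc m"]
      by (rule Lim_transform_eventually) (auto simp: flat_exp_def eventually_at_filter)
    then show ?thesis using 2 by (simp add: flat_exp_def DERIV_def)
  next
    case 3
    have eq: "flat_exp k s = exp (- 1 / s - real k * ln s)" if "s > 0" for k and s :: real
      using that by (simp add: flat_exp_def exp_diff exp_of_nat_mult)
    have "((\<lambda>t. exp (- 1 / t - real m * ln t)) has_real_derivative
        exp (- 1 / t - real m * ln t) * (1 / t\<^sup>2 - real m / t)) (at t)"
      using 3 by (auto intro!: derivative_eq_intros simp: power2_eq_square)
    moreover have "exp (- 1 / t - real m * ln t) * (1 / t\<^sup>2 - real m / t)
        = - real m * flat_exp (Suc m) t + flat_exp (m + 2) t"
      using 3 unfolding eq[OF 3, of m, symmetric] by (simp add: flat_exp_def power2_eq_square field_simps)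
    ultimately show ?thesis
      by (subst DERIV_cong_ev[OF refl _ refl, where g="\<lambda>t. exp (- 1 / t - real m * ln t)"])
        (use 3 eq in \<open>auto simp: eventually_nhds intro!: exI[of _ "{0<..}"]\<close>)
  qed
qed

text \<open>A class of functions containing the bump functions that is closed under partial derivatives.\<close>

inductive bump_algebra :: "'a::euclidean_space \<Rightarrow> real \<Rightarrow> ('a \<Rightarrow> real) \<Rightarrow> bool" for p r where
  "bump_algebra p r (\<lambda>_. c)"
| "bump_algebra p r (\<lambda>x. (x - p) \<bullet> b)"
| "bump_algebra p r f \<Longrightarrow> bump_algebra p r g \<Longrightarrow> bump_algebra p r (\<lambda>x. f x + g x)"
| "bump_algebra p r f \<Longrightarrow> bump_algebra p r g \<Longrightarrow> bump_algebra p r (\<lambda>x. f x * g x)"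
| "bump_algebra p r (\<lambda>x. flat_exp m (r\<^sup>2 - (x - p) \<bullet> (x - p)))"

lemma bump_algebra_derivative:
  assumes "bump_algebra p r f"
  shows "\<exists>f'. (\<forall>x. (f has_derivative f' x) (at x)) \<and> (\<forall>b. bump_algebra p r (\<lambda>x. f' x b))"
  using assms
proof induction
  case (1 c)
  show ?case by (intro exI[of _ "\<lambda>x v. 0"]) (auto intro: bump_algebra.intros)
next
  case (2 b)
  show ?case
    by (intro exI[of _ "\<lambda>x v. v \<bullet> b"]) (auto intro!: bump_algebra.intros derivative_eq_intros)
next
  case (3 f g)
  then obtain f' g' where
    "\<And>x. (f has_derivative f' x) (at x)" "\<And>b. bump_algebra p r (\<lambda>x. f' x b)"
    "\<And>x. (g has_derivative g' x) (at x)" "\<And>b. bump_algebra p r (\<lambda>x. g' x b)" by blast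
  then show ?case
    by (intro exI[of _ "\<lambda>x v. f' x v + g' x v"]) (auto intro!: bump_algebra.intros derivative_intros)
next
  case (4 f g)
  then obtain f' g' where
    "\<And>x. (f has_derivative f' x) (at x)" "\<And>b. bump_algebra p r (\<lambda>x. f' x b)"
    "\<And>x. (g has_derivative g' x) (at x)" "\<And>b. bump_algebra p r (\<lambda>x. g' x b)" by blast
  then show ?case using 4
    by (intro exI[of _ "\<lambda>x v. f x * g' x v + f' x v * g x"]) (auto intro!: bump_algebra.intros derivative_intros)
next
  case (5 m)
  let ?q = "\<lambda>x. r\<^sup>2 - (x - p) \<bullet> (x - p)"
  let ?d = "\<lambda>x. (- real m) * flat_exp (Suc m) (?q x) + flat_exp (m + 2) (?q x)"
  have "((\<lambda>x. flat_exp m (?q x)) has_derivative (\<lambda>v. ?d x * ((- 2) * ((x - p) \<bullet> v)))) (at x)" for x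
  proof -
    have q: "(?q has_derivative (\<lambda>v. (- 2) * ((x - p) \<bullet> v))) (at x)"
      by (auto intro!: derivative_eq_intros simp: inner_commute)
    have g: "(flat_exp m has_derivative (\<lambda>h. ?d x * h)) (at (?q x))"
      using DERIV_flat_exp[of m "?q x"] by (simp add: has_field_derivative_def)
    show ?thesis using diff_chain_at[OF q g] by (simp add: o_def)
  qed
  moreover have "bump_algebra p r (\<lambda>x. ?d x * ((- 2) * ((x - p) \<bullet> b)))" for b
    by (intro bump_algebra.intros)
  ultimately show ?case
    by (intro exI[of _ "\<lambda>x v. ?d x * ((- 2) * ((x - p) \<bullet> v))"]) blast
qed

lemma bump_algebra_smooth:
  assumes "bump_algebra p r f"
  shows "smooth f"
proof -
  have "times_differentiable n f" for n
    using assms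
  proof (induction n arbitrary: f)
    case 0
    then obtain f' where "\<And>x. (f has_derivative f' x) (at x)" using bump_algebra_derivative by blast
    then show ?case by (auto simp: continuous_on_eq_continuous_at intro: has_derivative_continuous)
  next
    case (Suc n)
    then obtain f' where f': "\<And>x. (f has_derivative f' x) (at x)" "\<And>b. bump_algebra p r (\<lambda>x. f' x b)"
      using bump_algebra_derivative by blast
    have "frechet_derivative f (at x) = f' x" for x using frechet_derivative_at[OF f'(1)] by metis
    then show ?case using f'(2) Suc.IH differentiableI[OF f'(1)] by auto
  qed
  then show ?thesis by (simp add: smooth_def)
qed

lemma bump_function_exists:
  fixes p :: "'a::euclidean_space"
  assumes r: "r > 0" and sub: "cball p r \<subseteq> \<Omega>"
  obtains f where "f \<in> test_functions \<Omega>" "\<And>x. x \<notin> cball p r \<Longrightarrow> f x = 0" "\<And>x. x \<in> ball p r \<Longrightarrow> f x > 0"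
proof (rule that)
  let ?f = "\<lambda>x. flat_exp 0 (r\<^sup>2 - (x - p) \<bullet> (x - p))"
  have q: "r\<^sup>2 - (x - p) \<bullet> (x - p) > 0 \<longleftrightarrow> x \<in> ball p r" for x
  proof -
    have "(norm (x - p))\<^sup>2 < r\<^sup>2 \<longleftrightarrow> norm (x - p) < r"
      using r by (auto intro: power_strict_mono power2_less_imp_less)
    then show ?thesis by (simp add: power2_norm_eq_inner[symmetric] dist_norm norm_minus_commute)
  qed
  show zero: "?f x = 0" if "x \<notin> cball p r" for x
    using q[of x] that by (auto simp: flat_exp_def)
  show "?f x > 0" if "x \<in> ball p r" for x using q[of x] that by (simp add: flat_exp_def)
  show "?f \<in> test_functions \<Omega>"
    by (rule test_functionsI[OF bump_algebra_smooth compact_cball sub zero]) (rule bump_algebra.intros)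
qed

section \<open>The Dirichlet energy on functions of finite energy\<close>

text \<open>The maximal domain of the forms. Inequalities are proved on it and then restricted to
  limits of test functions, so Hardy's inequality need not be passed to a limit again.\<close>

definition finite_energy :: "'a::euclidean_space set \<Rightarrow> ('a \<Rightarrow> real) set" where
  "finite_energy \<Omega> = {u. (\<forall>x. x \<notin> \<Omega> \<longrightarrow> u x = 0) \<and> square_integrable lborel u \<and>
     square_integrable near_measure (difference u)}"

definition l2_form :: "('a::euclidean_space \<Rightarrow> real) \<Rightarrow> ('a \<Rightarrow> real) \<Rightarrow> real" where
  "l2_form u v = (LINT x|lborel. u x * v x)"

definition log_form :: "('a::euclidean_space \<Rightarrow> real) \<Rightarrow> ('a \<Rightarrow> real) \<Rightarrow> real" where
  "log_form u v = (LINT x|lborel. ln (norm x) * (u x * v x))"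

text \<open>The factor 1/2 arises because \<open>near_form\<close> runs over ordered pairs. The
  weight in \<open>log_form\<close> is ln|x| rather than ln(1/|x|), hence the minus sign before
  \<mu>.\<close>

definition energy_form :: "real \<Rightarrow> ('a::euclidean_space \<Rightarrow> real) \<Rightarrow> ('a \<Rightarrow> real) \<Rightarrow> real" where
  "energy_form \<mu> u v = c_const DIM('a) / 2 * near_form u v - c_const DIM('a) * far_form u v
     + rho_const DIM('a) * l2_form u v - 2 * \<mu> * log_form u v"

text \<open>The common reference norm: it is independent of \<mu>, and every form in question is
  bounded by it on a bounded set.\<close>

definition graph_form :: "('a::euclidean_space \<Rightarrow> real) \<Rightarrow> ('a \<Rightarrow> real) \<Rightarrow> real" where
  "graph_form u v = near_form u v + l2_form u v"

lemma finite_energyD: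
  assumes "u \<in> finite_energy \<Omega>"
  shows "u \<in> borel_measurable borel" "\<And>x. x \<notin> \<Omega> \<Longrightarrow> u x = 0" "square_integrable lborel u"
    "square_integrable near_measure (difference u)"
  using assms by (auto simp: finite_energy_def square_integrable_def)

lemma difference_lincomb:
  "difference (\<lambda>x. a * u x + b * v x) = (\<lambda>z. a * difference u z + b * difference v z)"
  by (auto simp: difference_def algebra_simps)

lemma difference_diff: "difference (\<lambda>x. u x - v x) = (\<lambda>z. difference u z - difference v z)"
  by (auto simp: difference_def algebra_simps)

lemma function_subspace_finite_energy: "function_subspace (finite_energy \<Omega>)"
proof -
  have "(\<lambda>_. 0) \<in> finite_energy \<Omega>"
    by (simp add: finite_energy_def square_integrable_def difference_def[abs_def])
  then show ?thesis
    unfolding function_subspace_def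
    by (auto simp: finite_energy_def difference_lincomb intro!: square_integrable_lincomb)
qed

lemma l2_form_nonneg: "0 \<le> l2_form u u"
  by (simp add: l2_form_def)

lemma near_form_nonneg: "0 \<le> near_form u u"
  by (simp add: near_form_def)

lemma l2_form_square: "l2_form u u = (LINT x|lborel. (u x)\<^sup>2)"
  by (simp add: l2_form_def power2_eq_square)

lemma near_form_square: "near_form u u = (LINT z|near_measure. (difference u z)\<^sup>2)"
  by (simp add: near_form_def power2_eq_square)

lemma bilinear_near_form: "bilinear_on (finite_energy \<Omega>) near_form"
proof
  have i: "integrable near_measure (\<lambda>z. difference u z * difference v z)"
    if "u \<in> finite_energy \<Omega>" "v \<in> finite_energy \<Omega>" for u v
    using that by (intro square_integrable_mult finite_energyD(4))
  show "symmetric_bilinear_on (finite_energy \<Omega>) near_form"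
    unfolding symmetric_bilinear_on_def
  proof (intro conjI ballI allI)
    fix u v assume "u \<in> finite_energy \<Omega>" "v \<in> finite_energy \<Omega>"
    show "near_form u v = near_form v u" by (simp add: near_form_def mult.commute)
    fix w a b assume "w \<in> finite_energy \<Omega>"
    with \<open>u \<in> _\<close> \<open>v \<in> _\<close> show "near_form (\<lambda>x. a * u x + b * v x) w = a * near_form u w + b * near_form v w"
      using i[of u w] i[of v w] by (simp add: near_form_def difference_lincomb distrib_right mult.assoc)
  qed
qed (rule function_subspace_finite_energy)

lemma bilinear_l2_form: "bilinear_on (finite_energy \<Omega>) l2_form"
proof
  have i: "integrable lborel (\<lambda>z. u z * v z)"
    if "u \<in> finite_energy \<Omega>" "v \<in> finite_energy \<Omega>" for u v
    using that by (intro square_integrable_mult finite_energyD(3))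
  show "symmetric_bilinear_on (finite_energy \<Omega>) l2_form"
    unfolding symmetric_bilinear_on_def
  proof (intro conjI ballI allI)
    fix u v assume "u \<in> finite_energy \<Omega>" "v \<in> finite_energy \<Omega>"
    show "l2_form u v = l2_form v u" by (simp add: l2_form_def mult.commute)
    fix w a b assume "w \<in> finite_energy \<Omega>"
    with \<open>u \<in> _\<close> \<open>v \<in> _\<close> show "l2_form (\<lambda>x. a * u x + b * v x) w = a * l2_form u w + b * l2_form v w"
      using i[of u w] i[of v w] by (simp add: l2_form_def distrib_right mult.assoc)
  qed
qed (rule function_subspace_finite_energy)

lemma bilinear_on_lincomb:
  assumes "bilinear_on H F" "bilinear_on H G"
  shows "bilinear_on H (\<lambda>u v. a * F u v + b * G u v)"
proof -
  interpret F: bilinear_on H F by fact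
  interpret G: bilinear_on H G by fact
  show ?thesis
    by unfold_locales (use F.subspace in \<open>auto simp: symmetric_bilinear_on_def F.sym G.sym F.left G.left algebra_simps\<close>)
qed

lemma bilinear_graph_form: "bilinear_on (finite_energy \<Omega>) graph_form"
  using bilinear_on_lincomb[OF bilinear_near_form bilinear_l2_form, of \<Omega> 1 1] by (simp add: graph_form_def[abs_def])

lemma far_kernel_bound: "\<bar>indicator {1..} (norm z) / norm z ^ DIM('a) * a\<bar> \<le> \<bar>a\<bar>" for z :: "'a::euclidean_space" and a :: real
proof -
  have "\<bar>indicator {1..} (norm z) / norm z ^ DIM('a)\<bar> \<le> (1 :: real)"
    by (auto simp: indicator_def divide_simps one_le_power)
  then show ?thesis unfolding abs_mult by (intro mult_left_le_one_le) auto
qed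

text \<open>A radius of at least 1 makes ln R nonnegative and powers of R monotone in the
  exponent.\<close>

locale bounded_set =
  fixes \<Omega> :: "'a::euclidean_space set" and R :: real
  assumes R: "1 \<le> R" and subset: "\<Omega> \<subseteq> cball 0 R"
begin

lemma support: "u \<in> finite_energy \<Omega> \<Longrightarrow> norm x > R \<Longrightarrow> u x = 0"
  using finite_energyD(2)[of u \<Omega> x] subset by force

lemma finite_energy_integrable: "u \<in> finite_energy \<Omega> \<Longrightarrow> integrable lborel u"
  by (rule square_integrable_bounded_support[OF finite_energyD(3) support])

lemma log_integrable:
  assumes u: "u \<in> finite_energy \<Omega>" and v: "v \<in> finite_energy \<Omega>"
  shows "integrable lborel (\<lambda>x. ln (norm x) * (u x * v x))"
proof (rule Bochner_Integration.integrable_bound)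
  note [measurable] = finite_energyD(1)[OF u] finite_energyD(1)[OF v]
  have "integrable lborel (\<lambda>x. ln (norm x) * (w x)\<^sup>2)" if "w \<in> finite_energy \<Omega>" for w
    by (rule logarithmic_Hardy(1)[OF R finite_energyD(3)[OF that] finite_energyD(4)[OF that] support[OF that]])
  then show "integrable lborel (\<lambda>x. \<bar>ln (norm x) * (u x)\<^sup>2\<bar> + \<bar>ln (norm x) * (v x)\<^sup>2\<bar>)" using u v by simp
  show "(\<lambda>x. ln (norm x) * (u x * v x)) \<in> borel_measurable lborel" by measurable
  show "AE x in lborel. norm (ln (norm x) * (u x * v x)) \<le> norm (\<bar>ln (norm x) * (u x)\<^sup>2\<bar> + \<bar>ln (norm x) * (v x)\<^sup>2\<bar>)"
  proof (rule AE_I2)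
    fix x
    have "2 * (\<bar>u x\<bar> * \<bar>v x\<bar>) \<le> (u x)\<^sup>2 + (v x)\<^sup>2" using sum_squares_bound[of "\<bar>u x\<bar>" "\<bar>v x\<bar>"] by simp
    moreover have "0 \<le> \<bar>u x\<bar> * \<bar>v x\<bar>" by simp
    ultimately have "\<bar>u x\<bar> * \<bar>v x\<bar> \<le> (u x)\<^sup>2 + (v x)\<^sup>2" by linarith
    then have "\<bar>ln (norm x)\<bar> * (\<bar>u x\<bar> * \<bar>v x\<bar>) \<le> \<bar>ln (norm x)\<bar> * ((u x)\<^sup>2 + (v x)\<^sup>2)" by (rule mult_left_mono) simp
    then show "norm (ln (norm x) * (u x * v x)) \<le> norm (\<bar>ln (norm x) * (u x)\<^sup>2\<bar> + \<bar>ln (norm x) * (v x)\<^sup>2\<bar>)"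
      by (simp add: abs_mult distrib_left)
  qed
qed

lemma bilinear_log_form: "bilinear_on (finite_energy \<Omega>) log_form"
proof
  show "symmetric_bilinear_on (finite_energy \<Omega>) log_form"
    unfolding symmetric_bilinear_on_def
  proof (intro conjI ballI allI)
    fix u v assume "u \<in> finite_energy \<Omega>" "v \<in> finite_energy \<Omega>"
    show "log_form u v = log_form v u" by (simp add: log_form_def mult.commute)
    fix w a b assume w: "w \<in> finite_energy \<Omega>"
    have "(\<lambda>x. ln (norm x) * ((a * u x + b * v x) * w x)) = (\<lambda>x. a * (ln (norm x) * (u x * w x)) + b * (ln (norm x) * (v x * w x)))"
      by (auto simp: algebra_simps)
    then show "log_form (\<lambda>x. a * u x + b * v x) w = a * log_form u w + b * log_form v w"
      using log_integrable[OF \<open>u \<in> _\<close> w] log_integrable[OF \<open>v \<in> _\<close> w] by (simp add: log_form_def)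
  qed
qed (rule function_subspace_finite_energy)

lemma far_integrable:
  assumes u: "u \<in> finite_energy \<Omega>" and v: "v \<in> finite_energy \<Omega>"
  shows "integrable (lborel \<Otimes>\<^sub>M lborel)
    (\<lambda>z. indicator {1..} (norm (fst z - snd z)) / norm (fst z - snd z) ^ DIM('a) * (u (fst z) * v (snd z)))"
proof (rule Bochner_Integration.integrable_bound)
  note [measurable] = finite_energyD(1)[OF u] finite_energyD(1)[OF v]
  show "integrable (lborel \<Otimes>\<^sub>M lborel) (\<lambda>z. u (fst z) * v (snd z))"
    by (rule integrable_lborel_pair_product[OF finite_energy_integrable[OF u] finite_energy_integrable[OF v]])
  show "(\<lambda>z. indicator {1..} (norm (fst z - snd z)) / norm (fst z - snd z) ^ DIM('a) * (u (fst z) * v (snd z)))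
      \<in> borel_measurable (lborel \<Otimes>\<^sub>M lborel)" by measurable
  show "AE z in lborel \<Otimes>\<^sub>M lborel. norm (indicator {1..} (norm (fst z - snd z)) / norm (fst z - snd z) ^ DIM('a) * (u (fst z) * v (snd z)))
      \<le> norm (u (fst z) * v (snd z))"
    unfolding real_norm_def by (intro AE_I2 far_kernel_bound)
qed

lemma bilinear_far_form: "bilinear_on (finite_energy \<Omega>) far_form"
proof
  let ?k = "\<lambda>z :: 'a \<times> 'a. indicator {1..} (norm (fst z - snd z)) / norm (fst z - snd z) ^ DIM('a) :: real"
  show "symmetric_bilinear_on (finite_energy \<Omega>) far_form"
    unfolding symmetric_bilinear_on_def
  proof (intro conjI ballI allI)
    fix u v assume "u \<in> finite_energy \<Omega>" "v \<in> finite_energy \<Omega>"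
    show "far_form u v = far_form v u"
      unfolding far_form_def
      by (subst lborel_pair_swap(2)[symmetric]) (simp add: norm_minus_commute mult.commute)
    fix w a b assume w: "w \<in> finite_energy \<Omega>"
    have "(\<lambda>z. ?k z * ((a * u (fst z) + b * v (fst z)) * w (snd z)))
        = (\<lambda>z. a * (?k z * (u (fst z) * w (snd z))) + b * (?k z * (v (fst z) * w (snd z))))"
      by (intro ext) (simp only: algebra_simps)
    then show "far_form (\<lambda>x. a * u x + b * v x) w = a * far_form u w + b * far_form v w"
      unfolding far_form_def
      using far_integrable[OF \<open>u \<in> _\<close> w] far_integrable[OF \<open>v \<in> _\<close> w]
      by (simp only: Bochner_Integration.integral_add integrable_mult_right integral_mult_right_zero)
  qed
qed (rule function_subspace_finite_energy)

lemma bilinear_energy_form: "bilinear_on (finite_energy \<Omega>) (energy_form \<mu>)"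
proof -
  have "bilinear_on (finite_energy \<Omega>) (\<lambda>u v. 1 * (1 * (c_const DIM('a) / 2 * near_form u v + (- c_const DIM('a)) * far_form u v)
     + rho_const DIM('a) * l2_form u v) + (- 2 * \<mu>) * log_form u v)"
    by (intro bilinear_on_lincomb bilinear_near_form bilinear_far_form bilinear_l2_form bilinear_log_form)
  then show ?thesis by (simp add: energy_form_def[abs_def])
qed

text \<open>The far kernel is at most 1 and both points lie in the ball of radius R, so the
  arithmetic-geometric mean inequality leaves the volume of that ball.\<close>

lemma far_form_bound:
  assumes u: "u \<in> finite_energy \<Omega>"
  shows "\<bar>far_form u u\<bar> \<le> measure lborel (cball (0::'a) R) * l2_form u u"
proof -
  note [measurable] = finite_energyD(1)[OF u]
  let ?k = "\<lambda>z :: 'a \<times> 'a. indicator {1..} (norm (fst z - snd z)) / norm (fst z - snd z) ^ DIM('a) :: real"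
  let ?i = "indicator (cball (0::'a) R) :: 'a \<Rightarrow> real"
  let ?M = "lborel \<Otimes>\<^sub>M lborel :: ('a \<times> 'a) measure"
  have u2: "integrable lborel (\<lambda>x. (u x)\<^sup>2)" using finite_energyD(3)[OF u] by (rule square_integrable_square)
  have ii: "integrable lborel ?i"
    using emeasure_bounded_finite[of "cball (0::'a) R"] by (intro integrable_real_indicator) auto
  have p: "integrable ?M (\<lambda>z. (u (fst z))\<^sup>2 * ?i (snd z))" by (rule integrable_lborel_pair_product[OF u2 ii])
  have pI: "(LINT z|?M. (u (fst z))\<^sup>2 * ?i (snd z)) = measure lborel (cball (0::'a) R) * l2_form u u"
    using lborel_pair.integral_fst'[OF p, symmetric] by (simp add: l2_form_square mult.commute)
  have q: "integrable ?M (\<lambda>z. (u (snd z))\<^sup>2 * ?i (fst z))" and qI: "(LINT z|?M. (u (snd z))\<^sup>2 * ?i (fst z)) = measure lborel (cball (0::'a) R) * l2_form u u"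
    using lborel_pair_swap[of "\<lambda>z. (u (fst z))\<^sup>2 * ?i (snd z)"] p pI by simp_all
  have "\<bar>far_form u u\<bar> \<le> (LINT z|?M. \<bar>?k z * (u (fst z) * u (snd z))\<bar>)"
    unfolding far_form_def by (rule integral_abs_bound)
  also have "\<dots> \<le> (LINT z|?M. 1/2 * ((u (fst z))\<^sup>2 * ?i (snd z)) + 1/2 * ((u (snd z))\<^sup>2 * ?i (fst z)))"
  proof (rule integral_mono)
    show "integrable ?M (\<lambda>z. \<bar>?k z * (u (fst z) * u (snd z))\<bar>)" by (intro integrable_abs far_integrable u)
    show "integrable ?M (\<lambda>z. 1/2 * ((u (fst z))\<^sup>2 * ?i (snd z)) + 1/2 * ((u (snd z))\<^sup>2 * ?i (fst z)))"
      using p q by simp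
    fix z :: "'a \<times> 'a"
    have "\<bar>?k z * (u (fst z) * u (snd z))\<bar> \<le> \<bar>u (fst z) * u (snd z)\<bar>"
      by (rule far_kernel_bound)
    also have "\<dots> \<le> 1/2 * ((u (fst z))\<^sup>2 * ?i (snd z)) + 1/2 * ((u (snd z))\<^sup>2 * ?i (fst z))"
    proof (cases "norm (fst z) \<le> R \<and> norm (snd z) \<le> R")
      case True
      then show ?thesis using sum_squares_bound[of "\<bar>u (fst z)\<bar>" "\<bar>u (snd z)\<bar>"]
        by (simp add: abs_mult)
    next
      case False
      then show ?thesis using support[OF u, of "fst z"] support[OF u, of "snd z"] by (auto simp: not_le)
    qed
    finally show "\<bar>?k z * (u (fst z) * u (snd z))\<bar> \<le> 1/2 * ((u (fst z))\<^sup>2 * ?i (snd z)) + 1/2 * ((u (snd z))\<^sup>2 * ?i (fst z))" .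
  qed
  also have "\<dots> = measure lborel (cball (0::'a) R) * l2_form u u"
    using p q pI qI by simp
  finally show ?thesis .
qed

text \<open>The radius \<rho> is kept apart from R, which is at least 1: the radius in the lower
  bound for the first eigenvalue may be smaller than 1.\<close>

lemma log_form_upper:
  assumes u: "u \<in> finite_energy \<Omega>" and \<rho>: "\<Omega> \<subseteq> cball 0 \<rho>"
  shows "log_form u u \<le> ln \<rho> * l2_form u u"
proof -
  have "log_form u u \<le> (LINT x|lborel. ln \<rho> * (u x)\<^sup>2)"
    unfolding log_form_def
  proof (rule integral_mono_AE)
    show "integrable lborel (\<lambda>x. ln (norm x) * (u x * u x))" by (rule log_integrable[OF u u])
    show "integrable lborel (\<lambda>x. ln \<rho> * (u x)\<^sup>2)"
      using square_integrable_square[OF finite_energyD(3)[OF u]] by simp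
    show "AE x in lborel. ln (norm x) * (u x * u x) \<le> ln \<rho> * (u x)\<^sup>2"
      using AE_lborel_singleton[of 0]
    proof eventually_elim
      case (elim x)
      show ?case
      proof (cases "x \<in> \<Omega>")
        case True
        then have "norm x \<le> \<rho>" using \<rho> by auto
        then have "ln (norm x) \<le> ln \<rho>" using elim by (intro ln_mono) auto
        then show ?thesis by (simp add: power2_eq_square mult_right_mono)
      qed (simp add: finite_energyD(2)[OF u])
    qed
  qed
  then show ?thesis by (simp add: l2_form_square)
qed

definition Hardy_const :: real where
  "Hardy_const = 2 * Digamma (DIM('a) / 4) - Digamma (DIM('a) / 2) + euler_mascheroni"

lemma Hardy:
  assumes u: "u \<in> finite_energy \<Omega>"
  shows "Hardy_const * l2_form u u - 2 * log_form u u \<le> c_const DIM('a) / 2 * near_form u u - c_const DIM('a) * far_form u u"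
  using logarithmic_Hardy(2)[OF R finite_energyD(3)[OF u] finite_energyD(4)[OF u] support[OF u]]
  by (simp add: Hardy_const_def l2_form_def log_form_def power2_eq_square)

text \<open>The sum of \<open>Hardy_const\<close> and \<open>rho_const\<close> is free of Digamma
  (N/2) and of Euler's constant. The logarithm in Hardy's inequality and the one in the potential
  add up to the coefficient 1 + \<mu>.\<close>

lemma energy_form_Hardy:
  assumes u: "u \<in> finite_energy \<Omega>"
  shows "2 * (Digamma (DIM('a) / 4) + ln 2) * l2_form u u - 2 * (1 + \<mu>) * log_form u u \<le> energy_form \<mu> u u"
  using Hardy[OF u] by (simp add: energy_form_def Hardy_const_def rho_const_def algebra_simps)

end

section \<open>Test functions and the pointwise operator\<close>

abbreviation near_kernel :: "'a::euclidean_space \<Rightarrow> real" where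
  "near_kernel z \<equiv> indicator {..<1} (norm z) / norm z ^ DIM('a)"

abbreviation far_kernel :: "'a::euclidean_space \<Rightarrow> real" where
  "far_kernel z \<equiv> indicator {1..} (norm z) / norm z ^ DIM('a)"

lemma near_kernel_nonneg: "0 \<le> near_kernel z"
  by simp

text \<open>A Lipschitz increment cancels k powers of the singularity and leaves the integrable
  kernel |z|^(k-N). The case k = 1 serves the operator, and k = 2 the near energy.\<close>

lemma near_kernel_Lipschitz:
  fixes z :: "'a::euclidean_space"
  assumes "\<bar>a\<bar> \<le> L * norm z" "k > 0"
  shows "near_kernel z * \<bar>a\<bar> ^ k \<le> L ^ k * (indicator {..<1} (norm z) * norm z powr (real k - real DIM('a)))"
proof (cases "norm z < 1 \<and> z \<noteq> 0")
  case True
  have "\<bar>a\<bar> ^ k \<le> (L * norm z) ^ k" using assms(1) by (intro power_mono) auto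
  then have "1 / norm z ^ DIM('a) * \<bar>a\<bar> ^ k \<le> 1 / norm z ^ DIM('a) * (L * norm z) ^ k"
    by (intro mult_left_mono) auto
  also have "\<dots> = L ^ k * (norm z ^ k / norm z ^ DIM('a))" by (simp add: power_mult_distrib)
  also have "norm z ^ k / norm z ^ DIM('a) = norm z powr (real k - real DIM('a))"
    using True by (simp add: powr_diff powr_realpow)
  finally show ?thesis using True by simp
next
  case False
  then show ?thesis using assms by (auto simp: indicator_def power_0_left)
qed

lemma nn_integral_unit_ball_powr_shift:
  fixes x :: "'a::euclidean_space"
  assumes e: "e > 0"
  shows "(\<integral>\<^sup>+y. ennreal (indicator {..<1} (norm (x - y)) * norm (x - y) powr (e - real DIM('a))) \<partial>lborel)
    = ennreal (real DIM('a) * unit_ball_vol DIM('a) / e)"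
  using nn_integral_lborel_affine[of "\<lambda>z::'a. ennreal (indicator {..<1} (norm z) * norm z powr (e - real DIM('a)))" "-1" x]
    nn_integral_unit_ball_powr[OF e, where 'a='a] by simp

lemma test_functions_integrable:
  assumes f: "f \<in> test_functions \<Omega>"
  shows "integrable lborel f" "square_integrable lborel f"
proof -
  obtain M R where M: "\<And>x. \<bar>f x\<bar> \<le> M" and supp: "\<And>x. norm x > R \<Longrightarrow> f x = 0"
    using test_functions_bounded[OF f] by blast
  have i: "integrable lborel (indicator (cball (0::'a) R) :: 'a \<Rightarrow> real)"
    using emeasure_bounded_finite[of "cball (0::'a) R"] by (intro integrable_real_indicator) auto
  have M0: "0 \<le> M" using M[of 0] by linarith
  have 1: "\<bar>f x\<bar> \<le> M * indicator (cball 0 R) x" and 2: "(f x)\<^sup>2 \<le> M\<^sup>2 * indicator (cball 0 R) x" for x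
    using M[of x] supp[of x] power_mono[of "\<bar>f x\<bar>" M 2] by (auto simp: indicator_def not_le)
  note [measurable] = test_functionsD(3)[OF f]
  show "integrable lborel f"
    by (rule Bochner_Integration.integrable_bound[OF integrable_mult_right[OF i, of M]]) (use 1 M0 in auto)
  have "integrable lborel (\<lambda>x. (f x)\<^sup>2)"
    by (rule Bochner_Integration.integrable_bound[OF integrable_mult_right[OF i, of "M\<^sup>2"]]) (use 2 in auto)
  then show "square_integrable lborel f" by (simp add: square_integrable_def)
qed

lemma integrable_near_kernel_Lipschitz:
  fixes v :: "'a::euclidean_space \<Rightarrow> real"
  assumes v: "integrable lborel v" and k: "k > 0" and [measurable]: "f \<in> borel_measurable (lborel \<Otimes>\<^sub>M lborel)"
    and f: "\<And>z. \<bar>f z\<bar> \<le> \<bar>v (fst z)\<bar> * \<bar>w z\<bar> ^ k" and w: "\<And>z. \<bar>w z\<bar> \<le> L * norm (fst z - snd z)"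
  shows "integrable (lborel \<Otimes>\<^sub>M lborel) (\<lambda>z. near_kernel (fst z - snd z) * f z)"
proof (rule integrableI_bounded)
  let ?M = "lborel \<Otimes>\<^sub>M lborel :: ('a \<times> 'a) measure"
  let ?g = "\<lambda>z::'a. indicator {..<1} (norm z) * norm z powr (real k - real DIM('a))"
  have [measurable]: "v \<in> borel_measurable borel" using borel_measurable_integrable[OF v] by simp
  show "(\<lambda>z. near_kernel (fst z - snd z) * f z) \<in> borel_measurable ?M" by measurable
  have "(\<integral>\<^sup>+z. ennreal (norm (near_kernel (fst z - snd z) * f z)) \<partial>?M)
      \<le> (\<integral>\<^sup>+z. ennreal (\<bar>L ^ k * v (fst z)\<bar>) * ennreal (?g (fst z - snd z)) \<partial>?M)"
  proof (rule nn_integral_mono)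
    fix z :: "'a \<times> 'a"
    have "\<bar>near_kernel (fst z - snd z) * f z\<bar> = near_kernel (fst z - snd z) * \<bar>f z\<bar>"
      unfolding abs_mult by simp
    also have "\<dots> \<le> near_kernel (fst z - snd z) * (\<bar>v (fst z)\<bar> * \<bar>w z\<bar> ^ k)"
      by (rule mult_left_mono[OF f near_kernel_nonneg])
    also have "\<dots> = \<bar>v (fst z)\<bar> * (near_kernel (fst z - snd z) * \<bar>w z\<bar> ^ k)" by (simp only: mult.left_commute)
    also have "\<dots> \<le> \<bar>v (fst z)\<bar> * (L ^ k * ?g (fst z - snd z))"
      by (rule mult_left_mono[OF near_kernel_Lipschitz[OF w k]]) simp
    also have "\<dots> \<le> \<bar>L ^ k * v (fst z)\<bar> * ?g (fst z - snd z)"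
      by (simp add: abs_mult mult_right_mono mult.assoc mult.left_commute)
    finally show "ennreal (norm (near_kernel (fst z - snd z) * f z)) \<le> ennreal (\<bar>L ^ k * v (fst z)\<bar>) * ennreal (?g (fst z - snd z))"
      by (subst ennreal_mult'[symmetric]) (auto intro: ennreal_leI)
  qed
  also have "\<dots> = (\<integral>\<^sup>+x. ennreal \<bar>L ^ k * v x\<bar> \<partial>lborel) * (\<integral>\<^sup>+x. ennreal (?g x) \<partial>lborel)"
    by (rule nn_integral_lborel_pair_product) measurable
  also have "\<dots> < \<infinity>"
  proof -
    have "(\<integral>\<^sup>+x. ennreal \<bar>L ^ k * v x\<bar> \<partial>lborel) < \<infinity>"
      using integrable_mult_right[OF v, of "L ^ k"] unfolding integrable_iff_bounded real_norm_def by blast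
    then show ?thesis using k nn_integral_unit_ball_powr[of "real k", where 'a='a] by (simp add: ennreal_mult_less_top)
  qed
  finally show "(\<integral>\<^sup>+z. ennreal (norm (near_kernel (fst z - snd z) * f z)) \<partial>?M) < \<infinity>" .
qed

lemma test_functions_finite_energy:
  assumes f: "f \<in> test_functions \<Omega>"
  shows "f \<in> finite_energy \<Omega>"
proof -
  obtain L where L: "\<And>x y. \<bar>f x - f y\<bar> \<le> L * norm (x - y)" using test_functions_Lipschitz[OF f] by blast
  obtain M R where R: "0 < R" and supp: "\<And>x. norm x > R \<Longrightarrow> f x = 0"
    using test_functions_bounded[OF f] by blast
  note [measurable] = test_functionsD(3)[OF f]
  \<comment> \<open>At distance below 1 the difference vanishes once the first point leaves the ball
    of radius R + 1. The indicator put into \<open>?g\<close> makes the bound by \<open>?v\<close>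
    valid for all pairs.\<close>
  let ?v = "indicator (cball (0::'a) (R + 1)) :: 'a \<Rightarrow> real"
  let ?g = "\<lambda>z. indicator {z. norm (fst z - snd z) < 1} z * (difference f z)\<^sup>2 :: real"
  have "integrable (lborel \<Otimes>\<^sub>M lborel) (\<lambda>z. near_kernel (fst z - snd z) * ?g z)"
  proof (rule integrable_near_kernel_Lipschitz[where k=2 and w="difference f" and v="?v"])
    show "integrable lborel ?v"
      using emeasure_bounded_finite[of "cball (0::'a) (R + 1)"] by (intro integrable_real_indicator) auto
    show "?g \<in> borel_measurable (lborel \<Otimes>\<^sub>M lborel)" by measurable
    show "\<bar>difference f z\<bar> \<le> L * norm (fst z - snd z)" for z using L by (simp add: difference_def)
    fix z :: "'a \<times> 'a"
    show "\<bar>?g z\<bar> \<le> \<bar>?v (fst z)\<bar> * \<bar>difference f z\<bar>\<^sup>2"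
    proof (cases "norm (fst z - snd z) < 1 \<and> norm (fst z) > R + 1")
      case True
      then have "norm (snd z) > R" using norm_triangle_ineq2[of "fst z" "snd z"] by linarith
      then show ?thesis using True supp[of "fst z"] supp[of "snd z"] by (simp add: difference_def)
    qed (auto simp: indicator_def)
  qed simp
  moreover have "(\<lambda>z. near_kernel (fst z - snd z) * ?g z) = (\<lambda>z. near_kernel (fst z - snd z) * (difference f z)\<^sup>2)"
    by (auto simp: fun_eq_iff indicator_def)
  ultimately have "integrable near_measure (\<lambda>z. (difference f z)\<^sup>2)"
    by (subst near_measure_integrable_iff) auto
  then show ?thesis
    using test_functions_integrable(2)[OF f] test_functionsD(4)[OF f]
    by (simp add: finite_energy_def square_integrable_def[of near_measure])
qed

lemma integrable_near_section:
  assumes f: "f \<in> test_functions \<Omega>"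
  shows "integrable lborel (\<lambda>y. near_kernel (x - y) * (f x - f y))"
proof (rule integrableI_bounded)
  obtain L where L: "0 \<le> L" "\<And>x y. \<bar>f x - f y\<bar> \<le> L * norm (x - y)" using test_functions_Lipschitz[OF f] by blast
  note [measurable] = test_functionsD(3)[OF f]
  show "(\<lambda>y. near_kernel (x - y) * (f x - f y)) \<in> borel_measurable lborel" by measurable
  have "(\<integral>\<^sup>+y. ennreal (norm (near_kernel (x - y) * (f x - f y))) \<partial>lborel)
      \<le> (\<integral>\<^sup>+y. ennreal L * ennreal (indicator {..<1} (norm (x - y)) * norm (x - y) powr (1 - real DIM('a))) \<partial>lborel)"
  proof (rule nn_integral_mono)
    fix y
    have "norm (near_kernel (x - y) * (f x - f y)) \<le> L * (indicator {..<1} (norm (x - y)) * norm (x - y) powr (1 - real DIM('a)))"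
      using near_kernel_Lipschitz[OF L(2)[of x y], of 1] by (simp add: abs_mult)
    then show "ennreal (norm (near_kernel (x - y) * (f x - f y)))
        \<le> ennreal L * ennreal (indicator {..<1} (norm (x - y)) * norm (x - y) powr (1 - real DIM('a)))"
      using L(1) by (subst ennreal_mult'[symmetric]) (auto intro: ennreal_leI)
  qed
  also have "\<dots> < \<infinity>"
    using nn_integral_unit_ball_powr_shift[of 1 x] by (subst nn_integral_cmult) (auto simp: ennreal_mult_less_top)
  finally show "(\<integral>\<^sup>+y. ennreal (norm (near_kernel (x - y) * (f x - f y))) \<partial>lborel) < \<infinity>" .
qed

text \<open>Lipschitz continuity makes the singular integral absolutely convergent, so the principal
  value is an ordinary integral by dominated convergence.\<close>

lemma pv_part_test_function:
  assumes f: "f \<in> test_functions \<Omega>"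
  shows "pv_part f x = (LINT y|lborel. near_kernel (x - y) * (f x - f y))"
proof -
  note [measurable] = test_functionsD(3)[OF f]
  let ?F = "\<lambda>\<epsilon>. LINT y:ball x 1 - ball x \<epsilon>|lborel. (f x - f y) / norm (x - y) ^ DIM('a)"
  let ?l = "LINT y|lborel. near_kernel (x - y) * (f x - f y)"
  have "(?F \<longlongrightarrow> ?l) (at_right 0)"
  proof (rule tendsto_at_right_sequentially[of 0 1])
    fix S :: "nat \<Rightarrow> real"
    assume S: "\<And>n. 0 < S n" "S \<longlonglongrightarrow> 0"
    show "(\<lambda>n. ?F (S n)) \<longlonglongrightarrow> ?l"
      unfolding set_lebesgue_integral_def
    proof (rule integral_dominated_convergence[where w="\<lambda>y. norm (near_kernel (x - y) * (f x - f y))"])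
      show "integrable lborel (\<lambda>y. norm (near_kernel (x - y) * (f x - f y)))"
        using integrable_near_section[OF f] by (rule integrable_norm)
      show "AE y in lborel. (\<lambda>n. indicator (ball x 1 - ball x (S n)) y *\<^sub>R ((f x - f y) / norm (x - y) ^ DIM('a)))
          \<longlonglongrightarrow> near_kernel (x - y) * (f x - f y)"
        using AE_lborel_singleton[of x]
      proof eventually_elim
        case (elim y)
        then have "norm (x - y) > 0" by simp
        then have "\<forall>\<^sub>F n in sequentially. S n < norm (x - y)" using S(2) by (rule order_tendstoD(2)[rotated])
        then have "\<forall>\<^sub>F n in sequentially. indicator (ball x 1 - ball x (S n)) y *\<^sub>R ((f x - f y) / norm (x - y) ^ DIM('a))
            = near_kernel (x - y) * (f x - f y)"
          by eventually_elim (auto simp: indicator_def dist_norm)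
        then show ?case by (rule tendsto_eventually)
      qed
      show "AE y in lborel. norm (indicator (ball x 1 - ball x (S n)) y *\<^sub>R ((f x - f y) / norm (x - y) ^ DIM('a)))
          \<le> norm (near_kernel (x - y) * (f x - f y))" for n
        by (intro AE_I2) (auto simp: indicator_def dist_norm)
      have [measurable]: "(\<lambda>y. (f x - f y) / norm (x - y) ^ DIM('a)) \<in> borel_measurable borel" by measurable
      show "(\<lambda>y. indicator (ball x 1 - ball x (S n)) y *\<^sub>R ((f x - f y) / norm (x - y) ^ DIM('a))) \<in> borel_measurable lborel" for n
        by (intro borel_measurable_scaleR borel_measurable_indicator) auto
      show "(\<lambda>y. near_kernel (x - y) * (f x - f y)) \<in> borel_measurable lborel" by measurable
    qed
  qed simp
  then show ?thesis unfolding pv_part_def by (intro tendsto_Lim) auto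
qed

lemma far_part_translate:
  fixes f :: "'a::euclidean_space \<Rightarrow> real"
  shows "(LINT y:UNIV - ball 0 1|lborel. f (x + y) / norm y ^ DIM('a)) = (LINT y|lborel. far_kernel (x - y) * f y)"
proof -
  have "(LINT y|lborel. far_kernel (x - y) * f y) = (LINT y|lborel. far_kernel (x - (x + 1 *\<^sub>R y)) * f (x + 1 *\<^sub>R y))"
    by (subst lborel_integral_affine[of 1 _ x]) auto
  also have "\<dots> = (LINT y:UNIV - ball 0 1|lborel. f (x + y) / norm y ^ DIM('a))"
    unfolding set_lebesgue_integral_def
    by (intro Bochner_Integration.integral_cong) (auto simp: indicator_def)
  finally show ?thesis by simp
qed

lemma log_laplacian_test_function:
  fixes x :: "'a::euclidean_space"
  assumes f: "f \<in> test_functions \<Omega>"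
  shows "log_laplacian f x = c_const DIM('a) * (LINT y|lborel. near_kernel (x - y) * (f x - f y))
     - c_const DIM('a) * (LINT y|lborel. far_kernel (x - y) * f y) + rho_const DIM('a) * f x"
  by (simp add: log_laplacian_def pv_part_test_function[OF f] far_part_translate)

lemma set_integral_eq_integral:
  fixes g :: "'a \<Rightarrow> real"
  assumes "\<And>x. x \<notin> \<Omega> \<Longrightarrow> g x = 0"
  shows "(LINT x:\<Omega>|M. g x) = (LINT x|M. g x)"
  unfolding set_lebesgue_integral_def
  by (intro Bochner_Integration.integral_cong) (use assms in \<open>auto simp: indicator_def\<close>)

context bounded_set
begin

text \<open>Symmetrization: in the integral of k(x-y) u(x) (f(x) - f(y)) the roles of x and y are
  exchanged, and the sum of the two versions is the near form. Absolute integrability over pairs,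
  due to the Lipschitz bound, justifies the use of Fubini's theorem.\<close>

lemma
  assumes u: "u \<in> test_functions \<Omega>" and f: "f \<in> test_functions \<Omega>"
  shows integrable_mult_log_laplacian: "integrable lborel (\<lambda>x. u x * log_laplacian f x)"
    and integral_mult_log_laplacian: "(LINT x|lborel. u x * log_laplacian f x) = c_const DIM('a) / 2 * near_form u f
      - c_const DIM('a) * far_form u f + rho_const DIM('a) * l2_form u f"
proof -
  note [measurable] = test_functionsD(3)[OF f] test_functionsD(3)[OF u]
  note ue = test_functions_finite_energy[OF u] and fe = test_functions_finite_energy[OF f]
  obtain L where L: "\<And>x y. \<bar>f x - f y\<bar> \<le> L * norm (x - y)" using test_functions_Lipschitz[OF f] by blast
  let ?M = "lborel \<Otimes>\<^sub>M lborel :: ('a \<times> 'a) measure"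
  let ?k1 = "\<lambda>z. near_kernel (fst z - snd z :: 'a) * (u (fst z) * difference f z)"
  let ?k2 = "\<lambda>z. far_kernel (fst z - snd z :: 'a) * (u (fst z) * f (snd z))"
  have k1: "integrable ?M ?k1"
    by (rule integrable_near_kernel_Lipschitz[where k=1 and w="difference f" and v=u])
      (use test_functions_integrable(1)[OF u] L in \<open>auto simp: abs_mult difference_def\<close>)
  have k2: "integrable ?M ?k2" by (rule far_integrable[OF ue fe])
  have e1: "u x * (LINT y|lborel. near_kernel (x - y) * (f x - f y)) = (LINT y|lborel. ?k1 (x, y))" for x
    by (simp add: difference_def mult.left_commute flip: integral_mult_right_zero)
  have e2: "u x * (LINT y|lborel. far_kernel (x - y) * f y) = (LINT y|lborel. ?k2 (x, y))" for x
    by (simp add: mult.left_commute flip: integral_mult_right_zero)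
  have eq: "u x * log_laplacian f x = c_const DIM('a) * (LINT y|lborel. ?k1 (x, y))
     - c_const DIM('a) * (LINT y|lborel. ?k2 (x, y)) + rho_const DIM('a) * (u x * f x)" for x
    unfolding e1[symmetric] e2[symmetric] log_laplacian_test_function[OF f] by (simp add: algebra_simps)
  have i1: "integrable lborel (\<lambda>x. LINT y|lborel. ?k1 (x, y))" and I1: "(LINT x|lborel. LINT y|lborel. ?k1 (x, y)) = (LINT z|?M. ?k1 z)"
    using lborel_pair.integrable_fst'[OF k1] lborel_pair.integral_fst'[OF k1] by simp_all
  have i2: "integrable lborel (\<lambda>x. LINT y|lborel. ?k2 (x, y))" and I2: "(LINT x|lborel. LINT y|lborel. ?k2 (x, y)) = far_form u f"
    using lborel_pair.integrable_fst'[OF k2] lborel_pair.integral_fst'[OF k2] by (simp_all add: far_form_def)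
  have i3: "integrable lborel (\<lambda>x. u x * f x)"
    by (intro square_integrable_mult test_functions_integrable(2)[OF u] test_functions_integrable(2)[OF f])
  show "integrable lborel (\<lambda>x. u x * log_laplacian f x)"
    unfolding eq by (intro Bochner_Integration.integrable_add Bochner_Integration.integrable_diff integrable_mult_right i1 i2 i3)
  have swap: "integrable ?M (\<lambda>z. ?k1 (snd z, fst z))" "(LINT z|?M. ?k1 (snd z, fst z)) = (LINT z|?M. ?k1 z)"
    using lborel_pair_swap[of ?k1] k1 by auto
  have "near_form u f = (LINT z|?M. ?k1 z + ?k1 (snd z, fst z))"
    unfolding near_form_def
  proof (subst near_measure_integrable_iff)
    show "(LINT z|?M. near_kernel (fst z - snd z) * (difference u z * difference f z)) = (LINT z|?M. ?k1 z + ?k1 (snd z, fst z))"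
      by (intro Bochner_Integration.integral_cong) (auto simp: difference_def norm_minus_commute algebra_simps diff_divide_distrib add_divide_distrib)
  qed measurable
  also have "\<dots> = 2 * (LINT z|?M. ?k1 z)"
    using k1 swap by simp
  finally have nf: "(LINT z|?M. ?k1 z) = near_form u f / 2" by simp
  have "(LINT x|lborel. u x * log_laplacian f x) = c_const DIM('a) * (LINT z|?M. ?k1 z) - c_const DIM('a) * far_form u f + rho_const DIM('a) * l2_form u f"
    unfolding eq I1[symmetric] I2[symmetric] l2_form_def
    by (simp only: Bochner_Integration.integral_add Bochner_Integration.integral_diff Bochner_Integration.integrable_add
      Bochner_Integration.integrable_diff integrable_mult_right i1 i2 i3 integral_mult_right_zero)
  then show "(LINT x|lborel. u x * log_laplacian f x) = c_const DIM('a) / 2 * near_form u f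
      - c_const DIM('a) * far_form u f + rho_const DIM('a) * l2_form u f"
    unfolding nf by simp
qed

text \<open>The identity extends to the origin through the conventions 1/0 = 0 and ln 0 = 0.\<close>

lemma ln_inverse_norm: "ln (1 / norm x) = - ln (norm x)" for x :: 'a
  by (cases "x = 0") (auto simp: ln_div)

lemma test_energy_eq:
  assumes u: "u \<in> test_functions \<Omega>" and f: "f \<in> test_functions \<Omega>"
  shows "test_energy \<Omega> \<mu> u f = energy_form \<mu> u f"
proof -
  have "(LINT x:\<Omega>|lborel. u x * log_laplacian f x) = (LINT x|lborel. u x * log_laplacian f x)"
    by (rule set_integral_eq_integral) (simp add: test_functionsD(4)[OF u])
  moreover have "(LINT x:\<Omega>|lborel. ln (1 / norm x) * u x * f x) = - log_form u f"
    by (subst set_integral_eq_integral) (simp_all add: test_functionsD(4)[OF u] log_form_def ln_inverse_norm mult.assoc)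
  ultimately show ?thesis
    by (simp add: test_energy_def energy_form_def integral_mult_log_laplacian[OF u f])
qed

end

section \<open>Dilations of test functions\<close>

text \<open>The signed difference of indicators treats expansion and contraction together: its sign
  changes at r = 1 exactly as that of ln r does.\<close>

lemma annulus_integral:
  assumes r: "r > 0"
  shows "integrable lborel (\<lambda>z::'a::euclidean_space. (indicator {..<r} (norm z) - indicator {..<1} (norm z)) / norm z ^ DIM('a))"
    and "(LINT z|(lborel :: 'a measure). (indicator {..<r} (norm z) - indicator {..<1} (norm z)) / norm z ^ DIM('a)) =
      real DIM('a) * unit_ball_vol DIM('a) * ln r"
proof -
  have *: "integrable lborel (\<lambda>z::'a. indicator {a..<b} (norm z) / norm z ^ DIM('a) :: real)"
    "(LINT z|(lborel :: 'a measure). indicator {a..<b} (norm z) / norm z ^ DIM('a) :: real) = real DIM('a) * unit_ball_vol DIM('a) * ln (b / a)"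
    if ab: "0 < a" "a \<le> b" for a b :: real
  proof -
    have "0 \<le> ln (b / a)" using ab by (simp add: field_simps)
    then have pos: "0 \<le> real DIM('a) * unit_ball_vol DIM('a) * ln (b / a)" by simp
    note nn = nn_integral_annulus[OF ab, where 'a='a]
    show "integrable lborel (\<lambda>z::'a. indicator {a..<b} (norm z) / norm z ^ DIM('a) :: real)"
      by (rule integrableI_nonneg) (auto simp: nn)
    have "(LINT z|(lborel :: 'a measure). indicator {a..<b} (norm z) / norm z ^ DIM('a) :: real)
        = enn2real (ennreal (real DIM('a) * unit_ball_vol DIM('a) * ln (b / a)))"
      unfolding nn[symmetric] by (rule integral_eq_nn_integral) auto
    then show "(LINT z|(lborel :: 'a measure). indicator {a..<b} (norm z) / norm z ^ DIM('a) :: real) = real DIM('a) * unit_ball_vol DIM('a) * ln (b / a)"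
      using pos by simp
  qed
  have "integrable lborel (\<lambda>z::'a. (indicator {..<r} (norm z) - indicator {..<1} (norm z)) / norm z ^ DIM('a)) \<and>
    (LINT z|(lborel :: 'a measure). (indicator {..<r} (norm z) - indicator {..<1} (norm z)) / norm z ^ DIM('a)) =
      real DIM('a) * unit_ball_vol DIM('a) * ln r"
  proof (cases "r \<ge> 1")
    case True
    then have "(\<lambda>z::'a. (indicator {..<r} (norm z) - indicator {..<1} (norm z)) / norm z ^ DIM('a)) =
        (\<lambda>z. indicator {1..<r} (norm z) / norm z ^ DIM('a) :: real)"
      by (auto simp: fun_eq_iff indicator_def)
    then show ?thesis using *[of 1 r] True by simp
  next
    case False
    then have "(\<lambda>z::'a. (indicator {..<r} (norm z) - indicator {..<1} (norm z)) / norm z ^ DIM('a)) =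
        (\<lambda>z. - (indicator {r..<1} (norm z) / norm z ^ DIM('a) :: real))"
      by (auto simp: fun_eq_iff indicator_def)
    then show ?thesis using *[of r 1] False r by (simp add: ln_div)
  qed
  then show "integrable lborel (\<lambda>z::'a. (indicator {..<r} (norm z) - indicator {..<1} (norm z)) / norm z ^ DIM('a))"
    "(LINT z|(lborel :: 'a measure). (indicator {..<r} (norm z) - indicator {..<1} (norm z)) / norm z ^ DIM('a)) =
      real DIM('a) * unit_ball_vol DIM('a) * ln r" by auto
qed

text \<open>Near and far parts merge into one absolutely convergent integral in which the radius 1
  occurs only in front of f x. Moving that radius therefore costs an annulus integral times f
  x.\<close>

lemma
  fixes x :: "'a::euclidean_space"
  assumes f: "f \<in> test_functions \<Omega>"
  shows log_laplacian_kernel_integrable: "integrable lborel (\<lambda>z. (indicator {..<1} (norm z) * f x - f (x + z)) / norm z ^ DIM('a))"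
    and log_laplacian_single_integral: "log_laplacian f x = c_const DIM('a) *
      (LINT z|lborel. (indicator {..<1} (norm z) * f x - f (x + z)) / norm z ^ DIM('a)) + rho_const DIM('a) * f x"
proof -
  note [measurable] = test_functionsD(3)[OF f]
  have n: "integrable lborel (\<lambda>z. near_kernel z * (f x - f (x + z)))"
    "(LINT y|lborel. near_kernel (x - y) * (f x - f y)) = (LINT z|lborel. near_kernel z * (f x - f (x + z)))"
    using lborel_integrable_affine_iff[of 1 "\<lambda>y. near_kernel (x - y) * (f x - f y)" x] integrable_near_section[OF f, of x]
      lborel_integral_affine[of 1 "\<lambda>y. near_kernel (x - y) * (f x - f y)" x] by simp_all
  have "integrable lborel (\<lambda>z. f (x + z))"
    using lborel_integrable_affine_iff[of 1 f x] test_functions_integrable(1)[OF f] by simp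
  then have "integrable lborel (\<lambda>z. far_kernel z * f (x + z))"
    by (rule Bochner_Integration.integrable_bound) (measurable, use far_kernel_bound in \<open>auto simp only: real_norm_def\<close>)
  moreover have "(LINT y|lborel. far_kernel (x - y) * f y) = (LINT z|lborel. far_kernel z * f (x + z))"
    using lborel_integral_affine[of 1 "\<lambda>y. far_kernel (x - y) * f y" x] by simp
  ultimately have f': "integrable lborel (\<lambda>z. far_kernel z * f (x + z))"
    "(LINT y|lborel. far_kernel (x - y) * f y) = (LINT z|lborel. far_kernel z * f (x + z))" by auto
  have eq: "(\<lambda>z. (indicator {..<1} (norm z) * f x - f (x + z)) / norm z ^ DIM('a))
      = (\<lambda>z. near_kernel z * (f x - f (x + z)) - far_kernel z * f (x + z))"
    by (auto simp: fun_eq_iff indicator_def)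
  show "integrable lborel (\<lambda>z. (indicator {..<1} (norm z) * f x - f (x + z)) / norm z ^ DIM('a))"
    unfolding eq by (intro Bochner_Integration.integrable_diff n f')
  show "log_laplacian f x = c_const DIM('a) *
      (LINT z|lborel. (indicator {..<1} (norm z) * f x - f (x + z)) / norm z ^ DIM('a)) + rho_const DIM('a) * f x"
    unfolding eq log_laplacian_test_function[OF f] n(2) f'(2)
      Bochner_Integration.integral_diff[OF n(1) f'(1)] by (simp add: right_diff_distrib)
qed

definition dilate :: "real \<Rightarrow> ('a::euclidean_space \<Rightarrow> real) \<Rightarrow> 'a \<Rightarrow> real" where
  "dilate l u x = l powr (- (DIM('a) / 2)) * u ((1 / l) *\<^sub>R x)"

text \<open>The measure |z|^-N dz is invariant under scaling, but the cutoff radius 1 becomes 1/l.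
  The annulus in between contributes f x times the sphere area times ln(1/l), and
  \<open>c_const\<close> turns the area into 2.\<close>

lemma log_laplacian_dilate:
  fixes x :: "'a::euclidean_space"
  assumes f: "f \<in> test_functions \<Omega>" and l: "l > 0"
  shows "log_laplacian (dilate l f) (l *\<^sub>R x) = l powr (- (DIM('a) / 2)) * (log_laplacian f x - 2 * ln l * f x)"
proof -
  let ?k = "l powr (- (real DIM('a) / 2))"
  let ?A = "\<lambda>z. (indicator {..<1} (norm z) * f x - f (x + z)) / norm z ^ DIM('a)"
  let ?B = "\<lambda>z::'a. (indicator {..<1 / l} (norm z) - indicator {..<1} (norm z)) / norm z ^ DIM('a) :: real"
  have g: "dilate l f \<in> test_functions ((\<lambda>x. l *\<^sub>R x) ` \<Omega>)"
    using test_functions_dilation[OF f l, of ?k] by (simp add: dilate_def[abs_def])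
  have "(LINT z|lborel. (indicator {..<1} (norm z) * dilate l f (l *\<^sub>R x) - dilate l f (l *\<^sub>R x + z)) / norm z ^ DIM('a))
      = \<bar>l\<bar> ^ DIM('a) * (LINT z|lborel. (indicator {..<1} (norm (0 + l *\<^sub>R z)) * dilate l f (l *\<^sub>R x) - dilate l f (l *\<^sub>R x + (0 + l *\<^sub>R z))) / norm (0 + l *\<^sub>R z) ^ DIM('a))"
    by (rule lborel_integral_affine) (use l in simp)
  also have "\<dots> = (LINT z|lborel. l ^ DIM('a) * ((indicator {..<1} (norm (0 + l *\<^sub>R z)) * dilate l f (l *\<^sub>R x) - dilate l f (l *\<^sub>R x + (0 + l *\<^sub>R z))) / norm (0 + l *\<^sub>R z) ^ DIM('a)))"
    unfolding abs_of_pos[OF l] by (rule integral_mult_right_zero[symmetric])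
  also have "\<dots> = (LINT z|lborel. ?k * (?A z + f x * ?B z))"
  proof (rule Bochner_Integration.integral_cong[OF refl])
    fix z :: 'a
    have "norm (l *\<^sub>R z) < 1 \<longleftrightarrow> norm z < 1 / l" using l by (simp add: field_simps)
    moreover have "dilate l f (l *\<^sub>R x) = ?k * f x" "dilate l f (l *\<^sub>R x + l *\<^sub>R z) = ?k * f (x + z)"
      using l by (simp_all add: dilate_def scaleR_add_right)
    moreover have "norm (l *\<^sub>R z) ^ DIM('a) = l ^ DIM('a) * norm z ^ DIM('a)" using l by (simp add: power_mult_distrib)
    ultimately have "l ^ DIM('a) * ((indicator {..<1} (norm (0 + l *\<^sub>R z)) * dilate l f (l *\<^sub>R x) - dilate l f (l *\<^sub>R x + (0 + l *\<^sub>R z))) / norm (0 + l *\<^sub>R z) ^ DIM('a))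
       = (indicator {..<1 / l} (norm z) * (?k * f x) - ?k * f (x + z)) / norm z ^ DIM('a)"
      using l by (simp add: indicator_def)
    also have "\<dots> = ?k * (?A z + f x * ?B z)"
      by (simp add: add_divide_distrib[symmetric]) (simp add: algebra_simps)
    finally show "l ^ DIM('a) * ((indicator {..<1} (norm (0 + l *\<^sub>R z)) * dilate l f (l *\<^sub>R x) - dilate l f (l *\<^sub>R x + (0 + l *\<^sub>R z))) / norm (0 + l *\<^sub>R z) ^ DIM('a))
       = ?k * (?A z + f x * ?B z)" .
  qed
  also have "\<dots> = ?k * ((LINT z|lborel. ?A z) + f x * (real DIM('a) * unit_ball_vol DIM('a) * ln (1 / l)))"
  proof -
    have r: "0 < 1 / l" using l by simp
    show ?thesis
      by (simp only: integral_mult_right_zero annulus_integral(2)[OF r, where 'a='a]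
        Bochner_Integration.integral_add[OF log_laplacian_kernel_integrable[OF f] integrable_mult_right[OF annulus_integral(1)[OF r]]])
  qed
  finally have I: "(LINT z|lborel. (indicator {..<1} (norm z) * dilate l f (l *\<^sub>R x) - dilate l f (l *\<^sub>R x + z)) / norm z ^ DIM('a))
      = ?k * ((LINT z|lborel. ?A z) - f x * (real DIM('a) * unit_ball_vol DIM('a) * ln l))"
    using l by (simp add: ln_div)
  have "log_laplacian (dilate l f) (l *\<^sub>R x) = c_const DIM('a) * (?k * ((LINT z|lborel. ?A z) - f x * (real DIM('a) * unit_ball_vol DIM('a) * ln l)))
      + rho_const DIM('a) * (?k * f x)"
    unfolding log_laplacian_single_integral[OF g] I using l by (simp add: dilate_def)
  also have "\<dots> = ?k * (c_const DIM('a) * (LINT z|lborel. ?A z) + rho_const DIM('a) * f x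
      - (c_const DIM('a) * (real DIM('a) * unit_ball_vol DIM('a))) * ln l * f x)"
    by (simp add: algebra_simps)
  finally show ?thesis unfolding c_const_unit_ball_vol log_laplacian_single_integral[OF f] by simp
qed

lemma dilate_square: "l > 0 \<Longrightarrow> l ^ DIM('a) * (l powr (- (DIM('a) / 2)) * l powr (- (DIM('a::euclidean_space) / 2))) = (1::real)"
  using powr_add[of l "- (real DIM('a) / 2)" "- (real DIM('a) / 2)"]
  by (simp only: mult.assoc[symmetric]) (simp add: powr_realpow[symmetric] powr_minus field_simps)

lemma integral_dilate_product:
  fixes u w :: "'a::euclidean_space \<Rightarrow> real"
  assumes l: "l > 0" and w: "\<And>x. w (l *\<^sub>R x) = l powr (- (DIM('a) / 2)) * v x"
  shows "(LINT x|lborel. dilate l u x * w x) = (LINT x|lborel. u x * v x)"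
proof -
  let ?k = "l powr (- (real DIM('a) / 2))"
  have "(LINT x|lborel. dilate l u x * w x) = \<bar>l\<bar> ^ DIM('a) * (LINT x|lborel. dilate l u (0 + l *\<^sub>R x) * w (0 + l *\<^sub>R x))"
    by (rule lborel_integral_affine) (use l in simp)
  also have "\<dots> = l ^ DIM('a) * (LINT x|lborel. (?k * ?k) * (u x * v x))"
    using l by (simp add: dilate_def w mult_ac)
  also have "\<dots> = (l ^ DIM('a) * (?k * ?k)) * (LINT x|lborel. u x * v x)" by simp
  finally show ?thesis unfolding dilate_square[OF l] by simp
qed

lemma dilate_scale: "l > 0 \<Longrightarrow> dilate l u (l *\<^sub>R x) = l powr (- (DIM('a) / 2)) * u x" for x :: "'a::euclidean_space"
  by (simp add: dilate_def)

lemma l2_form_dilate: "l > 0 \<Longrightarrow> l2_form (dilate l u) (dilate l v) = l2_form u v"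
  unfolding l2_form_def by (rule integral_dilate_product) (auto simp: dilate_scale)

lemma bounded_set_dilate:
  assumes "bounded_set \<Omega> R" "l > 0"
  shows "bounded_set ((\<lambda>x. l *\<^sub>R x) ` \<Omega>) (max 1 (l * R))"
proof
  interpret bounded_set \<Omega> R by fact
  show "(\<lambda>x. l *\<^sub>R x) ` \<Omega> \<subseteq> cball 0 (max 1 (l * R))"
  proof
    fix y assume "y \<in> (\<lambda>x. l *\<^sub>R x) ` \<Omega>"
    then obtain x where "x \<in> \<Omega>" "y = l *\<^sub>R x" by auto
    then show "y \<in> cball 0 (max 1 (l * R))" using subset assms(2)
      by (force intro: le_max_iff_disj[THEN iffD2] mult_left_mono)
  qed
qed simp

lemma test_functions_dilate:
  "f \<in> test_functions \<Omega> \<Longrightarrow> l > 0 \<Longrightarrow> dilate l f \<in> test_functions ((\<lambda>x. l *\<^sub>R x) ` \<Omega>)"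
  using test_functions_dilation[of f \<Omega> l] by (simp add: dilate_def[abs_def])

text \<open>Stated for test functions, whose energy can be written with the pointwise operator; the
  closure is reached afterwards by density.\<close>

lemma (in bounded_set) energy_form_dilate:
  assumes u: "u \<in> test_functions \<Omega>" and f: "f \<in> test_functions \<Omega>" and l: "l > 0"
  shows "energy_form \<mu> (dilate l u) (dilate l f) = energy_form \<mu> u f - 2 * (1 + \<mu>) * ln l * l2_form u f"
proof -
  let ?k = "l powr (- (real DIM('a) / 2))"
  note [measurable] = test_functionsD(3)[OF u] test_functionsD(3)[OF f]
  interpret d: bounded_set "(\<lambda>x. l *\<^sub>R x) ` \<Omega>" "max 1 (l * R)"
    by (rule bounded_set_dilate[OF bounded_set_axioms l])
  have uf: "integrable lborel (\<lambda>x. u x * f x)"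
    by (intro square_integrable_mult test_functions_integrable(2)[OF u] test_functions_integrable(2)[OF f])
  have energy: "energy_form \<mu> u f = (LINT x|lborel. u x * log_laplacian f x) - 2 * \<mu> * log_form u f"
    by (simp add: energy_form_def integral_mult_log_laplacian[OF u f])
  have "energy_form \<mu> (dilate l u) (dilate l f)
      = (LINT x|lborel. dilate l u x * log_laplacian (dilate l f) x) - 2 * \<mu> * log_form (dilate l u) (dilate l f)"
    by (simp add: energy_form_def d.integral_mult_log_laplacian[OF test_functions_dilate[OF u l] test_functions_dilate[OF f l]])
  also have "(LINT x|lborel. dilate l u x * log_laplacian (dilate l f) x) = (LINT x|lborel. u x * (log_laplacian f x - 2 * ln l * f x))"
    by (rule integral_dilate_product[where w="log_laplacian (dilate l f)" and v="\<lambda>x. log_laplacian f x - 2 * ln l * f x", OF l])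
      (rule log_laplacian_dilate[OF f l])
  also have "\<dots> = (LINT x|lborel. u x * log_laplacian f x - 2 * ln l * (u x * f x))"
    by (intro Bochner_Integration.integral_cong) (auto simp: algebra_simps)
  also have "\<dots> = (LINT x|lborel. u x * log_laplacian f x) - 2 * ln l * l2_form u f"
    using integrable_mult_log_laplacian[OF u f] uf by (simp add: l2_form_def)
  also have "log_form (dilate l u) (dilate l f) = (LINT x|lborel. dilate l u x * (ln (norm x) * dilate l f x))"
    by (simp add: log_form_def mult.left_commute)
  also have "\<dots> = (LINT x|lborel. u x * (ln (norm (l *\<^sub>R x)) * f x))"
    by (rule integral_dilate_product[OF l]) (use l in \<open>simp add: dilate_scale\<close>)
  also have "\<dots> = (LINT x|lborel. ln (norm x) * (u x * f x) + ln l * (u x * f x))"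
  \<comment> \<open>The logarithm of l|x| splits into a sum only away from the origin.\<close>
  proof (rule integral_cong_AE)
    show "AE x in lborel. u x * (ln (norm (l *\<^sub>R x)) * f x) = ln (norm x) * (u x * f x) + ln l * (u x * f x)"
      using AE_lborel_singleton[of 0]
      by eventually_elim (use l in \<open>simp add: ln_mult algebra_simps\<close>)
  qed measurable
  also have "\<dots> = log_form u f + ln l * l2_form u f"
    using log_integrable[OF test_functions_finite_energy[OF u] test_functions_finite_energy[OF f]] uf
    by (simp add: log_form_def l2_form_def)
  finally show ?thesis unfolding energy by (simp add: algebra_simps)
qed

section \<open>Coercivity and closedness\<close>

context bounded_set
begin

section \<open>Comparison of the logarithmic weight with the near form\<close>

lemma plus_log_integrable:
  assumes u: "u \<in> finite_energy \<Omega>"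
  shows "integrable lborel (\<lambda>x. max 0 (ln (1 / norm x)) * (u x)\<^sup>2)"
proof (rule Bochner_Integration.integrable_bound[OF log_integrable[OF u u]])
  note [measurable] = finite_energyD(1)[OF u]
  show "(\<lambda>x. max 0 (ln (1 / norm x)) * (u x)\<^sup>2) \<in> borel_measurable lborel" by measurable
  show "AE x in lborel. norm (max 0 (ln (1 / norm x)) * (u x)\<^sup>2) \<le> norm (ln (norm x) * (u x * u x))"
    by (intro AE_I2) (auto simp: ln_inverse_norm abs_mult power2_eq_square intro!: mult_right_mono)
qed

definition plus_log_form :: "('a \<Rightarrow> real) \<Rightarrow> real" where
  "plus_log_form u = (LINT x|lborel. max 0 (ln (1 / norm x)) * (u x)\<^sup>2)"

lemma plus_log_form_nonneg: "0 \<le> plus_log_form u"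
  unfolding plus_log_form_def by (rule integral_nonneg_AE) simp

lemma plus_log_form_le:
  assumes u: "u \<in> finite_energy \<Omega>"
  shows "plus_log_form u \<le> - log_form u u + ln R * l2_form u u"
proof -
  have u2: "integrable lborel (\<lambda>x. (u x)\<^sup>2)" using finite_energyD(3)[OF u] by (rule square_integrable_square)
  have i: "integrable lborel (\<lambda>x. - (ln (norm x) * (u x * u x)) + ln R * (u x)\<^sup>2)"
    using log_integrable[OF u u] u2 by simp
  have "plus_log_form u \<le> (LINT x|lborel. - (ln (norm x) * (u x * u x)) + ln R * (u x)\<^sup>2)"
    unfolding plus_log_form_def
  proof (rule integral_mono_AE[OF plus_log_integrable[OF u] i])
    show "AE x in lborel. max 0 (ln (1 / norm x)) * (u x)\<^sup>2 \<le> - (ln (norm x) * (u x * u x)) + ln R * (u x)\<^sup>2"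
      using AE_lborel_singleton[of 0]
    proof eventually_elim
      case (elim x)
      show ?case
      proof (cases "norm x \<le> R")
        case True
        then have "ln (norm x) \<le> ln R" "0 \<le> ln R" using elim R by auto
        then have "max 0 (ln (1 / norm x)) \<le> - ln (norm x) + ln R" by (simp add: ln_inverse_norm)
        then have "max 0 (ln (1 / norm x)) * (u x)\<^sup>2 \<le> (- ln (norm x) + ln R) * (u x)\<^sup>2" by (rule mult_right_mono) simp
        then show ?thesis by (simp add: algebra_simps power2_eq_square)
      qed (simp add: support[OF u])
    qed
  qed
  also have "\<dots> = - log_form u u + ln R * l2_form u u"
    using log_integrable[OF u u] u2 by (simp add: log_form_def l2_form_square)
  finally show ?thesis .
qed

definition far_bound :: real where
  "far_bound = c_const DIM('a) * measure lborel (cball (0::'a) R)"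

lemma far_bound_nonneg: "0 \<le> far_bound"
  using c_const_pos[where 'a='a] by (simp add: far_bound_def)

lemma far_form_bound':
  assumes u: "u \<in> finite_energy \<Omega>"
  shows "\<bar>c_const DIM('a) * far_form u u\<bar> \<le> far_bound * l2_form u u"
  using mult_left_mono[OF far_form_bound[OF u], of "c_const DIM('a)"] c_const_pos[where 'a='a]
  by (simp add: far_bound_def abs_mult)

text \<open>Hardy's inequality read as a bound on the singular potential. The near form appears with
  the same coefficient c/2 as in \<open>energy_form\<close>, so any fraction below 1 of this
  potential can be absorbed.\<close>

lemma minus_log_form_le:
  assumes u: "u \<in> finite_energy \<Omega>"
  shows "- 2 * log_form u u \<le> c_const DIM('a) / 2 * near_form u u + (far_bound + \<bar>Hardy_const\<bar>) * l2_form u u"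
proof -
  have "- (\<bar>Hardy_const\<bar> * l2_form u u) \<le> Hardy_const * l2_form u u"
    using mult_right_mono[of "- \<bar>Hardy_const\<bar>" Hardy_const "l2_form u u"] l2_form_nonneg[of u] by simp
  then show ?thesis using Hardy[OF u] far_form_bound'[OF u] by (simp add: distrib_right abs_le_iff)
qed

lemma graph_form_ge: "near_form u u \<le> graph_form u u" "l2_form u u \<le> graph_form u u" "0 \<le> graph_form u u"
  using near_form_nonneg[of u] l2_form_nonneg[of u] by (auto simp: graph_form_def)

lemma log_form_bounded:
  "\<exists>C\<ge>0. \<forall>u\<in>finite_energy \<Omega>. \<bar>log_form u u\<bar> \<le> C * graph_form u u"
proof (intro exI conjI ballI)
  let ?C = "c_const DIM('a) / 2 + (far_bound + \<bar>Hardy_const\<bar>) + ln R"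
  have nn: "0 \<le> c_const DIM('a) / 2" "0 \<le> far_bound + \<bar>Hardy_const\<bar>" "0 \<le> ln R"
    using c_const_pos[where 'a='a] far_bound_nonneg R by auto
  then show "0 \<le> ?C" by simp
  fix u assume u: "u \<in> finite_energy \<Omega>"
  have 1: "c_const DIM('a) / 2 * near_form u u \<le> c_const DIM('a) / 2 * graph_form u u"
    "(far_bound + \<bar>Hardy_const\<bar>) * l2_form u u \<le> (far_bound + \<bar>Hardy_const\<bar>) * graph_form u u"
    "ln R * l2_form u u \<le> ln R * graph_form u u"
    using nn graph_form_ge[of u] by (auto intro: mult_left_mono)
  have 2: "0 \<le> c_const DIM('a) / 2 * graph_form u u" "0 \<le> (far_bound + \<bar>Hardy_const\<bar>) * graph_form u u" "0 \<le> ln R * graph_form u u"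
    using nn graph_form_ge[of u] by auto
  have "?C * graph_form u u = c_const DIM('a) / 2 * graph_form u u + (far_bound + \<bar>Hardy_const\<bar>) * graph_form u u + ln R * graph_form u u"
    by (simp only: distrib_right)
  then show "\<bar>log_form u u\<bar> \<le> ?C * graph_form u u"
    using minus_log_form_le[OF u] log_form_upper[OF u subset] 1 2 unfolding abs_le_iff by linarith
qed

lemma energy_form_bounded:
  "\<exists>C\<ge>0. \<forall>u\<in>finite_energy \<Omega>. \<bar>energy_form \<mu> u u\<bar> \<le> C * graph_form u u"
proof -
  obtain C where C: "0 \<le> C" "\<And>u. u \<in> finite_energy \<Omega> \<Longrightarrow> \<bar>log_form u u\<bar> \<le> C * graph_form u u"
    using log_form_bounded by blast
  let ?C = "c_const DIM('a) / 2 + far_bound + \<bar>rho_const DIM('a)\<bar> + \<bar>2 * \<mu>\<bar> * C"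
  show ?thesis
  proof (intro exI conjI ballI)
    show "0 \<le> ?C" using C(1) c_const_pos[where 'a='a] far_bound_nonneg by simp
    fix u assume u: "u \<in> finite_energy \<Omega>"
    have "\<bar>energy_form \<mu> u u\<bar> \<le> \<bar>c_const DIM('a) / 2 * near_form u u\<bar> + \<bar>c_const DIM('a) * far_form u u\<bar>
        + \<bar>rho_const DIM('a) * l2_form u u\<bar> + \<bar>2 * \<mu> * log_form u u\<bar>"
      unfolding energy_form_def by linarith
    also have "\<dots> \<le> c_const DIM('a) / 2 * graph_form u u + far_bound * graph_form u u
        + \<bar>rho_const DIM('a)\<bar> * graph_form u u + \<bar>2 * \<mu>\<bar> * (C * graph_form u u)"
    proof (intro add_mono)
      show "\<bar>c_const DIM('a) / 2 * near_form u u\<bar> \<le> c_const DIM('a) / 2 * graph_form u u"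
        using c_const_pos[where 'a='a] near_form_nonneg[of u] graph_form_ge[of u] by (simp add: abs_mult)
      show "\<bar>c_const DIM('a) * far_form u u\<bar> \<le> far_bound * graph_form u u"
        using far_form_bound'[OF u] mult_left_mono[OF graph_form_ge(2)[of u] far_bound_nonneg] by linarith
      show "\<bar>rho_const DIM('a) * l2_form u u\<bar> \<le> \<bar>rho_const DIM('a)\<bar> * graph_form u u"
        using l2_form_nonneg[of u] graph_form_ge[of u] by (simp add: abs_mult mult_left_mono)
      show "\<bar>2 * \<mu> * log_form u u\<bar> \<le> \<bar>2 * \<mu>\<bar> * (C * graph_form u u)"
        using C(2)[OF u] by (simp add: abs_mult[of "2 * \<mu>"] mult_left_mono)
    qed
    also have "\<dots> = ?C * graph_form u u" by (simp add: algebra_simps)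
    finally show "\<bar>energy_form \<mu> u u\<bar> \<le> ?C * graph_form u u" .
  qed
qed

text \<open>For \<mu> < 0 the potential consumes the fraction t = -\<mu> of the near form and leaves
  (1 - t) c/2 > 0. For \<mu> \<ge> 0 it is bounded below by an L2 term, since ln|x| \<le> ln R on
  the domain.\<close>

lemma energy_form_coercive:
  assumes \<mu>: "\<mu> > -1"
  shows "\<exists>k>0. \<exists>K\<ge>0. \<forall>u\<in>finite_energy \<Omega>. k * near_form u u \<le> energy_form \<mu> u u + K * l2_form u u"
proof -
  define t where "t = max 0 (- \<mu>)"
  have t: "0 \<le> t" "t < 1" using \<mu> by (auto simp: t_def)
  let ?K = "far_bound + \<bar>rho_const DIM('a)\<bar> + \<bar>2 * \<mu>\<bar> * ln R + (far_bound + \<bar>Hardy_const\<bar>)"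
  show ?thesis
  proof (intro exI conjI ballI)
    show "0 < (1 - t) * (c_const DIM('a) / 2)" using t c_const_pos[where 'a='a] by simp
    show "0 \<le> ?K" using R far_bound_nonneg by simp
    fix u assume u: "u \<in> finite_energy \<Omega>"
    have far: "- (far_bound * l2_form u u) \<le> - (c_const DIM('a) * far_form u u)" using far_form_bound'[OF u] by linarith
    have rho: "- (\<bar>rho_const DIM('a)\<bar> * l2_form u u) \<le> rho_const DIM('a) * l2_form u u"
      using mult_right_mono[of "- \<bar>rho_const DIM('a)\<bar>" "rho_const DIM('a)" "l2_form u u"] l2_form_nonneg[of u] by simp
    have pos: "0 \<le> (far_bound + \<bar>Hardy_const\<bar>) * l2_form u u" "0 \<le> \<bar>2 * \<mu>\<bar> * ln R * l2_form u u"
      using far_bound_nonneg l2_form_nonneg[of u] R by auto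
    have log: "- (t * (c_const DIM('a) / 2 * near_form u u)) - (far_bound + \<bar>Hardy_const\<bar>) * l2_form u u - \<bar>2 * \<mu>\<bar> * ln R * l2_form u u
        \<le> - 2 * \<mu> * log_form u u"
    proof (cases "\<mu> < 0")
      case True
      then have "t = - \<mu>" by (simp add: t_def)
      then have "t * (- 2 * log_form u u) \<le> t * (c_const DIM('a) / 2 * near_form u u + (far_bound + \<bar>Hardy_const\<bar>) * l2_form u u)"
        using minus_log_form_le[OF u] t by (intro mult_left_mono)
      moreover have "t * ((far_bound + \<bar>Hardy_const\<bar>) * l2_form u u) \<le> 1 * ((far_bound + \<bar>Hardy_const\<bar>) * l2_form u u)"
        using t pos by (intro mult_right_mono) auto
      moreover have "t * (- 2 * log_form u u) = 2 * \<mu> * log_form u u" by (simp add: \<open>t = - \<mu>\<close>)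
      ultimately show ?thesis using pos by (simp only: distrib_left)
    next
      case False
      then have "t = 0" by (simp add: t_def)
      have "2 * \<mu> * log_form u u \<le> 2 * \<mu> * (ln R * l2_form u u)"
        using False log_form_upper[OF u subset] by (intro mult_left_mono) auto
      moreover have "\<bar>2 * \<mu>\<bar> * ln R * l2_form u u = 2 * \<mu> * (ln R * l2_form u u)" using False by simp
      ultimately show ?thesis using pos \<open>t = 0\<close> by simp
    qed
    have "(1 - t) * (c_const DIM('a) / 2) * near_form u u = c_const DIM('a) / 2 * near_form u u - t * (c_const DIM('a) / 2 * near_form u u)"
      by (simp add: left_diff_distrib)
    moreover have "?K * l2_form u u = far_bound * l2_form u u + \<bar>rho_const DIM('a)\<bar> * l2_form u u + \<bar>2 * \<mu>\<bar> * ln R * l2_form u u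
        + (far_bound + \<bar>Hardy_const\<bar>) * l2_form u u"
      by (simp only: distrib_right)
    ultimately show "(1 - t) * (c_const DIM('a) / 2) * near_form u u \<le> energy_form \<mu> u u + ?K * l2_form u u"
      unfolding energy_form_def using far rho log by linarith
  qed
qed

section \<open>Coercivity and boundedness of the energy inner product\<close>

lemma inner_ln_mu_eq:
  assumes u: "u \<in> finite_energy \<Omega>"
  shows "inner_ln_mu \<Omega> \<mu> u u = c_const DIM('a) * near_form u u + (1 + max 0 (d_const \<Omega>)) * l2_form u u + 2 * \<mu> * plus_log_form u"
proof -
  note [measurable] = finite_energyD(1)[OF u]
  have "(LINT z:{(x, y). norm (x - y) < 1}|lborel \<Otimes>\<^sub>M lborel. (case z of (x, y) \<Rightarrow> (u x - u y) * (u x - u y) / norm (x - y) ^ DIM('a)))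
      = (LINT z|(lborel \<Otimes>\<^sub>M lborel). near_kernel (fst z - snd z) * (difference u z * difference u z))"
    unfolding set_lebesgue_integral_def
    by (intro Bochner_Integration.integral_cong) (auto simp: indicator_def difference_def)
  also have "\<dots> = near_form u u"
    unfolding near_form_def by (rule near_measure_integrable_iff(2)[symmetric]) measurable
  finally have 1: "(LINT z:{(x, y). norm (x - y) < 1}|lborel \<Otimes>\<^sub>M lborel. (case z of (x, y) \<Rightarrow> (u x - u y) * (u x - u y) / norm (x - y) ^ DIM('a))) = near_form u u" .
  have 2: "(LINT x:\<Omega>|lborel. u x * u x) = l2_form u u"
    by (subst set_integral_eq_integral) (auto simp: finite_energyD(2)[OF u] l2_form_def)
  have 3: "(LINT x:\<Omega>|lborel. max 0 (ln (1 / norm x)) * u x * u x) = plus_log_form u"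
    by (subst set_integral_eq_integral) (auto simp: finite_energyD(2)[OF u] plus_log_form_def power2_eq_square mult.assoc)
  show ?thesis unfolding inner_ln_mu_def inner_ln_def 1 2 3 by (simp add: algebra_simps)
qed

text \<open>The inner product carries c times the near form, twice the share in the energy. The
  logarithmic term costs at most c/2 of it, so c/2 is left uniformly in \<mu> > -1.\<close>

lemma inner_ln_mu_coercive:
  assumes \<mu>: "\<mu> > -1"
  shows "\<exists>k>0. \<exists>K\<ge>0. \<forall>u\<in>finite_energy \<Omega>. k * near_form u u \<le> inner_ln_mu \<Omega> \<mu> u u + K * l2_form u u"
proof (intro exI conjI ballI)
  show "0 < c_const DIM('a) / 2" using c_const_pos[where 'a='a] by simp
  let ?K = "far_bound + \<bar>Hardy_const\<bar> + 2 * ln R"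
  show "0 \<le> ?K" using far_bound_nonneg R by simp
  fix u assume u: "u \<in> finite_energy \<Omega>"
  have "2 * plus_log_form u \<le> c_const DIM('a) / 2 * near_form u u + (far_bound + \<bar>Hardy_const\<bar>) * l2_form u u + 2 * (ln R * l2_form u u)"
    using plus_log_form_le[OF u] minus_log_form_le[OF u] by linarith
  moreover have "- 2 * plus_log_form u \<le> 2 * \<mu> * plus_log_form u"
    using mult_right_mono[of "-2" "2 * \<mu>" "plus_log_form u"] plus_log_form_nonneg[of u] \<mu> by simp
  moreover have "0 \<le> (1 + max 0 (d_const \<Omega>)) * l2_form u u" using l2_form_nonneg[of u] by (intro mult_nonneg_nonneg) auto
  moreover have "?K * l2_form u u = (far_bound + \<bar>Hardy_const\<bar>) * l2_form u u + 2 * (ln R * l2_form u u)"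
    by (simp only: distrib_right mult.assoc)
  ultimately show "c_const DIM('a) / 2 * near_form u u \<le> inner_ln_mu \<Omega> \<mu> u u + ?K * l2_form u u"
    unfolding inner_ln_mu_eq[OF u] by linarith
qed

lemma inner_ln_mu_bounded:
  "\<exists>C\<ge>0. \<forall>u\<in>finite_energy \<Omega>. inner_ln_mu \<Omega> \<mu> u u \<le> C * graph_form u u"
proof -
  obtain C where C: "0 \<le> C" "\<And>u. u \<in> finite_energy \<Omega> \<Longrightarrow> \<bar>log_form u u\<bar> \<le> C * graph_form u u"
    using log_form_bounded by blast
  let ?C = "c_const DIM('a) + (1 + max 0 (d_const \<Omega>)) + \<bar>2 * \<mu>\<bar> * (C + ln R)"
  show ?thesis
  proof (intro exI conjI ballI)
    show "0 \<le> ?C" using C(1) c_const_pos[where 'a='a] R by simp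
    fix u assume u: "u \<in> finite_energy \<Omega>"
    have "ln R * l2_form u u \<le> ln R * graph_form u u" using R graph_form_ge[of u] by (intro mult_left_mono) auto
    then have "plus_log_form u \<le> (C + ln R) * graph_form u u"
      using plus_log_form_le[OF u] C(2)[OF u] unfolding distrib_right by linarith
    then have "\<bar>2 * \<mu>\<bar> * plus_log_form u \<le> \<bar>2 * \<mu>\<bar> * ((C + ln R) * graph_form u u)" by (rule mult_left_mono) simp
    moreover have "2 * \<mu> * plus_log_form u \<le> \<bar>2 * \<mu>\<bar> * plus_log_form u"
      using plus_log_form_nonneg[of u] by (intro mult_right_mono) auto
    moreover have "c_const DIM('a) * near_form u u \<le> c_const DIM('a) * graph_form u u"
      using c_const_pos[where 'a='a] graph_form_ge[of u] by (intro mult_left_mono) auto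
    moreover have "(1 + max 0 (d_const \<Omega>)) * l2_form u u \<le> (1 + max 0 (d_const \<Omega>)) * graph_form u u"
      using graph_form_ge[of u] by (intro mult_left_mono) auto
    ultimately have "inner_ln_mu \<Omega> \<mu> u u \<le> c_const DIM('a) * graph_form u u + (1 + max 0 (d_const \<Omega>)) * graph_form u u
        + \<bar>2 * \<mu>\<bar> * ((C + ln R) * graph_form u u)"
      unfolding inner_ln_mu_eq[OF u] by linarith
    also have "\<dots> = ?C * graph_form u u" by (simp only: distrib_right mult.assoc)
    finally show "inner_ln_mu \<Omega> \<mu> u u \<le> ?C * graph_form u u" .
  qed
qed

end

text \<open>Completeness gives a subsequence converging almost everywhere to some L2 limit h; the
  distance of h from the prescribed limit is bounded by terms tending to 0, so the two agree almost
  everywhere.\<close>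

lemma L2_limit_AE_subseq:
  fixes f :: "nat \<Rightarrow> 'b \<Rightarrow> real"
  assumes f: "\<And>n. square_integrable M (f n)" and g: "square_integrable M g"
    and lim: "(\<lambda>n. LINT x|M. (f n x - g x)\<^sup>2) \<longlonglongrightarrow> 0"
  obtains r where "strict_mono r" "AE x in M. (\<lambda>n. f (r n) x) \<longlonglongrightarrow> g x"
proof -
  have two: "(LINT x|M. (p x + q x)\<^sup>2) \<le> 2 * (LINT x|M. (p x)\<^sup>2) + 2 * (LINT x|M. (q x)\<^sup>2)"
    if p: "square_integrable M p" and q: "square_integrable M q" for p q
  proof -
    have "(LINT x|M. (p x + q x)\<^sup>2) \<le> (LINT x|M. 2 * (p x)\<^sup>2 + 2 * (q x)\<^sup>2)"
    proof (rule integral_mono)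
      show "integrable M (\<lambda>x. (p x + q x)\<^sup>2)"
        using square_integrable_square[OF square_integrable_lincomb[OF p q, of 1 1]] by simp
      show "integrable M (\<lambda>x. 2 * (p x)\<^sup>2 + 2 * (q x)\<^sup>2)"
        using square_integrable_square[OF p] square_integrable_square[OF q] by simp
      show "(p x + q x)\<^sup>2 \<le> 2 * (p x)\<^sup>2 + 2 * (q x)\<^sup>2" for x
        using sum_squares_bound[of "p x" "q x"] by (simp add: power2_sum)
    qed
    then show ?thesis using square_integrable_square[OF p] square_integrable_square[OF q] by simp
  qed
  have d: "square_integrable M (\<lambda>x. f n x - g x)" for n by (rule square_integrable_diff[OF f g])
  have cauchy: "\<exists>K. \<forall>m\<ge>K. \<forall>n\<ge>K. (LINT x|M. (f m x - f n x)\<^sup>2) < e" if e: "e > 0" for e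
  proof -
    obtain K where K: "\<And>n. n \<ge> K \<Longrightarrow> (LINT x|M. (f n x - g x)\<^sup>2) < e / 4"
      using order_tendstoD(2)[OF lim, of "e / 4"] e by (auto simp: eventually_sequentially)
    have "(LINT x|M. (f m x - f n x)\<^sup>2) < e" if "m \<ge> K" "n \<ge> K" for m n
      using two[OF d[of m] square_integrable_diff[OF g f[of n]]] K[OF that(1)] K[OF that(2)]
      by (simp add: power2_commute[of "g _" "f n _"])
    then show ?thesis by blast
  qed
  obtain h r where h: "square_integrable M h" "(\<lambda>n. LINT x|M. (f n x - h x)\<^sup>2) \<longlonglongrightarrow> 0"
    and r: "strict_mono r" "AE x in M. (\<lambda>n. f (r n) x) \<longlonglongrightarrow> h x"
    by (rule square_integrable_complete[OF f cauchy]) (assumption, rule that)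
  have L: "(\<lambda>n. 2 * (LINT x|M. (f n x - g x)\<^sup>2) + 2 * (LINT x|M. (f n x - h x)\<^sup>2)) \<longlonglongrightarrow> 2 * 0 + 2 * 0"
    by (intro tendsto_intros lim h)
  have le: "(LINT x|M. (h x - g x)\<^sup>2) \<le> 2 * (LINT x|M. (f n x - g x)\<^sup>2) + 2 * (LINT x|M. (f n x - h x)\<^sup>2)" for n
    using two[OF d[of n] square_integrable_diff[OF h(1) f[of n]]] by (simp add: power2_commute[of "h _" "f n _"])
  have "(LINT x|M. (h x - g x)\<^sup>2) \<le> 2 * 0 + 2 * 0"
    by (rule LIMSEQ_le_const[OF L]) (intro exI allI impI le)
  then have "(LINT x|M. (h x - g x)\<^sup>2) \<le> 0" by simp
  then have "(LINT x|M. (h x - g x)\<^sup>2) = 0" by (intro antisym) auto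
  then have "AE x in M. (h x - g x)\<^sup>2 = 0"
    using integral_nonneg_eq_0_iff_AE[OF square_integrable_square[OF square_integrable_diff[OF h(1) g]]] by simp
  then have "AE x in M. (\<lambda>n. f (r n) x) \<longlonglongrightarrow> g x" using r(2) by eventually_elim simp
  with r(1) show ?thesis using that by blast
qed

text \<open>An exceptional null set N for one variable becomes the strips N x UNIV and UNIV x N.
  Both are null for the product measure, hence for the measure with a density.\<close>

lemma AE_near_measure_difference:
  fixes u :: "'a::euclidean_space \<Rightarrow> real"
  assumes "AE x in lborel. (\<lambda>n. s n x) \<longlonglongrightarrow> u x"
  shows "AE z in near_measure. (\<lambda>n. difference (s n) z) \<longlonglongrightarrow> difference u z"
proof -
  obtain N where N: "{x. \<not> (\<lambda>n. s n x) \<longlonglongrightarrow> u x} \<subseteq> N" "emeasure lborel N = 0" "N \<in> sets lborel"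
    using AE_E[OF assms] by auto
  have "N \<times> UNIV \<in> null_sets (lborel \<Otimes>\<^sub>M lborel)" "UNIV \<times> N \<in> null_sets (lborel \<Otimes>\<^sub>M lborel)"
    using N lborel.emeasure_pair_measure_Times[of N lborel UNIV] lborel.emeasure_pair_measure_Times[of UNIV lborel N]
    by (auto simp: null_sets_def intro!: pair_measureI)
  then have "AE z in lborel \<Otimes>\<^sub>M lborel. z \<notin> N \<times> UNIV" "AE z in lborel \<Otimes>\<^sub>M lborel. z \<notin> UNIV \<times> N"
    using AE_not_in by blast+
  then have "AE z in lborel \<Otimes>\<^sub>M lborel. (\<lambda>n. difference (s n) z) \<longlonglongrightarrow> difference u z"
  proof eventually_elim
    case (elim z)
    then have "fst z \<notin> N" "snd z \<notin> N" by (auto simp: mem_Times_iff)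
    then show ?case unfolding difference_def using N(1) by (intro tendsto_intros) auto
  qed
  then show ?thesis unfolding near_measure_def by (subst AE_density) (measurable, auto)
qed

text \<open>Closedness of the near form. One almost everywhere convergent subsequence identifies the
  limit in both L2 spaces, so the limit of the differences is the difference of the limit.\<close>

lemma finite_energy_Cauchy_limit:
  assumes s: "\<And>n. s n \<in> finite_energy \<Omega>" and g: "g \<in> borel_measurable borel" "\<And>x. x \<notin> \<Omega> \<Longrightarrow> g x = 0"
    and r: "strict_mono r" "AE x in lborel. (\<lambda>n. s (r n) x) \<longlonglongrightarrow> g x"
    and l2: "\<And>e. e > 0 \<Longrightarrow> \<exists>K. \<forall>m\<ge>K. \<forall>n\<ge>K. l2_form (\<lambda>x. s m x - s n x) (\<lambda>x. s m x - s n x) < e"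
    and near: "\<And>e. e > 0 \<Longrightarrow> \<exists>K. \<forall>m\<ge>K. \<forall>n\<ge>K. near_form (\<lambda>x. s m x - s n x) (\<lambda>x. s m x - s n x) < e"
  shows "g \<in> finite_energy \<Omega>" "(\<lambda>n. graph_form (\<lambda>x. s n x - g x) (\<lambda>x. s n x - g x)) \<longlonglongrightarrow> 0"
proof -
  have c1: "\<exists>K. \<forall>m\<ge>K. \<forall>n\<ge>K. (LINT x|lborel. (s m x - s n x)\<^sup>2) < e" if "e > 0" for e
    using l2[OF that] by (simp only: l2_form_square)
  have c2: "\<exists>K. \<forall>m\<ge>K. \<forall>n\<ge>K. (LINT z|near_measure. (difference (s m) z - difference (s n) z)\<^sup>2) < e" if "e > 0" for e
    using near[OF that] by (simp only: near_form_square difference_diff)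
  have g1: "g \<in> borel_measurable lborel" using g(1) by simp
  have g2: "difference g \<in> borel_measurable near_measure"
    using borel_measurable_difference[OF g(1)] by simp
  note 1 = square_integrable_Cauchy_limit[OF finite_energyD(3)[OF s] g1 r c1]
  note 2 = square_integrable_Cauchy_limit[OF finite_energyD(4)[OF s] g2 r(1) AE_near_measure_difference[OF r(2)] c2]
  show "g \<in> finite_energy \<Omega>" using g 1 2 by (simp add: finite_energy_def)
  show "(\<lambda>n. graph_form (\<lambda>x. s n x - g x) (\<lambda>x. s n x - g x)) \<longlonglongrightarrow> 0"
    using tendsto_add[OF 2(2) 1(2)] by (simp add: graph_form_def near_form_square l2_form_square difference_diff)
qed

section \<open>Compact embedding\<close>

text \<open>The shift by \<open>d\<close> removes the singularity and the numerator makes the kernel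
  continuous across the unit sphere; away from the origin it stays below
  \<open>near_kernel\<close>.\<close>

definition cutoff_kernel :: "real \<Rightarrow> 'a::euclidean_space \<Rightarrow> real" where
  "cutoff_kernel d z = max 0 (1 - norm z) / (d + norm z) ^ DIM('a)"

lemma cutoff_kernel_continuous: "d > 0 \<Longrightarrow> continuous_on S (cutoff_kernel d)"
  unfolding cutoff_kernel_def[abs_def]
  by (intro continuous_intros) (auto simp: add_pos_nonneg intro!: less_imp_neq[symmetric])

text \<open>At z = 0 the right-hand side of the last bound is 0 because division by zero gives 0, so
  the comparison leaves out the origin. In the application the difference vanishes there.\<close>

lemma cutoff_kernel_bounds:
  fixes z :: "'a::euclidean_space"
  assumes d: "d > 0"
  shows "0 \<le> cutoff_kernel d z" "cutoff_kernel d z \<le> 1 / d ^ DIM('a)"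
    "cutoff_kernel d z * (if z = 0 then 0 else a\<^sup>2) \<le> near_kernel z * a\<^sup>2"
proof -
  have pos: "0 < d + norm z" using d by (simp add: add_pos_nonneg)
  then have p: "0 < (d + norm z) ^ DIM('a)" by simp
  show "0 \<le> cutoff_kernel d z" using p by (simp add: cutoff_kernel_def)
  have "d ^ DIM('a) \<le> (d + norm z) ^ DIM('a)" using d by (intro power_mono) auto
  then show "cutoff_kernel d z \<le> 1 / d ^ DIM('a)"
    unfolding cutoff_kernel_def using d p by (intro frac_le) auto
  show "cutoff_kernel d z * (if z = 0 then 0 else a\<^sup>2) \<le> near_kernel z * a\<^sup>2"
  proof (cases "z = 0 \<or> norm z \<ge> 1")
    case False
    have "norm z ^ DIM('a) \<le> (d + norm z) ^ DIM('a)" using d by (intro power_mono) auto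
    then have "max 0 (1 - norm z) / (d + norm z) ^ DIM('a) \<le> 1 / norm z ^ DIM('a)"
      using False by (intro frac_le) auto
    then have "cutoff_kernel d z \<le> near_kernel z" using False by (simp add: cutoff_kernel_def)
    then have "cutoff_kernel d z * a\<^sup>2 \<le> near_kernel z * a\<^sup>2" by (rule mult_right_mono) simp
    then show ?thesis using False by simp
  qed (auto simp: cutoff_kernel_def)
qed

lemma cutoff_kernel_integrable:
  assumes d: "d > 0"
  shows "integrable lborel (cutoff_kernel d :: 'a::euclidean_space \<Rightarrow> real)"
proof (rule Bochner_Integration.integrable_bound)
  let ?i = "\<lambda>z::'a. 1 / d ^ DIM('a) * indicator (cball 0 1) z"
  have "integrable lborel (indicator (cball (0::'a) 1) :: 'a \<Rightarrow> real)"
    using emeasure_bounded_finite[of "cball (0::'a) 1"] by (intro integrable_real_indicator) auto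
  then show "integrable lborel ?i" by (rule integrable_mult_right)
  show "cutoff_kernel d \<in> borel_measurable lborel"
    using borel_measurable_continuous_onI[OF cutoff_kernel_continuous[OF d]] by simp
  have "\<bar>cutoff_kernel d z\<bar> \<le> ?i z" for z :: 'a
    using cutoff_kernel_bounds(1,2)[OF d, of z] by (cases "norm z \<le> 1") (auto simp: cutoff_kernel_def)
  then show "AE z in lborel. norm (cutoff_kernel d z) \<le> norm (?i z)"
    using d by (intro AE_I2) simp
qed

text \<open>On the annulus d \<le> |z| < 1/2 the numerator is at least 1/2 and d + |z| \<le> 2|z|.
  This gives the factor 2^-(N+1) in front of the mass of |z|^-N, which is logarithmic in d.\<close>

lemma cutoff_kernel_mass:
  assumes d: "0 < d" "d < 1/2"
  shows "real DIM('a) * unit_ball_vol DIM('a) * ln (1 / (2 * d)) / 2 ^ (DIM('a) + 1) \<le> (LINT z|(lborel :: 'a::euclidean_space measure). cutoff_kernel d z)"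
proof -
  let ?C = "real DIM('a) * unit_ball_vol DIM('a)"
  let ?g = "\<lambda>z::'a. indicator {d..<1/2} (norm z) / norm z ^ DIM('a) :: real"
  have nn: "(\<integral>\<^sup>+z. ennreal (?g z) \<partial>lborel) = ennreal (?C * ln (1 / (2 * d)))"
    using nn_integral_annulus[of d "1/2", where 'a='a] d by simp
  have g: "integrable lborel ?g" by (rule integrableI_nonneg) (auto simp: nn)
  have "0 \<le> ln (1 / (2 * d))" using d by (simp add: field_simps)
  then have pos: "0 \<le> ?C * ln (1 / (2 * d))" by simp
  have "(LINT z|lborel. ?g z) = enn2real (ennreal (?C * ln (1 / (2 * d))))"
    unfolding nn[symmetric] by (rule integral_eq_nn_integral) auto
  then have I: "(LINT z|lborel. ?g z) = ?C * ln (1 / (2 * d))" using pos by simp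
  have "(LINT z|lborel. 1 / 2 ^ (DIM('a) + 1) * ?g z) \<le> (LINT z|(lborel :: 'a measure). cutoff_kernel d z)"
  proof (rule integral_mono)
    fix z :: 'a
    show "1 / 2 ^ (DIM('a) + 1) * ?g z \<le> cutoff_kernel d z"
    proof (cases "d \<le> norm z \<and> norm z < 1/2")
      case True
      then have z: "0 < norm z" using d by linarith
      have "(d + norm z) ^ DIM('a) \<le> (2 * norm z) ^ DIM('a)" using True d by (intro power_mono) auto
      then have "(1/2) / (2 * norm z) ^ DIM('a) \<le> max 0 (1 - norm z) / (d + norm z) ^ DIM('a)"
        using True d z by (intro frac_le) (auto simp: add_pos_pos)
      then show ?thesis using True by (simp add: cutoff_kernel_def power_mult_distrib field_simps)
    qed (use cutoff_kernel_bounds(1)[OF d(1), of z] in auto)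
  qed (rule integrable_mult_right[OF g], rule cutoff_kernel_integrable[OF d(1)])
  then show ?thesis unfolding integral_mult_right_zero I by simp
qed

lemma integrable_pair_convolution:
  fixes f g :: "'a::euclidean_space \<Rightarrow> real"
  assumes f: "integrable lborel f" "\<And>x. 0 \<le> f x" and g: "integrable lborel g" "\<And>x. 0 \<le> g x"
  shows "integrable (lborel \<Otimes>\<^sub>M lborel) (\<lambda>z. g (fst z - snd z) * f (fst z))"
    "(LINT z|(lborel \<Otimes>\<^sub>M lborel). g (fst z - snd z) * f (fst z)) = (LINT x|lborel. g x) * (LINT x|lborel. f x)"
proof -
  have [measurable]: "f \<in> borel_measurable borel" "g \<in> borel_measurable borel"
    using borel_measurable_integrable f g by auto
  have nn: "(\<integral>\<^sup>+z. ennreal (g (fst z - snd z) * f (fst z)) \<partial>(lborel \<Otimes>\<^sub>M lborel)) = ennreal ((LINT x|lborel. g x) * (LINT x|lborel. f x))"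
  proof -
    have "(\<integral>\<^sup>+z. ennreal (g (fst z - snd z) * f (fst z)) \<partial>(lborel \<Otimes>\<^sub>M lborel))
        = (\<integral>\<^sup>+z. ennreal (f (fst z)) * ennreal (g (fst z - snd z)) \<partial>(lborel \<Otimes>\<^sub>M lborel))"
      using f g by (simp add: ennreal_mult'[symmetric] mult.commute)
    also have "\<dots> = (\<integral>\<^sup>+x. ennreal (f x) \<partial>lborel) * (\<integral>\<^sup>+x. ennreal (g x) \<partial>lborel)"
      by (rule nn_integral_lborel_pair_product) measurable
    also have "\<dots> = ennreal (LINT x|lborel. f x) * ennreal (LINT x|lborel. g x)"
      using f g by (simp add: nn_integral_eq_integral)
    finally show ?thesis using f g by (simp add: ennreal_mult'[symmetric] mult.commute)
  qed
  show "integrable (lborel \<Otimes>\<^sub>M lborel) (\<lambda>z. g (fst z - snd z) * f (fst z))"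
    by (rule integrableI_nonneg) (use f g in \<open>auto simp: nn\<close>)
  have "(LINT z|(lborel \<Otimes>\<^sub>M lborel). g (fst z - snd z) * f (fst z)) = enn2real (ennreal ((LINT x|lborel. g x) * (LINT x|lborel. f x)))"
    unfolding nn[symmetric] by (rule integral_eq_nn_integral) (use f g in auto)
  moreover have "0 \<le> (LINT x|lborel. g x) * (LINT x|lborel. f x)" using f g by simp
  ultimately show "(LINT z|(lborel \<Otimes>\<^sub>M lborel). g (fst z - snd z) * f (fst z)) = (LINT x|lborel. g x) * (LINT x|lborel. f x)"
    by simp
qed

text \<open>Convolution with a kernel that is deliberately not normalized: the growth of its mass as
  d tends to 0 is what drives compactness.\<close>

definition mollify :: "real \<Rightarrow> ('a::euclidean_space \<Rightarrow> real) \<Rightarrow> 'a \<Rightarrow> real" where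
  "mollify d u x = (LINT y|lborel. cutoff_kernel d (x - y) * u y)"

context bounded_set
begin

lemma mollify_integrable:
  assumes d: "d > 0" and u: "u \<in> finite_energy \<Omega>"
  shows "integrable lborel (\<lambda>y. cutoff_kernel d (x - y) * u y)"
proof (rule Bochner_Integration.integrable_bound)
  show "integrable lborel (\<lambda>y. 1 / d ^ DIM('a) * u y)" by (intro integrable_mult_right finite_energy_integrable u)
  have [measurable]: "cutoff_kernel d \<in> borel_measurable (borel :: 'a measure)"
    by (rule borel_measurable_continuous_onI[OF cutoff_kernel_continuous[OF d]])
  note [measurable] = finite_energyD(1)[OF u]
  show "(\<lambda>y. cutoff_kernel d (x - y) * u y) \<in> borel_measurable lborel" by measurable
  show "AE y in lborel. norm (cutoff_kernel d (x - y) * u y) \<le> norm (1 / d ^ DIM('a) * u y)"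
  proof (rule AE_I2)
    fix y
    have "\<bar>cutoff_kernel d (x - y)\<bar> * \<bar>u y\<bar> \<le> 1 / d ^ DIM('a) * \<bar>u y\<bar>"
      using cutoff_kernel_bounds(1,2)[OF d, of "x - y"] by (intro mult_right_mono) auto
    then show "norm (cutoff_kernel d (x - y) * u y) \<le> norm (1 / d ^ DIM('a) * u y)"
      using d by (simp add: abs_mult)
  qed
qed

text \<open>Expanding \<open>\<integral>\<integral> k(x - y) (v x - v y)\<^sup>2\<close> for the cutoff kernel \<open>k\<close>: its mass tends to infinity as
  \<open>d\<close> tends to 0, so uniform convergence of the mollified functions forces convergence in \<open>L\<^sup>2\<close>.\<close>

lemma near_form_controls_mollify:
  assumes d: "d > 0" and v: "v \<in> finite_energy \<Omega>" and \<sigma>: "\<And>x. norm x \<le> R \<Longrightarrow> \<bar>mollify d v x\<bar> \<le> \<sigma>"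
  shows "(LINT z|(lborel :: 'a measure). cutoff_kernel d z) * l2_form v v \<le> near_form v v / 2 + \<sigma> * (LINT x|lborel. \<bar>v x\<bar>)"
proof -
  let ?M = "lborel \<Otimes>\<^sub>M lborel :: ('a \<times> 'a) measure"
  let ?m = "LINT z|(lborel :: 'a measure). cutoff_kernel d z"
  define k where "k z = (cutoff_kernel d (fst z - snd z) :: real)" for z :: "'a \<times> 'a"
  have [measurable]: "cutoff_kernel d \<in> borel_measurable (borel :: 'a measure)"
    by (rule borel_measurable_continuous_onI[OF cutoff_kernel_continuous[OF d]])
  note [measurable] = finite_energyD(1)[OF v]
  have v1: "integrable lborel v" by (rule finite_energy_integrable[OF v])
  have v2: "integrable lborel (\<lambda>x. (v x)\<^sup>2)" using finite_energyD(3)[OF v] by (rule square_integrable_square)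
  have i1: "integrable ?M (\<lambda>z. k z * (v (fst z))\<^sup>2)" and I1: "(LINT z|?M. k z * (v (fst z))\<^sup>2) = ?m * l2_form v v"
    using integrable_pair_convolution[OF v2 _ cutoff_kernel_integrable[OF d] cutoff_kernel_bounds(1)[OF d]]
    by (simp_all add: k_def l2_form_square)
  have ksym: "k (snd z, fst z) = k z" for z by (simp add: k_def cutoff_kernel_def norm_minus_commute)
  have i2: "integrable ?M (\<lambda>z. k z * (v (snd z))\<^sup>2)" and I2: "(LINT z|?M. k z * (v (snd z))\<^sup>2) = ?m * l2_form v v"
    using lborel_pair_swap[of "\<lambda>z. k z * (v (fst z))\<^sup>2"] i1 I1 by (simp_all add: ksym)
  have i3: "integrable ?M (\<lambda>z. k z * (v (fst z) * v (snd z)))"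
  proof (rule Bochner_Integration.integrable_bound)
    show "integrable ?M (\<lambda>z. 1 / d ^ DIM('a) * (v (fst z) * v (snd z)))"
      by (intro integrable_mult_right integrable_lborel_pair_product v1)
    show "AE z in ?M. norm (k z * (v (fst z) * v (snd z))) \<le> norm (1 / d ^ DIM('a) * (v (fst z) * v (snd z)))"
    proof (rule AE_I2)
      fix z
      have "\<bar>k z\<bar> * \<bar>v (fst z) * v (snd z)\<bar> \<le> 1 / d ^ DIM('a) * \<bar>v (fst z) * v (snd z)\<bar>"
        unfolding k_def using cutoff_kernel_bounds(1,2)[OF d, of "fst z - snd z"] by (intro mult_right_mono) auto
      then show "norm (k z * (v (fst z) * v (snd z))) \<le> norm (1 / d ^ DIM('a) * (v (fst z) * v (snd z)))"
        using d by (simp add: abs_mult)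
    qed
  qed (simp add: k_def)
  have I3: "(LINT z|?M. k z * (v (fst z) * v (snd z))) \<le> \<sigma> * (LINT x|lborel. \<bar>v x\<bar>)"
  proof -
    have sec: "(LINT y|lborel. k (x, y) * (v x * v y)) = v x * mollify d v x" for x
      by (simp add: k_def mollify_def mult.left_commute flip: integral_mult_right_zero)
    have "(LINT z|?M. k z * (v (fst z) * v (snd z))) = (LINT x|lborel. v x * mollify d v x)"
      using lborel_pair.integral_fst'[OF i3] by (simp add: sec)
    also have "\<dots> \<le> (LINT x|lborel. \<sigma> * \<bar>v x\<bar>)"
    proof (rule integral_mono)
      show "integrable lborel (\<lambda>x. v x * mollify d v x)"
        using lborel_pair.integrable_fst'[OF i3] by (simp add: sec)
      show "integrable lborel (\<lambda>x. \<sigma> * \<bar>v x\<bar>)" using v1 by simp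
      fix x
      show "v x * mollify d v x \<le> \<sigma> * \<bar>v x\<bar>"
      proof (cases "norm x \<le> R")
        case True
        have "v x * mollify d v x \<le> \<bar>v x\<bar> * \<bar>mollify d v x\<bar>" by (metis abs_ge_self abs_mult)
        also have "\<dots> \<le> \<bar>v x\<bar> * \<sigma>" using \<sigma>[OF True] by (intro mult_left_mono) auto
        finally show ?thesis by (simp add: mult.commute)
      qed (simp add: support[OF v])
    qed
    finally show ?thesis by simp
  qed
  have sq: "k z * (difference v z)\<^sup>2 = k z * (v (fst z))\<^sup>2 + k z * (v (snd z))\<^sup>2 - 2 * (k z * (v (fst z) * v (snd z)))" for z
    by (simp add: difference_def power2_eq_square algebra_simps)
  have isq: "integrable ?M (\<lambda>z. k z * (difference v z)\<^sup>2)"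
    unfolding sq by (intro Bochner_Integration.integrable_diff Bochner_Integration.integrable_add i1 i2 integrable_mult_right i3)
  have Isq: "(LINT z|?M. k z * (difference v z)\<^sup>2) = 2 * (?m * l2_form v v) - 2 * (LINT z|?M. k z * (v (fst z) * v (snd z)))"
    unfolding sq using i1 i2 i3 I1 I2 by simp
  have "(LINT z|?M. k z * (difference v z)\<^sup>2) \<le> (LINT z|?M. near_kernel (fst z - snd z) * (difference v z)\<^sup>2)"
  proof (rule integral_mono[OF isq])
    show "integrable ?M (\<lambda>z. near_kernel (fst z - snd z) * (difference v z)\<^sup>2)"
      using square_integrable_square[OF finite_energyD(4)[OF v]] by (subst (asm) near_measure_integrable_iff) auto
    fix z
    show "k z * (difference v z)\<^sup>2 \<le> near_kernel (fst z - snd z) * (difference v z)\<^sup>2"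
      using cutoff_kernel_bounds(3)[OF d, of "fst z - snd z" "difference v z"]
      by (cases "fst z = snd z") (auto simp: k_def difference_def)
  qed
  also have "\<dots> = near_form v v"
    unfolding near_form_square by (rule near_measure_integrable_iff(2)[symmetric]) measurable
  finally show ?thesis using Isq I3 by linarith
qed

lemma mollify_diff:
  assumes "d > 0" "u \<in> finite_energy \<Omega>" "v \<in> finite_energy \<Omega>"
  shows "mollify d (\<lambda>x. u x - v x) x = mollify d u x - mollify d v x"
  unfolding mollify_def right_diff_distrib
  by (rule Bochner_Integration.integral_diff[OF mollify_integrable[OF assms(1,2)] mollify_integrable[OF assms(1,3)]])

lemma integral_abs_le:
  assumes u: "u \<in> finite_energy \<Omega>"
  shows "(LINT x|lborel. \<bar>u x\<bar>) \<le> measure lborel (cball (0::'a) R) + l2_form u u"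
proof -
  let ?i = "indicator (cball (0::'a) R) :: 'a \<Rightarrow> real"
  have i: "integrable lborel ?i"
    using emeasure_bounded_finite[of "cball (0::'a) R"] by (intro integrable_real_indicator) auto
  have u2: "integrable lborel (\<lambda>x. (u x)\<^sup>2)" using finite_energyD(3)[OF u] by (rule square_integrable_square)
  have "(LINT x|lborel. \<bar>u x\<bar>) \<le> (LINT x|lborel. ?i x + (u x)\<^sup>2)"
  proof (rule integral_mono)
    show "integrable lborel (\<lambda>x. \<bar>u x\<bar>)" by (intro integrable_abs finite_energy_integrable u)
    show "integrable lborel (\<lambda>x. ?i x + (u x)\<^sup>2)" using i u2 by simp
    fix x
    have "2 * \<bar>u x\<bar> \<le> 1 + (u x)\<^sup>2" using sum_squares_bound[of 1 "\<bar>u x\<bar>"] by simp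
    then show "\<bar>u x\<bar> \<le> ?i x + (u x)\<^sup>2" using support[OF u, of x] by (cases "norm x \<le> R") auto
  qed
  also have "\<dots> = measure lborel (cball (0::'a) R) + l2_form u u" using i u2 by (simp add: l2_form_square)
  finally show ?thesis .
qed

text \<open>For one precision \<open>e\<close> a single kernel of sufficiently large mass is enough.
  The convolutions are uniformly bounded and equicontinuous, since the sequence is bounded in L1,
  and a uniformly convergent subsequence of them makes the original functions close in L2.\<close>

lemma compact_step:
  fixes s :: "nat \<Rightarrow> 'a \<Rightarrow> real"
  assumes s: "\<And>n. s n \<in> finite_energy \<Omega>" and one: "\<And>n. l2_form (s n) (s n) = 1"
    and B: "\<And>n. near_form (s n) (s n) \<le> B" and e: "e > 0"
  shows "\<exists>r :: nat \<Rightarrow> nat. strict_mono r \<and> (\<exists>K. \<forall>i\<ge>K. \<forall>j\<ge>K. l2_form (\<lambda>x. s (r i) x - s (r j) x) (\<lambda>x. s (r i) x - s (r j) x) < e)"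
proof -
  interpret near: bilinear_on "finite_energy \<Omega>" near_form by (rule bilinear_near_form)
  define c where "c = measure lborel (cball (0::'a) R) + 1"
  have c: "1 \<le> c" by (simp add: c_def)
  have abs_le: "(LINT x|lborel. \<bar>s n x\<bar>) \<le> c" for n
    using integral_abs_le[OF s, of n] by (simp add: one c_def)
  have B0: "0 \<le> B" using B[of 0] near_form_nonneg[of "s 0"] by linarith
  \<comment> \<open>The final estimate reads mass times squared distance \<le> 2 B + 1: the near
    form of a difference is at most 4 B and enters halved, and the convolution term is at most 1.
    Mass Y then forces the squared distance below e/2.\<close>
  define Y where "Y = 2 * (2 * B + 1) / e"
  have Y: "0 < Y" using B0 e by (simp add: Y_def)
  let ?C = "real DIM('a) * unit_ball_vol DIM('a)"
  have C: "0 < ?C" by simp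
  \<comment> \<open>With d = exp(-T)/2 one has ln(1/(2d)) = T, and the lower bound for the mass
    becomes exactly Y.\<close>
  define T where "T = Y * 2 ^ (DIM('a) + 1) / ?C"
  have T: "0 < T" using Y C by (simp add: T_def)
  define d where "d = exp (- T) / 2"
  have d: "0 < d" "d < 1/2" using T by (auto simp: d_def)
  let ?m = "LINT z|(lborel :: 'a measure). cutoff_kernel d z"
  have "ln (1 / (2 * d)) = T" by (simp add: d_def ln_div)
  then have "?C * T / 2 ^ (DIM('a) + 1) \<le> ?m" using cutoff_kernel_mass[OF d, where 'a='a] by simp
  moreover have "?C * T / 2 ^ (DIM('a) + 1) = Y"
  proof -
    have "?C \<noteq> 0" using C by (metis less_irrefl)
    then show ?thesis unfolding T_def by (simp only: times_divide_eq_right nonzero_mult_div_cancel_left) simp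
  qed
  ultimately have m: "Y \<le> ?m" by simp
  let ?F = "\<lambda>n. mollify d (s n)"
  have "\<exists>g k. strict_mono (k :: nat \<Rightarrow> nat) \<and> (\<forall>e>0. \<exists>N. \<forall>n x. n \<ge> N \<and> x \<in> cball 0 R \<longrightarrow> norm (?F (k n) x - g x) < e)"
  proof (rule Arzela_Ascoli[of "cball (0::'a) R" ?F "1 / d ^ DIM('a) * c"])
    fix n and x :: 'a
    have "\<bar>?F n x\<bar> \<le> (LINT y|lborel. \<bar>cutoff_kernel d (x - y) * s n y\<bar>)"
      unfolding mollify_def by (rule integral_abs_bound)
    also have "\<dots> \<le> (LINT y|lborel. 1 / d ^ DIM('a) * \<bar>s n y\<bar>)"
    proof (rule integral_mono)
      show "integrable lborel (\<lambda>y. \<bar>cutoff_kernel d (x - y) * s n y\<bar>)"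
        by (intro integrable_abs mollify_integrable d s)
      show "integrable lborel (\<lambda>y. 1 / d ^ DIM('a) * \<bar>s n y\<bar>)"
        by (intro integrable_mult_right integrable_abs finite_energy_integrable s)
      show "\<bar>cutoff_kernel d (x - y) * s n y\<bar> \<le> 1 / d ^ DIM('a) * \<bar>s n y\<bar>" for y
        unfolding abs_mult using cutoff_kernel_bounds(1,2)[OF d(1), of "x - y"] by (intro mult_right_mono) auto
    qed
    also have "\<dots> \<le> 1 / d ^ DIM('a) * c"
      using abs_le[of n] d by (simp add: divide_right_mono)
    finally show "norm (?F n x) \<le> 1 / d ^ DIM('a) * c" by simp
  next
    fix x :: 'a and e' :: real
    assume x: "x \<in> cball 0 R" and e': "0 < e'"
    \<comment> \<open>Arguments x - w with both points in the ball of radius R stay in the ball of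
      radius 2 R. The modulus of continuity of the kernel is multiplied only by the L1 bound c and
      is therefore the same for all n.\<close>
    have "uniformly_continuous_on (cball (0::'a) (2 * R)) (cutoff_kernel d)"
      by (intro compact_uniformly_continuous cutoff_kernel_continuous d) auto
    moreover have "0 < e' / (2 * c)" using e' c by simp
    ultimately obtain \<delta> where \<delta>: "0 < \<delta>" "\<And>p q. p \<in> cball (0::'a) (2 * R) \<Longrightarrow> q \<in> cball 0 (2 * R) \<Longrightarrow> dist q p < \<delta>
        \<Longrightarrow> dist (cutoff_kernel d q) (cutoff_kernel d p) < e' / (2 * c)"
      unfolding uniformly_continuous_on_def by metis
    have "norm (?F n x - ?F n y) < e'" if y: "y \<in> cball 0 R" "norm (x - y) < \<delta>" for n y
    proof -
      have "?F n x - ?F n y = (LINT w|lborel. cutoff_kernel d (x - w) * s n w - cutoff_kernel d (y - w) * s n w)"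
        unfolding mollify_def by (rule Bochner_Integration.integral_diff[symmetric]) (intro mollify_integrable d s)+
      then have "\<bar>?F n x - ?F n y\<bar> \<le> (LINT w|lborel. \<bar>cutoff_kernel d (x - w) * s n w - cutoff_kernel d (y - w) * s n w\<bar>)"
        using integral_abs_bound by metis
      also have "\<dots> \<le> (LINT w|lborel. e' / (2 * c) * \<bar>s n w\<bar>)"
      proof (rule integral_mono)
        show "integrable lborel (\<lambda>w. \<bar>cutoff_kernel d (x - w) * s n w - cutoff_kernel d (y - w) * s n w\<bar>)"
          by (intro integrable_abs Bochner_Integration.integrable_diff mollify_integrable d s)
        show "integrable lborel (\<lambda>w. e' / (2 * c) * \<bar>s n w\<bar>)"
          by (intro integrable_mult_right integrable_abs finite_energy_integrable s)
        fix w
        show "\<bar>cutoff_kernel d (x - w) * s n w - cutoff_kernel d (y - w) * s n w\<bar> \<le> e' / (2 * c) * \<bar>s n w\<bar>"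
        proof (cases "norm w \<le> R")
          case True
          have "norm (x - w) \<le> 2 * R" "norm (y - w) \<le> 2 * R"
            using norm_triangle_ineq4[of x w] norm_triangle_ineq4[of y w] x y(1) True by auto
          then have "\<bar>cutoff_kernel d (x - w) - cutoff_kernel d (y - w)\<bar> < e' / (2 * c)"
            using \<delta>(2)[of "y - w" "x - w"] y(2) unfolding mem_cball_0 dist_norm by simp
          then have "\<bar>cutoff_kernel d (x - w) - cutoff_kernel d (y - w)\<bar> * \<bar>s n w\<bar> \<le> e' / (2 * c) * \<bar>s n w\<bar>"
            by (intro mult_right_mono) auto
          then show ?thesis by (simp only: left_diff_distrib[symmetric] abs_mult)
        qed (simp add: support[OF s])
      qed
      also have "\<dots> = e' / (2 * c) * (LINT w|lborel. \<bar>s n w\<bar>)" by simp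
      also have "\<dots> \<le> e' / (2 * c) * c" using abs_le[of n] e' c by (intro mult_left_mono) auto
      also have "\<dots> < e'" using e' c by simp
      finally show ?thesis by simp
    qed
    then show "\<exists>\<delta>>0. \<forall>n y. y \<in> cball 0 R \<and> norm (x - y) < \<delta> \<longrightarrow> norm (?F n x - ?F n y) < e'"
      using \<delta>(1) by blast
  next
    fix g and k :: "nat \<Rightarrow> nat"
    assume "strict_mono k" "\<And>e. 0 < e \<Longrightarrow> \<exists>N. \<forall>n x. N \<le> n \<and> x \<in> cball 0 R \<longrightarrow> norm (?F (k n) x - g x) < e"
    then show ?thesis by blast
  qed simp
  then obtain g and k :: "nat \<Rightarrow> nat" where k: "strict_mono k"
    and conv: "\<forall>e>0. \<exists>N. \<forall>n x. n \<ge> N \<and> x \<in> cball 0 R \<longrightarrow> norm (?F (k n) x - g x) < e" by blast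
  \<comment> \<open>The L1 norm of a difference is at most 2 c, so this choice bounds the
    convolution term by 1.\<close>
  define \<sigma> where "\<sigma> = 1 / (2 * c)"
  have "0 < \<sigma> / 2" using c by (simp add: \<sigma>_def)
  then obtain N where N: "\<And>n x. n \<ge> N \<Longrightarrow> norm x \<le> R \<Longrightarrow> \<bar>?F (k n) x - g x\<bar> < \<sigma> / 2"
    using conv by (metis mem_cball_0 real_norm_def)
  have "l2_form (\<lambda>x. s (k i) x - s (k j) x) (\<lambda>x. s (k i) x - s (k j) x) < e" if ij: "i \<ge> N" "j \<ge> N" for i j
  proof -
    let ?v = "\<lambda>x. s (k i) x - s (k j) x"
    have v: "?v \<in> finite_energy \<Omega>" by (rule function_subspace_diff[OF function_subspace_finite_energy s s])
    have "\<bar>mollify d ?v x\<bar> \<le> \<sigma>" if "norm x \<le> R" for x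
      using N[OF ij(1) that] N[OF ij(2) that] unfolding mollify_diff[OF d(1) s s] by linarith
    then have main: "?m * l2_form ?v ?v \<le> near_form ?v ?v / 2 + \<sigma> * (LINT x|lborel. \<bar>?v x\<bar>)"
      by (rule near_form_controls_mollify[OF d(1) v])
    have "near_form ?v ?v \<le> 2 * near_form (s (k i)) (s (k i)) + 2 * near_form (s (k j)) (s (k j))"
      using near.quadratic_diff[OF s s, of "k i" "k j"] near.quadratic_add[OF s s, of "k i" "k j"]
        near_form_nonneg[of "\<lambda>x. s (k i) x + s (k j) x"] by linarith
    then have nv: "near_form ?v ?v \<le> 4 * B" using B[of "k i"] B[of "k j"] by linarith
    have "(LINT x|lborel. \<bar>?v x\<bar>) \<le> (LINT x|lborel. \<bar>s (k i) x\<bar> + \<bar>s (k j) x\<bar>)"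
      by (intro integral_mono integrable_abs finite_energy_integrable v Bochner_Integration.integrable_add s) auto
    also have "\<dots> = (LINT x|lborel. \<bar>s (k i) x\<bar>) + (LINT x|lborel. \<bar>s (k j) x\<bar>)"
      by (intro Bochner_Integration.integral_add integrable_abs finite_energy_integrable s)
    finally have "\<sigma> * (LINT x|lborel. \<bar>?v x\<bar>) \<le> \<sigma> * (2 * c)"
      using abs_le[of "k i"] abs_le[of "k j"] c by (intro mult_left_mono) (auto simp: \<sigma>_def)
    also have "\<dots> = 1" using c by (simp add: \<sigma>_def)
    finally have "?m * l2_form ?v ?v \<le> 2 * B + 1" using main nv by linarith
    moreover have "Y * l2_form ?v ?v \<le> ?m * l2_form ?v ?v" using m l2_form_nonneg by (intro mult_right_mono)
    ultimately have "Y * l2_form ?v ?v \<le> 2 * B + 1" by linarith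
    moreover have "Y * l2_form ?v ?v = (2 * B + 1) * (2 * l2_form ?v ?v / e)"
      unfolding Y_def times_divide_eq_left times_divide_eq_right by (simp only: mult_ac)
    ultimately have "(2 * B + 1) * (2 * l2_form ?v ?v / e) \<le> (2 * B + 1) * 1" by simp
    then have "2 * l2_form ?v ?v / e \<le> 1" using B0 by (subst (asm) mult_le_cancel_left_pos) auto
    then have "2 * l2_form ?v ?v \<le> e" using e by simp
    then show ?thesis using e by linarith
  qed
  then show ?thesis using k by blast
qed

text \<open>Each precision 1/(n+1) costs a further subsequence. Closeness on a tail is inherited by
  subsequences, so the diagonal sequence has it for every precision.\<close>

lemma compact_embedding:
  fixes s :: "nat \<Rightarrow> 'a \<Rightarrow> real"
  assumes s: "\<And>n. s n \<in> finite_energy \<Omega>" and one: "\<And>n. l2_form (s n) (s n) = 1"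
    and B: "\<And>n. near_form (s n) (s n) \<le> B"
  shows "\<exists>r :: nat \<Rightarrow> nat. strict_mono r \<and> (\<forall>e>0. \<exists>K. \<forall>i\<ge>K. \<forall>j\<ge>K. l2_form (\<lambda>x. s (r i) x - s (r j) x) (\<lambda>x. s (r i) x - s (r j) x) < e)"
proof -
  define P where "P n r \<longleftrightarrow> (\<exists>K. \<forall>i\<ge>K. \<forall>j\<ge>K. l2_form (\<lambda>x. s (r i) x - s (r j) x) (\<lambda>x. s (r i) x - s (r j) x) < 1 / real (Suc n))"
    for n and r :: "nat \<Rightarrow> nat"
  interpret subseqs P
  proof
    fix n and r :: "nat \<Rightarrow> nat"
    show "\<exists>r'. strict_mono r' \<and> P n (r \<circ> r')"
      using compact_step[of "\<lambda>n. s (r n)" B "1 / real (Suc n)"] s one B by (simp add: P_def o_def)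
  qed
  have holds: "P k (diagseq \<circ> ((+) (Suc k)))" for k
  proof (rule diagseq_holds)
    fix r t :: "nat \<Rightarrow> nat" and n
    assume r: "strict_mono r" and "P n t"
    then obtain K where K: "\<And>i j. i \<ge> K \<Longrightarrow> j \<ge> K \<Longrightarrow> l2_form (\<lambda>x. s (t i) x - s (t j) x) (\<lambda>x. s (t i) x - s (t j) x) < 1 / real (Suc n)"
      unfolding P_def by blast
    have "r i \<ge> K" if "i \<ge> K" for i using seq_suble[OF r, of i] that by linarith
    then show "P n (t \<circ> r)" unfolding P_def o_def using K by blast
  qed
  have "\<exists>K. \<forall>i\<ge>K. \<forall>j\<ge>K. l2_form (\<lambda>x. s (diagseq i) x - s (diagseq j) x) (\<lambda>x. s (diagseq i) x - s (diagseq j) x) < e"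
    if e: "e > 0" for e
  proof -
    obtain k where k: "1 / real (Suc k) < e" using e by (metis nat_approx_posE)
    obtain K where K: "\<And>i j. i \<ge> K \<Longrightarrow> j \<ge> K \<Longrightarrow>
        l2_form (\<lambda>x. s (diagseq (Suc k + i)) x - s (diagseq (Suc k + j)) x) (\<lambda>x. s (diagseq (Suc k + i)) x - s (diagseq (Suc k + j)) x) < 1 / real (Suc k)"
      using holds[of k] unfolding P_def o_def by blast
    have "l2_form (\<lambda>x. s (diagseq i) x - s (diagseq j) x) (\<lambda>x. s (diagseq i) x - s (diagseq j) x) < e"
      if "i \<ge> Suc k + K" "j \<ge> Suc k + K" for i j
    proof -
      have "K \<le> i - Suc k" "K \<le> j - Suc k" "Suc k + (i - Suc k) = i" "Suc k + (j - Suc k) = j" using that by linarith+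
      then show ?thesis using K[of "i - Suc k" "j - Suc k"] k by simp
    qed
    then show ?thesis by blast
  qed
  then show ?thesis using subseq_diagseq by blast
qed

section \<open>The closure of the test functions\<close>

lemma graph_form_lim_iff:
  "(\<lambda>n. graph_form (\<lambda>x. s n x - u x) (\<lambda>x. s n x - u x)) \<longlonglongrightarrow> 0 \<longleftrightarrow>
   (\<lambda>n. near_form (\<lambda>x. s n x - u x) (\<lambda>x. s n x - u x)) \<longlonglongrightarrow> 0 \<and> (\<lambda>n. l2_form (\<lambda>x. s n x - u x) (\<lambda>x. s n x - u x)) \<longlonglongrightarrow> 0"
proof
  assume lim: "(\<lambda>n. graph_form (\<lambda>x. s n x - u x) (\<lambda>x. s n x - u x)) \<longlonglongrightarrow> 0"
  have "(\<lambda>n. near_form (\<lambda>x. s n x - u x) (\<lambda>x. s n x - u x)) \<longlonglongrightarrow> 0"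
    by (rule tendsto_sandwich[OF _ _ tendsto_const lim]) (auto intro!: always_eventually near_form_nonneg graph_form_ge)
  moreover have "(\<lambda>n. l2_form (\<lambda>x. s n x - u x) (\<lambda>x. s n x - u x)) \<longlonglongrightarrow> 0"
    by (rule tendsto_sandwich[OF _ _ tendsto_const lim]) (auto intro!: always_eventually l2_form_nonneg graph_form_ge)
  ultimately show "(\<lambda>n. near_form (\<lambda>x. s n x - u x) (\<lambda>x. s n x - u x)) \<longlonglongrightarrow> 0 \<and> (\<lambda>n. l2_form (\<lambda>x. s n x - u x) (\<lambda>x. s n x - u x)) \<longlonglongrightarrow> 0" ..
next
  assume "(\<lambda>n. near_form (\<lambda>x. s n x - u x) (\<lambda>x. s n x - u x)) \<longlonglongrightarrow> 0 \<and> (\<lambda>n. l2_form (\<lambda>x. s n x - u x) (\<lambda>x. s n x - u x)) \<longlonglongrightarrow> 0"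
  then have "(\<lambda>n. near_form (\<lambda>x. s n x - u x) (\<lambda>x. s n x - u x) + l2_form (\<lambda>x. s n x - u x) (\<lambda>x. s n x - u x)) \<longlonglongrightarrow> 0 + 0"
    by (intro tendsto_add) auto
  then show "(\<lambda>n. graph_form (\<lambda>x. s n x - u x) (\<lambda>x. s n x - u x)) \<longlonglongrightarrow> 0" by (simp add: graph_form_def)
qed

lemma form_triangle:
  assumes "bilinear_on (finite_energy \<Omega>) F" and pos: "\<And>u. 0 \<le> F u u"
    and "u \<in> finite_energy \<Omega>" "v \<in> finite_energy \<Omega>" "w \<in> finite_energy \<Omega>"
  shows "F (\<lambda>x. u x - w x) (\<lambda>x. u x - w x) \<le> 2 * F (\<lambda>x. u x - v x) (\<lambda>x. u x - v x) + 2 * F (\<lambda>x. w x - v x) (\<lambda>x. w x - v x)"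
proof -
  interpret F: bilinear_on "finite_energy \<Omega>" F by fact
  note d = function_subspace_diff[OF F.subspace assms(3,4)] function_subspace_diff[OF F.subspace assms(5,4)]
  have "(\<lambda>x. (u x - v x) - (w x - v x)) = (\<lambda>x. u x - w x)" by auto
  then show ?thesis
    using F.quadratic_diff[OF d] F.quadratic_add[OF d] pos[of "\<lambda>x. (u x - v x) + (w x - v x)"] by simp
qed

lemma convergent_imp_Cauchy:
  assumes F: "bilinear_on (finite_energy \<Omega>) F" and pos: "\<And>u. 0 \<le> F u u"
    and s: "\<And>n. s n \<in> finite_energy \<Omega>" and u: "u \<in> finite_energy \<Omega>"
    and lim: "(\<lambda>n. F (\<lambda>x. s n x - u x) (\<lambda>x. s n x - u x)) \<longlonglongrightarrow> 0" and e: "e > 0"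
  shows "\<exists>K. \<forall>m\<ge>K. \<forall>n\<ge>K. F (\<lambda>x. s m x - s n x) (\<lambda>x. s m x - s n x) < e"
proof -
  obtain K where K: "\<And>n. n \<ge> K \<Longrightarrow> F (\<lambda>x. s n x - u x) (\<lambda>x. s n x - u x) < e / 4"
    using order_tendstoD(2)[OF lim, of "e / 4"] e by (auto simp: eventually_sequentially)
  have "F (\<lambda>x. s m x - s n x) (\<lambda>x. s m x - s n x) < e" if "m \<ge> K" "n \<ge> K" for m n
    using form_triangle[OF F pos s[of m] u s[of n]] K[OF that(1)] K[OF that(2)] by linarith
  then show ?thesis by blast
qed

lemma L2_norm_eq: "u \<in> finite_energy \<Omega> \<Longrightarrow> L2_norm \<Omega> u = sqrt (l2_form u u)"
  unfolding L2_norm_def l2_form_square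
  by (subst set_integral_eq_integral) (auto simp: finite_energyD(2))

text \<open>The real square root is extended to negative arguments as an odd increasing function, so
  the equivalence covers an inner product whose sign has not been determined.\<close>

lemma sqrt_less_iff_square: "e > 0 \<Longrightarrow> sqrt x < e \<longleftrightarrow> x < e\<^sup>2"
  using real_sqrt_less_iff[of x "e\<^sup>2"] by simp

lemma L2_space_iff: "u \<in> L2_space \<Omega> \<longleftrightarrow> (\<forall>x. x \<notin> \<Omega> \<longrightarrow> u x = 0) \<and> square_integrable lborel u"
proof -
  have "set_integrable lborel \<Omega> (\<lambda>x. (u x)\<^sup>2) \<longleftrightarrow> integrable lborel (\<lambda>x. (u x)\<^sup>2)" if "\<forall>x. x \<notin> \<Omega> \<longrightarrow> u x = 0"
  proof -
    have "(\<lambda>x. indicator \<Omega> x *\<^sub>R (u x)\<^sup>2) = (\<lambda>x. (u x)\<^sup>2)" using that by (auto simp: fun_eq_iff indicator_def)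
    then show ?thesis by (simp add: set_integrable_def)
  qed
  then show ?thesis by (auto simp: L2_space_def square_integrable_def)
qed

text \<open>The energy norm bounds the near form only up to an L2 term. The L2 convergence required
  in \<open>approximates\<close> makes that term small, so the sequence is Cauchy in the graph
  norm.\<close>

lemma approximates_imp:
  assumes \<mu>: "\<mu> > -1" and u: "u \<in> L2_space \<Omega>" and L: "approximates \<Omega> \<mu> s u"
  shows "u \<in> finite_energy \<Omega>" "(\<lambda>n. graph_form (\<lambda>x. s n x - u x) (\<lambda>x. s n x - u x)) \<longlonglongrightarrow> 0"
proof -
  have s: "s n \<in> test_functions \<Omega>" for n using L by (simp add: approximates_def)
  have sD: "s n \<in> finite_energy \<Omega>" for n by (rule test_functions_finite_energy[OF s])
  have u0: "\<And>x. x \<notin> \<Omega> \<Longrightarrow> u x = 0" and u2: "square_integrable lborel u" using u by (auto simp: L2_space_iff)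
  have "L2_norm \<Omega> (\<lambda>x. s n x - u x) = sqrt (LINT x|lborel. (s n x - u x)\<^sup>2)" for n
    unfolding L2_norm_def by (subst set_integral_eq_integral) (simp_all add: u0 finite_energyD(2)[OF sD])
  then have "(\<lambda>n. sqrt (LINT x|lborel. (s n x - u x)\<^sup>2)) \<longlonglongrightarrow> 0" using L by (simp add: approximates_def)
  then have "(\<lambda>n. (sqrt (LINT x|lborel. (s n x - u x)\<^sup>2))\<^sup>2) \<longlonglongrightarrow> 0\<^sup>2" by (rule tendsto_power)
  then have lim: "(\<lambda>n. LINT x|lborel. (s n x - u x)\<^sup>2) \<longlonglongrightarrow> 0" by simp
  obtain r where r: "strict_mono r" "AE x in lborel. (\<lambda>n. s (r n) x) \<longlonglongrightarrow> u x"
    by (rule L2_limit_AE_subseq[OF finite_energyD(3)[OF sD] u2 lim])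
  have wD: "(\<lambda>x. s m x - s n x) \<in> finite_energy \<Omega>" for m n
    by (rule function_subspace_diff[OF function_subspace_finite_energy sD sD])
  have l2_cauchy: "\<exists>K. \<forall>m\<ge>K. \<forall>n\<ge>K. l2_form (\<lambda>x. s m x - s n x) (\<lambda>x. s m x - s n x) < e" if e: "e > 0" for e
  proof -
    obtain K where K: "\<And>n. n \<ge> K \<Longrightarrow> (LINT x|lborel. (s n x - u x)\<^sup>2) < e / 4"
      using order_tendstoD(2)[OF lim, of "e / 4"] e by (auto simp: eventually_sequentially)
    have "l2_form (\<lambda>x. s m x - s n x) (\<lambda>x. s m x - s n x) < e" if mn: "m \<ge> K" "n \<ge> K" for m n
    proof -
      have d: "square_integrable lborel (\<lambda>x. s n x - u x)" for n by (rule square_integrable_diff[OF finite_energyD(3)[OF sD] u2])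
      have "l2_form (\<lambda>x. s m x - s n x) (\<lambda>x. s m x - s n x) \<le> (LINT x|lborel. 2 * (s m x - u x)\<^sup>2 + 2 * (s n x - u x)\<^sup>2)"
        unfolding l2_form_square
      proof (rule integral_mono)
        show "integrable lborel (\<lambda>x. (s m x - s n x)\<^sup>2)" by (rule square_integrable_square[OF finite_energyD(3)[OF wD]])
        show "integrable lborel (\<lambda>x. 2 * (s m x - u x)\<^sup>2 + 2 * (s n x - u x)\<^sup>2)"
          using square_integrable_square[OF d[of m]] square_integrable_square[OF d[of n]] by simp
        have "(a - b)\<^sup>2 \<le> 2 * (a - c)\<^sup>2 + 2 * (b - c)\<^sup>2" for a b c :: real
          using zero_le_power2[of "(a - c) + (b - c)"] by (simp add: power2_eq_square algebra_simps)
        then show "(s m x - s n x)\<^sup>2 \<le> 2 * (s m x - u x)\<^sup>2 + 2 * (s n x - u x)\<^sup>2" for x .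
      qed
      also have "\<dots> = 2 * (LINT x|lborel. (s m x - u x)\<^sup>2) + 2 * (LINT x|lborel. (s n x - u x)\<^sup>2)"
        using square_integrable_square[OF d[of m]] square_integrable_square[OF d[of n]] by simp
      finally show ?thesis using K[OF mn(1)] K[OF mn(2)] by linarith
    qed
    then show ?thesis by blast
  qed
  obtain k K where kK: "0 < k" "0 \<le> K" "\<And>u. u \<in> finite_energy \<Omega> \<Longrightarrow> k * near_form u u \<le> inner_ln_mu \<Omega> \<mu> u u + K * l2_form u u"
    using inner_ln_mu_coercive[OF \<mu>] by blast
  have near_cauchy: "\<exists>K. \<forall>m\<ge>K. \<forall>n\<ge>K. near_form (\<lambda>x. s m x - s n x) (\<lambda>x. s m x - s n x) < e" if e: "e > 0" for e
  proof -
    \<comment> \<open>The budget k e is divided equally between the inner product and the L2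
      correction; K + 1 avoids division by zero.\<close>
    have p: "0 < sqrt (k * e / 2)" "0 < k * e / 2 / (K + 1)" using e kK by auto
    obtain K1 where K1: "\<And>m n. m \<ge> K1 \<Longrightarrow> n \<ge> K1 \<Longrightarrow> norm_ln_mu \<Omega> \<mu> (\<lambda>x. s m x - s n x) < sqrt (k * e / 2)"
      using L p(1) unfolding approximates_def by blast
    obtain K2 where K2: "\<And>m n. m \<ge> K2 \<Longrightarrow> n \<ge> K2 \<Longrightarrow> l2_form (\<lambda>x. s m x - s n x) (\<lambda>x. s m x - s n x) < k * e / 2 / (K + 1)"
      using l2_cauchy[OF p(2)] by blast
    have "near_form (\<lambda>x. s m x - s n x) (\<lambda>x. s m x - s n x) < e" if mn: "m \<ge> max K1 K2" "n \<ge> max K1 K2" for m n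
    proof -
      let ?w = "\<lambda>x. s m x - s n x"
      have "inner_ln_mu \<Omega> \<mu> ?w ?w < k * e / 2"
        using K1[of m n] mn by (simp add: norm_ln_mu_def)
      moreover have "K * l2_form ?w ?w \<le> k * e / 2"
      proof -
        have "K * l2_form ?w ?w \<le> (K + 1) * (k * e / 2 / (K + 1))"
          using K2[of m n] mn kK(2) l2_form_nonneg[of ?w] by (intro mult_mono) auto
        also have "\<dots> = k * e / 2"
        proof -
          have "K + 1 \<noteq> 0" using kK(2) by linarith
          then show ?thesis by (subst times_divide_eq_right) (rule nonzero_mult_div_cancel_left)
        qed
        finally show ?thesis .
      qed
      ultimately have "k * near_form ?w ?w < k * e" using kK(3)[OF wD[of m n]] by linarith
      then show ?thesis using kK(1) by simp
    qed
    then show ?thesis by blast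
  qed
  show "u \<in> finite_energy \<Omega>" "(\<lambda>n. graph_form (\<lambda>x. s n x - u x) (\<lambda>x. s n x - u x)) \<longlonglongrightarrow> 0"
    using finite_energy_Cauchy_limit[OF sD _ u0 r l2_cauchy near_cauchy] u2 by (auto simp: square_integrable_def)
qed

text \<open>Here only an upper bound of the inner product by the graph form is used, so this
  direction is available for every \<mu>.\<close>

lemma approximates_if:
  assumes s: "\<And>n. s n \<in> test_functions \<Omega>" and u: "u \<in> finite_energy \<Omega>"
    and lim: "(\<lambda>n. graph_form (\<lambda>x. s n x - u x) (\<lambda>x. s n x - u x)) \<longlonglongrightarrow> 0"
  shows "approximates \<Omega> \<mu> s u"
  unfolding approximates_def
proof (intro conjI allI impI)
  have sD: "s n \<in> finite_energy \<Omega>" for n by (rule test_functions_finite_energy[OF s])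
  have d: "(\<lambda>x. s n x - u x) \<in> finite_energy \<Omega>" for n
    by (rule function_subspace_diff[OF function_subspace_finite_energy sD u])
  have wD: "(\<lambda>x. s m x - s n x) \<in> finite_energy \<Omega>" for m n
    by (rule function_subspace_diff[OF function_subspace_finite_energy sD sD])
  show "s n \<in> test_functions \<Omega>" for n by (rule s)
  have "(\<lambda>n. sqrt (l2_form (\<lambda>x. s n x - u x) (\<lambda>x. s n x - u x))) \<longlonglongrightarrow> sqrt 0"
    using lim by (intro tendsto_real_sqrt) (simp add: graph_form_lim_iff)
  then show "(\<lambda>n. L2_norm \<Omega> (\<lambda>x. s n x - u x)) \<longlonglongrightarrow> 0" by (simp add: L2_norm_eq[OF d])
  fix e :: real assume e: "e > 0"
  obtain C where C: "0 \<le> C" "\<And>u. u \<in> finite_energy \<Omega> \<Longrightarrow> inner_ln_mu \<Omega> \<mu> u u \<le> C * graph_form u u"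
    using inner_ln_mu_bounded by blast
  have "0 < e\<^sup>2 / (C + 1)" using e C by simp
  then obtain M where M: "\<And>m n. m \<ge> M \<Longrightarrow> n \<ge> M \<Longrightarrow> graph_form (\<lambda>x. s m x - s n x) (\<lambda>x. s m x - s n x) < e\<^sup>2 / (C + 1)"
    using convergent_imp_Cauchy[OF bilinear_graph_form graph_form_ge(3) sD u lim] by blast
  have "norm_ln_mu \<Omega> \<mu> (\<lambda>x. s m x - s n x) < e" if "m \<ge> M" "n \<ge> M" for m n
  proof -
    let ?w = "\<lambda>x. s m x - s n x"
    have "inner_ln_mu \<Omega> \<mu> ?w ?w \<le> (C + 1) * graph_form ?w ?w"
      using C(2)[OF wD[of m n]] graph_form_ge(3)[of ?w] unfolding distrib_right by linarith
    also have "\<dots> < (C + 1) * (e\<^sup>2 / (C + 1))" using M[OF that] C(1) by (intro mult_strict_left_mono) auto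
    also have "\<dots> = e\<^sup>2" using C(1) by simp
    finally show ?thesis using e by (simp add: norm_ln_mu_def sqrt_less_iff_square)
  qed
  then show "\<exists>M. \<forall>m\<ge>M. \<forall>n\<ge>M. norm_ln_mu \<Omega> \<mu> (\<lambda>x. s m x - s n x) < e" by blast
qed

text \<open>The graph norm does not involve \<mu>, so one space serves all \<mu> > -1. The dilation
  argument exploits this by working with \<mu> = 0.\<close>

definition test_closure :: "('a \<Rightarrow> real) set" where
  "test_closure = {u \<in> finite_energy \<Omega>. \<exists>s. (\<forall>n. s n \<in> test_functions \<Omega>) \<and>
     (\<lambda>n::nat. graph_form (\<lambda>x. s n x - u x) (\<lambda>x. s n x - u x)) \<longlonglongrightarrow> 0}"

lemma test_closure_finite_energy: "u \<in> test_closure \<Longrightarrow> u \<in> finite_energy \<Omega>"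
  by (simp add: test_closure_def)

lemma test_closureE:
  assumes "u \<in> test_closure"
  shows "\<exists>s. (\<forall>n. s n \<in> test_functions \<Omega>) \<and> (\<lambda>n::nat. graph_form (\<lambda>x. s n x - u x) (\<lambda>x. s n x - u x)) \<longlonglongrightarrow> 0"
  using assms by (simp add: test_closure_def)

lemma energy_space_eq:
  assumes \<mu>: "\<mu> > -1"
  shows "energy_space \<Omega> \<mu> = test_closure"
proof (intro subset_antisym subsetI)
  fix u assume "u \<in> energy_space \<Omega> \<mu>"
  then obtain s where u: "u \<in> L2_space \<Omega>" and s: "approximates \<Omega> \<mu> s u" unfolding energy_space_def by blast
  have "\<forall>n. s n \<in> test_functions \<Omega>" using s by (simp add: approximates_def)
  then show "u \<in> test_closure"
    unfolding test_closure_def using approximates_imp[OF \<mu> u s] by blast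
next
  fix u assume u: "u \<in> test_closure"
  note uD = test_closure_finite_energy[OF u]
  obtain s where s: "\<And>n. s n \<in> test_functions \<Omega>" "(\<lambda>n::nat. graph_form (\<lambda>x. s n x - u x) (\<lambda>x. s n x - u x)) \<longlonglongrightarrow> 0"
    using test_closureE[OF u] by blast
  have "u \<in> L2_space \<Omega>" using finite_energyD[OF uD] by (auto simp: L2_space_iff)
  then show "u \<in> energy_space \<Omega> \<mu>"
    unfolding energy_space_def using approximates_if[OF s(1) uD s(2)] by blast
qed

lemma energy_form_limit:
  assumes "\<And>n. s n \<in> finite_energy \<Omega>" "\<And>n. t n \<in> finite_energy \<Omega>" "u \<in> finite_energy \<Omega>" "v \<in> finite_energy \<Omega>"
    "(\<lambda>n. graph_form (\<lambda>x. s n x - u x) (\<lambda>x. s n x - u x)) \<longlonglongrightarrow> 0"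
    "(\<lambda>n. graph_form (\<lambda>x. t n x - v x) (\<lambda>x. t n x - v x)) \<longlonglongrightarrow> 0"
  shows "(\<lambda>n. energy_form \<mu> (s n) (t n)) \<longlonglongrightarrow> energy_form \<mu> u v"
proof -
  obtain C where C: "\<And>u. u \<in> finite_energy \<Omega> \<Longrightarrow> \<bar>energy_form \<mu> u u\<bar> \<le> C * graph_form u u"
    using energy_form_bounded by blast
  show ?thesis
    by (rule bounded_form_convergence[OF bilinear_energy_form bilinear_graph_form graph_form_ge(3) C assms])
qed

lemma energy_eq:
  assumes \<mu>: "\<mu> > -1" and u: "u \<in> test_closure" and v: "v \<in> test_closure"
  shows "energy \<Omega> \<mu> u v = energy_form \<mu> u v"
  unfolding energy_def
proof (rule the_equality)
  note uD = test_closure_finite_energy[OF u] and vD = test_closure_finite_energy[OF v]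
  have L2: "u \<in> L2_space \<Omega>" "v \<in> L2_space \<Omega>" using finite_energyD[OF uD] finite_energyD[OF vD] by (auto simp: L2_space_iff)
  have lim: "(\<lambda>n. test_energy \<Omega> \<mu> (s n) (t n)) \<longlonglongrightarrow> energy_form \<mu> u v"
    if s: "approximates \<Omega> \<mu> s u" and t: "approximates \<Omega> \<mu> t v" for s t
  proof -
    have st: "s n \<in> test_functions \<Omega>" "t n \<in> test_functions \<Omega>" for n using s t by (auto simp: approximates_def)
    show ?thesis unfolding test_energy_eq[OF st]
      by (intro energy_form_limit test_functions_finite_energy st uD vD approximates_imp(2)[OF \<mu> L2(1) s] approximates_imp(2)[OF \<mu> L2(2) t])
  qed
  then show "\<forall>s t. approximates \<Omega> \<mu> s u \<longrightarrow> approximates \<Omega> \<mu> t v \<longrightarrow> (\<lambda>n. test_energy \<Omega> \<mu> (s n) (t n)) \<longlonglongrightarrow> energy_form \<mu> u v"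
    by blast
  fix e assume e: "\<forall>s t. approximates \<Omega> \<mu> s u \<longrightarrow> approximates \<Omega> \<mu> t v \<longrightarrow> (\<lambda>n. test_energy \<Omega> \<mu> (s n) (t n)) \<longlonglongrightarrow> e"
  \<comment> \<open>Uniqueness of the described number requires at least one pair of approximating
    sequences; without one, every number would satisfy the description vacuously.\<close>
  have "\<exists>s. approximates \<Omega> \<mu> s w" if w: "w \<in> test_closure" for w
  proof -
    obtain s where s: "\<And>n. s n \<in> test_functions \<Omega>" "(\<lambda>n::nat. graph_form (\<lambda>x. s n x - w x) (\<lambda>x. s n x - w x)) \<longlonglongrightarrow> 0"
      using test_closureE[OF w] by blast
    show ?thesis using approximates_if[OF s(1) test_closure_finite_energy[OF w] s(2)] by blast
  qed
  then obtain s t where s: "approximates \<Omega> \<mu> s u" and t: "approximates \<Omega> \<mu> t v" using u v by blast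
  have "(\<lambda>n. test_energy \<Omega> \<mu> (s n) (t n)) \<longlonglongrightarrow> e" using e s t by blast
  then show "e = energy_form \<mu> u v" using lim[OF s t] by (rule LIMSEQ_unique)
qed

lemma test_functions_zero: "(\<lambda>_. 0) \<in> test_functions \<Omega>"
  by (rule test_functionsI[OF bump_algebra_smooth compact_empty]) (auto intro: bump_algebra.intros)

lemma function_subspace_test_closure: "function_subspace test_closure"
  unfolding function_subspace_def
proof (intro conjI ballI allI)
  interpret G: bilinear_on "finite_energy \<Omega>" graph_form by (rule bilinear_graph_form)
  have "(\<lambda>_. 0) \<in> test_closure"
    unfolding test_closure_def
    using test_functions_zero test_functions_finite_energy[OF test_functions_zero]
    by (auto intro!: exI[of _ "\<lambda>_ _. 0"] simp: graph_form_def near_form_def l2_form_def difference_def)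
  then show "test_closure \<noteq> {}" by blast
  fix u v a b assume u: "u \<in> test_closure" and v: "v \<in> test_closure"
  note uD = test_closure_finite_energy[OF u] and vD = test_closure_finite_energy[OF v]
  obtain s where s: "\<And>n. s n \<in> test_functions \<Omega>" "(\<lambda>n::nat. graph_form (\<lambda>x. s n x - u x) (\<lambda>x. s n x - u x)) \<longlonglongrightarrow> 0"
    using test_closureE[OF u] by blast
  obtain t where t: "\<And>n. t n \<in> test_functions \<Omega>" "(\<lambda>n::nat. graph_form (\<lambda>x. t n x - v x) (\<lambda>x. t n x - v x)) \<longlonglongrightarrow> 0"
    using test_closureE[OF v] by blast
  let ?w = "\<lambda>n x. (a * s n x + b * t n x) - (a * u x + b * v x)"
  have d: "(\<lambda>x. s n x - u x) \<in> finite_energy \<Omega>" "(\<lambda>x. t n x - v x) \<in> finite_energy \<Omega>" for n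
    using function_subspace_diff[OF G.subspace test_functions_finite_energy[OF s(1)] uD]
      function_subspace_diff[OF G.subspace test_functions_finite_energy[OF t(1)] vD] by auto
  have "graph_form (?w n) (?w n) \<le> 2 * a\<^sup>2 * graph_form (\<lambda>x. s n x - u x) (\<lambda>x. s n x - u x)
      + 2 * b\<^sup>2 * graph_form (\<lambda>x. t n x - v x) (\<lambda>x. t n x - v x)" for n
  proof -
    have "?w n = (\<lambda>x. a * (s n x - u x) + b * (t n x - v x))" by (auto simp: algebra_simps)
    then show ?thesis
      using G.quadratic[OF d(1)[of n] d(2)[of n], of a b] G.quadratic[OF d(1)[of n] d(2)[of n], of a "-b"]
        graph_form_ge(3)[of "\<lambda>x. a * (s n x - u x) + - b * (t n x - v x)"] by simp
  qed
  moreover have "(\<lambda>n. 2 * a\<^sup>2 * graph_form (\<lambda>x. s n x - u x) (\<lambda>x. s n x - u x)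
      + 2 * b\<^sup>2 * graph_form (\<lambda>x. t n x - v x) (\<lambda>x. t n x - v x)) \<longlonglongrightarrow> 2 * a\<^sup>2 * 0 + 2 * b\<^sup>2 * 0"
    by (intro tendsto_intros s t)
  ultimately have "(\<lambda>n. graph_form (?w n) (?w n)) \<longlonglongrightarrow> 0"
    by (intro tendsto_sandwich[OF _ _ tendsto_const, of 0 "\<lambda>n. graph_form (?w n) (?w n)"])
      (auto intro!: always_eventually graph_form_ge)
  then show "(\<lambda>x. a * u x + b * v x) \<in> test_closure"
    unfolding test_closure_def
    using function_subspace_lincomb[OF function_subspace_finite_energy uD vD] test_functions_lincomb[OF s(1) t(1)]
    by (auto intro!: exI[of _ "\<lambda>n x. a * s n x + b * t n x"])
qed

lemma bilinear_on_test_closure: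
  assumes "bilinear_on (finite_energy \<Omega>) F"
  shows "bilinear_on test_closure F"
proof
  interpret bilinear_on "finite_energy \<Omega>" F by fact
  show "symmetric_bilinear_on test_closure F"
    unfolding symmetric_bilinear_on_def using sym left test_closure_finite_energy by simp
qed (rule function_subspace_test_closure)

end

section \<open>Eigenvalues\<close>

lemma disjoint_bumps:
  fixes \<Omega> :: "'a::euclidean_space set"
  assumes "open \<Omega>" "0 \<in> \<Omega>"
  shows "\<exists>\<psi> :: nat \<Rightarrow> 'a \<Rightarrow> real. (\<forall>i. \<psi> i \<in> test_functions \<Omega>) \<and> (\<forall>i j. i \<noteq> j \<longrightarrow> l2_form (\<psi> i) (\<psi> j) = 0) \<and>
    (\<forall>i. 0 < l2_form (\<psi> i) (\<psi> i))"
proof -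
  obtain \<rho> where \<rho>: "0 < \<rho>" "ball 0 \<rho> \<subseteq> \<Omega>" using assms by (meson openE)
  obtain b :: 'a where b: "b \<in> Basis" using nonempty_Basis by blast
  \<comment> \<open>The balls of radius q/8 around points of norm q/2 lie in the shells between 3q/8
    and 5q/8. Halving q moves the outer radius to 5q/16, below 6q/16, so the shells are
    disjoint.\<close>
  define q where "q i = \<rho> * (1/2) ^ i" for i :: nat
  have q: "0 < q i" "q i \<le> \<rho>" for i using \<rho>(1) by (auto simp: q_def power_le_one mult_left_le)
  define p where "p i = (q i / 2) *\<^sub>R b" for i
  have np: "norm (p i) = q i / 2" for i using q(1)[of i] b by (simp add: p_def)
  have range: "3/8 * q i \<le> norm x \<and> norm x \<le> 5/8 * q i" if "x \<in> cball (p i) (q i / 8)" for i x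
    using that np[of i] norm_triangle_ineq2[of "p i" x] norm_triangle_ineq2[of x "p i"]
    by (auto simp: dist_norm norm_minus_commute)
  have "\<exists>f. f \<in> test_functions \<Omega> \<and> (\<forall>x. x \<notin> cball (p i) (q i / 8) \<longrightarrow> f x = 0) \<and> (\<forall>x. x \<in> ball (p i) (q i / 8) \<longrightarrow> 0 < f x)" for i
  proof -
    have "cball (p i) (q i / 8) \<subseteq> ball 0 \<rho>" using range[of _ i] q[of i] by force
    then have "cball (p i) (q i / 8) \<subseteq> \<Omega>" using \<rho>(2) by blast
    from bump_function_exists[OF _ this] q(1)[of i] show ?thesis by (metis divide_pos_pos zero_less_numeral)
  qed
  then obtain \<psi> where \<psi>: "\<And>i. \<psi> i \<in> test_functions \<Omega>" "\<And>i x. x \<notin> cball (p i) (q i / 8) \<Longrightarrow> \<psi> i x = 0"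
    "\<And>i x. x \<in> ball (p i) (q i / 8) \<Longrightarrow> 0 < \<psi> i x" by metis
  have less: "\<psi> i x * \<psi> j x = 0" if ij: "i < j" for i j x
  proof (rule ccontr)
    assume "\<psi> i x * \<psi> j x \<noteq> 0"
    then have "x \<in> cball (p i) (q i / 8)" "x \<in> cball (p j) (q j / 8)" using \<psi>(2)[of x i] \<psi>(2)[of x j] by auto
    then have "3/8 * q i \<le> 5/8 * q j" using range[of x i] range[of x j] by linarith
    moreover have "q j \<le> q i / 2"
    proof -
      have "(1/2::real) ^ j \<le> (1/2) ^ Suc i" using ij by (intro power_decreasing) auto
      then show ?thesis using \<rho>(1) by (simp add: q_def)
    qed
    ultimately show False using q(1)[of i] by linarith
  qed
  have "l2_form (\<psi> i) (\<psi> j) = 0" if "i \<noteq> j" for i j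
  proof -
    have z: "\<psi> i x * \<psi> j x = 0" for x using less[of i j x] less[of j i x] that by (metis mult.commute linorder_neqE_nat)
    show ?thesis unfolding l2_form_def z by simp
  qed
  moreover have "0 < l2_form (\<psi> i) (\<psi> i)" for i
  proof (rule ccontr)
    assume "\<not> 0 < l2_form (\<psi> i) (\<psi> i)"
    then have "(LINT x|lborel. (\<psi> i x)\<^sup>2) = 0" using l2_form_nonneg[of "\<psi> i"] unfolding l2_form_square by linarith
    then have "AE x in lborel. (\<psi> i x)\<^sup>2 = 0"
      using integral_nonneg_eq_0_iff_AE[OF square_integrable_square[OF test_functions_integrable(2)[OF \<psi>(1)]]] by simp
    then have "AE x in lborel. x \<notin> ball (p i) (q i / 8)"
    proof eventually_elim
      case (elim x)
      then show ?case using \<psi>(3)[of x i] by auto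
    qed
    then have "ball (p i) (q i / 8) \<in> null_sets lborel" by (subst AE_iff_null_sets) auto
    then have "emeasure lborel (ball (p i) (q i / 8)) = 0" by auto
    moreover have "0 < unit_ball_vol (real DIM('a)) * (q i / 8) ^ DIM('a)" using q(1)[of i] by simp
    ultimately show False using q(1)[of i] by (simp add: emeasure_ball ennreal_eq_0_iff)
  qed
  ultimately show ?thesis using \<psi>(1) by blast
qed

context bounded_set
begin

lemma test_functions_test_closure:
  assumes f: "f \<in> test_functions \<Omega>"
  shows "f \<in> test_closure"
proof -
  have "graph_form (\<lambda>x. f x - f x) (\<lambda>x. f x - f x) = 0"
    by (simp add: graph_form_def near_form_def l2_form_def difference_def)
  then show ?thesis
    unfolding test_closure_def using f test_functions_finite_energy[OF f] by (auto intro!: exI[of _ "\<lambda>_. f"])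
qed

text \<open>Coercivity turns Cauchy sequences for the energy into Cauchy sequences for the graph norm,
  and Fatou's lemma provides the limit.\<close>

lemma test_closure_complete:
  assumes \<mu>: "\<mu> > -1" and s: "\<And>n. s n \<in> test_closure"
    and l2: "\<And>e. e > 0 \<Longrightarrow> \<exists>M. \<forall>m\<ge>M. \<forall>n\<ge>M. l2_form (\<lambda>x. s m x - s n x) (\<lambda>x. s m x - s n x) < e"
    and en: "\<And>e. e > 0 \<Longrightarrow> \<exists>M. \<forall>m\<ge>M. \<forall>n\<ge>M. energy_form \<mu> (\<lambda>x. s m x - s n x) (\<lambda>x. s m x - s n x) < e"
  shows "\<exists>u\<in>test_closure. (\<lambda>n::nat. l2_form (\<lambda>x. s n x - u x) (\<lambda>x. s n x - u x)) \<longlonglongrightarrow> 0 \<and>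
        (\<lambda>n. energy_form \<mu> (\<lambda>x. s n x - u x) (\<lambda>x. s n x - u x)) \<longlonglongrightarrow> 0"
proof -
  interpret G: bilinear_on "finite_energy \<Omega>" graph_form by (rule bilinear_graph_form)
  note sD = test_closure_finite_energy[OF s]
  have wD: "(\<lambda>x. s m x - s n x) \<in> finite_energy \<Omega>" for m n by (rule function_subspace_diff[OF G.subspace sD sD])
  obtain k K where kK: "0 < k" "0 \<le> K" "\<And>u. u \<in> finite_energy \<Omega> \<Longrightarrow> k * near_form u u \<le> energy_form \<mu> u u + K * l2_form u u"
    using energy_form_coercive[OF \<mu>] by blast
  have near: "\<exists>M. \<forall>m\<ge>M. \<forall>n\<ge>M. near_form (\<lambda>x. s m x - s n x) (\<lambda>x. s m x - s n x) < e" if e: "e > 0" for e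
  proof -
    have p: "0 < k * e / 2" "0 < k * e / 2 / (K + 1)" using e kK by auto
    obtain K1 where K1: "\<And>m n. m \<ge> K1 \<Longrightarrow> n \<ge> K1 \<Longrightarrow> energy_form \<mu> (\<lambda>x. s m x - s n x) (\<lambda>x. s m x - s n x) < k * e / 2"
      using en[OF p(1)] by blast
    obtain K2 where K2: "\<And>m n. m \<ge> K2 \<Longrightarrow> n \<ge> K2 \<Longrightarrow> l2_form (\<lambda>x. s m x - s n x) (\<lambda>x. s m x - s n x) < k * e / 2 / (K + 1)"
      using l2[OF p(2)] by blast
    have "near_form (\<lambda>x. s m x - s n x) (\<lambda>x. s m x - s n x) < e" if mn: "m \<ge> max K1 K2" "n \<ge> max K1 K2" for m n
    proof -
      let ?w = "\<lambda>x. s m x - s n x"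
      have "K * l2_form ?w ?w \<le> (K + 1) * (k * e / 2 / (K + 1))"
        using K2[of m n] mn kK(2) l2_form_nonneg[of ?w] by (intro mult_mono) auto
      also have "\<dots> = k * e / 2"
      proof -
        have "K + 1 \<noteq> 0" using kK(2) by linarith
        then show ?thesis by (subst times_divide_eq_right) (rule nonzero_mult_div_cancel_left)
      qed
      finally have "k * near_form ?w ?w < k * e" using kK(3)[OF wD[of m n]] K1[of m n] mn by simp
      then show ?thesis using kK(1) by simp
    qed
    then show ?thesis by blast
  qed
  have c: "\<exists>M. \<forall>m\<ge>M. \<forall>n\<ge>M. (LINT x|lborel. (s m x - s n x)\<^sup>2) < e" if "e > 0" for e
    using l2[OF that] by (simp only: l2_form_square)
  obtain g r where g: "square_integrable lborel g" "strict_mono r" "g = (\<lambda>x. lim (\<lambda>n. s (r n) x))" "AE x in lborel. (\<lambda>n. s (r n) x) \<longlonglongrightarrow> g x"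
    by (rule square_integrable_complete[OF finite_energyD(3)[OF sD] c]) (assumption, rule that)
  have g0: "g x = 0" if "x \<notin> \<Omega>" for x using finite_energyD(2)[OF sD that] by (simp add: g(3))
  have gm: "g \<in> borel_measurable borel" using g(1) by (simp add: square_integrable_def)
  note lim = finite_energy_Cauchy_limit[OF sD gm g0 g(2,4) l2 near]
  have gD: "g \<in> finite_energy \<Omega>" and graph: "(\<lambda>n. graph_form (\<lambda>x. s n x - g x) (\<lambda>x. s n x - g x)) \<longlonglongrightarrow> 0"
    using lim by auto
  \<comment> \<open>Each member is a graph-norm limit of test functions; choosing one within 1/(n+1)
    of the n-th member gives test functions that converge to the same limit.\<close>
  have "\<exists>t. t \<in> test_functions \<Omega> \<and> graph_form (\<lambda>x. t x - s n x) (\<lambda>x. t x - s n x) < 1 / real (Suc n)" for n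
  proof -
    obtain t where t: "\<And>i. t i \<in> test_functions \<Omega>" "(\<lambda>i::nat. graph_form (\<lambda>x. t i x - s n x) (\<lambda>x. t i x - s n x)) \<longlonglongrightarrow> 0"
      using test_closureE[OF s] by blast
    have "\<forall>\<^sub>F i in sequentially. graph_form (\<lambda>x. t i x - s n x) (\<lambda>x. t i x - s n x) < 1 / real (Suc n)"
      by (rule order_tendstoD(2)[OF t(2)]) simp
    then show ?thesis using t(1) by (auto simp: eventually_sequentially)
  qed
  then obtain t where t: "\<And>n. t n \<in> test_functions \<Omega>" "\<And>n. graph_form (\<lambda>x. t n x - s n x) (\<lambda>x. t n x - s n x) < 1 / real (Suc n)"
    by metis
  have "graph_form (\<lambda>x. t n x - g x) (\<lambda>x. t n x - g x) \<le> 2 * (1 / real (Suc n)) + 2 * graph_form (\<lambda>x. s n x - g x) (\<lambda>x. s n x - g x)" for n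
  proof -
    have "graph_form (\<lambda>x. g x - s n x) (\<lambda>x. g x - s n x) = graph_form (\<lambda>x. s n x - g x) (\<lambda>x. s n x - g x)"
      using G.quadratic_diff[OF gD sD[of n]] G.quadratic_diff[OF sD[of n] gD] G.sym[OF gD sD[of n]] by simp
    then show ?thesis
      using form_triangle[OF bilinear_graph_form graph_form_ge(3) test_functions_finite_energy[OF t(1)[of n]] sD[of n] gD] t(2)[of n] by linarith
  qed
  moreover have "(\<lambda>n. 2 * (1 / real (Suc n)) + 2 * graph_form (\<lambda>x. s n x - g x) (\<lambda>x. s n x - g x)) \<longlonglongrightarrow> 2 * 0 + 2 * 0"
    using LIMSEQ_inverse_real_of_nat by (intro tendsto_intros graph) (simp add: inverse_eq_divide)
  ultimately have "(\<lambda>n. graph_form (\<lambda>x. t n x - g x) (\<lambda>x. t n x - g x)) \<longlonglongrightarrow> 0"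
    by (intro tendsto_sandwich[OF _ _ tendsto_const, of 0 "\<lambda>n. graph_form (\<lambda>x. t n x - g x) (\<lambda>x. t n x - g x)"])
      (auto intro!: always_eventually graph_form_ge)
  then have gT: "g \<in> test_closure" unfolding test_closure_def using gD t(1) by blast
  obtain C where C: "\<And>u. u \<in> finite_energy \<Omega> \<Longrightarrow> \<bar>energy_form \<mu> u u\<bar> \<le> C * graph_form u u"
    using energy_form_bounded by blast
  have "(\<lambda>n. C * graph_form (\<lambda>x. s n x - g x) (\<lambda>x. s n x - g x)) \<longlonglongrightarrow> C * 0" by (intro tendsto_intros graph)
  then have C0: "(\<lambda>n. C * graph_form (\<lambda>x. s n x - g x) (\<lambda>x. s n x - g x)) \<longlonglongrightarrow> 0" by simp
  have "(\<lambda>n. energy_form \<mu> (\<lambda>x. s n x - g x) (\<lambda>x. s n x - g x)) \<longlonglongrightarrow> 0"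
    by (rule Lim_null_comparison[OF always_eventually C0])
      (use C[OF function_subspace_diff[OF G.subspace sD gD]] in auto)
  moreover have "(\<lambda>n. l2_form (\<lambda>x. s n x - g x) (\<lambda>x. s n x - g x)) \<longlonglongrightarrow> 0" using graph by (simp add: graph_form_lim_iff)
  ultimately show ?thesis using gT by blast
qed

lemma variational_problem_exists:
  assumes \<mu>: "\<mu> > -1" and \<Omega>: "open \<Omega>" "0 \<in> \<Omega>"
  shows "\<exists>K. variational_problem test_closure l2_form (energy_form \<mu>) K"
proof -
  obtain k K where kK: "0 < k" "0 \<le> K" "\<And>u. u \<in> finite_energy \<Omega> \<Longrightarrow> k * near_form u u \<le> energy_form \<mu> u u + K * l2_form u u"
    using energy_form_coercive[OF \<mu>] by blast
  interpret P: bilinear_on test_closure l2_form by (rule bilinear_on_test_closure[OF bilinear_l2_form])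
  interpret Q: bilinear_on test_closure "energy_form \<mu>" by (rule bilinear_on_test_closure[OF bilinear_energy_form])
  have "variational_problem test_closure l2_form (energy_form \<mu>) K"
  proof unfold_locales
    fix u assume u: "u \<in> test_closure"
    show "0 \<le> l2_form u u" by (rule l2_form_nonneg)
    have "0 \<le> k * near_form u u" using kK(1) near_form_nonneg[of u] by simp
    then show "- K * l2_form u u \<le> energy_form \<mu> u u"
      using kK(3)[OF test_closure_finite_energy[OF u]] by simp
  next
    fix s :: "nat \<Rightarrow> 'a \<Rightarrow> real"
    assume "\<And>n. s n \<in> test_closure"
      "\<And>e. e > 0 \<Longrightarrow> \<exists>M. \<forall>m\<ge>M. \<forall>n\<ge>M. l2_form (\<lambda>x. s m x - s n x) (\<lambda>x. s m x - s n x) < e"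
      "\<And>e. e > 0 \<Longrightarrow> \<exists>M. \<forall>m\<ge>M. \<forall>n\<ge>M. energy_form \<mu> (\<lambda>x. s m x - s n x) (\<lambda>x. s m x - s n x) < e"
    then show "\<exists>u\<in>test_closure. (\<lambda>n. l2_form (\<lambda>x. s n x - u x) (\<lambda>x. s n x - u x)) \<longlonglongrightarrow> 0 \<and>
        (\<lambda>n. energy_form \<mu> (\<lambda>x. s n x - u x) (\<lambda>x. s n x - u x)) \<longlonglongrightarrow> 0"
      by (rule test_closure_complete[OF \<mu>])
  next
    fix s :: "nat \<Rightarrow> 'a \<Rightarrow> real" and C
    assume s: "\<And>n. s n \<in> test_closure" "\<And>n. l2_form (s n) (s n) = 1" "\<And>n. energy_form \<mu> (s n) (s n) \<le> C"
    note sD = test_closure_finite_energy[OF s(1)]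
    have "near_form (s n) (s n) \<le> (C + K) / k" for n
    proof -
      have "k * near_form (s n) (s n) \<le> C + K" using kK(3)[OF sD[of n]] s(2,3)[of n] by simp
      then show ?thesis using kK(1) by (simp add: field_simps)
    qed
    then show "\<exists>r :: nat \<Rightarrow> nat. strict_mono r \<and> (\<forall>e>0. \<exists>M. \<forall>m\<ge>M. \<forall>n\<ge>M.
        l2_form (\<lambda>x. s (r m) x - s (r n) x) (\<lambda>x. s (r m) x - s (r n) x) < e)"
      by (rule compact_embedding[OF sD s(2)])
  next
    fix \<phi> :: "nat \<Rightarrow> 'a \<Rightarrow> real" and k :: nat
    assume \<phi>: "\<And>j. j \<in> {1..<k} \<Longrightarrow> \<phi> j \<in> test_closure"
    obtain \<psi> :: "nat \<Rightarrow> 'a \<Rightarrow> real" where \<psi>: "\<And>i. \<psi> i \<in> test_functions \<Omega>" "\<And>i j. i \<noteq> j \<Longrightarrow> l2_form (\<psi> i) (\<psi> j) = 0"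
      "\<And>i. 0 < l2_form (\<psi> i) (\<psi> i)" using disjoint_bumps[OF \<Omega>] by blast
    note \<psi>T = test_functions_test_closure[OF \<psi>(1)]
    \<comment> \<open>There are k + 1 disjoint bumps against at most k - 1 constraints, so some
      nontrivial combination is orthogonal to all prescribed functions; disjointness keeps its norm
      positive.\<close>
    have "card {1..<k} < card {..k}" by simp
    then obtain a where a: "\<exists>i\<in>{..k}. a i \<noteq> 0" "\<And>j. j \<in> {1..<k} \<Longrightarrow> (\<Sum>i\<in>{..k}. a i * l2_form (\<psi> i) (\<phi> j)) = 0"
      using underdetermined_system[OF finite_atLeastLessThan finite_atMost, of 1 k k "\<lambda>i j. l2_form (\<psi> i) (\<phi> j)"] by blast
    let ?u = "\<lambda>x. \<Sum>i\<in>{..k}. a i * \<psi> i x"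
    have uT: "?u \<in> test_closure" by (rule function_subspace_sum[OF P.subspace]) (use \<psi>T in auto)
    have "l2_form ?u ?u = (\<Sum>i\<in>{..k}. (a i)\<^sup>2 * l2_form (\<psi> i) (\<psi> i))"
      by (rule P.quadratic_sum_orthogonal) (use \<psi>T \<psi>(2) in auto)
    also have "\<dots> > 0"
    proof -
      obtain i where i: "i \<in> {..k}" "a i \<noteq> 0" using a(1) by blast
      show ?thesis
        by (rule sum_pos2[OF _ i(1)]) (use i \<psi>(3) in \<open>auto intro!: mult_nonneg_nonneg mult_pos_pos l2_form_nonneg\<close>)
    qed
    finally have pos: "0 < l2_form ?u ?u" .
    have orth: "l2_form ?u (\<phi> j) = 0" if "j \<in> {1..<k}" for j
      using P.left_sum[of "{..k}" \<psi> "\<phi> j" a] \<psi>T \<phi>[OF that] a(2)[OF that] by simp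
    let ?c = "1 / sqrt (l2_form ?u ?u)"
    have "(\<lambda>x. ?c * ?u x) \<in> constrained_unit_sphere test_closure l2_form \<phi> k"
      unfolding constrained_unit_sphere_def
    proof (intro CollectI conjI ballI)
      show "(\<lambda>x. ?c * ?u x) \<in> test_closure" by (rule function_subspace_scale[OF P.subspace uT])
      show "l2_form (\<lambda>x. ?c * ?u x) (\<lambda>x. ?c * ?u x) = 1"
        unfolding P.quadratic_scale[OF uT] using pos by (simp only: power_divide real_sqrt_pow2 less_imp_le) simp
      show "l2_form (\<lambda>x. ?c * ?u x) (\<phi> j) = 0" if "j \<in> {1..<k}" for j
        unfolding P.left_scale[OF uT \<phi>[OF that]] orth[OF that] by simp
    qed
    then show "constrained_unit_sphere test_closure l2_form \<phi> k \<noteq> {}" by blast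
  qed
  then show ?thesis ..
qed

lemma admissible_eq:
  assumes \<mu>: "\<mu> > -1"
  shows "admissible \<Omega> \<mu> \<phi> k = constrained_unit_sphere test_closure l2_form \<phi> k"
proof -
  have "(L2_norm \<Omega> u = 1 \<and> (\<forall>j\<in>{1..<k}. (LINT x:\<Omega>|lborel. u x * \<phi> j x) = 0))
      = (l2_form u u = 1 \<and> (\<forall>j\<in>{1..<k}. l2_form u (\<phi> j) = 0))" if u: "u \<in> test_closure" for u
  proof -
    note uD = test_closure_finite_energy[OF u]
    have "(LINT x:\<Omega>|lborel. u x * \<phi> j x) = l2_form u (\<phi> j)" for j
      unfolding l2_form_def by (rule set_integral_eq_integral) (simp add: finite_energyD(2)[OF uD])
    then show ?thesis by (simp add: L2_norm_eq[OF uD])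
  qed
  then show ?thesis
    unfolding admissible_def constrained_unit_sphere_def energy_space_eq[OF \<mu>] by auto
qed

text \<open>\<open>eigenfunction\<close> is an arbitrary choice. Independence of the choice allows
  the eigenvalue to be evaluated along any convenient sequence of minimizers, such as a dilated
  one.\<close>

lemma eigenvalue_eq:
  assumes \<mu>: "\<mu> > -1" and V: "variational_problem test_closure l2_form (energy_form \<mu>) K"
    and \<psi>: "variational_problem.minimizer_sequence test_closure l2_form (energy_form \<mu>) \<psi>" and k: "k \<ge> 1"
  shows "eigenvalue \<Omega> \<mu> k = energy_form \<mu> (\<psi> k) (\<psi> k)"
proof -
  interpret variational_problem test_closure l2_form "energy_form \<mu>" K by (rule V)
  have en: "energy \<Omega> \<mu> u u = energy_form \<mu> u u" if "u \<in> constrained_unit_sphere test_closure l2_form \<phi> k" for u \<phi> k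
    using that by (intro energy_eq \<mu>) (auto simp: constrained_unit_sphere_def)
  have succ: "successive_minimizers \<Omega> \<mu> \<phi> \<longleftrightarrow> minimizer_sequence \<phi>" for \<phi>
    unfolding successive_minimizers_def minimizer_sequence_def is_minimizer_def admissible_eq[OF \<mu>]
    using en by (metis (no_types, lifting))
  define \<phi> where "\<phi> = eigenfunction \<Omega> \<mu>"
  have \<phi>: "minimizer_sequence \<phi>"
    unfolding \<phi>_def eigenfunction_def succ using minimizer_sequence_exists by (rule someI_ex)
  have mem: "\<phi> k \<in> constrained_unit_sphere test_closure l2_form \<phi> k"
    and min: "\<And>u. u \<in> constrained_unit_sphere test_closure l2_form \<phi> k \<Longrightarrow> energy_form \<mu> (\<phi> k) (\<phi> k) \<le> energy_form \<mu> u u"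
    using \<phi> k by (auto simp: minimizer_sequence_def is_minimizer_def)
  have "eigenvalue \<Omega> \<mu> k = energy_form \<mu> (\<phi> k) (\<phi> k)"
    unfolding eigenvalue_def admissible_eq[OF \<mu>] \<phi>_def[symmetric]
  proof (rule Least_equality)
    show "\<exists>u\<in>constrained_unit_sphere test_closure l2_form \<phi> k. energy_form \<mu> (\<phi> k) (\<phi> k) = energy \<Omega> \<mu> u u"
      using mem en[OF mem] by (intro bexI[of _ "\<phi> k"]) auto
    show "energy_form \<mu> (\<phi> k) (\<phi> k) \<le> e" if "\<exists>u\<in>constrained_unit_sphere test_closure l2_form \<phi> k. e = energy \<Omega> \<mu> u u" for e
      using that min en by auto
  qed
  then show ?thesis using minimizer_sequence_value[OF \<phi> \<psi> k] by simp
qed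

end

section \<open>Dilation of the energy space and of the eigenvalues\<close>

lemma dilate_dilate: "l > 0 \<Longrightarrow> dilate (1 / l) (dilate l u) = u" "l > 0 \<Longrightarrow> dilate l (dilate (1 / l) u) = u"
  for u :: "'a::euclidean_space \<Rightarrow> real"
  by (auto simp: dilate_def[abs_def] powr_mult[symmetric] mult.assoc[symmetric] fun_eq_iff)

lemma dilate_diff: "dilate l (\<lambda>x. u x - v x) = (\<lambda>x. dilate l u x - dilate l v x)"
  by (auto simp: dilate_def right_diff_distrib)

lemma square_integrable_dilate:
  fixes u :: "'a::euclidean_space \<Rightarrow> real"
  assumes l: "l > 0" and u: "square_integrable lborel u"
  shows "square_integrable lborel (dilate l u)"
proof -
  have [measurable]: "u \<in> borel_measurable borel" using u by (simp add: square_integrable_def)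
  have "integrable lborel (\<lambda>x. (u (0 + (1 / l) *\<^sub>R x))\<^sup>2)"
    using square_integrable_square[OF u] l by (subst lborel_integrable_affine_iff) auto
  then have "integrable lborel (\<lambda>x. (l powr (- (DIM('a) / 2)))\<^sup>2 * (u ((1 / l) *\<^sub>R x))\<^sup>2)" by simp
  then show ?thesis by (simp add: square_integrable_def dilate_def[abs_def] power_mult_distrib)
qed

text \<open>The near form is not invariant under dilation, since its cutoff moves. Its control is
  indirect: the energy with \<mu> = 0 changes by an explicit L2 term, and coercivity on the dilated
  set returns from that energy to the near form.\<close>

lemma (in bounded_set)
  assumes u: "u \<in> test_closure" and l: "l > 0"
  shows dilate_test_closure: "dilate l u \<in> bounded_set.test_closure ((\<lambda>x. l *\<^sub>R x) ` \<Omega>)"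
    and energy_form_dilate_test_closure:
      "energy_form \<mu> (dilate l u) (dilate l u) = energy_form \<mu> u u - 2 * (1 + \<mu>) * ln l * l2_form u u"
proof -
  interpret d: bounded_set "(\<lambda>x. l *\<^sub>R x) ` \<Omega>" "max 1 (l * R)"
    by (rule bounded_set_dilate[OF bounded_set_axioms l])
  interpret P: bilinear_on "finite_energy \<Omega>" l2_form by (rule bilinear_l2_form)
  note uD = test_closure_finite_energy[OF u]
  obtain s where s: "\<And>n. s n \<in> test_functions \<Omega>" and lim: "(\<lambda>n::nat. graph_form (\<lambda>x. s n x - u x) (\<lambda>x. s n x - u x)) \<longlonglongrightarrow> 0"
    using test_closureE[OF u] by blast
  note sD = test_functions_finite_energy[OF s]
  define s' where "s' n = dilate l (s n)" for n
  have s': "s' n \<in> test_functions ((\<lambda>x. l *\<^sub>R x) ` \<Omega>)" for n unfolding s'_def by (rule test_functions_dilate[OF s l])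
  note s'D = test_functions_finite_energy[OF s']
  have w: "(\<lambda>x. s m x - s n x) \<in> test_functions \<Omega>" for m n
    using test_functions_lincomb[OF s[of m] s[of n], of 1 "-1"] by simp
  have s'_diff: "(\<lambda>x. s' m x - s' n x) = dilate l (\<lambda>x. s m x - s n x)" for m n
    by (simp add: s'_def dilate_diff)
  have s'_u: "(\<lambda>x. s' n x - dilate l u x) = dilate l (\<lambda>x. s n x - u x)" for n
    by (simp add: s'_def dilate_diff)
  have l2_lim: "(\<lambda>n. LINT x|lborel. (s' n x - dilate l u x)\<^sup>2) \<longlonglongrightarrow> 0"
  proof -
    have "(LINT x|lborel. (s' n x - dilate l u x)\<^sup>2) = l2_form (\<lambda>x. s n x - u x) (\<lambda>x. s n x - u x)" for n
      using l2_form_square[of "\<lambda>x. s' n x - dilate l u x"] unfolding s'_u l2_form_dilate[OF l] by simp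
    then show ?thesis using lim by (simp add: graph_form_lim_iff)
  qed
  have du: "square_integrable lborel (dilate l u)" by (rule square_integrable_dilate[OF l finite_energyD(3)[OF uD]])
  obtain r where r: "strict_mono r" "AE x in lborel. (\<lambda>n. s' (r n) x) \<longlonglongrightarrow> dilate l u x"
    by (rule L2_limit_AE_subseq[OF finite_energyD(3)[OF s'D] du l2_lim])
  obtain C where C: "0 \<le> C" "\<And>u. u \<in> finite_energy \<Omega> \<Longrightarrow> \<bar>energy_form 0 u u\<bar> \<le> C * graph_form u u"
    using energy_form_bounded[of 0] by blast
  have zero: "(0::real) > -1" by simp
  obtain k K where kK: "0 < k" "0 \<le> K"
    "\<And>u. u \<in> finite_energy ((\<lambda>x. l *\<^sub>R x) ` \<Omega>) \<Longrightarrow> k * near_form u u \<le> energy_form 0 u u + K * l2_form u u"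
    using d.energy_form_coercive[OF zero] by blast
  \<comment> \<open>The summand 1 keeps D positive, so that e / D is a legitimate tolerance.\<close>
  define D where "D = (C + \<bar>2 * ln l\<bar> + K + 1) / k"
  have D: "0 < D" using C(1) kK by (simp add: D_def)
  have near_le: "near_form (\<lambda>x. s' m x - s' n x) (\<lambda>x. s' m x - s' n x) \<le> D * graph_form (\<lambda>x. s m x - s n x) (\<lambda>x. s m x - s n x)" for m n
  proof -
    let ?w = "\<lambda>x. s m x - s n x"
    note wD = test_functions_finite_energy[OF w[of m n]]
    have "k * near_form (dilate l ?w) (dilate l ?w) \<le> energy_form 0 ?w ?w - 2 * ln l * l2_form ?w ?w + K * l2_form ?w ?w"
      using kK(3)[OF test_functions_finite_energy[OF test_functions_dilate[OF w[of m n] l]]]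
        energy_form_dilate[OF w[of m n] w[of m n] l, of 0] unfolding l2_form_dilate[OF l] by simp
    also have "\<dots> \<le> C * graph_form ?w ?w + \<bar>2 * ln l\<bar> * graph_form ?w ?w + K * graph_form ?w ?w"
    proof -
      have "energy_form 0 ?w ?w \<le> C * graph_form ?w ?w" using C(2)[OF wD] by linarith
      moreover have "- (2 * ln l) * l2_form ?w ?w \<le> \<bar>2 * ln l\<bar> * graph_form ?w ?w"
        using l2_form_nonneg[of ?w] graph_form_ge[of ?w] by (intro mult_mono) auto
      moreover have "K * l2_form ?w ?w \<le> K * graph_form ?w ?w" using kK(2) graph_form_ge[of ?w] by (intro mult_left_mono)
      ultimately show ?thesis by simp
    qed
    also have "\<dots> \<le> (C + \<bar>2 * ln l\<bar> + K + 1) * graph_form ?w ?w"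
      using graph_form_ge(3)[of ?w] by (simp add: distrib_right)
    finally have "near_form (dilate l ?w) (dilate l ?w) \<le> D * graph_form ?w ?w"
      using kK(1) by (simp add: D_def field_simps)
    then show ?thesis unfolding s'_diff .
  qed
  note graph_cauchy = convergent_imp_Cauchy[OF bilinear_graph_form graph_form_ge(3) sD uD lim]
  have near_cauchy: "\<exists>K. \<forall>m\<ge>K. \<forall>n\<ge>K. near_form (\<lambda>x. s' m x - s' n x) (\<lambda>x. s' m x - s' n x) < e" if e: "e > 0" for e
  proof -
    obtain M where M: "\<And>m n. m \<ge> M \<Longrightarrow> n \<ge> M \<Longrightarrow> graph_form (\<lambda>x. s m x - s n x) (\<lambda>x. s m x - s n x) < e / D"
      using graph_cauchy[of "e / D"] e D by auto
    have "near_form (\<lambda>x. s' m x - s' n x) (\<lambda>x. s' m x - s' n x) < e" if "m \<ge> M" "n \<ge> M" for m n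
    proof -
      have "D * graph_form (\<lambda>x. s m x - s n x) (\<lambda>x. s m x - s n x) < D * (e / D)"
        using M[OF that] D by (intro mult_strict_left_mono)
      then show ?thesis using near_le[of m n] D by simp
    qed
    then show ?thesis by blast
  qed
  have l2_cauchy: "\<exists>K. \<forall>m\<ge>K. \<forall>n\<ge>K. l2_form (\<lambda>x. s' m x - s' n x) (\<lambda>x. s' m x - s' n x) < e" if e: "e > 0" for e
  proof -
    obtain M where M: "\<And>m n. m \<ge> M \<Longrightarrow> n \<ge> M \<Longrightarrow> graph_form (\<lambda>x. s m x - s n x) (\<lambda>x. s m x - s n x) < e"
      using graph_cauchy[OF e] by blast
    have "l2_form (\<lambda>x. s' m x - s' n x) (\<lambda>x. s' m x - s' n x) < e" if "m \<ge> M" "n \<ge> M" for m n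
      unfolding s'_diff l2_form_dilate[OF l] using M[OF that] graph_form_ge(2)[of "\<lambda>x. s m x - s n x"] by linarith
    then show ?thesis by blast
  qed
  have du0: "dilate l u x = 0" if "x \<notin> (\<lambda>x. l *\<^sub>R x) ` \<Omega>" for x
  proof -
    have "(1 / l) *\<^sub>R x \<notin> \<Omega>" using that l by (auto simp: image_iff)
    then show ?thesis using finite_energyD(2)[OF uD] by (simp add: dilate_def)
  qed
  have dum: "dilate l u \<in> borel_measurable borel" using du by (simp add: square_integrable_def)
  note conv = finite_energy_Cauchy_limit[OF s'D dum du0 r l2_cauchy near_cauchy]
  have duD: "dilate l u \<in> finite_energy ((\<lambda>x. l *\<^sub>R x) ` \<Omega>)"
    and lim': "(\<lambda>n. graph_form (\<lambda>x. s' n x - dilate l u x) (\<lambda>x. s' n x - dilate l u x)) \<longlonglongrightarrow> 0"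
    using conv by auto
  show "dilate l u \<in> bounded_set.test_closure ((\<lambda>x. l *\<^sub>R x) ` \<Omega>)"
    unfolding d.test_closure_def using duD s' lim' by blast
  have "(\<lambda>n. energy_form \<mu> (s' n) (s' n)) \<longlonglongrightarrow> energy_form \<mu> (dilate l u) (dilate l u)"
    by (rule d.energy_form_limit[OF s'D s'D duD duD lim' lim'])
  moreover have "(\<lambda>n. energy_form \<mu> (s n) (s n) - 2 * (1 + \<mu>) * ln l * l2_form (s n) (s n)) \<longlonglongrightarrow>
      energy_form \<mu> u u - 2 * (1 + \<mu>) * ln l * l2_form u u"
  proof (intro tendsto_intros)
    show "(\<lambda>n. energy_form \<mu> (s n) (s n)) \<longlonglongrightarrow> energy_form \<mu> u u"
      by (rule energy_form_limit[OF sD sD uD uD lim lim])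
    show "(\<lambda>n. l2_form (s n) (s n)) \<longlonglongrightarrow> l2_form u u"
      by (rule bounded_form_convergence[OF bilinear_l2_form bilinear_graph_form graph_form_ge(3) _ sD sD uD uD lim lim, where C=1])
        (simp add: abs_of_nonneg[OF l2_form_nonneg] graph_form_ge(2))
  qed
  moreover have "energy_form \<mu> (s' n) (s' n) = energy_form \<mu> (s n) (s n) - 2 * (1 + \<mu>) * ln l * l2_form (s n) (s n)" for n
    unfolding s'_def by (rule energy_form_dilate[OF s s l])
  ultimately show "energy_form \<mu> (dilate l u) (dilate l u) = energy_form \<mu> u u - 2 * (1 + \<mu>) * ln l * l2_form u u"
    using LIMSEQ_unique by simp
qed

lemma (in bounded_set) eigenvalue_dilate:
  assumes \<mu>: "\<mu> > -1" and \<Omega>: "open \<Omega>" "0 \<in> \<Omega>" and k: "k \<ge> 1" and l: "l > 0"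
  shows "eigenvalue ((\<lambda>x. l *\<^sub>R x) ` \<Omega>) \<mu> k = eigenvalue \<Omega> \<mu> k - 2 * (1 + \<mu>) * ln l"
proof -
  let ?\<Omega>' = "(\<lambda>x. l *\<^sub>R x) ` \<Omega>"
  interpret d: bounded_set ?\<Omega>' "max 1 (l * R)"
    by (rule bounded_set_dilate[OF bounded_set_axioms l])
  have \<Omega>': "open ?\<Omega>'" "0 \<in> ?\<Omega>'" using \<Omega> l by (auto intro: open_scaling)
  have dilate_back: "(\<lambda>x. (1 / l) *\<^sub>R x) ` ?\<Omega>' = \<Omega>" using l by (simp add: image_image)
  obtain K where V: "variational_problem test_closure l2_form (energy_form \<mu>) K" using variational_problem_exists[OF \<mu> \<Omega>] by blast
  obtain K' where V': "variational_problem d.test_closure l2_form (energy_form \<mu>) K'" using d.variational_problem_exists[OF \<mu> \<Omega>'] by blast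
  interpret V: variational_problem test_closure l2_form "energy_form \<mu>" K by (rule V)
  interpret V': variational_problem d.test_closure l2_form "energy_form \<mu>" K' by (rule V')
  obtain \<psi> where \<psi>: "V.minimizer_sequence \<psi>" using V.minimizer_sequence_exists ..
  define \<psi>' where "\<psi>' j = dilate l (\<psi> j)" for j
  have energy_dilate: "energy_form \<mu> (dilate l u) (dilate l u) = energy_form \<mu> u u - 2 * (1 + \<mu>) * ln l"
    if "u \<in> test_closure" "l2_form u u = 1" for u
    using energy_form_dilate_test_closure[OF that(1) l, of \<mu>] that(2) by simp
  have "V'.minimizer_sequence \<psi>'"
    unfolding V'.minimizer_sequence_def V'.is_minimizer_def
  proof (intro allI impI conjI ballI)
    fix j :: nat assume j: "j \<ge> 1"
    have mem: "\<psi> j \<in> constrained_unit_sphere test_closure l2_form \<psi> j"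
      and minimal: "\<And>v. v \<in> constrained_unit_sphere test_closure l2_form \<psi> j \<Longrightarrow> energy_form \<mu> (\<psi> j) (\<psi> j) \<le> energy_form \<mu> v v"
      using \<psi> j by (auto simp: V.minimizer_sequence_def V.is_minimizer_def)
    show "\<psi>' j \<in> constrained_unit_sphere d.test_closure l2_form \<psi>' j"
      using mem dilate_test_closure[OF _ l] by (auto simp: constrained_unit_sphere_def \<psi>'_def l2_form_dilate[OF l])
    fix v assume v: "v \<in> constrained_unit_sphere d.test_closure l2_form \<psi>' j"
    \<comment> \<open>Dilation by 1/l is the inverse, so every competitor on the dilated set comes
      from one on \<Omega>; the energies of normalized functions differ by the same
      constant.\<close>
    define w where "w = dilate (1 / l) v"
    have vw: "v = dilate l w" by (simp add: w_def dilate_dilate[OF l])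
    have "w \<in> test_closure"
      using d.dilate_test_closure[of v "1 / l"] v l unfolding dilate_back by (simp add: w_def constrained_unit_sphere_def)
    moreover from v have "l2_form w w = 1" "\<forall>i\<in>{1..<j}. l2_form w (\<psi> i) = 0"
      by (auto simp: constrained_unit_sphere_def vw \<psi>'_def l2_form_dilate[OF l])
    ultimately have w: "w \<in> test_closure" "l2_form w w = 1" "w \<in> constrained_unit_sphere test_closure l2_form \<psi> j"
      by (auto simp: constrained_unit_sphere_def)
    have "\<psi> j \<in> test_closure" "l2_form (\<psi> j) (\<psi> j) = 1" using mem by (auto simp: constrained_unit_sphere_def)
    then show "energy_form \<mu> (\<psi>' j) (\<psi>' j) \<le> energy_form \<mu> v v"
      unfolding vw \<psi>'_def using minimal[OF w(3)] w by (simp add: energy_dilate)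
  qed
  then have "eigenvalue ?\<Omega>' \<mu> k = energy_form \<mu> (\<psi>' k) (\<psi>' k)" by (rule d.eigenvalue_eq[OF \<mu> V' _ k])
  also have "\<dots> = energy_form \<mu> (\<psi> k) (\<psi> k) - 2 * (1 + \<mu>) * ln l"
    unfolding \<psi>'_def using V.sequence_mem[OF \<psi> k] by (intro energy_dilate) auto
  also have "energy_form \<mu> (\<psi> k) (\<psi> k) = eigenvalue \<Omega> \<mu> k" by (rule eigenvalue_eq[OF \<mu> V \<psi> k, symmetric])
  finally show ?thesis .
qed

lemma (in bounded_set) first_eigenvalue_lower_bound:
  assumes \<mu>: "\<mu> > -1" and \<Omega>: "open \<Omega>" "0 \<in> \<Omega>" and \<rho>: "\<Omega> \<subseteq> cball 0 \<rho>"
  shows "2 * (Digamma (real DIM('a) / 4) + ln 2) - 2 * (1 + \<mu>) * ln \<rho> \<le> eigenvalue \<Omega> \<mu> 1"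
proof -
  obtain K where V: "variational_problem test_closure l2_form (energy_form \<mu>) K" using variational_problem_exists[OF \<mu> \<Omega>] by blast
  interpret V: variational_problem test_closure l2_form "energy_form \<mu>" K by (rule V)
  obtain \<psi> where \<psi>: "V.minimizer_sequence \<psi>" using V.minimizer_sequence_exists ..
  let ?u = "\<psi> 1"
  have u: "?u \<in> finite_energy \<Omega>" "l2_form ?u ?u = 1"
    using V.sequence_mem[OF \<psi>, of 1] test_closure_finite_energy by auto
  \<comment> \<open>The sign of 1 + \<mu> decides the direction of the estimate here.\<close>
  have "2 * (1 + \<mu>) * log_form ?u ?u \<le> 2 * (1 + \<mu>) * ln \<rho>"
    using log_form_upper[OF u(1) \<rho>] u(2) \<mu> by (intro mult_left_mono) auto
  then show ?thesis
    using energy_form_Hardy[OF u(1), of \<mu>] u(2) eigenvalue_eq[OF \<mu> V \<psi>, of 1] by simp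
qed

theorem theorem1p4:
  fixes \<Omega> :: "'a::euclidean_space set" and \<mu> :: real
  assumes "bounded_lipschitz_domain \<Omega>" and "0 \<in> \<Omega>" and "\<mu> > -1"
  shows "eigenvalue \<Omega> \<mu> 1 \<ge>
           2 * (Digamma (real DIM('a) / 4) + ln 2) - 2 * (1 + \<mu>) * ln (SUP x\<in>\<Omega>. norm x) \<and>
         (\<forall>k\<ge>1. \<forall>l>0. eigenvalue ((\<lambda>x. l *\<^sub>R x) ` \<Omega>) \<mu> k =
           eigenvalue \<Omega> \<mu> k - 2 * (1 + \<mu>) * ln l)"
proof -
  have \<Omega>: "open \<Omega>" "bounded \<Omega>" using assms(1) by (auto simp: bounded_lipschitz_domain_def)
  obtain B where B: "\<And>x. x \<in> \<Omega> \<Longrightarrow> norm x \<le> B" using \<Omega>(2) by (auto simp: bounded_iff)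
  interpret bounded_set \<Omega> "max 1 B"
  proof unfold_locales
    show "1 \<le> max 1 B" by simp
    show "\<Omega> \<subseteq> cball 0 (max 1 B)" using B by (auto simp: le_max_iff_disj)
  qed
  have "bdd_above (norm ` \<Omega>)" using B by (intro bdd_aboveI2)
  \<comment> \<open>The lower bound is stated with the exact radius of the domain, whereas the
    locale was instantiated with a radius of at least 1.\<close>
  then have "\<Omega> \<subseteq> cball 0 (SUP x\<in>\<Omega>. norm x)" by (auto intro: cSUP_upper)
  then show ?thesis
    using first_eigenvalue_lower_bound[OF assms(3) \<Omega>(1) assms(2)] eigenvalue_dilate[OF assms(3) \<Omega>(1) assms(2)] by simp
qed

end
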